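(* Let $\omega\subset\mathbb{R}^2$ be a bounded and connected open set whose boundary is Lipschitz-continuous. Let $V(\omega)=V_H(\omega)\times V_3(\omega)$, where $V_H(\omega)$ is a closed subspace of $H^1(\omega)\times H^1(\omega)$ and $V_3(\omega)$ is a closed subspace of $H^2(\omega)$ such that $$u_3\in V_3(\omega)\ \text{ and }\ \partial_{\alpha\beta}u_3=0 \text{ in } \omega \text{ for all } \alpha,\beta\in\{1,2\}\quad\text{imply}\quad u_3=0 \text{ in } \omega.$$ Assume that $V(\omega)$ satisfies the following rigidity property: $$\boldsymbol{u}\in V(\omega)\ \text{ and }\ \boldsymbol{E}(\boldsymbol{u})=\boldsymbol{0}\text{ in }\omega\quad\text{imply}\quad \boldsymbol{u}=\boldsymbol{0}\text{ in }\omega.$$ Then the Kirchhoff-Love energy functional $J$ (defined in the context) has a minimizer in the set $V(\omega)$.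
   Context: Greek indices range in $\{1,2\}$, Latin indices in $\{1,2,3\}$, and summation over repeated indices is understood. $\partial_\alpha=\partial/\partial y_\alpha$, $\partial_{\alpha\beta}=\partial^2/\partial y_\alpha\partial y_\beta$ (distributional derivatives); $\mathbb{S}^2$ is the space of symmetric $2\times2$ real matrices. Fix constants $\varepsilon>0$, $\lambda\ge 0$, $\mu>0$. Let $\Omega^\varepsilon=\omega\times(-\varepsilon,\varepsilon)$ and $\Gamma^\varepsilon_\pm=\omega\times\{-\varepsilon,\varepsilon\}$, and let arbitrary force densities $(f_i^\varepsilon)\in L^2(\Omega^\varepsilon;\mathbb{R}^3)$ and $(g_i^\varepsilon)\in L^2(\Gamma^\varepsilon_\pm;\mathbb{R}^3)$ be given. Define $p_i^\varepsilon,q_\alpha^\varepsilon\in L^2(\omega)$ by $$p_i^\varepsilon=\int_{-\varepsilon}^{\varepsilon}f_i^\varepsilon(\cdot,x_3)\,dx_3+g_i^\varepsilon(\cdot,+\varepsilon)+g_i^\varepsilon(\cdot,-\varepsilon),\qquad q_\alpha^\varepsilon=\int_{-\varepsilon}^{\varepsilon}x_3f_\alpha^\varepsilon(\cdot,x_3)\,dx_3+\varepsilon\big(g_\alpha^\varepsilon(\cdot,+\varepsilon)-g_\alpha^\varepsilon(\cdot,-\varepsilon)\big).$$ For $\boldsymbol{u}=(u_i)\in H^1(\omega)\times H^1(\omega)\times H^2(\omega)$ define $\boldsymbol{E}(\boldsymbol{u})=(E_{\alpha\beta}(\boldsymbol{u}))$ and $\boldsymbol{F}(\boldsymbol{u})=(F_{\alpha\beta}(\boldsymbol{u}))$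 in $L^2(\omega;\mathbb{S}^2)$ by $$E_{\alpha\beta}(\boldsymbol{u})=\tfrac12(\partial_\alpha u_\beta+\partial_\beta u_\alpha+\partial_\alpha u_3\,\partial_\beta u_3),\qquad F_{\alpha\beta}(\boldsymbol{u})=\partial_{\alpha\beta}u_3.$$ For $(s_{\alpha\beta})\in L^2(\omega;\mathbb{S}^2)$ let $\|(s_{\alpha\beta})\|_{\lambda,\mu}^2=\int_\omega a^{\alpha\beta\sigma\tau}s_{\sigma\tau}(y)s_{\alpha\beta}(y)\,dy$, where $a^{\alpha\beta\sigma\tau}=\frac{4\lambda\mu}{\lambda+2\mu}\delta_{\sigma\tau}\delta_{\alpha\beta}+2\mu(\delta_{\alpha\sigma}\delta_{\beta\tau}+\delta_{\alpha\tau}\delta_{\beta\sigma})$. The functional $J:H^1(\omega)\times H^1(\omega)\times H^2(\omega)\to\mathbb{R}$ is $$J(\boldsymbol{u})=\frac{\varepsilon}{2}\|\boldsymbol{E}(\boldsymbol{u})\|_{\lambda,\mu}^2+\frac{\varepsilon^3}{6}\|\boldsymbol{F}(\boldsymbol{u})\|_{\lambda,\mu}^2-L(\boldsymbol{u}),\qquad L(\boldsymbol{u})=\int_\omega\big(p_i^\varepsilon u_i-q_\alpha^\varepsilon\partial_\alpha u_3\big)\,dy.$$ A minimizer of $J$ in $V(\omega)$ is an element $\boldsymbol{u}\in V(\omega)$ with $J(\boldsymbol{u})=\inf_{\boldsymbol{w}\in V(\omega)}J(\boldsymbol{w})$. *)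

theory Defs
  imports "HOL-Analysis.Analysis"
begin

text \<open>
  Elements of Lebesgue and Sobolev spaces are represented by functions on the whole ambient
  space. Only their values on the domain matter, up to Lebesgue-null sets, so identities
  ``in \<open>\<omega>\<close>'' are stated as \<open>AE y in lebesgue_on \<omega>\<close>. Three-dimensional space is
  \<open>(real^2) \<times> real\<close>: horizontal part and vertical component.
\<close>

section \<open>Sobolev spaces of square-integrable functions\<close>

definition L2 :: "'a::euclidean_space set \<Rightarrow> ('a \<Rightarrow> 'b::euclidean_space) set" where
  "L2 S = {u \<in> borel_measurable (lebesgue_on S). integrable (lebesgue_on S) (\<lambda>y. (norm (u y))\<^sup>2)}"

primrec partial_derivs :: "'n::finite list \<Rightarrow> (real^'n \<Rightarrow> real) \<Rightarrow> real^'n \<Rightarrow> real" where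
  "partial_derivs [] \<phi> = \<phi>"
| "partial_derivs (\<alpha> # as) \<phi> =
     (\<lambda>y. frechet_derivative (partial_derivs as \<phi>) (at y) (axis \<alpha> 1))"

text \<open>
  Infinitely differentiable functions with compact support in \<open>\<omega>\<close>: if all iterated partial
  derivatives are differentiable, they are in particular all continuous.
\<close>

definition test_functions :: "(real^'n::finite) set \<Rightarrow> (real^'n \<Rightarrow> real) set" where
  "test_functions \<omega> =
     {\<phi>. (\<forall>as y. partial_derivs as \<phi> differentiable (at y)) \<and>
         compact (closure {y. \<phi> y \<noteq> 0}) \<and> closure {y. \<phi> y \<noteq> 0} \<subseteq> \<omega>}"

definition locally_integrable :: "(real^'n::finite) set \<Rightarrow> (real^'n \<Rightarrow> real) \<Rightarrow> bool" where
  "locally_integrable \<omega> u \<longleftrightarrow> (\<forall>K. compact K \<and> K \<subseteq> \<omega> \<longrightarrow> integrable (lebesgue_on K) u)"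

definition is_weak_deriv ::
    "(real^'n::finite) set \<Rightarrow> 'n list \<Rightarrow> (real^'n \<Rightarrow> real) \<Rightarrow> (real^'n \<Rightarrow> real) \<Rightarrow> bool" where
  "is_weak_deriv \<omega> as u v \<longleftrightarrow>
     locally_integrable \<omega> u \<and> locally_integrable \<omega> v \<and>
     (\<forall>\<phi> \<in> test_functions \<omega>.
        (\<integral>y. u y * partial_derivs as \<phi> y \<partial>lebesgue_on \<omega>) =
        (- 1) ^ length as * (\<integral>y. v y * \<phi> y \<partial>lebesgue_on \<omega>))"

text \<open>For open \<open>\<omega>\<close> the weak derivative is unique up to a null set; an arbitrary
  representative is chosen.\<close>

definition weak_deriv ::
    "(real^'n::finite) set \<Rightarrow> 'n list \<Rightarrow> (real^'n \<Rightarrow> real) \<Rightarrow> real^'n \<Rightarrow> real" where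
  "weak_deriv \<omega> as u = (SOME v. is_weak_deriv \<omega> as u v)"

definition sobolev :: "nat \<Rightarrow> (real^'n::finite) set \<Rightarrow> (real^'n \<Rightarrow> real) set" where
  "sobolev m \<omega> =
     {u \<in> L2 \<omega>. \<forall>as. length as \<le> m \<longrightarrow> (\<exists>v \<in> L2 \<omega>. is_weak_deriv \<omega> as u v)}"

definition sobolev_norm :: "nat \<Rightarrow> (real^'n::finite) set \<Rightarrow> (real^'n \<Rightarrow> real) \<Rightarrow> real" where
  "sobolev_norm m \<omega> u =
     sqrt (\<Sum>as | length as \<le> m. \<integral>y. (weak_deriv \<omega> as u y)\<^sup>2 \<partial>lebesgue_on \<omega>)"

definition sobolev_vec :: "nat \<Rightarrow> (real^'n::finite) set \<Rightarrow> (real^'n \<Rightarrow> real^'k::finite) set" where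
  "sobolev_vec m \<omega> = {u. \<forall>i. (\<lambda>y. u y $ i) \<in> sobolev m \<omega>}"

definition sobolev_vec_norm ::
    "nat \<Rightarrow> (real^'n::finite) set \<Rightarrow> (real^'n \<Rightarrow> real^'k::finite) \<Rightarrow> real" where
  "sobolev_vec_norm m \<omega> u = sqrt (\<Sum>i\<in>UNIV. (sobolev_norm m \<omega> (\<lambda>y. u y $ i))\<^sup>2)"

text \<open>
  Since \<open>nrm\<close> is a seminorm on functions, vanishing exactly on those that are null almost
  everywhere, sequential closedness also makes \<open>V\<close> invariant under changes on null sets.
\<close>

definition closed_subspace ::
    "('a \<Rightarrow> 'b::real_vector) set \<Rightarrow> (('a \<Rightarrow> 'b) \<Rightarrow> real) \<Rightarrow> ('a \<Rightarrow> 'b) set \<Rightarrow> bool" where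
  "closed_subspace H nrm V \<longleftrightarrow>
     V \<subseteq> H \<and> (\<lambda>y. 0) \<in> V \<and>
     (\<forall>u\<in>V. \<forall>v\<in>V. (\<lambda>y. u y + v y) \<in> V) \<and>
     (\<forall>c. \<forall>u\<in>V. (\<lambda>y. c *\<^sub>R u y) \<in> V) \<and>
     (\<forall>s. \<forall>u\<in>H. (\<forall>n. s n \<in> V) \<and> (\<lambda>n. nrm (\<lambda>y. s n y - u y)) \<longlonglongrightarrow> 0 \<longrightarrow> u \<in> V)"

section \<open>Plane domains with Lipschitz-continuous boundary\<close>

text \<open>Near each boundary point, in suitable orthonormal coordinates, \<open>\<omega>\<close> is exactly the set
  of points above the graph of a Lipschitz function.\<close>

definition lipschitz_boundary :: "(real^2) set \<Rightarrow> bool" where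
  "lipschitz_boundary \<omega> \<longleftrightarrow>
     (\<forall>x \<in> frontier \<omega>. \<exists>U T a C.
        open U \<and> x \<in> U \<and> orthogonal_transformation (T :: real^2 \<Rightarrow> real^2) \<and>
        C-lipschitz_on UNIV (a :: real \<Rightarrow> real) \<and>
        \<omega> \<inter> U = {y \<in> U. a (T y $ 1) < T y $ 2})"

section \<open>The Kirchhoff-Love energy\<close>

type_synonym displacement = "(real^2 \<Rightarrow> real^2) \<times> (real^2 \<Rightarrow> real)"

definition strain_E :: "(real^2) set \<Rightarrow> displacement \<Rightarrow> real^2 \<Rightarrow> real^2^2" where
  "strain_E \<omega> u y = (\<chi> \<alpha> \<beta>.
     (weak_deriv \<omega> [\<alpha>] (\<lambda>z. fst u z $ \<beta>) y + weak_deriv \<omega> [\<beta>] (\<lambda>z. fst u z $ \<alpha>) y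
      + weak_deriv \<omega> [\<alpha>] (snd u) y * weak_deriv \<omega> [\<beta>] (snd u) y) / 2)"

definition curvature_F :: "(real^2) set \<Rightarrow> displacement \<Rightarrow> real^2 \<Rightarrow> real^2^2" where
  "curvature_F \<omega> u y = (\<chi> \<alpha> \<beta>. weak_deriv \<omega> [\<alpha>, \<beta>] (snd u) y)"

definition elasticity :: "real \<Rightarrow> real \<Rightarrow> 2 \<Rightarrow> 2 \<Rightarrow> 2 \<Rightarrow> 2 \<Rightarrow> real" where
  "elasticity lam mu \<alpha> \<beta> \<sigma> \<tau> =
     4 * lam * mu / (lam + 2 * mu) * of_bool (\<sigma> = \<tau>) * of_bool (\<alpha> = \<beta>)
     + 2 * mu * (of_bool (\<alpha> = \<sigma>) * of_bool (\<beta> = \<tau>) + of_bool (\<alpha> = \<tau>) * of_bool (\<beta> = \<sigma>))"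

definition elastic_norm_sq ::
    "real \<Rightarrow> real \<Rightarrow> (real^2) set \<Rightarrow> (real^2 \<Rightarrow> real^2^2) \<Rightarrow> real" where
  "elastic_norm_sq lam mu \<omega> s =
     (\<integral>y. (\<Sum>\<alpha>\<in>UNIV. \<Sum>\<beta>\<in>UNIV. \<Sum>\<sigma>\<in>UNIV. \<Sum>\<tau>\<in>UNIV.
              elasticity lam mu \<alpha> \<beta> \<sigma> \<tau> * s y $ \<sigma> $ \<tau> * s y $ \<alpha> $ \<beta>) \<partial>lebesgue_on \<omega>)"

text \<open>The surface measure on the two faces \<open>\<omega> \<times> {-\<epsilon>, \<epsilon>}\<close> is the two-dimensional Lebesgue
  measure on each of them.\<close>

definition L2_faces ::
    "(real^2) set \<Rightarrow> real \<Rightarrow> ((real^2) \<times> real \<Rightarrow> 'b::euclidean_space) set" where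
  "L2_faces \<omega> \<epsilon> = {g. (\<lambda>y. g (y, \<epsilon>)) \<in> L2 \<omega> \<and> (\<lambda>y. g (y, - \<epsilon>)) \<in> L2 \<omega>}"

definition resultant_p ::
    "real \<Rightarrow> ((real^2) \<times> real \<Rightarrow> (real^2) \<times> real) \<Rightarrow> ((real^2) \<times> real \<Rightarrow> (real^2) \<times> real)
      \<Rightarrow> real^2 \<Rightarrow> (real^2) \<times> real" where
  "resultant_p \<epsilon> f g y =
     (\<integral>t. f (y, t) \<partial>lebesgue_on {-\<epsilon><..<\<epsilon>}) + g (y, \<epsilon>) + g (y, - \<epsilon>)"

definition resultant_q ::
    "real \<Rightarrow> ((real^2) \<times> real \<Rightarrow> (real^2) \<times> real) \<Rightarrow> ((real^2) \<times> real \<Rightarrow> (real^2) \<times> real)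
      \<Rightarrow> real^2 \<Rightarrow> real^2" where
  "resultant_q \<epsilon> f g y =
     (\<integral>t. t *\<^sub>R fst (f (y, t)) \<partial>lebesgue_on {-\<epsilon><..<\<epsilon>})
     + \<epsilon> *\<^sub>R (fst (g (y, \<epsilon>)) - fst (g (y, - \<epsilon>)))"

definition load_L ::
    "(real^2) set \<Rightarrow> real \<Rightarrow> ((real^2) \<times> real \<Rightarrow> (real^2) \<times> real)
      \<Rightarrow> ((real^2) \<times> real \<Rightarrow> (real^2) \<times> real) \<Rightarrow> displacement \<Rightarrow> real" where
  "load_L \<omega> \<epsilon> f g u =
     (\<integral>y. (\<Sum>\<alpha>\<in>UNIV. fst (resultant_p \<epsilon> f g y) $ \<alpha> * fst u y $ \<alpha>)
           + snd (resultant_p \<epsilon> f g y) * snd u y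
           - (\<Sum>\<alpha>\<in>UNIV. resultant_q \<epsilon> f g y $ \<alpha> * weak_deriv \<omega> [\<alpha>] (snd u) y)
        \<partial>lebesgue_on \<omega>)"

definition energy_J ::
    "(real^2) set \<Rightarrow> real \<Rightarrow> real \<Rightarrow> real \<Rightarrow> ((real^2) \<times> real \<Rightarrow> (real^2) \<times> real)
      \<Rightarrow> ((real^2) \<times> real \<Rightarrow> (real^2) \<times> real) \<Rightarrow> displacement \<Rightarrow> real" where
  "energy_J \<omega> \<epsilon> lam mu f g u =
     \<epsilon> / 2 * elastic_norm_sq lam mu \<omega> (strain_E \<omega> u)
     + \<epsilon> ^ 3 / 6 * elastic_norm_sq lam mu \<omega> (curvature_F \<omega> u)
     - load_L \<omega> \<epsilon> f g u"

text \<open>The infimum is taken in \<open>ereal\<close>, because on \<open>real\<close> it carries no information for sets that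
  are not bounded below.\<close>

definition is_minimizer :: "('a \<Rightarrow> real) \<Rightarrow> 'a set \<Rightarrow> 'a \<Rightarrow> bool" where
  "is_minimizer J V u \<longleftrightarrow> u \<in> V \<and> ereal (J u) = (INF w\<in>V. ereal (J w))"

end

theory Submission
 imports Defs "HOL-Computational_Algebra.Polynomial" "HOL-Complex_Analysis.Great_Picard" "HOL-Library.Diagonal_Subsequence"
begin

text \<open>The elastic energy is a sum of squared norms of entries of \<open>E\<close> and \<open>F\<close>. Along a bounded minimizing
 sequence Rellich's theorem and the Ladyzhenskaya inequality make the gradients of \<open>u\<^sub>3\<close> converge in
 the fourth power mean, so the quadratic part of \<open>E\<close> converges. The parallelogram identity for the
 midpoints of the sequence then makes \<open>E\<close> and \<open>F\<close> converge in the mean, and by Korn's inequality the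
 sequence itself converges strongly; no weak topology is needed. Sublevel sets are bounded because
 otherwise the rescaled displacements \<open>(u\<^sub>H / t^2, u\<^sub>3 / t)\<close> have a limit with \<open>E = 0\<close>, which is 0 by
 rigidity, and then all norms tend to 0, against the normalization.

 Korn's inequality is proved for distributional derivatives: after subtracting a projection onto
 gradients of test functions the displacement gradient is a harmonic field. Caccioppoli's estimate
 bounds the gradient of its skew part by its symmetric part times the inverse distance to the
 boundary, and Hardy's inequality along the transversal direction of a Lipschitz chart removes the
 weight.\<close>

text \<open>The energy is not convex because of the products of slopes in E. Its defect at a
  midpoint comes from a quarter of the quadratic form in the difference of the slopes, so it
  disappears along a sequence whose slopes converge in the fourth power mean, and the usual argument
  for uniformly convex functionals applies. Coercivity takes two passes. After rescaling the strain
  energy tends to 0, but the curvature energy stays comparable with the work of the in-plane forces.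
  Only when rigidity has annihilated the limit does this work tend to 0, and with it the curvature.
  At that stage second derivatives are merely bounded, yet the limit has to lie in V. Functions are
  extended by 0 and mollified on the whole plane, which respects derivatives only at a distance from
  the boundary. Boundary estimates are therefore proved where a local defining function exceeds some
  \<delta> > 0, with constants independent of \<delta>. Behind Korn's inequality stands an identity
  for curl-free matrix fields: the gradient of the skew part is a combination of derivatives of the
  symmetric part.\<close>

abbreviation lims (infix "---->" 60) where "s ----> l == s \<longlonglongrightarrow> l"
abbreviation nnlb (binder "NN " [60] 60) where "nnlb f == nn_integral lborel f"
abbreviation "bmeas == borel_measurable borel"
abbreviation "integ == integrable lborel"
abbreviation "pd i == partial_derivs [i]"

section \<open>Square-integrable functions\<close>

definition sq_int :: "'a measure => ('a => real) set" where
 "sq_int M = {f\<in>borel_measurable M. integrable M (%x. (f x)^2)}"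

text \<open>A seminorm on functions rather than a norm on classes. The integral defaults to 0 when
  the square is not integrable, so a small value says nothing without membership in
  \<open>sq_int\<close>, which every estimate carries along.\<close>

definition ltwo :: "'a measure => ('a => real) => real" where
 "ltwo M f = sqrt (\<integral>x. (f x)^2 \<partial>M)"

abbreviation "sqi == sq_int lborel"
abbreviation "nrm == ltwo lborel"

lemma sq_int_measurable [measurable_dest]: "f\<in>sq_int M ==> f\<in>borel_measurable M"
 by (simp add: sq_int_def)

lemma sq_int_integrable: "f\<in>sq_int M ==> integrable M (%x. (f x)^2)"
 by (simp add: sq_int_def)

lemma sq_intI: "f\<in>borel_measurable M ==> integrable M (%x. (f x)^2) ==> f\<in>sq_int M"
 by (simp add: sq_int_def)

lemma sq_int_bound:
 assumes "f\<in>borel_measurable M" "g\<in>sq_int M" "AE x in M. \<bar>f x\<bar>\<le>\<bar>g x\<bar>"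
 shows "f\<in>sq_int M"
proof (rule sq_intI)
 show "integrable M (%x. (f x)^2)"
  by (rule Bochner_Integration.integrable_bound[OF sq_int_integrable[OF assms(2)]])
    (use assms in \<open>auto simp: abs_le_square_iff\<close>)
qed fact

lemma sq_int_mult_integrable:
 assumes "f\<in>sq_int M" "g\<in>sq_int M"
 shows "integrable M (%x. f x*g x)"
proof (rule Bochner_Integration.integrable_bound)
 show "integrable M (%x. (f x)^2 + (g x)^2)"
  using assms by (simp add: sq_int_integrable)
 show "(%x. f x*g x)\<in>borel_measurable M"
  using assms by (simp add: sq_int_measurable)
 have "\<bar>f x\<bar>*\<bar>g x\<bar>\<le>(f x)^2 + (g x)^2" for x
 proof -
  have "0\<le>\<bar>f x\<bar>*\<bar>g x\<bar>" by simp
  then show ?thesis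
   using sum_squares_bound[of "\<bar>f x\<bar>" "\<bar>g x\<bar>"] by (simp only: mult.assoc power2_abs)
 qed
 then show "AE x in M. norm (f x*g x)\<le>norm ((f x)^2 + (g x)^2)"
  by (auto simp: abs_mult)
qed

lemma sq_int_zero [simp, intro]: "(%x. 0)\<in>sq_int M"
 by (simp add: sq_int_def)

lemma sq_int_add:
 assumes "f\<in>sq_int M" "g\<in>sq_int M"
 shows "(%x. f x + g x)\<in>sq_int M"
proof (rule sq_intI)
 show "(%x. f x + g x)\<in>borel_measurable M"
  using assms by (simp add: sq_int_measurable)
 have "integrable M (%x. (f x)^2 + (g x)^2 + 2*(f x*g x))"
  using assms by (simp add: sq_int_integrable sq_int_mult_integrable)
 then show "integrable M (%x. (f x + g x)^2)"
  by (simp add: power2_sum mult.assoc)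
qed

lemma sq_int_cmult: "f\<in>sq_int M ==> (%x. c*f x)\<in>sq_int M"
 by (auto simp: sq_int_def power_mult_distrib)

lemma sq_int_uminus: "f\<in>sq_int M ==> (%x. - f x)\<in>sq_int M"
 by (auto simp: sq_int_def)

lemma sq_int_divide: "f\<in>sq_int M ==> (%x. f x/c)\<in>sq_int M"
 by (auto simp: sq_int_def power_divide)

lemma sq_int_diff: "f\<in>sq_int M ==> g\<in>sq_int M ==> (%x. f x - g x)\<in>sq_int M"
 using sq_int_add[OF _ sq_int_uminus] by fastforce

lemma sq_int_sum: "(\<And>i. i\<in>I ==> f i\<in>sq_int M) ==> (%x. \<Sum>i\<in>I. f i x)\<in>sq_int M"
 by (induction I rule: infinite_finite_induct) (auto intro!: sq_int_add)

lemma sq_int_abs: "f\<in>sq_int M ==> (%x. \<bar>f x\<bar>)\<in>sq_int M"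
 by (auto simp: sq_int_def)

lemma sq_int_bounded_mult:
 assumes "f\<in>sq_int M" "g\<in>borel_measurable M" "\<And>x. \<bar>g x\<bar>\<le>C"
 shows "(%x. g x*f x)\<in>sq_int M"
proof (rule sq_int_bound)
 show "(%x. C*f x)\<in>sq_int M" using assms(1) by (rule sq_int_cmult)
 have "\<bar>g x*f x\<bar>\<le>\<bar>C*f x\<bar>" for x
 proof -
  have "\<bar>g x\<bar>\<le>\<bar>C\<bar>" using assms(3)[of x] by linarith
  then show ?thesis unfolding abs_mult by (rule mult_right_mono) simp
 qed
 then show "AE x in M. \<bar>g x*f x\<bar>\<le>\<bar>C*f x\<bar>" by simp
qed (use assms in \<open>auto simp: sq_int_def\<close>)

lemma ltwo_nonneg [simp]: "0\<le>ltwo M f"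
 by (simp add: ltwo_def)

lemma ltwo_sq: "(ltwo M f)^2 = (\<integral>x. (f x)^2 \<partial>M)"
 by (simp add: ltwo_def)

lemma ltwo_zero [simp]: "ltwo M (%x. 0) = 0"
 by (simp add: ltwo_def)

lemma ltwo_cmult: "ltwo M (%x. c*f x) = \<bar>c\<bar>*ltwo M f"
 by (simp add: ltwo_def power_mult_distrib real_sqrt_mult)

lemma ltwo_uminus [simp]: "ltwo M (%x. - f x) = ltwo M f"
 by (simp add: ltwo_def)

lemma ltwo_diff_commute: "ltwo M (%x. f x - g x) = ltwo M (%x. g x - f x)"
 by (simp add: ltwo_def power2_commute)

lemma ltwo_CS:
 assumes "f\<in>sq_int M" "g\<in>sq_int M"
 shows "\<bar>\<integral>x. f x*g x \<partial>M\<bar>\<le>ltwo M f*ltwo M g"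
proof -
 have "0\<le>(\<integral>x. (f x)^2 \<partial>M) + 2*t*(\<integral>x. f x*g x \<partial>M) + t^2*(\<integral>x. (g x)^2 \<partial>M)" for t
 proof -
  have "0\<le>(\<integral>x. (f x + t*g x)^2 \<partial>M)" by simp
  also have "(%x. (f x + t*g x)^2) = (%x. (f x)^2 + (2*t)*(f x*g x) + t^2*(g x)^2)"
   by (auto simp: power2_eq_square algebra_simps)
  also have "(\<integral>x. ... x \<partial>M) = (\<integral>x. (f x)^2 \<partial>M) + 2*t*(\<integral>x. f x*g x \<partial>M) + t^2*(\<integral>x. (g x)^2 \<partial>M)"
   using assms by (simp add: sq_int_integrable sq_int_mult_integrable)
  finally show ?thesis .
 qed
 note * = this
 define a b c where "a = (\<integral>x. (f x)^2 \<partial>M)" and "b = (\<integral>x. f x*g x \<partial>M)"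
  and "c = (\<integral>x. (g x)^2 \<partial>M)"
 have c0: "c\<ge>0" and a0: "a\<ge>0" by (auto simp: a_def c_def)
 have "b^2\<le>a*c"
 proof (cases "c = 0")
  case True
  have "b = 0"
  proof (rule ccontr)
   assume "b\<noteq>0"
   \<comment> \<open>With \<open>c = 0\<close> the polynomial in \<open>t\<close> is affine, and
     this choice of \<open>t\<close> gives it the value -1.\<close>
   have "0\<le>a + 2*(-(a+1)/(2*b))*b + (-(a+1)/(2*b))^2*c"
    unfolding a_def b_def c_def by (rule *)
   then show False using \<open>b \<noteq> 0\<close> True a0 by (simp add: field_simps)
  qed
  then show ?thesis using True by simp
 next
  case False
  have "0\<le>a + 2*(-b/c)*b + (-b/c)^2*c"
   unfolding a_def b_def c_def by (rule *)
  then have "0\<le>a - b^2/c" using False by (simp add: power2_eq_square)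
  then show ?thesis using False c0 by (simp add: field_simps)
 qed
 then have "\<bar>b\<bar>\<le>sqrt (a*c)" by (simp add: real_le_rsqrt)
 then show ?thesis by (simp add: ltwo_def a_def b_def c_def real_sqrt_mult)
qed

lemma ltwo_triangle:
 assumes "f\<in>sq_int M" "g\<in>sq_int M"
 shows "ltwo M (%x. f x + g x)\<le>ltwo M f + ltwo M g"
proof -
 have "(ltwo M (%x. f x + g x))^2 = (\<integral>x. (f x)^2 + (g x)^2 + 2*(f x*g x) \<partial>M)"
  by (simp add: ltwo_sq power2_sum mult.assoc)
 also have "... = (ltwo M f)^2 + (ltwo M g)^2 + 2*(\<integral>x. f x*g x \<partial>M)"
  using assms by (simp add: ltwo_sq sq_int_integrable sq_int_mult_integrable)
 also have "...\<le>(ltwo M f + ltwo M g)^2"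
  using ltwo_CS[OF assms] by (simp add: power2_sum)
 finally show ?thesis by (rule power2_le_imp_le) simp
qed

lemma ltwo_triangle_diff:
 assumes "f\<in>sq_int M" "g\<in>sq_int M"
 shows "ltwo M (%x. f x - g x)\<le>ltwo M f + ltwo M g"
 using ltwo_triangle[OF assms(1) sq_int_uminus[OF assms(2)]] by simp

lemma ltwo_triangle3:
 assumes "f\<in>sq_int M" "g\<in>sq_int M" "h\<in>sq_int M"
 shows "ltwo M (%x. f x - h x)\<le>ltwo M (%x. f x - g x) + ltwo M (%x. g x - h x)"
 using ltwo_triangle[OF sq_int_diff[OF assms(1,2)] sq_int_diff[OF assms(2,3)]] by simp

lemma ltwo_abs_diff:
 assumes "f\<in>sq_int M" "g\<in>sq_int M"
 shows "\<bar>ltwo M f - ltwo M g\<bar>\<le>ltwo M (%x. f x - g x)"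
 using ltwo_triangle3[OF assms sq_int_zero] ltwo_triangle3[OF assms(2,1) sq_int_zero]
 by (simp add: ltwo_diff_commute[of M g f])

lemma ltwo_mono_AE:
 assumes "f\<in>borel_measurable M" "g\<in>sq_int M" "AE x in M. \<bar>f x\<bar>\<le>\<bar>g x\<bar>"
 shows "ltwo M f\<le>ltwo M g"
 unfolding ltwo_def real_sqrt_le_iff
 using sq_int_integrable[OF sq_int_bound[OF assms]] sq_int_integrable[OF assms(2)]
 by (rule integral_mono_AE) (use assms(3) in \<open>auto simp: abs_le_square_iff\<close>)

lemma ltwo_eq_0_iff:
 assumes "f\<in>sq_int M"
 shows "ltwo M f = 0 \<longleftrightarrow> (AE x in M. f x = 0)"
 using integral_nonneg_eq_0_iff_AE[OF sq_int_integrable[OF assms]] by (simp add: ltwo_def)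

section \<open>Convergence in the mean: limits of norms and products, completeness, subsequences
  converging almost everywhere\<close>

lemma ltwo_tendsto_norm:
 assumes "f\<in>sq_int M" "\<And>n. s n\<in>sq_int M" "(%n. ltwo M (%x. s n x - f x))---->0"
 shows "(%n. ltwo M (s n))---->ltwo M f"
proof -
 have "(%n. ltwo M (s n) - ltwo M f)---->0"
  by (rule Lim_null_comparison[OF _ assms(3)])
    (use ltwo_abs_diff[OF assms(2) assms(1)] in auto)
 then show ?thesis by (simp add: LIM_zero_iff)
qed

lemma ltwo_tendsto_inner:
 assumes "f\<in>sq_int M" "\<And>n. s n\<in>sq_int M" "(%n. ltwo M (%x. s n x - f x))---->0"
  and "g\<in>sq_int M"
 shows "(%n. \<integral>x. s n x*g x \<partial>M)---->(\<integral>x. f x*g x \<partial>M)"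
proof -
 have "(%n. (\<integral>x. s n x*g x \<partial>M) - (\<integral>x. f x*g x \<partial>M))---->0"
 proof (rule Lim_null_comparison)
  show "\<forall>\<^sub>F n in sequentially. norm ((\<integral>x. s n x*g x \<partial>M) - (\<integral>x. f x*g x \<partial>M))
    \<le> ltwo M (%x. s n x - f x)*ltwo M g"
  proof (rule always_eventually, rule allI)
   fix n
   have "(\<integral>x. s n x*g x \<partial>M) - (\<integral>x. f x*g x \<partial>M) = (\<integral>x. (s n x - f x)*g x \<partial>M)"
    using sq_int_mult_integrable[OF assms(2)[of n] assms(4)] sq_int_mult_integrable[OF assms(1,4)]
    by (simp add: left_diff_distrib)
   then show "norm ((\<integral>x. s n x*g x \<partial>M) - (\<integral>x. f x*g x \<partial>M))\<le>ltwo M (%x. s n x - f x)*ltwo M g"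
    using ltwo_CS[OF sq_int_diff[OF assms(2)[of n] assms(1)] assms(4)] by simp
  qed
  show "(%n. ltwo M (%x. s n x - f x)*ltwo M g)---->0"
   using tendsto_mult_left_zero[OF assms(3)] by simp
 qed
 then show ?thesis by (simp add: LIM_zero_iff)
qed

lemma ltwo_parallelogram:
 assumes "f\<in>sq_int M" "g\<in>sq_int M"
 shows "(ltwo M (%x. (f x + g x)/2))^2 + (ltwo M (%x. f x - g x))^2/4
  = ((ltwo M f)^2 + (ltwo M g)^2)/2"
proof -
 have *: "integrable M (%x. f x*g x)" "integrable M (%x. (f x)^2)" "integrable M (%x. (g x)^2)"
  using assms by (auto intro: sq_int_mult_integrable sq_int_integrable)
 have "((f x + g x)/2)^2 = (f x)^2/4 + (g x)^2/4 + (f x*g x)/2"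
  "(f x - g x)^2 = (f x)^2 + (g x)^2 - 2*(f x*g x)" for x
  by (auto simp: power2_eq_square field_simps)
 then show ?thesis using * by (simp add: ltwo_sq diff_divide_distrib add_divide_distrib)
qed

text \<open>The weights \<open>4^k\<close> are small enough for the integrals of the weighted
  squares to stay below \<open>(1/2)^k\<close>, hence summable, and large enough that almost
  everywhere the increments are eventually at most \<open>(1/2)^k\<close>.\<close>

lemma AE_convergent_of_fast:
 assumes s: "\<And>n. s n\<in>sq_int M"
  and fast: "\<And>k. (ltwo M (%x. s (Suc k) x - s k x))^2\<le>(1/8)^k"
 shows "AE x in M. convergent (%k. s k x)"
proof -
 note [measurable] = sq_int_measurable[OF s]
 define d where "d k x = 4^k*(s (Suc k) x - s k x)^2" for k x
 have d0: "d k x\<ge>0" for k x by (simp add: d_def)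
 have [measurable]: "d k\<in>borel_measurable M" for k unfolding d_def by measurable
 have dint: "integrable M (d k)" for k
  unfolding d_def using sq_int_integrable[OF sq_int_diff[OF s s]] by simp
 have "(\<integral>\<^sup>+x. ennreal (d k x) \<partial>M)\<le>ennreal ((1/2)^k)" for k
 proof -
  have "(\<integral>\<^sup>+x. ennreal (d k x) \<partial>M) = ennreal (\<integral>x. d k x \<partial>M)"
   by (rule nn_integral_eq_integral[OF dint]) (simp add: d0)
  also have "(\<integral>x. d k x \<partial>M) = 4^k*(ltwo M (%x. s (Suc k) x - s k x))^2"
   by (simp add: d_def ltwo_sq)
  also have "...\<le>4^k*(1/8)^k" using fast[of k] by simp
  also have "... = (1/2)^k" by (simp flip: power_mult_distrib)
  finally show ?thesis by (simp add: ennreal_leI)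
 qed
 then have "(\<Sum>k. \<integral>\<^sup>+x. ennreal (d k x) \<partial>M)\<le>(\<Sum>k. ennreal ((1/2)^k))"
  by (intro suminf_le) auto
 also have "... = ennreal (\<Sum>k. (1/2)^k)"
  by (rule suminf_ennreal2) (auto intro: summable_geometric)
 finally have "(\<integral>\<^sup>+x. (\<Sum>k. ennreal (d k x)) \<partial>M) < \<infinity>"
  by (simp add: nn_integral_suminf) (metis ennreal_less_top le_less_trans)
 then have "AE x in M. (\<Sum>k. ennreal (d k x))\<noteq>\<infinity>"
  by (intro nn_integral_noteq_infinite) auto
 then show ?thesis
 proof eventually_elim
  case (elim x)
  have "summable (%k. d k x)"
   using elim d0 by (intro summable_suminf_not_top) auto
  then have "(%k. d k x)---->0" by (rule summable_LIMSEQ_zero)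
  then have "eventually (%k. d k x < 1) sequentially"
   by (rule order_tendstoD) simp
  then have "eventually (%k. norm (s (Suc k) x - s k x)\<le>(1/2)^k) sequentially"
  proof eventually_elim
   case (elim k)
   then have "(2^k*(s (Suc k) x - s k x))^2\<le>1^2"
    by (simp add: d_def power_mult_distrib flip: power_mult) (simp add: power_mult mult.commute[of k 2])
   then have "\<bar>2^k*(s (Suc k) x - s k x)\<bar>\<le>1"
    by (metis abs_le_square_iff abs_one)
   then have "2^k*\<bar>s (Suc k) x - s k x\<bar>\<le>1" by (simp only: abs_mult) simp
   then show ?case by (simp add: power_divide pos_le_divide_eq mult.commute)
  qed
  then have "summable (%k. s (Suc k) x - s k x)"
   by (rule summable_comparison_test_ev) (simp add: summable_geometric)
  then have "convergent (%n. \<Sum>k<n. s (Suc k) x - s k x)"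
   by (simp add: summable_iff_convergent)
  then have "convergent (%n. s n x - s 0 x)" using sum_lessThan_telescope[of "%k. s k x"] by simp
  then have "convergent (%n. (s n x - s 0 x) + s 0 x)"
   by (rule convergent_add) (rule convergent_const)
  then show "convergent (%n. s n x)" by simp
 qed
qed

definition ltwo_Cauchy :: "'a measure => (nat => 'a => real) => bool" where
 "ltwo_Cauchy M s \<longleftrightarrow> (\<forall>e>0. \<exists>N. \<forall>m\<ge>N. \<forall>n\<ge>N. ltwo M (%x. s m x - s n x) < e)"

text \<open>Fatou's lemma for the squares. The bound is asked for eventually only, so that tails of
  Cauchy sequences can be used.\<close>

lemma ltwo_Fatou:
 assumes s: "\<And>n. s n\<in>sq_int M" and f: "f\<in>borel_measurable M"
  and lim: "AE x in M. (%n. s n x)---->f x" and B: "eventually (%n. ltwo M (s n)\<le>B) sequentially"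
 shows "f\<in>sq_int M" "ltwo M f\<le>B"
proof -
 note [measurable] = sq_int_measurable[OF s] f
 have B0: "B\<ge>0"
  using eventually_happens[OF B] ltwo_nonneg by (auto dest: order_trans[OF ltwo_nonneg])
 have eq: "(\<integral>\<^sup>+x. ennreal ((s n x)^2) \<partial>M) = ennreal ((ltwo M (s n))^2)" for n
  using nn_integral_eq_integral[OF sq_int_integrable[OF s]] by (simp add: ltwo_sq)
 have "(\<integral>\<^sup>+x. ennreal ((f x)^2) \<partial>M) = (\<integral>\<^sup>+x. liminf (%n. ennreal ((s n x)^2)) \<partial>M)"
 proof (rule nn_integral_cong_AE)
  show "AE x in M. ennreal ((f x)^2) = liminf (%n. ennreal ((s n x)^2))"
   using lim
  proof eventually_elim
   case (elim x)
   have "(%n. ennreal ((s n x)^2))---->ennreal ((f x)^2)"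
    by (intro tendsto_ennrealI tendsto_power elim)
   from lim_imp_Liminf[OF _ this] show ?case by simp
  qed
 qed
 also have "...\<le>liminf (%n. \<integral>\<^sup>+x. ennreal ((s n x)^2) \<partial>M)"
  by (rule nn_integral_liminf) auto
 also have "...\<le>ennreal (B^2)"
 proof (rule Liminf_le)
  show "eventually (%n. (\<integral>\<^sup>+x. ennreal ((s n x)^2) \<partial>M)\<le>ennreal (B^2)) sequentially"
   using B by eventually_elim (auto simp: eq intro!: ennreal_leI power_mono)
 qed simp
 finally have *: "(\<integral>\<^sup>+x. ennreal ((f x)^2) \<partial>M)\<le>ennreal (B^2)" .
 have "integrable M (%x. (f x)^2)"
  by (rule integrableI_bounded) (use * in \<open>auto intro: le_less_trans\<close>)
 then show "f\<in>sq_int M" using f by (rule sq_intI[rotated])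
 have "ennreal ((ltwo M f)^2)\<le>ennreal (B^2)"
  using * nn_integral_eq_integral[OF \<open>integrable M (%x. (f x)^2)\<close>] by (simp add: ltwo_sq)
 then have "(ltwo M f)^2\<le>B^2" by (simp add: B0)
 then show "ltwo M f\<le>B" using B0 by (rule power2_le_imp_le)
qed

lemma ltwo_Cauchy_subseq_fast:
 assumes "ltwo_Cauchy M s"
 obtains r where "strict_mono r" "\<And>k. (ltwo M (%x. s (r (Suc k)) x - s (r k) x))^2\<le>(1/8)^k"
proof -
 have "\<exists>N. \<forall>m\<ge>N. \<forall>n\<ge>N. (ltwo M (%x. s m x - s n x))^2\<le>(1/8)^k" for k
 proof -
  have "sqrt ((1/8)^k) > 0" by simp
  then obtain N where N: "\<And>m n. m\<ge>N ==> n\<ge>N ==> ltwo M (%x. s m x - s n x) < sqrt ((1/8)^k)"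
   using assms unfolding ltwo_Cauchy_def by blast
  have "(ltwo M (%x. s m x - s n x))^2\<le>(sqrt ((1/8)^k))^2" if "m\<ge>N" "n\<ge>N" for m n
   using N[OF that] by (intro power_mono) auto
  then show ?thesis by auto
 qed
 then obtain N where N: "\<And>k m n. m\<ge>N k ==> n\<ge>N k ==> (ltwo M (%x. s m x - s n x))^2\<le>(1/8)^k"
  by metis
 define r where "r = rec_nat (N 0) (%k p. Suc (max p (N (Suc k))))"
 have r0: "r 0 = N 0" and rS: "r (Suc k) = Suc (max (r k) (N (Suc k)))" for k
  by (simp_all add: r_def)
 have "r k\<ge>N k" for k by (cases k) (auto simp: r0 rS)
 moreover have "strict_mono r" by (rule strict_monoI_Suc) (simp add: rS)
 moreover from calculation have "r (Suc k)\<ge>N k" for k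
  using strict_mono_less_eq[of r k "Suc k"] le_trans by (metis le_SucI order_refl)
 ultimately show ?thesis using N that by blast
qed

text \<open>Riesz-Fischer. The candidate is the pointwise limit of a fast subsequence; Fatou's lemma
  along this subsequence, with the other index fixed, turns the Cauchy bound into a bound on the
  distance to the limit for the full sequence.\<close>

theorem ltwo_complete:
 assumes s: "\<And>n. s n\<in>sq_int M" and C: "ltwo_Cauchy M s"
 obtains f where "f\<in>sq_int M" "(%n. ltwo M (%x. s n x - f x))---->0"
proof -
 note [measurable] = sq_int_measurable[OF s]
 obtain r where r: "strict_mono r" "\<And>k. (ltwo M (%x. s (r (Suc k)) x - s (r k) x))^2\<le>(1/8)^k"
  using ltwo_Cauchy_subseq_fast[OF C] by blast
 have conv: "AE x in M. convergent (%k. s (r k) x)"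
  by (rule AE_convergent_of_fast) (use s r in auto)
 define f where "f x = lim (%k. s (r k) x)" for x
 have [measurable]: "f\<in>borel_measurable M" unfolding f_def by measurable
 have lim: "AE x in M. (%k. s (r k) x)---->f x"
  using conv by eventually_elim (simp add: f_def convergent_LIMSEQ_iff)
 have bd: "(%x. s n x - f x)\<in>sq_int M\<and>ltwo M (%x. s n x - f x)\<le>e"
  if N: "\<And>m n. m\<ge>N ==> n\<ge>N ==> ltwo M (%x. s m x - s n x) < e" and n: "n\<ge>N" for n N e
 proof -
  have 1: "\<And>k. (%x. s n x - s (r k) x)\<in>sq_int M" by (intro sq_int_diff s)
  have 2: "AE x in M. (%k. s n x - s (r k) x)---->s n x - f x"
   using lim by eventually_elim (intro tendsto_intros)
  have 3: "eventually (%k. ltwo M (%x. s n x - s (r k) x)\<le>e) sequentially"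
   using eventually_ge_at_top[of N]
   by eventually_elim (use N n seq_suble[OF r(1)] le_trans in \<open>blast intro: less_imp_le\<close>)
  show ?thesis using ltwo_Fatou[OF 1 _ 2 3] by simp
 qed
 have ex: "\<exists>N. \<forall>m\<ge>N. \<forall>n\<ge>N. ltwo M (%x. s m x - s n x) < e" if "e > 0" for e
  using C that unfolding ltwo_Cauchy_def by blast
 obtain N where N: "\<And>m n. m\<ge>N ==> n\<ge>N ==> ltwo M (%x. s m x - s n x) < 1"
  using ex[of 1] by auto
 have "(%x. s N x - f x)\<in>sq_int M" using bd[OF N le_refl] by blast
 then have "(%x. s N x - (s N x - f x))\<in>sq_int M"
  by (rule sq_int_diff[OF s])
 then have "f\<in>sq_int M" by simp
 moreover have "(%n. ltwo M (%x. s n x - f x))---->0"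
 proof (rule LIMSEQ_I)
  fix e :: real assume "e > 0"
  then obtain N where "\<And>m n. m\<ge>N ==> n\<ge>N ==> ltwo M (%x. s m x - s n x) < e/2"
   using ex[of "e/2"] by auto
  from bd[OF this] have "ltwo M (%x. s n x - f x)\<le>e/2" if "n\<ge>N" for n
   using that by blast
  then show "\<exists>N. \<forall>n\<ge>N. norm (ltwo M (%x. s n x - f x) - 0) < e"
   using \<open>e > 0\<close> by (intro exI[of _ N]) (fastforce simp: field_simps)
 qed
 ultimately show ?thesis by (rule that)
qed

lemma ltwo_tendsto_imp_Cauchy:
 assumes "\<And>n. s n\<in>sq_int M" "f\<in>sq_int M" "(%n. ltwo M (%x. s n x - f x))---->0"
 shows "ltwo_Cauchy M s"
 unfolding ltwo_Cauchy_def
proof (intro allI impI)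
 fix e :: real assume "e > 0"
 then have "eventually (%n. ltwo M (%x. s n x - f x) < e/2) sequentially"
  using assms(3) by (intro order_tendstoD) auto
 then obtain N where N: "\<And>n. n\<ge>N ==> ltwo M (%x. s n x - f x) < e/2"
  by (auto simp: eventually_sequentially)
 have "ltwo M (%x. s m x - s n x) < e" if "m\<ge>N" "n\<ge>N" for m n
  using ltwo_triangle3[OF assms(1,2) assms(1), of m n] N[OF that(1)] N[OF that(2)]
  by (simp add: ltwo_diff_commute[of M f])
 then show "\<exists>N. \<forall>m\<ge>N. \<forall>n\<ge>N. ltwo M (%x. s m x - s n x) < e" by blast
qed

lemma ltwo_tendsto_AE_subseq:
 assumes s: "\<And>n. s n\<in>sq_int M" and f: "f\<in>sq_int M"
  and l: "(%n. ltwo M (%x. s n x - f x))---->0"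
 obtains r where "strict_mono r" "AE x in M. (%k. s (r k) x)---->f x"
proof -
 note [measurable] = sq_int_measurable[OF s] sq_int_measurable[OF f]
 obtain r where r: "strict_mono r" "\<And>k. (ltwo M (%x. s (r (Suc k)) x - s (r k) x))^2\<le>(1/8)^k"
  using ltwo_Cauchy_subseq_fast[OF ltwo_tendsto_imp_Cauchy[OF s f l]] by blast
 have conv: "AE x in M. convergent (%k. s (r k) x)"
  by (rule AE_convergent_of_fast) (use s r in auto)
 define g where "g x = lim (%k. s (r k) x)" for x
 have [measurable]: "g\<in>borel_measurable M" unfolding g_def by measurable
 have lim: "AE x in M. (%k. s (r k) x)---->g x"
  using conv by eventually_elim (simp add: g_def convergent_LIMSEQ_iff)
 have lim': "AE x in M. (%k. s (r k) x - f x)---->g x - f x"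
  using lim by eventually_elim (intro tendsto_intros)
 have lr: "(%n. ltwo M (%x. s (r n) x - f x))---->0"
  using LIMSEQ_subseq_LIMSEQ[OF l r(1)] by (simp add: o_def)
 have ev: "eventually (%n. ltwo M (%x. s (r n) x - f x)\<le>e) sequentially" if "e > 0" for e
  using order_tendstoD(2)[OF lr that] by eventually_elim simp
 have sq: "\<And>n. (%x. s (r n) x - f x)\<in>sq_int M" by (intro sq_int_diff s f)
 have "ltwo M (%x. g x - f x)\<le>e" if "e > 0" for e
  by (rule ltwo_Fatou(2)[OF sq _ lim' ev[OF that]]) simp
 then have "ltwo M (%x. g x - f x) = 0"
  using ltwo_nonneg[of M "%x. g x - f x"] by (meson antisym dense_ge)
 moreover have "(%x. g x - f x)\<in>sq_int M"
  by (rule ltwo_Fatou(1)[OF sq _ lim' ev[of 1]]) simp_all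
 ultimately have "AE x in M. g x - f x = 0" by (simp add: ltwo_eq_0_iff)
 with lim have "AE x in M. (%k. s (r k) x)---->f x" by eventually_elim simp
 with r(1) show ?thesis by (rule that)
qed

section \<open>Smooth functions and mollifiers\<close>

definition smooth :: "(real^'n::finite => real) => bool" where
 "smooth p \<longleftrightarrow> (\<forall>as y. partial_derivs as p differentiable (at y))"

lemma test_functions_iff:
 "p\<in>test_functions G \<longleftrightarrow> smooth p\<and>compact (closure {y. p y\<noteq>0})\<and>closure {y. p y\<noteq>0}\<subseteq>G"
 by (simp add: test_functions_def smooth_def)

lemma test_functions_mono: "G\<subseteq>G' ==> test_functions G\<subseteq>test_functions G'"
 by (auto simp: test_functions_def)

lemma partial_derivs_append: "partial_derivs as (partial_derivs bs p) = partial_derivs (as @ bs) p"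
 by (induction as) simp_all

lemma smooth_partial_derivs: "smooth p ==> smooth (partial_derivs as p)"
 by (simp add: smooth_def partial_derivs_append)

lemma smooth_differentiable: "smooth p ==> p differentiable (at y)"
 unfolding smooth_def by (metis partial_derivs.simps(1))

lemma vec_eq_sum_axis: "(h::real^'n) = (\<Sum>i\<in>UNIV. h $ i *\<^sub>R axis i 1)"
 by (simp add: vec_eq_iff axis_def if_distrib[of "%x. _*x"] sum.delta cong: if_cong)

lemma smooth_has_derivative:
 fixes p :: "real^'n => real"
 assumes "smooth p"
 shows "(p has_derivative (%h. \<Sum>i\<in>UNIV. h $ i*pd i p y)) (at y)"
proof -
 let ?D = "frechet_derivative p (at y)"
 have D: "(p has_derivative ?D) (at y)"
  using smooth_differentiable[OF assms] frechet_derivative_works by blast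
 have lin: "linear ?D" by (rule has_derivative_linear[OF D])
 have "?D h = (\<Sum>i\<in>UNIV. h $ i*pd i p y)" for h
 proof -
  have "?D h = ?D (\<Sum>i\<in>UNIV. h $ i *\<^sub>R axis i 1)" by (simp add: vec_eq_sum_axis[symmetric])
  also have "... = (\<Sum>i\<in>UNIV. h $ i*?D (axis i 1))"
   using lin by (simp add: linear_sum linear_scale)
  finally show ?thesis by simp
 qed
 then have "?D = (%h. \<Sum>i\<in>UNIV. h $ i*pd i p y)" by blast
 then show ?thesis using D by simp
qed

lemma partial_deriv_eq:
 fixes f :: "real^'n => real"
 assumes "(f has_derivative (%h. \<Sum>i\<in>UNIV. h $ i*g i)) (at y)"
 shows "frechet_derivative f (at y) (axis k 1) = g k"
proof -
 have "frechet_derivative f (at y) = (%h. \<Sum>i\<in>UNIV. h $ i*g i)"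
  using frechet_derivative_at[OF assms] by simp
 then show ?thesis by (simp add: axis_def if_distrib[of "%x. x * _"] cong: if_cong)
qed

text \<open>Induction on the list of directions: a class of differentiable functions that is closed
  under first partial derivatives contains all iterated ones. It spares a formula for higher
  derivatives of products.\<close>

lemma smoothI_class:
 assumes "p\<in>C" and diff: "\<And>f y. f\<in>C ==> f differentiable (at y)"
  and cl: "\<And>f i. f\<in>C ==> (%y. frechet_derivative f (at y) (axis i 1))\<in>C"
 shows "smooth p"
proof -
 have "partial_derivs as p\<in>C" for as
  by (induction as) (simp_all add: assms cl)
 then show ?thesis unfolding smooth_def using diff by blast
qed

lemma partial_derivs_add:
 assumes "smooth p" "smooth q"
 shows "partial_derivs as (%x. p x + q x) = (%x. partial_derivs as p x + partial_derivs as q x)"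
proof (induction as)
 case (Cons a as)
 have "frechet_derivative (%x. partial_derivs as p x + partial_derivs as q x) (at y) =
   (%h. frechet_derivative (partial_derivs as p) (at y) h + frechet_derivative (partial_derivs as q) (at y) h)" for y
  using assms unfolding smooth_def
  by (intro frechet_derivative_at[symmetric] has_derivative_add) (auto simp flip: frechet_derivative_works)
 then show ?case by (simp add: Cons)
qed simp

lemma partial_derivs_cmult:
 assumes "smooth p"
 shows "partial_derivs as (%x. c*p x) = (%x. c*partial_derivs as p x)"
proof (induction as)
 case (Cons a as)
 have "frechet_derivative (%x. c*partial_derivs as p x) (at y) =
   (%h. c*frechet_derivative (partial_derivs as p) (at y) h)" for y
  using assms unfolding smooth_def
  by (intro frechet_derivative_at[symmetric] has_derivative_mult_right) (auto simp flip: frechet_derivative_works)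
 then show ?case by (simp add: Cons)
qed simp

lemma smooth_add: "smooth p ==> smooth q ==> smooth (%x. p x + q x)"
 by (simp add: smooth_def partial_derivs_add[unfolded smooth_def])

lemma smooth_cmult: "smooth p ==> smooth (%x. c*p x)"
 by (simp add: smooth_def partial_derivs_cmult[unfolded smooth_def])

lemma smooth_affine_has_derivative:
 assumes "smooth p"
 shows "((%x. p (a + c *\<^sub>R x)) has_derivative
  (%h. \<Sum>i\<in>UNIV. h $ i*(c*pd i p (a + c *\<^sub>R y)))) (at y)"
proof -
 have "((%x. a + c *\<^sub>R x) has_derivative (%h. c *\<^sub>R h)) (at y)"
  by (auto intro!: derivative_eq_intros)
 from has_derivative_compose[OF this smooth_has_derivative[OF assms]]
 show ?thesis by (simp add: mult_ac)
qed

lemma partial_derivs_affine: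
 assumes "smooth f"
 shows "partial_derivs as (%x. f (a + c *\<^sub>R x)) = (%x. c^length as*partial_derivs as f (a + c *\<^sub>R x))"
proof (induction as)
 case (Cons k as)
 let ?p = "partial_derivs as f"
 have "((%x. c^length as*?p (a + c *\<^sub>R x)) has_derivative
   (%h. \<Sum>i\<in>UNIV. h $ i*(c^Suc (length as)*pd i ?p (a + c *\<^sub>R y)))) (at y)" for y
  using has_derivative_mult_right[OF smooth_affine_has_derivative[OF smooth_partial_derivs[OF assms, of as]], of "c^length as" a c y]
  by (simp add: sum_distrib_left mult_ac)
 from partial_deriv_eq[OF this] show ?case by (simp add: Cons)
qed simp

lemma smooth_affine:
 assumes "smooth p"
 shows "smooth (%x. p (a + c *\<^sub>R x))"
proof -
 have "(%x. c^length as*partial_derivs as p (a + c *\<^sub>R x)) differentiable (at y)" for as y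
  by (intro differentiable_mult differentiable_const)
    (use smooth_affine_has_derivative[OF smooth_partial_derivs[OF assms, of as]] in \<open>auto simp: differentiable_def\<close>)
 then show ?thesis using assms by (simp add: smooth_def partial_derivs_affine)
qed

lemma smooth_continuous: "smooth p ==> continuous_on A p"
 by (meson smooth_differentiable differentiable_imp_continuous_within continuous_at_imp_continuous_on)

subsection \<open>A bump function\<close>

text \<open>The polynomial parameter makes the family closed under differentiation: with
  \<open>x = 1/t\<close> the derivative of \<open>p(x) exp(-x)\<close> in \<open>t\<close> is
  \<open>x^2 (p(x) - p'(x)) exp(-x)\<close>, again of this form.\<close>

definition expinv :: "real poly => real => real" where
 "expinv p t = (if t > 0 then poly p (1/t)*exp (- (1/t)) else 0)"

lemma poly_exp_tendsto_0: "((%x. poly p x*exp (- x))\<longlongrightarrow>(0::real)) at_top"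
proof -
 have "((%x::real. \<Sum>i\<le>degree p. coeff p i*(x^i/exp x))\<longlongrightarrow>(\<Sum>i\<le>degree p. coeff p i*0)) at_top"
  by (intro tendsto_sum tendsto_mult tendsto_const tendsto_power_div_exp_0)
 then show ?thesis
  by (simp add: poly_altdef exp_minus sum_distrib_right field_simps sum_divide_distrib)
qed

lemma expinv_deriv:
 "(expinv p has_real_derivative expinv ([:0,0,1:]*(p - pderiv p)) t) (at t)"
proof -
 let ?q = "[:0,0,1:]*(p - pderiv p)"
 consider "t > 0" | "t < 0" | "t = 0" by linarith
 then show ?thesis
 proof cases
  case 1
  have "((%t. poly p (1/t)*exp (- (1/t))) has_real_derivative expinv ?q t) (at t)"
   using 1 by (auto intro!: derivative_eq_intros simp: expinv_def power2_eq_square field_simps)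
  then show ?thesis
   by (rule has_field_derivative_transform_within_open[of _ _ _ "{0<..}"]) (use 1 in \<open>auto simp: expinv_def\<close>)
 next
  case 2
  have "((%t. 0) has_real_derivative expinv ?q t) (at t)" using 2 by (auto simp: expinv_def)
  then show ?thesis
   by (rule has_field_derivative_transform_within_open[of _ _ _ "{..<0}"]) (use 2 in \<open>auto simp: expinv_def\<close>)
 next
  case 3
  have "((%h. expinv p h/h)\<longlongrightarrow>0) (at_right 0)"
  proof -
   have "((%x. poly ([:0,1:]*p) (inverse x)*exp (- inverse x))\<longlongrightarrow>(0::real)) (at_right 0)"
    by (rule filterlim_compose[OF poly_exp_tendsto_0 filterlim_inverse_at_top_right])
   then show ?thesis
    by (rule Lim_transform_eventually)
      (auto simp: eventually_at_right_less expinv_def field_simps eventually_at_filter)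
  qed
  moreover have "((%h. expinv p h/h)\<longlongrightarrow>0) (at_left 0)"
   by (rule Lim_transform_eventually[of "%_. 0"])
     (auto simp: expinv_def eventually_at_filter)
  ultimately have "((%h. expinv p h/h)\<longlongrightarrow>0) (at 0)" by (simp add: filterlim_split_at)
  then show ?thesis using 3 by (simp add: DERIV_def expinv_def)
 qed
qed

text \<open>An algebra generated by one-variable profiles. Its generators are closed under
  differentiation, so the product rule keeps all partial derivatives inside and
  \<open>smoothI_class\<close> applies.\<close>

inductive_set bump_class :: "(real^'n::finite => real) set" where
 base: "(%x. expinv p (1 + s*x $ i))\<in>bump_class"
| const: "(%x. c)\<in>bump_class"
| add: "f\<in>bump_class ==> g\<in>bump_class ==> (%x. f x + g x)\<in>bump_class"
| mult: "f\<in>bump_class ==> g\<in>bump_class ==> (%x. f x*g x)\<in>bump_class"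

lemma bump_class_deriv:
 fixes f :: "real^'n => real"
 assumes "f\<in>bump_class"
 shows "\<exists>g. (\<forall>i. g i\<in>bump_class)\<and>(\<forall>y. (f has_derivative (%h. \<Sum>i\<in>UNIV. h $ i*g i y)) (at y))"
 using assms
proof induction
 case (base p s k)
 let ?q = "[:0,0,1:]*(p - pderiv p)"
 define g where "g i = (%x::real^'n. (if i = k then s else 0)*expinv ?q (1 + s*x $ k))" for i
 have "(%x::real^'n. (if i = k then s else 0))\<in>bump_class" for i by (rule bump_class.const)
 then have "g i\<in>bump_class" for i
  unfolding g_def by (rule bump_class.mult) (rule bump_class.base)
 moreover have "((%x. expinv p (1 + s*x $ k)) has_derivative (%h. \<Sum>i\<in>UNIV. h $ i*g i y)) (at y)" for y :: "real^'n"
 proof -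
  have "((%x. expinv p (1 + s*x $ k)) has_derivative (%h. expinv ?q (1 + s*y $ k)*(s*h $ k))) (at y)"
  proof -
   have 1: "((%x. 1 + s*x $ k) has_derivative (%h. s*h $ k)) (at y)"
    by (auto intro!: derivative_eq_intros bounded_linear_imp_has_derivative bounded_linear_vec_nth)
   show ?thesis
    by (rule has_derivative_compose[OF 1 expinv_deriv[unfolded has_field_derivative_def]])
  qed
  moreover have "(\<Sum>i\<in>UNIV. h $ i*g i y) = expinv ?q (1 + s*y $ k)*(s*h $ k)" for h
   unfolding g_def by (simp add: if_distrib[of "%x. x * _"] if_distrib[of "%x. _*x"] mult_ac cong: if_cong)
  ultimately show ?thesis by simp
 qed
 ultimately show ?case by blast
next
 case (const c)
 then show ?case by (intro exI[of _ "%i x. 0"]) (auto intro: bump_class.const)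
next
 case (add f1 f2)
 then obtain g1 g2 where
  "\<And>i. g1 i\<in>bump_class" "\<And>y. (f1 has_derivative (%h. \<Sum>i\<in>UNIV. h $ i*g1 i y)) (at y)"
  "\<And>i. g2 i\<in>bump_class" "\<And>y. (f2 has_derivative (%h. \<Sum>i\<in>UNIV. h $ i*g2 i y)) (at y)" by blast
 note g = this
 have "((%x. f1 x + f2 x) has_derivative (%h. \<Sum>i\<in>UNIV. h $ i*(g1 i y + g2 i y))) (at y)" for y
  using has_derivative_add[OF g(2,4)[of y]] by (simp add: distrib_left sum.distrib)
 then show ?case using g by (intro exI[of _ "%i x. g1 i x + g2 i x"]) (auto intro: bump_class.add)
next
 case (mult f1 f2)
 then obtain g1 g2 where
  "\<And>i. g1 i\<in>bump_class" "\<And>y. (f1 has_derivative (%h. \<Sum>i\<in>UNIV. h $ i*g1 i y)) (at y)"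
  "\<And>i. g2 i\<in>bump_class" "\<And>y. (f2 has_derivative (%h. \<Sum>i\<in>UNIV. h $ i*g2 i y)) (at y)" by blast
 note g = this
 have "((%x. f1 x*f2 x) has_derivative (%h. \<Sum>i\<in>UNIV. h $ i*(f1 y*g2 i y + g1 i y*f2 y))) (at y)" for y
  using has_derivative_mult[OF g(2,4)[of y]]
  by (simp add: distrib_left sum.distrib sum_distrib_left sum_distrib_right mult_ac)
 then show ?case using g mult.hyps
  by (intro exI[of _ "%i x. f1 x*g2 i x + g1 i x*f2 x"] conjI allI bump_class.add bump_class.mult) blast+
qed

lemma bump_class_smooth:
 assumes "f\<in>bump_class"
 shows "smooth f"
 using assms
proof (rule smoothI_class)
 fix f :: "real^'n => real" and y i
 assume "f\<in>bump_class"
 then obtain g where g: "\<And>i. g i\<in>bump_class" "\<And>y. (f has_derivative (%h. \<Sum>i\<in>UNIV. h $ i*g i y)) (at y)"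
  using bump_class_deriv by blast
 show "f differentiable (at y)" using g(2) by (auto simp: differentiable_def)
 show "(%y. frechet_derivative f (at y) (axis i 1))\<in>bump_class"
  using partial_deriv_eq[OF g(2)] g(1) by simp
qed

lemma bump_class_prod: "(\<And>i. i\<in>I ==> f i\<in>bump_class) ==> (%x. \<Prod>i\<in>I. f i x)\<in>bump_class"
 by (induction I rule: infinite_finite_induct) (auto intro: bump_class.intros)

section \<open>Bounds for test functions and existence of mollifiers\<close>

lemma test_function_support:
 assumes "p\<in>test_functions G"
 obtains r where "r > 0" "\<And>x. p x\<noteq>0 ==> norm x\<le>r"
proof -
 have "bounded {y. p y\<noteq>0}"
  using assms by (auto simp: test_functions_def intro: bounded_subset[OF compact_imp_bounded closure_subset])
 then show ?thesis using that unfolding bounded_pos by auto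
qed

lemma test_functionsI:
 assumes "smooth p" "compact K" "K\<subseteq>G" "\<And>y. p y\<noteq>0 ==> y\<in>K"
 shows "p\<in>test_functions G"
proof -
 have "closure {y. p y\<noteq>0}\<subseteq>K"
  using assms by (intro closure_minimal compact_imp_closed) auto
 moreover from this have "compact (closure {y. p y\<noteq>0})"
  by (metis assms(2) closed_closure compact_Int_closed inf.absorb_iff2)
 ultimately show ?thesis using assms by (auto simp: test_functions_iff)
qed

lemma support_partial_derivs:
 "{y. partial_derivs as p y\<noteq>0}\<subseteq>closure {y. p y\<noteq>0}"
proof (induction as)
 case (Cons a as)
 show ?case
 proof (rule subsetI, rule ccontr)
  fix y assume y: "y\<in>{y. partial_derivs (a # as) p y\<noteq>0}" "y\<notin>closure {y. p y\<noteq>0}"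
  have "((%x. 0) has_derivative (%h. 0)) (at y)" by simp
  then have "(partial_derivs as p has_derivative (%h. 0)) (at y)"
   by (rule has_derivative_transform_within_open[of _ _ _ _ "- closure {y. p y\<noteq>0}"])
     (use y Cons in auto)
  then have "frechet_derivative (partial_derivs as p) (at y) = (%h. 0)"
   using frechet_derivative_at by metis
  then show False using y by simp
 qed
qed (auto intro: closure_subset[THEN subsetD])

lemma test_functions_partial_derivs:
 assumes "p\<in>test_functions G"
 shows "partial_derivs as p\<in>test_functions G"
 using assms support_partial_derivs[of as p]
 by (intro test_functionsI[of _ "closure {y. p y\<noteq>0}"]) (auto simp: test_functions_iff smooth_partial_derivs)

lemma test_functions_bounded:
 assumes "p\<in>test_functions G"
 obtains B where "\<And>x. \<bar>p x\<bar>\<le>B" "B\<ge>0"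
proof -
 have "compact (p ` closure {y. p y\<noteq>0})"
  using assms by (intro compact_continuous_image smooth_continuous) (auto simp: test_functions_iff)
 then obtain B where B: "B > 0" "\<And>x. x\<in>closure {y. p y\<noteq>0} ==> \<bar>p x\<bar>\<le>B"
  using compact_imp_bounded bounded_pos by (metis imageI real_norm_def)
 have "\<bar>p x\<bar>\<le>B" for x
  using B closure_subset[of "{y. p y\<noteq>0}"] by (cases "p x = 0") auto
 then show ?thesis using that B by force
qed

lemma test_functions_measurable: "p\<in>test_functions G ==> p\<in>bmeas"
 by (intro borel_measurable_continuous_onI smooth_continuous) (simp add: test_functions_iff)

lemma integrable_bounded_support:
 fixes f :: "'a::euclidean_space => real"
 assumes "f\<in>bmeas" "\<And>x. \<bar>f x\<bar>\<le>B" "\<And>x. f x\<noteq>0 ==> norm x\<le>r"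
 shows "integ f"
proof (rule Bochner_Integration.integrable_bound)
 show "integ (%x::'a. B*indicator (cball 0 r) x)"
  by (intro integrable_mult_right integrable_real_indicator)
    (use emeasure_lborel_cball_finite[of 0 r] in \<open>auto simp: top.not_eq_extremum\<close>)
 show "AE x in lborel. norm (f x)\<le>norm (B*indicator (cball 0 r) x)"
 proof (rule AE_I2)
  fix x :: 'a
  show "norm (f x)\<le>norm (B*indicator (cball 0 r) x)"
   using assms(2)[of x] assms(3)[of x] by (cases "f x = 0") auto
 qed
qed (use assms in auto)

lemma test_functions_integrable: "p\<in>test_functions G ==> integ p"
 by (metis test_functions_bounded test_function_support integrable_bounded_support test_functions_measurable)

lemma sq_int_bounded_support:
 fixes f :: "'a::euclidean_space => real"
 assumes "f\<in>bmeas" "\<And>x. \<bar>f x\<bar>\<le>B" "\<And>x. f x\<noteq>0 ==> norm x\<le>r"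
 shows "f\<in>sqi"
proof (rule sq_intI)
 show "integ (%x. (f x)^2)"
 proof (rule integrable_bounded_support)
  show "\<bar>(f x)^2\<bar>\<le>B^2" for x
   using power_mono[OF assms(2)[of x], of 2] by simp
 qed (use assms in auto)
qed (use assms in auto)

lemma test_functions_sq_int: "p\<in>test_functions G ==> p\<in>sqi"
 by (metis test_functions_bounded test_function_support sq_int_bounded_support test_functions_measurable)

definition mollifier :: "real => (real^'n::finite => real) => bool" where
 "mollifier e b \<longleftrightarrow> b\<in>test_functions UNIV\<and>(\<forall>x. 0\<le>b x)\<and>(\<forall>x. b x\<noteq>0 --> norm x < e)
   \<and> integral\<^sup>L lborel b = 1"

lemma mollifier_exists:
 assumes "\<eta> > 0"
 shows "\<exists>b::real^'n::finite => real. mollifier \<eta> b"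
proof -
 \<comment> \<open>The product vanishes unless every coordinate is smaller than \<open>1/N\<close>
   in modulus. Comparison of the norm with the sum of the coordinates then gives support in the ball
   of radius \<open>CARD('n)/N = \<eta>\<close>.\<close>
 define N where "N = real CARD('n)/\<eta>"
 have N: "N > 0" using assms by (simp add: N_def)
 define f :: "real^'n => real" where "f x = (\<Prod>i\<in>UNIV. expinv 1 (1 + N*x $ i)*expinv 1 (1 + (-N)*x $ i))" for x
 have "f\<in>bump_class" unfolding f_def
  by (intro bump_class_prod bump_class.mult bump_class.base)
 then have sm: "smooth f" by (rule bump_class_smooth)
 have e0: "expinv 1 t\<ge>0" for t by (auto simp: expinv_def)
 have f0: "f x\<ge>0" for x unfolding f_def by (intro prod_nonneg) (auto simp: e0)
 have supp: "norm x < \<eta>" if "f x\<noteq>0" for x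
 proof -
  have *: "expinv 1 (1 + N*x $ i)\<noteq>0\<and>expinv 1 (1 + (-N)*x $ i)\<noteq>0" for i
   using that unfolding f_def by (auto simp: prod_zero_iff)
  have "\<bar>x $ i\<bar> < 1/N" for i
  proof -
   have "1 + N*x $ i > 0" "1 + (-N)*x $ i > 0" using *[of i] by (auto simp: expinv_def split: if_splits)
   then show ?thesis using N by (auto simp: abs_less_iff field_simps)
  qed
  then have "(\<Sum>i\<in>UNIV. \<bar>x $ i\<bar>) < (\<Sum>i\<in>(UNIV::'n set). 1/N)" by (intro sum_strict_mono) auto
  then show ?thesis using norm_le_l1_cart[of x] assms by (simp add: N_def)
 qed
 have tf: "f\<in>test_functions UNIV"
  by (rule test_functionsI[OF sm, of "cball 0 \<eta>"]) (use supp in \<open>auto simp: less_imp_le\<close>)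
 have int: "integ f" by (rule test_functions_integrable[OF tf])
 have "f 0 > 0" unfolding f_def by (intro prod_pos) (auto simp: expinv_def)
 have "integral\<^sup>L lborel f\<noteq>0"
 proof
  assume "integral\<^sup>L lborel f = 0"
  \<comment> \<open>The zero set of \<open>f\<close> is closed; if it had full measure it would be
    the whole space and contain 0.\<close>
  then have "AE x in lborel. f x = 0" using integral_nonneg_eq_0_iff_AE[OF int] f0 by simp
  then have "AE x in lborel. x\<in>{x. f x = 0}" by simp
  moreover have "closed {x. f x = 0}"
   using sm by (intro closed_Collect_eq continuous_intros smooth_continuous)
  ultimately have "0\<in>{x. f x = 0}"
   using mem_closed_if_AE_lebesgue[of "{x. f x = 0}" 0] by (metis AE_completion)
  then show False using \<open>f 0 > 0\<close> by simp
 qed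
 moreover have "integral\<^sup>L lborel f\<ge>0" using f0 by simp
 ultimately have pos: "integral\<^sup>L lborel f > 0" by simp
 define b where "b x = (1/integral\<^sup>L lborel f)*f x" for x
 have "b\<in>test_functions UNIV"
  by (rule test_functionsI[of _ "cball 0 \<eta>"])
    (use supp smooth_cmult[OF sm, of "1/integral\<^sup>L lborel f"] in \<open>auto simp: less_imp_le b_def[abs_def]\<close>)
 moreover have "integral\<^sup>L lborel b = 1" unfolding b_def using pos int by simp
 moreover have "b x\<ge>0" for x using pos f0 by (simp add: b_def)
 moreover have "norm x < \<eta>" if "b x\<noteq>0" for x using that supp by (auto simp: b_def)
 ultimately show ?thesis unfolding mollifier_def by blast
qed

subsection \<open>Convolution\<close>

definition conv :: "('a::euclidean_space => real) => ('a => real) => 'a => real" where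
 "conv u K x = (LBINT y. u y*K (x - y))"

lemma integrable_mult_bounded:
 fixes u K :: "'a => real"
 assumes "integrable M u" "K\<in>borel_measurable M" "\<And>x. \<bar>K x\<bar>\<le>B"
 shows "integrable M (%x. u x*K x)"
proof (rule Bochner_Integration.integrable_bound)
 show "integrable M (%x. B*u x)" using assms by simp
 show "AE x in M. norm (u x*K x)\<le>norm (B*u x)"
 proof (rule AE_I2)
  fix x
  have "\<bar>u x\<bar>*\<bar>K x\<bar>\<le>\<bar>u x\<bar>*\<bar>B\<bar>" using assms(3)[of x] by (intro mult_left_mono) auto
  then show "norm (u x*K x)\<le>norm (B*u x)" by (simp add: abs_mult mult.commute)
 qed
qed (use assms in auto)

lemma conv_integrand_integrable:
 fixes u K :: "'a::euclidean_space => real"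
 assumes "integ u" "K\<in>bmeas" "\<And>x. \<bar>K x\<bar>\<le>B"
 shows "integ (%y. u y*K (x - y))"
 by (rule integrable_mult_bounded[OF assms(1)]) (use assms(2,3) in auto)

lemma conv_abs_le:
 assumes "integ u" "K\<in>bmeas" "\<And>x. \<bar>K x\<bar>\<le>B"
 shows "\<bar>conv u K x\<bar>\<le>B*(LBINT y. \<bar>u y\<bar>)"
proof -
 have "\<bar>conv u K x\<bar>\<le>(LBINT y. \<bar>u y*K (x - y)\<bar>)"
  unfolding conv_def by (rule integral_abs_bound)
 also have "...\<le>(LBINT y. B*\<bar>u y\<bar>)"
 proof (rule integral_mono)
  show "integ (%y. \<bar>u y*K (x - y)\<bar>)"
   by (rule integrable_abs[OF conv_integrand_integrable[OF assms]])
  show "\<bar>u y*K (x - y)\<bar>\<le>B*\<bar>u y\<bar>" for y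
   using mult_right_mono[OF assms(3)[of "x - y"], of "\<bar>u y\<bar>"] by (simp add: abs_mult mult.commute)
 qed (use assms in auto)
 finally show ?thesis by simp
qed

lemma smooth_Lipschitz:
 fixes K :: "real^'n::finite => real"
 assumes "K\<in>test_functions UNIV"
 obtains B where "B\<ge>0" "\<And>x y. \<bar>K x - K y\<bar>\<le>B*norm (x - y)"
  "\<And>x h. \<bar>\<Sum>i\<in>UNIV. h $ i*pd i K x\<bar>\<le>B*norm h"
proof -
 have "\<forall>i. \<exists>b. (\<forall>x. \<bar>pd i K x\<bar>\<le>b)\<and>b\<ge>0"
  by (metis test_functions_bounded test_functions_partial_derivs assms)
 then obtain b where b: "\<And>i x. \<bar>pd i K x\<bar>\<le>b i" "\<And>i. b i\<ge>0" by metis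
 define B where "B = (\<Sum>i\<in>UNIV. b i)"
 have D: "\<bar>\<Sum>i\<in>UNIV. h $ i*pd i K x\<bar>\<le>B*norm h" for x h
 proof -
  have "\<bar>\<Sum>i\<in>UNIV. h $ i*pd i K x\<bar>\<le>(\<Sum>i\<in>UNIV. \<bar>h $ i*pd i K x\<bar>)"
   by (rule sum_abs)
  also have "...\<le>(\<Sum>i\<in>UNIV. b i*norm h)"
   unfolding abs_mult by (intro sum_mono) (metis b component_le_norm_cart mult.commute mult_mono' abs_ge_zero)
  finally show ?thesis by (simp add: B_def sum_distrib_right)
 qed
 have "norm (K x - K y)\<le>B*norm (x - y)" for x y
 proof (rule differentiable_bound[of UNIV])
  fix x :: "real^'n" assume "x\<in>UNIV"
  show "(K has_derivative (%h. \<Sum>i\<in>UNIV. h $ i*pd i K x)) (at x within UNIV)"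
   using assms smooth_has_derivative by (auto simp: test_functions_iff)
  show "onorm (%h. \<Sum>i\<in>UNIV. h $ i*pd i K x)\<le>B"
   by (rule onorm_le) (use D in simp)
 qed auto
 moreover have "B\<ge>0" unfolding B_def by (intro sum_nonneg) (simp add: b)
 ultimately show ?thesis using that D by simp
qed

text \<open>Dominated convergence: the remainder quotient \<open>R\<close> is bounded by twice the
  Lipschitz constant of the kernel and tends to 0 pointwise. All derivatives fall on the kernel, so
  \<open>u\<close> may be merely integrable.\<close>

lemma conv_has_derivative:
 fixes K :: "real^'n::finite => real"
 assumes u: "integ u" and K: "K\<in>test_functions UNIV"
 shows "(conv u K has_derivative (%h. \<Sum>i\<in>UNIV. h $ i*conv u (pd i K) x)) (at x)"
proof -
 have sm: "smooth K" using K by (simp add: test_functions_iff)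
 obtain b0 where b0: "\<And>x. \<bar>K x\<bar>\<le>b0" using test_functions_bounded[OF K] by blast
 have mK [measurable]: "K\<in>bmeas" by (rule test_functions_measurable[OF K])
 have mP [measurable]: "pd i K\<in>bmeas" for i
  by (rule test_functions_measurable[OF test_functions_partial_derivs[OF K]])
 have iP: "integ (%y. u y*pd i K (x - y))" for i
  using test_functions_bounded[OF test_functions_partial_derivs[OF K, of "[i]"]] mP u
  by (metis conv_integrand_integrable)
 have iK: "integ (%y. u y*K (z - y))" for z
  using conv_integrand_integrable[OF u mK b0] .
 obtain B where B: "B\<ge>0" "\<And>x y. \<bar>K x - K y\<bar>\<le>B*norm (x - y)"
  "\<And>x h. \<bar>\<Sum>i\<in>UNIV. h $ i*pd i K x\<bar>\<le>B*norm h"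
  using smooth_Lipschitz[OF K] by blast
 note [measurable] = borel_measurable_integrable[OF u]
 define D where "D z h = (\<Sum>i\<in>UNIV. h $ i*pd i K z)" for z h
 define R where "R h y = (K (x + h - y) - K (x - y) - D (x - y) h)/norm h" for h y
 have [measurable]: "R h\<in>bmeas" for h
  unfolding R_def[abs_def] D_def by measurable
 have Rb: "\<bar>R h y\<bar>\<le>2*B" for h y
 proof (cases "h = 0")
  case False
  have "\<bar>K (x + h - y) - K (x - y) - D (x - y) h\<bar>\<le>2*B*norm h"
   using B(2)[of "x + h - y" "x - y"] B(3)[of h "x - y"] by (simp add: D_def)
  then show ?thesis using False by (simp add: R_def divide_simps)
 qed (use B(1) in \<open>simp add: R_def\<close>)
 have eq: "(conv u K (x + h) - conv u K x - (\<Sum>i\<in>UNIV. h $ i*conv u (pd i K) x))/norm h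
   = (LBINT y. u y * R h y)" for h
 proof -
  have s: "(\<Sum>i\<in>UNIV. h $ i*conv u (pd i K) x) = (LBINT y. u y*D (x - y) h)"
   unfolding conv_def D_def sum_distrib_left
  proof (subst Bochner_Integration.integral_sum)
   have *: "(%y. u y*(h $ i*pd i K (x - y))) = (%y. h $ i*(u y*pd i K (x - y)))" for i
    by (auto simp: mult_ac)
   show "integ (%y. u y*(h $ i*pd i K (x - y)))" for i
    unfolding * using iP by (intro integrable_mult_right)
   show "(\<Sum>i\<in>UNIV. h $ i*(LBINT y. u y*pd i K (x - y))) =
    (\<Sum>i\<in>UNIV. LBINT y. u y*(h $ i*pd i K (x - y)))"
    unfolding * by simp
  qed
  have iD: "integ (%y. u y*D (x - y) h)"
  proof -
   have "(%y. u y*D (x - y) h) = (%y. \<Sum>i\<in>UNIV. h $ i*(u y*pd i K (x - y)))"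
    by (auto simp: D_def sum_distrib_left mult_ac)
   moreover have "integ ..."
    using iP by (intro Bochner_Integration.integrable_sum integrable_mult_right)
   ultimately show ?thesis by simp
  qed
  have "(LBINT y. u y * R h y) = (LBINT y. (u y*K (x + h - y) - u y*K (x - y) - u y*D (x - y) h)/norm h)"
   by (rule Bochner_Integration.integral_cong) (auto simp: R_def field_simps)
  also have "... = (conv u K (x + h) - conv u K x - (LBINT y. u y*D (x - y) h))/norm h"
   using iK iD by (simp add: conv_def)
  finally show ?thesis using s by simp
 qed
 have "((%h. (conv u K (x + h) - conv u K x - (\<Sum>i\<in>UNIV. h $ i*conv u (pd i K) x))/norm h)\<longlongrightarrow>0) (at 0)"
  unfolding eq tendsto_at_iff_sequentially o_def
 proof (intro allI impI)
  fix X :: "nat => real^'n" assume X: "\<forall>i. X i\<in>UNIV - {0}" "X---->0"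
  have "(%n. LBINT y. u y * R (X n) y)---->(\<integral>y. 0 \<partial>(lborel::(real^'n) measure))"
  proof (rule integral_dominated_convergence)
   show "integ (%y. 2*B*\<bar>u y\<bar>)" using u by simp
   show "AE y in lborel. norm (u y * R (X n) y)\<le>2*B*\<bar>u y\<bar>" for n
    using mult_left_mono[OF Rb[of "X n"] abs_ge_zero] by (auto simp: abs_mult mult_ac)
   show "AE y in lborel. (%n. u y * R (X n) y)---->0"
   proof (rule AE_I2)
    fix y
    have "((%h. R h y)\<longlongrightarrow>0) (at 0)"
    proof -
     have "((%h. norm (K ((x - y) + h) - K (x - y) - D (x - y) h)/norm h)\<longlongrightarrow>0) (at 0)"
      using smooth_has_derivative[OF sm, of "x - y"] unfolding has_derivative_at D_def by blast
     then have "((%h. norm (R h y))\<longlongrightarrow>0) (at 0)" by (simp add: R_def algebra_simps)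
     then show ?thesis by (rule tendsto_norm_zero_cancel)
    qed
    then have "(%n. R (X n) y)---->0"
     using X unfolding tendsto_at_iff_sequentially o_def by blast
    then show "(%n. u y * R (X n) y)---->0" by (rule tendsto_mult_right_zero)
   qed
  qed auto
  then show "(%n. LBINT y. u y * R (X n) y)---->0" by simp
 qed
 from tendsto_norm_zero[OF this] show ?thesis
  unfolding has_derivative_at
  by (intro conjI bounded_linear_sum bounded_linear_intros) (auto intro!: bounded_linear_mult_const bounded_linear_vec_nth)
qed

lemma partial_derivs_conv:
 fixes K :: "real^'n::finite => real"
 assumes u: "integ u" and K: "K\<in>test_functions UNIV"
 shows "partial_derivs as (conv u K) = conv u (partial_derivs as K)"
proof (induction as)
 case (Cons a as)
 have "frechet_derivative (conv u (partial_derivs as K)) (at y) (axis a 1) =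
   conv u (pd a (partial_derivs as K)) y" for y
  by (rule partial_deriv_eq, rule conv_has_derivative[OF u test_functions_partial_derivs[OF K]])
 then show ?case by (simp add: Cons)
qed simp

lemma smooth_conv:
 fixes K :: "real^'n::finite => real"
 assumes u: "integ u" and K: "K\<in>test_functions UNIV"
 shows "smooth (conv u K)"
 unfolding smooth_def partial_derivs_conv[OF assms] differentiable_def
 using conv_has_derivative[OF u test_functions_partial_derivs[OF K]] by blast

subsection \<open>Approximation in the mean\<close>

lemma distr_lborel_reflect: "distr lborel borel (%x. a - x) = (lborel :: 'a::euclidean_space measure)"
 by (subst (2) lborel_affine[of "-1" a]) (simp_all add: density_1)

lemma distr_lborel_shift: "distr lborel borel (%x. x + a) = (lborel :: 'a::euclidean_space measure)"
 using lborel_distr_plus[of a] by (simp add: add.commute[of _ a])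

lemma nn_integral_lborel_shift:
 fixes f :: "'a::euclidean_space => ennreal"
 assumes "f\<in>bmeas"
 shows "(NN x. f (x + a)) = (NN x. f x)"
 by (subst (2) distr_lborel_shift[of a, symmetric]) (use assms in \<open>simp add: nn_integral_distr\<close>)

lemma integral_lborel_reflect:
 fixes f :: "'a::euclidean_space => real"
 assumes "f\<in>bmeas"
 shows "(LBINT x. f (a - x)) = (LBINT x. f x)"
 by (subst (2) distr_lborel_reflect[of a, symmetric]) (use assms in \<open>simp add: integral_distr\<close>)

lemma integral_lborel_shift:
 fixes f :: "'a::euclidean_space => real"
 assumes "f\<in>bmeas"
 shows "(LBINT x. f (x + a)) = (LBINT x. f x)"
 by (subst (2) distr_lborel_shift[of a, symmetric]) (use assms in \<open>simp add: integral_distr\<close>)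

lemma integrable_lborel_reflect:
 fixes f :: "'a::euclidean_space => real"
 assumes "integ f"
 shows "integ (%x. f (a - x))"
proof -
 have "integrable (distr lborel borel (%x. a - x)) f" using assms by (simp add: distr_lborel_reflect)
 then show ?thesis using assms by (subst (asm) integrable_distr_eq) auto
qed

lemma integrable_lborel_shift:
 fixes f :: "'a::euclidean_space => real"
 assumes "integ f"
 shows "integ (%x. f (x + a))"
proof -
 have "integrable (distr lborel borel (%x. x + a)) f" using assms by (simp add: distr_lborel_shift)
 then show ?thesis using assms by (subst (asm) integrable_distr_eq) auto
qed

lemma sq_int_shift:
 fixes u :: "'a::euclidean_space => real"
 assumes "u\<in>sqi"
 shows "(%x. u (x - z))\<in>sqi" "nrm (%x. u (x - z)) = nrm u"
proof -
 have [measurable]: "u\<in>bmeas" using sq_int_measurable[OF assms] by simp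
 show "(%x. u (x - z))\<in>sqi"
  using integrable_lborel_shift[OF sq_int_integrable[OF assms], of "-z"] by (intro sq_intI) auto
 show "nrm (%x. u (x - z)) = nrm u"
  unfolding ltwo_def using integral_lborel_shift[of "%x. (u x)^2" "-z"] by simp
qed

lemma conv_commute:
 fixes u K :: "'a::euclidean_space => real"
 assumes [measurable]: "u\<in>bmeas" "K\<in>bmeas"
 shows "conv u K x = (LBINT z. u (x - z)*K z)"
 unfolding conv_def using integral_lborel_reflect[of "%y. u y*K (x - y)" x] by simp

lemma mollifierD:
 assumes "mollifier e b"
 shows "b\<in>test_functions UNIV" "b x\<ge>0" "norm x\<ge>e ==> b x = 0" "integral\<^sup>L lborel b = 1"
  "integ b" "b\<in>bmeas" "(NN x. b x) = 1"
proof -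
 show 1: "b\<in>test_functions UNIV" "\<And>x. b x\<ge>0" "norm x\<ge>e ==> b x = 0" "integral\<^sup>L lborel b = 1"
  using assms unfolding mollifier_def by (auto simp: not_less[symmetric])
 show 2: "integ b" "b\<in>bmeas"
  using test_functions_integrable[OF 1(1)] test_functions_measurable[OF 1(1)] by auto
 show "(NN x. b x) = 1"
  using nn_integral_eq_integral[OF 2(1)] 1(2,4) by simp
qed

text \<open>Cauchy-Schwarz with \<open>b\<close> split into two square roots, using that
  \<open>b\<close> has mass 1. The factor \<open>c\<close> merges two uses: 0 yields the contraction
  property and 1 the approximation error.\<close>

lemma conv_Jensen:
 fixes u :: "real^'n::finite => real"
 assumes u: "integ u" and b: "mollifier e b"
 shows "ennreal ((conv u b x - c*u x)^2)\<le>(NN z. ennreal (b z*(u (x - z) - c*u x)^2))"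
proof -
 note [measurable] = borel_measurable_integrable[OF u] mollifierD(6)[OF b]
 obtain B where B: "\<And>x. \<bar>b x\<bar>\<le>B" using test_functions_bounded[OF mollifierD(1)[OF b]] by blast
 have [simp]: "b z\<ge>0" for z by (rule mollifierD(2)[OF b])
 have "integ (%y. u (x - y))" by (rule integrable_lborel_reflect[OF u])
 then have i: "integ (%z. u (x - z)*b z)"
  by (rule integrable_mult_bounded) (use B in auto)
 define w where "w z = u (x - z) - c*u x" for z
 have [measurable]: "w\<in>bmeas" unfolding w_def by measurable
 have iw: "integ (%z. w z*b z)"
  unfolding w_def left_diff_distrib using i mollifierD(5)[OF b] by simp
 have "conv u b x - c*u x = (LBINT z. w z*b z)"
  using i mollifierD(4,5)[OF b] by (simp add: conv_commute w_def left_diff_distrib)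
 then have "ennreal \<bar>conv u b x - c*u x\<bar>\<le>ennreal (LBINT z. \<bar>w z*b z\<bar>)"
  by (simp add: ennreal_leI integral_abs_bound)
 also have "... = (NN z. ennreal \<bar>w z*b z\<bar>)"
  using nn_integral_eq_integral[OF integrable_abs[OF iw]] by simp
 also have "... = (NN z. ennreal (\<bar>w z\<bar> * sqrt (b z))*ennreal (sqrt (b z)))"
  by (intro nn_integral_cong) (simp add: abs_mult mult.assoc flip: ennreal_mult)
 finally have "(ennreal \<bar>conv u b x - c*u x\<bar>)^2\<le>...^2"
  by (rule power_mono) simp
 also have "...\<le>(NN z. (ennreal (\<bar>w z\<bar> * sqrt (b z)))^2)*(NN z. (ennreal (sqrt (b z)))^2)"
  by (rule Cauchy_Schwarz_nn_integral) auto
 also have "(NN z. (ennreal (sqrt (b z)))^2) = 1"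
  using mollifierD(7)[OF b] by (simp add: ennreal_power)
 also have "(NN z. (ennreal (\<bar>w z\<bar> * sqrt (b z)))^2) = (NN z. ennreal (b z*(w z)^2))"
  by (simp add: ennreal_power power_mult_distrib mult.commute)
 finally show ?thesis by (simp add: w_def ennreal_power)
qed

text \<open>By Tonelli's theorem a bound uniform over shifts shorter than \<open>e\<close> passes to
  the average with weight \<open>b\<close>. The set \<open>A\<close> is the whole space in global
  estimates and a set away from the boundary in the compactness argument.\<close>

lemma conv_Jensen_integral:
 fixes u :: "real^'n::finite => real"
 assumes u: "integ u" and b: "mollifier e b" and [measurable]: "A\<in>sets borel"
  and B: "\<And>z. norm z < e ==> (NN x. indicator A x*ennreal ((u (x - z) - c*u x)^2))\<le>B"
 shows "(NN x. indicator A x*ennreal ((conv u b x - c*u x)^2))\<le>B"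
proof -
 note [measurable] = borel_measurable_integrable[OF u] mollifierD(6)[OF b]
 have "(NN x. indicator A x*ennreal ((conv u b x - c*u x)^2))
  \<le> (NN x. indicator A x*(NN z. ennreal (b z*(u (x - z) - c*u x)^2)))"
  by (intro nn_integral_mono mult_left_mono conv_Jensen[OF u b]) auto
 also have "... = (NN x. NN z. indicator A x*ennreal (b z*(u (x - z) - c*u x)^2))"
  by (intro nn_integral_cong nn_integral_cmult[symmetric]) auto
 also have "... = (NN z. NN x. indicator A x*ennreal (b z*(u (x - z) - c*u x)^2))"
  by (rule lborel_pair.Fubini') measurable
 also have "... = (NN z. b z*(NN x. indicator A x*ennreal ((u (x - z) - c*u x)^2)))"
  by (subst nn_integral_cmult[symmetric])
    (auto simp: ennreal_mult mollifierD(2)[OF b] mult_ac)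
 also have "...\<le>(NN z. b z*B)"
 proof (intro nn_integral_mono)
  fix z
  show "ennreal (b z)*(NN x. indicator A x*ennreal ((u (x - z) - c*u x)^2))\<le>ennreal (b z)*B"
   using B[of z] mollifierD(3)[OF b, of z]
   by (cases "norm z < e") (auto intro: mult_left_mono)
 qed
 also have "... = B" using mollifierD(7)[OF b] by (simp add: nn_integral_multc)
 finally show ?thesis .
qed

lemma sq_int_nn_integral:
 assumes "f\<in>borel_measurable M" "B\<ge>0"
 shows "(\<integral>\<^sup>+x. ennreal ((f x)^2) \<partial>M)\<le>ennreal (B^2) \<longleftrightarrow> f\<in>sq_int M\<and>ltwo M f\<le>B"
proof
 assume *: "(\<integral>\<^sup>+x. ennreal ((f x)^2) \<partial>M)\<le>ennreal (B^2)"
 have i: "integrable M (%x. (f x)^2)"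
  by (rule integrableI_bounded) (use * assms in \<open>auto intro: le_less_trans\<close>)
 have "ennreal ((ltwo M f)^2)\<le>ennreal (B^2)"
  using * nn_integral_eq_integral[OF i] by (simp add: ltwo_sq)
 then have "(ltwo M f)^2\<le>B^2" by (simp add: assms)
 then show "f\<in>sq_int M\<and>ltwo M f\<le>B"
  using i assms power2_le_imp_le by (auto intro: sq_intI)
next
 assume *: "f\<in>sq_int M\<and>ltwo M f\<le>B"
 then have "(\<integral>\<^sup>+x. ennreal ((f x)^2) \<partial>M) = ennreal ((ltwo M f)^2)"
  using nn_integral_eq_integral[OF sq_int_integrable] by (auto simp: ltwo_sq)
 also have "...\<le>ennreal (B^2)" using * by (intro ennreal_leI power_mono) auto
 finally show "(\<integral>\<^sup>+x. ennreal ((f x)^2) \<partial>M)\<le>ennreal (B^2)" .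
qed

lemma conv_measurable:
 fixes u :: "real^'n::finite => real"
 assumes u: "integ u" and K: "K\<in>test_functions UNIV"
 shows "conv u K\<in>bmeas"
 by (intro borel_measurable_continuous_onI smooth_continuous smooth_conv assms)

lemma conv_contraction:
 fixes u :: "real^'n::finite => real"
 assumes u: "integ u" "u\<in>sqi" and b: "mollifier e b"
 shows "conv u b\<in>sqi" "nrm (conv u b)\<le>nrm u"
proof -
 note [measurable] = borel_measurable_integrable[OF u(1)] mollifierD(6)[OF b]
 have "(NN x. indicator UNIV x*ennreal ((conv u b x - 0*u x)^2))\<le>ennreal ((nrm u)^2)"
 proof (rule conv_Jensen_integral[OF u(1) b])
  fix z
  show "(NN x. indicator UNIV x*ennreal ((u (x - z) - 0*u x)^2))\<le>ennreal ((nrm u)^2)"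
   using sq_int_nn_integral[of "%x. u (x - z)" lborel "nrm u"] sq_int_shift[OF u(2), of z] by simp
 qed auto
 then show "conv u b\<in>sqi" "nrm (conv u b)\<le>nrm u"
  using sq_int_nn_integral[of "conv u b" lborel "nrm u"] conv_measurable[OF u(1) mollifierD(1)[OF b]]
  by auto
qed

section \<open>Continuity of translations in the mean, and approximation by mollification\<close>

definition trans_cont :: "('a::euclidean_space => real) => bool" where
 "trans_cont u \<longleftrightarrow> (\<forall>e>0. \<exists>d>0. \<forall>z. norm z < d --> nrm (%x. u (x - z) - u x) < e)"

lemma trans_cont_add:
 fixes u v :: "'a::euclidean_space => real"
 assumes "u\<in>sqi" "v\<in>sqi" "trans_cont u" "trans_cont v"
 shows "trans_cont (%x. u x + v x)"
 unfolding trans_cont_def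
proof (intro allI impI)
 fix e :: real assume "e > 0"
 then obtain d1 d2 where d: "d1 > 0" "\<And>z. norm z < d1 ==> nrm (%x. u (x - z) - u x) < e/2"
  "d2 > 0" "\<And>z. norm z < d2 ==> nrm (%x. v (x - z) - v x) < e/2"
  using assms(3,4)[unfolded trans_cont_def, rule_format, of "e/2"] by auto
 have "nrm (%x. u (x - z) + v (x - z) - (u x + v x)) < e" if "norm z < min d1 d2" for z
 proof -
  have "nrm (%x. (u (x - z) - u x) + (v (x - z) - v x))
   \<le> nrm (%x. u (x - z) - u x) + nrm (%x. v (x - z) - v x)"
   by (intro ltwo_triangle sq_int_diff sq_int_shift assms)
  then show ?thesis using d(2,4)[of z] that by (simp add: algebra_simps)
 qed
 then show "\<exists>d>0. \<forall>z. norm z < d --> nrm (%x. u (x - z) + v (x - z) - (u x + v x)) < e"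
  using d(1,3) by (intro exI[of _ "min d1 d2"]) auto
qed

lemma trans_cont_cmult:
 assumes "trans_cont u"
 shows "trans_cont (%x. c*u x)"
 unfolding trans_cont_def
proof (intro allI impI)
 fix e :: real assume "e > 0"
 then obtain d where d: "d > 0" "\<And>z. norm z < d ==> nrm (%x. u (x - z) - u x) < e/(\<bar>c\<bar>+1)"
  using assms[unfolded trans_cont_def, rule_format, of "e/(\<bar>c\<bar>+1)"] by auto
 have "nrm (%x. c*u (x - z) - c*u x) < e" if "norm z < d" for z
 proof -
  have "nrm (%x. c*u (x - z) - c*u x) = \<bar>c\<bar>*nrm (%x. u (x - z) - u x)"
   by (simp add: ltwo_cmult flip: right_diff_distrib)
  also have "...\<le>(\<bar>c\<bar> + 1)*nrm (%x. u (x - z) - u x)" by (intro mult_right_mono) auto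
  also have "... < e" using d(2)[OF that] by (simp add: field_simps)
  finally show ?thesis .
 qed
 then show "\<exists>d>0. \<forall>z. norm z < d --> nrm (%x. c*u (x - z) - c*u x) < e"
  using d(1) by blast
qed

lemma trans_cont_lim:
 fixes u :: "'a::euclidean_space => real"
 assumes u: "u\<in>sqi" and s: "\<And>n. s n\<in>sqi" "\<And>n. trans_cont (s n)"
  and lim: "(%n. nrm (%x. s n x - u x))---->0"
 shows "trans_cont u"
 unfolding trans_cont_def
proof (intro allI impI)
 fix e :: real assume e: "e > 0"
 obtain n where n: "nrm (%x. s n x - u x) < e/3"
  using eventually_happens[OF order_tendstoD(2)[OF lim, of "e/3"]] e by auto
 obtain d where d: "d > 0" "\<And>z. norm z < d ==> nrm (%x. s n (x - z) - s n x) < e/3"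
  using s(2)[unfolded trans_cont_def, rule_format, of "e/3"] e by force
 have "nrm (%x. u (x - z) - u x) < e" if "norm z < d" for z
 proof -
  note sq = u s(1) sq_int_shift(1)[OF u] sq_int_shift(1)[OF s(1)]
  have "nrm (%x. u (x - z) - u x)
   \<le> nrm (%x. u (x - z) - s n (x - z)) + nrm (%x. s n (x - z) - u x)"
   by (intro ltwo_triangle3 sq)
  also have "nrm (%x. s n (x - z) - u x)
   \<le> nrm (%x. s n (x - z) - s n x) + nrm (%x. s n x - u x)"
   by (intro ltwo_triangle3 sq)
  also have "nrm (%x. u (x - z) - s n (x - z)) = nrm (%x. s n x - u x)"
   using sq_int_shift(2)[OF sq_int_diff[OF u s(1)], of z n] by (simp add: ltwo_diff_commute)
  finally show ?thesis using n d(2)[OF that] by simp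
 qed
 then show "\<exists>d>0. \<forall>z. norm z < d --> nrm (%x. u (x - z) - u x) < e"
  using d(1) by blast
qed

text \<open>Regularity of the measure encloses \<open>A\<close> between a compact \<open>K\<close>
  and an open \<open>U\<close>. If the shift is shorter than the distance from \<open>K\<close> to
  the complement of \<open>U\<close>, then \<open>A\<close> can separate a point from its translate
  only when one of them lies in \<open>U - K\<close>.\<close>

lemma trans_cont_indicator:
 fixes A :: "'a::euclidean_space set"
 assumes A: "A\<in>sets borel" and bd: "bounded A"
 shows "trans_cont (indicator A)"
 unfolding trans_cont_def
proof (intro allI impI)
 fix e :: real assume e: "e > 0"
 \<comment> \<open>\<open>U - K\<close> has measure at most \<open>2*\<epsilon>\<close> and is
   counted twice, so the squared norm is at most \<open>4*\<epsilon>\<close>, which has to be below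
   \<open>e^2\<close>.\<close>
 define \<epsilon> where "\<epsilon> = e^2/5"
 have \<epsilon>: "\<epsilon> > 0" using e by (simp add: \<epsilon>_def)
 have AL: "A\<in>sets lebesgue" using A by simp
 obtain U where U: "open U" "A\<subseteq>U" "emeasure lebesgue (U - A) < ennreal \<epsilon>"
  by (rule sets_lebesgue_outer_open[OF AL \<epsilon>])
 obtain K where K: "closed K" "K\<subseteq>A" "emeasure lebesgue (A - K) < ennreal \<epsilon>"
  by (rule sets_lebesgue_inner_closed[OF AL \<epsilon>])
 have cK: "compact K" using K bd by (meson bounded_subset compact_eq_bounded_closed)
 have bU: "U\<in>sets borel" "K\<in>sets borel" using U K by auto
 have small: "emeasure lborel (U - K)\<le>ennreal (2*\<epsilon>)"
 proof -
  have "emeasure lborel (U - K)\<le>emeasure lborel ((U - A) \<union> (A - K))"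
   using A bU by (intro emeasure_mono) auto
  also have "...\<le>emeasure lborel (U - A) + emeasure lborel (A - K)"
   using A bU by (intro emeasure_subadditive) auto
  also have "...\<le>ennreal \<epsilon> + ennreal \<epsilon>"
   using U(3) K(3) A bU by (intro add_mono) (auto simp: less_imp_le)
  finally show ?thesis using \<epsilon> by (simp flip: ennreal_plus)
 qed
 obtain d where d: "d > 0" "\<And>x y. x\<in>K ==> y\<in>- U ==> d\<le>dist x y"
 proof -
  have "closed (- U)" "K\<inter>- U = {}" using U K by auto
  from separate_compact_closed[OF cK this] that show thesis by blast
 qed
 have "nrm (%x. indicator A (x - z) - indicator A x) < e" if z: "norm z < d" for z
 proof -
  have pt: "(indicator A (x - z) - indicator A x :: real)^2\<le>indicator (U - K) (x - z) + indicator (U - K) x" for x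
  proof (cases "x\<in>U - K\<or>x - z\<in>U - K\<or>(x\<in>A \<longleftrightarrow> x - z\<in>A)")
   case False
   then consider "x\<in>K" "x - z\<in>- U" | "x - z\<in>K" "x\<in>- U" using U K by blast
   then show ?thesis using d(2)[of x "x - z"] d(2)[of "x - z" x] z by cases (auto simp: dist_norm)
  qed (auto simp: indicator_def)
  have "(NN x. ennreal ((indicator A (x - z) - indicator A x)^2))
    \<le> (NN x. indicator (U - K) (x - z) + indicator (U - K) x)"
  proof (intro nn_integral_mono)
   fix x
   have "ennreal ((indicator A (x - z) - indicator A x)^2)\<le>ennreal (indicator (U - K) (x - z) + indicator (U - K) x)"
    by (rule ennreal_leI[OF pt])
   then show "ennreal ((indicator A (x - z) - indicator A x)^2)\<le>indicator (U - K) (x - z) + indicator (U - K) x"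
    by (simp add: ennreal_plus ennreal_indicator)
  qed
  also have "... = (NN x. indicator (U - K) (x - z)) + emeasure lborel (U - K)"
   using bU by (subst nn_integral_add) auto
  also have "(NN x. indicator (U - K) (x - z)) = emeasure lborel (U - K)"
   using nn_integral_lborel_shift[of "indicator (U - K)" "- z"] bU by simp
  also have "emeasure lborel (U - K) + emeasure lborel (U - K)\<le>ennreal (2*\<epsilon>) + ennreal (2*\<epsilon>)"
   by (intro add_mono small)
  also have "... = ennreal ((sqrt (4*\<epsilon>))^2)" using \<epsilon> by (simp flip: ennreal_plus)
  finally have "nrm (%x. indicator A (x - z) - indicator A x)\<le>sqrt (4*\<epsilon>)"
   using sq_int_nn_integral[of "%x. indicator A (x - z) - indicator A x" lborel "sqrt (4*\<epsilon>)"] A \<epsilon> by simp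
  also have "sqrt (4*\<epsilon>) < e"
   using e by (intro real_less_lsqrt) (auto simp: \<epsilon>_def power2_eq_square)
  finally show ?thesis .
 qed
 then show "\<exists>d>0. \<forall>z. norm z < d --> nrm (%x. indicator A (x - z) - indicator A x) < e"
  using d(1) by blast
qed

lemma trans_cont_sum:
 fixes f :: "'i => 'a::euclidean_space => real"
 assumes "\<And>i. i\<in>I ==> f i\<in>sqi" "\<And>i. i\<in>I ==> trans_cont (f i)"
 shows "trans_cont (%x. \<Sum>i\<in>I. f i x)"
 using assms
proof (induction I rule: infinite_finite_induct)
 case (insert i I)
 then have "trans_cont (%x. f i x + (\<Sum>i\<in>I. f i x))" by (intro trans_cont_add sq_int_sum) auto
 then show ?case using insert.hyps by simp
qed (auto simp: trans_cont_def intro: exI[of _ 1])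

text \<open>Density of simple functions cut off to balls. Each is a finite combination of indicators
  of bounded Borel sets, and the bound by \<open>2*\<bar>u\<bar>\<close> lets dominated convergence
  produce convergence in the mean.\<close>

theorem sq_int_trans_cont:
 fixes u :: "'a::euclidean_space => real"
 assumes u: "u\<in>sqi"
 shows "trans_cont u"
proof -
 have [measurable]: "u\<in>bmeas" using sq_int_measurable[OF u] by simp
 obtain F where F: "\<And>i. simple_function lborel (F i)" "\<And>x. (%i. F i x)---->u x"
  "\<And>i x. \<bar>F i x\<bar>\<le>2*\<bar>u x\<bar>"
  using borel_measurable_implies_sequence_metric[of u lborel 0] by (auto simp: dist_norm)
 define s where "s i x = F i x*indicator (cball 0 (real i)) x" for i x
 have [measurable]: "F i\<in>bmeas" for i
  using borel_measurable_simple_function[OF F(1)] by simp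
 have [measurable]: "cball (0::'a) r\<in>sets borel" for r by (rule borel_closed) simp
 have [measurable]: "s i\<in>bmeas" for i unfolding s_def by measurable
 have sb: "\<bar>s i x\<bar>\<le>2*\<bar>u x\<bar>" for i x
  using F(3)[of i x] by (auto simp: s_def indicator_def)
 have sq: "s i\<in>sqi" for i
  by (rule sq_int_bound[of _ _ "%x. 2*u x"]) (use u sb in \<open>auto simp: sq_int_cmult abs_mult\<close>)
 have tc: "trans_cont (s i)" for i
 proof -
  have fin: "finite (range (F i))" using simple_functionD(1)[OF F(1)[of i]] by simp
  have eq: "s i x = (\<Sum>v\<in>range (F i). v * indicator ({x. F i x = v}\<inter>cball 0 (real i)) x)" for x
  proof -
   have "(\<Sum>v\<in>range (F i). v * indicator ({x. F i x = v}\<inter>cball 0 (real i)) x)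
    = (\<Sum>v\<in>range (F i). if v = F i x then v * indicator (cball 0 (real i)) x else 0)"
    by (rule sum.cong) (auto simp: indicator_def)
   then show ?thesis using fin by (simp add: s_def)
  qed
  have "trans_cont (%x. \<Sum>v\<in>range (F i). v * indicator ({x. F i x = v}\<inter>cball 0 (real i)) x)"
  proof (intro trans_cont_sum)
   fix v
   have "{x. F i x = v}\<in>sets borel" by measurable
   then have m [measurable]: "{x. F i x = v}\<inter>cball 0 (real i)\<in>sets borel"
    by (rule sets.Int) simp
   have bd: "bounded ({x. F i x = v}\<inter>cball 0 (real i))" by (rule bounded_subset[of "cball 0 (real i)"]) auto
   show "trans_cont (%x. v * indicator ({x. F i x = v}\<inter>cball 0 (real i)) x)"
    using trans_cont_cmult[OF trans_cont_indicator[OF m bd]] by simp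
   show "(%x. v * indicator ({x. F i x = v}\<inter>cball 0 (real i)) x)\<in>sqi"
   proof (rule sq_int_bounded_support[of _ "\<bar>v\<bar>" "real i"])
    show "(%x. v * indicator ({x. F i x = v}\<inter>cball 0 (real i)) x)\<in>bmeas"
     by measurable
   qed (auto simp: indicator_def split: if_splits)
  qed
  then show ?thesis by (simp flip: eq)
 qed
 have lim: "(%n. nrm (%x. s n x - u x))---->0"
 proof -
  have "(%n. LBINT x. (s n x - u x)^2)---->(\<integral>x. 0 \<partial>(lborel :: 'a measure))"
  proof (rule integral_dominated_convergence)
   show "integ (%x. 9*(u x)^2)" using sq_int_integrable[OF u] by simp
   show "AE x in lborel. norm ((s n x - u x)^2)\<le>9*(u x)^2" for n
   proof (rule AE_I2)
    fix x
    have "\<bar>s n x - u x\<bar>\<le>\<bar>3*u x\<bar>" using sb[of n x] by linarith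
    then have "(s n x - u x)^2\<le>(3*u x)^2" by (simp only: abs_le_square_iff)
    then show "norm ((s n x - u x)^2)\<le>9*(u x)^2" by (simp add: power_mult_distrib)
   qed
   show "AE x in lborel. (%n. (s n x - u x)^2)---->0"
   proof (rule AE_I2)
    fix x :: 'a
    obtain N where N: "norm x\<le>real N" using real_arch_simple by blast
    have "(%n. s n x)---->u x"
     by (rule Lim_transform_eventually[OF F(2)[of x] eventually_sequentiallyI[of N]])
       (use N in \<open>auto simp: s_def indicator_def\<close>)
    then have "(%n. (s n x - u x)^2)---->(u x - u x)^2" by (intro tendsto_intros)
    then show "(%n. (s n x - u x)^2)---->0" by simp
   qed
  qed auto
  then have "(%n. sqrt (LBINT x. (s n x - u x)^2))---->sqrt 0"
   by (intro tendsto_real_sqrt) simp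
  then show ?thesis by (simp add: ltwo_def)
 qed
 show ?thesis by (rule trans_cont_lim[OF u sq tc lim])
qed

theorem conv_mollifier_tendsto:
 fixes u :: "real^'n::finite => real"
 assumes u: "integ u" "u\<in>sqi" and e: "e > 0"
 obtains d where "d > 0" "\<And>t b. t\<le>d ==> mollifier t b ==> nrm (%x. conv u b x - u x)\<le>e"
proof -
 obtain d where d: "d > 0" "\<And>z. norm z < d ==> nrm (%x. u (x - z) - u x) < e"
  using sq_int_trans_cont[OF u(2)] e unfolding trans_cont_def by blast
 have "nrm (%x. conv u b x - u x)\<le>e" if t: "t\<le>d" and b: "mollifier t b" for t b
 proof -
  note [measurable] = borel_measurable_integrable[OF u(1)] conv_measurable[OF u(1) mollifierD(1)[OF b]]
  have "(NN x. indicator UNIV x*ennreal ((conv u b x - 1*u x)^2))\<le>ennreal (e^2)"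
  proof (rule conv_Jensen_integral[OF u(1) b])
   fix z :: "real^'n" assume "norm z < t"
   then have "nrm (%x. u (x - z) - u x)\<le>e" using d(2)[of z] t by simp
   moreover have "(%x. u (x - z) - u x)\<in>sqi" by (intro sq_int_diff sq_int_shift u)
   ultimately show "(NN x. indicator UNIV x*ennreal ((u (x - z) - 1*u x)^2))\<le>ennreal (e^2)"
    using sq_int_nn_integral[of "%x. u (x - z) - u x" lborel e] e by simp
  qed auto
  then show ?thesis
   using sq_int_nn_integral[of "%x. conv u b x - u x" lborel e] e by simp
 qed
 then show ?thesis using that d(1) by blast
qed

section \<open>Integration by parts through difference quotients\<close>

text \<open>Regularity in one direction only: this is what integration along lines and difference
  quotients use, and it admits products with cut-offs such as \<open>bump2\<close> that are not
  smooth.\<close>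

definition dir_C1 :: "'a::euclidean_space => ('a => real) => ('a => real) => bool" where
 "dir_C1 v G G' \<longleftrightarrow> continuous_on UNIV G\<and>continuous_on UNIV G' \<and>
   (\<forall>x. ((%t. G (x + t *\<^sub>R v)) has_real_derivative G' x) (at 0))"

lemma dir_C1_deriv:
 assumes "dir_C1 v G G'"
 shows "((%t. G (x + t *\<^sub>R v)) has_real_derivative G' (x + t *\<^sub>R v)) (at t)"
proof -
 have "((%s. G ((x + t *\<^sub>R v) + s *\<^sub>R v)) has_real_derivative G' (x + t *\<^sub>R v)) (at 0)"
  using assms by (auto simp: dir_C1_def)
 then have "((%s. G (x + (s + t) *\<^sub>R v)) has_real_derivative G' (x + t *\<^sub>R v)) (at 0)"
  by (simp add: algebra_simps)
 then show ?thesis using DERIV_shift[of "%s. G (x + s *\<^sub>R v)" _ 0 t] by simp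
qed

lemma dir_C1_mult: "dir_C1 v F F' ==> dir_C1 v G G' ==> dir_C1 v (%x. F x*G x) (%x. F' x*G x + F x*G' x)"
 unfolding dir_C1_def by (auto intro!: continuous_intros derivative_eq_intros)

lemma dir_C1_power2: "dir_C1 v F F' ==> dir_C1 v (%x. (F x)^2) (%x. 2*(F x*F' x))"
 using dir_C1_mult[of v F F' F F'] by (simp add: power2_eq_square mult_ac)

lemma smooth_dir_C1:
 fixes p :: "real^'n::finite => real"
 assumes "smooth p"
 shows "dir_C1 v p (%x. \<Sum>i\<in>UNIV. v $ i*pd i p x)"
 unfolding dir_C1_def
proof (intro conjI allI)
 show "continuous_on UNIV p" by (rule smooth_continuous[OF assms])
 show "continuous_on UNIV (%x. \<Sum>i\<in>UNIV. v $ i*pd i p x)"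
  by (intro continuous_intros smooth_continuous smooth_partial_derivs assms)
 fix x
 have 1: "((%t. x + t *\<^sub>R v) has_derivative (%t. t *\<^sub>R v)) (at 0)"
  by (auto intro!: derivative_eq_intros)
 have 2: "(p has_derivative (%h. \<Sum>i\<in>UNIV. h $ i*pd i p x)) (at (x + 0 *\<^sub>R v))"
  using smooth_has_derivative[OF assms, of x] by simp
 show "((%t. p (x + t *\<^sub>R v)) has_real_derivative (\<Sum>i\<in>UNIV. v $ i*pd i p x)) (at 0)"
 proof -
  have "(%t. \<Sum>i\<in>UNIV. (t *\<^sub>R v) $ i*pd i p x) = (*) (\<Sum>i\<in>UNIV. v $ i*pd i p x)"
   by (simp add: fun_eq_iff sum_distrib_left sum_distrib_right mult_ac)
  then show ?thesis using has_derivative_compose[OF 1 2] by (simp add: has_field_derivative_def)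
 qed
qed

lemma smooth_dir_C1_axis:
 fixes p :: "real^'n::finite => real"
 assumes "smooth p"
 shows "dir_C1 (axis i 1) p (pd i p)"
proof -
 have "(\<Sum>k\<in>UNIV. axis i 1 $ k*pd k p x) = pd i p x" for x
  by (simp add: axis_def if_distrib[of "%x. x * _"] cong: if_cong)
 then show ?thesis using smooth_dir_C1[OF assms, of "axis i 1"] by simp
qed

lemma continuous_on_UNIV_LIMSEQ:
 assumes "continuous_on UNIV f" "X---->x"
 shows "(%n. f (X n))---->f x"
 using continuous_on_tendsto_compose[OF assms(1,2)] by simp

text \<open>The second difference \<open>Q\<close> is symmetric in the two directions. Two
  applications of the mean value theorem identify it with \<open>s^2\<close> times a mixed
  derivative at a point within \<open>2*s\<close> of \<open>x\<close>, in either order; continuity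
  of both mixed derivatives finishes.\<close>

lemma smooth_mixed_partials:
 fixes p :: "real^'n::finite => real"
 assumes "smooth p"
 shows "partial_derivs [i, j] p x = partial_derivs [j, i] p x"
proof -
 define Q where "Q k l s = p (x + s *\<^sub>R axis k 1 + s *\<^sub>R axis l 1) - p (x + s *\<^sub>R axis k 1) - p (x + s *\<^sub>R axis l 1) + p x" for k l s
 have main: "\<exists>\<xi>. norm (\<xi> - x)\<le>2 * s\<and>Q k l s = s * s*partial_derivs [l, k] p \<xi>" if s: "s > 0" for s k l
 proof -
  let ?k = "axis k 1 :: real^'n" and ?l = "axis l 1 :: real^'n"
  define g where "g t = p ((x + s *\<^sub>R ?l) + t *\<^sub>R ?k) - p (x + t *\<^sub>R ?k)" for t
  have d: "(g has_real_derivative (pd k p ((x + s *\<^sub>R ?l) + t *\<^sub>R ?k) - pd k p (x + t *\<^sub>R ?k))) (at t)" for t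
   unfolding g_def by (intro derivative_intros dir_C1_deriv smooth_dir_C1_axis assms)
  obtain t where t: "0 < t" "t < s"
   "g s - g 0 = (s - 0)*(pd k p ((x + s *\<^sub>R ?l) + t *\<^sub>R ?k) - pd k p (x + t *\<^sub>R ?k))"
   using MVT2[OF s d] by blast
  have d2: "((%r. pd k p ((x + t *\<^sub>R ?k) + r *\<^sub>R ?l)) has_real_derivative
    pd l (pd k p) ((x + t *\<^sub>R ?k) + r *\<^sub>R ?l)) (at r)" for r
   by (intro dir_C1_deriv smooth_dir_C1_axis smooth_partial_derivs assms)
  obtain r where r: "0 < r" "r < s"
   "pd k p ((x + t *\<^sub>R ?k) + s *\<^sub>R ?l) - pd k p ((x + t *\<^sub>R ?k) + 0 *\<^sub>R ?l) =
    (s - 0)*pd l (pd k p) ((x + t *\<^sub>R ?k) + r *\<^sub>R ?l)"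
   using MVT2[OF s d2] by blast
  have "norm ((x + t *\<^sub>R ?k) + r *\<^sub>R ?l - x)\<le>2 * s"
  proof -
   have "norm (t *\<^sub>R ?k + r *\<^sub>R ?l)\<le>norm (t *\<^sub>R ?k) + norm (r *\<^sub>R ?l)" by (rule norm_triangle_ineq)
   also have "...\<le>2 * s" using t r by simp
   finally show ?thesis by (simp add: algebra_simps)
  qed
  moreover have "Q k l s = s * s*partial_derivs [l, k] p ((x + t *\<^sub>R ?k) + r *\<^sub>R ?l)"
  proof -
   have "Q k l s = g s - g 0" by (simp add: Q_def g_def add.commute add.left_commute)
   also have "... = s*(s*pd l (pd k p) ((x + t *\<^sub>R ?k) + r *\<^sub>R ?l))"
    using t(3) r(3) by (simp add: add.commute add.left_commute)
   finally show ?thesis by simp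
  qed
  ultimately show ?thesis by blast
 qed
 define s where "s n = 1/real (Suc n)" for n
 have s0: "s n > 0" for n by (simp add: s_def)
 have sl: "s---->0" unfolding s_def by (rule LIMSEQ_Suc[OF lim_1_over_n])
 have key: "(%n. Q k l (s n)/(s n * s n))---->partial_derivs [l, k] p x" for k l
 proof -
  have "\<forall>n. \<exists>\<xi>. norm (\<xi> - x)\<le>2 * s n\<and>Q k l (s n) = s n * s n*partial_derivs [l, k] p \<xi>" using main[OF s0] by blast
  from choice[OF this] obtain \<xi> where \<xi>: "\<And>n. norm (\<xi> n - x)\<le>2 * s n" "\<And>n. Q k l (s n) = s n * s n*partial_derivs [l, k] p (\<xi> n)"
   by auto
  have "(%n. \<xi> n - x)---->0"
   by (rule Lim_null_comparison[of _ "%n. 2 * s n"]) (use \<xi>(1) sl in \<open>auto intro!: tendsto_mult_right_zero\<close>)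
  then have "\<xi>---->x" by (simp add: LIM_zero_iff)
  moreover have "continuous_on UNIV (partial_derivs [l, k] p)"
   by (intro smooth_continuous smooth_partial_derivs assms)
  ultimately have "(%n. partial_derivs [l, k] p (\<xi> n))---->partial_derivs [l, k] p x"
   by (rule continuous_on_UNIV_LIMSEQ[rotated])
  then show ?thesis unfolding \<xi>(2) using s0 by (simp add: less_imp_neq[OF s0, symmetric])
 qed
 have "Q i j = Q j i" by (auto simp: Q_def add_ac)
 with key[of i j] key[of j i] show ?thesis using LIMSEQ_unique by metis
qed

lemma tendsto_integral_bounded_support:
 fixes f :: "nat => 'a::euclidean_space => real"
 assumes [measurable]: "\<And>n. f n\<in>bmeas" "g\<in>bmeas"
  and B: "\<And>n x. \<bar>f n x\<bar>\<le>B" and r: "\<And>n x. f n x\<noteq>0 ==> norm x\<le>r"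
  and l: "\<And>x. (%n. f n x)---->g x"
 shows "(%n. LBINT x. f n x)---->(LBINT x. g x)"
proof (rule integral_dominated_convergence)
 show "integ (%x::'a. B*indicator (cball 0 r) x)"
  using emeasure_lborel_cball_finite[of "0::'a" r]
  by (intro integrable_mult_right integrable_real_indicator) (auto simp: top.not_eq_extremum)
 show "AE x in lborel. norm (f n x)\<le>B*indicator (cball 0 r) x" for n
 proof (rule AE_I2)
  fix x
  show "norm (f n x)\<le>B*indicator (cball 0 r) x"
   using B[of n x] r[of n x] by (cases "f n x = 0") (auto simp: indicator_def)
 qed
qed (use l in auto)

lemma continuous_bounded_on_cball:
 fixes G :: "'a::euclidean_space => real"
 assumes "continuous_on UNIV G"
 obtains B where "B\<ge>0" "\<And>x. norm x\<le>r ==> \<bar>G x\<bar>\<le>B"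
proof -
 have "compact (G ` cball 0 r)"
  by (intro compact_continuous_image continuous_on_subset[OF assms]) auto
 then obtain B where "B > 0" "\<And>y. y\<in>G ` cball 0 r ==> norm y\<le>B"
  using compact_imp_bounded bounded_pos by metis
 then show ?thesis using that[of B] by force
qed

text \<open>Summation by parts for a shift; dividing by its length and letting it tend to 0 gives
 integration by parts against weights that are merely Lipschitz.\<close>

lemma difference_quotient_by_parts:
 fixes w G :: "'a::euclidean_space => real"
 assumes w: "continuous_on UNIV w" "\<And>x. w x\<noteq>0 ==> norm x\<le>r" and G: "dir_C1 v G G'"
 shows "(%n. LBINT x. (w (x + (1/Suc n) *\<^sub>R v) - w x)/(1/Suc n)*G x)
   ----> - (LBINT x. w x*G' x)"
proof -
 have cG: "continuous_on UNIV G" "continuous_on UNIV G'" using G by (auto simp: dir_C1_def)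
 have [measurable]: "w\<in>bmeas" "G\<in>bmeas" "G'\<in>bmeas"
  by (intro borel_measurable_continuous_onI w cG)+
 obtain Bw where Bw: "Bw\<ge>0" "\<And>x. norm x\<le>r ==> \<bar>w x\<bar>\<le>Bw"
  using continuous_bounded_on_cball[OF w(1)] by blast
 have wb: "\<bar>w x\<bar>\<le>Bw" for x using Bw w(2)[of x] by (cases "w x = 0") auto
 obtain BG where BG: "BG\<ge>0" "\<And>x. norm x\<le>r + norm v ==> \<bar>G x\<bar>\<le>BG"
  using continuous_bounded_on_cball[OF cG(1)] by blast
 obtain BG' where BG': "BG'\<ge>0" "\<And>x. norm x\<le>r + norm v ==> \<bar>G' x\<bar>\<le>BG'"
  using continuous_bounded_on_cball[OF cG(2)] by blast
 define s where "s n = 1/real (Suc n)" for n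
 have s0: "0 < s n" "s n\<le>1" for n by (simp_all add: s_def)
 have near: "norm (x - t *\<^sub>R v)\<le>r + norm v" if "norm x\<le>r" "0\<le>t" "t\<le>s n" for x t n
 proof -
  have "norm (x - t *\<^sub>R v)\<le>norm x + t*norm v"
   using norm_triangle_ineq4[of x "t *\<^sub>R v"] that by simp
  also have "t*norm v\<le>1*norm v" using that s0(2)[of n] by (intro mult_right_mono) auto
  finally show ?thesis using that by simp
 qed
 \<comment> \<open>The shift turns the forward quotient of \<open>w\<close> into a backward quotient
   of \<open>G\<close>, whose limit is still \<open>G'\<close>; the minus sign of the result arises
   here.\<close>
 define q where "q n x = w x*((G x - G (x - s n *\<^sub>R v))/s n)" for n x
 have qeq: "(LBINT x. (w (x + s n *\<^sub>R v) - w x)/s n*G x) = - (LBINT x. q n x)" for n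
 proof -
  have i1: "integ (%x. w x*G x)"
  proof (rule integrable_bounded_support[of _ "Bw*BG" r])
   show "\<bar>w x*G x\<bar>\<le>Bw*BG" for x
   proof (cases "w x = 0")
    case False
    then have "norm x\<le>r + norm v" using w(2)[of x] norm_ge_zero[of v] by linarith
    then show ?thesis using BG wb[of x] by (simp add: abs_mult mult_mono)
   qed (use BG Bw in simp)
  qed (use w(2) in auto)
  have i2: "integ (%x. w x*G (x - s n *\<^sub>R v))"
  proof (rule integrable_bounded_support[of _ "Bw*BG" r])
   show "\<bar>w x*G (x - s n *\<^sub>R v)\<bar>\<le>Bw*BG" for x
   proof (cases "w x = 0")
    case False
    then have "norm (x - s n *\<^sub>R v)\<le>r + norm v" using near[of x "s n" n] w(2) s0[of n] by auto
    then show ?thesis using BG wb[of x] by (simp add: abs_mult mult_mono)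
   qed (use BG Bw in simp)
  qed (use w(2) in auto)
  have i3: "integ (%x. w (x + s n *\<^sub>R v)*G x)"
   using integrable_lborel_shift[OF i2, of "s n *\<^sub>R v"] by simp
  have e3: "(LBINT x. w (x + s n *\<^sub>R v)*G x) = (LBINT x. w x*G (x - s n *\<^sub>R v))"
   using integral_lborel_shift[of "%x. w x*G (x - s n *\<^sub>R v)" "s n *\<^sub>R v"] by simp
  have "(%x. (w (x + s n *\<^sub>R v) - w x)/s n*G x) = (%x. (w (x + s n *\<^sub>R v)*G x - w x*G x)/s n)"
   by (simp add: fun_eq_iff field_simps)
  moreover have "q n = (%x. (w x*G x - w x*G (x - s n *\<^sub>R v))/s n)"
   by (simp add: fun_eq_iff field_simps q_def)
  ultimately show ?thesis using i1 i2 i3 e3 s0(1)[of n] by (simp add: field_simps)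
 qed
 have "(%n. LBINT x. q n x)---->(LBINT x. w x*G' x)"
 proof (rule tendsto_integral_bounded_support)
  show "q n\<in>bmeas" for n unfolding q_def by measurable
  show "\<bar>q n x\<bar>\<le>Bw*BG'" for n x
  proof (cases "w x = 0")
   case False
   have d: "((%t. G (x + t *\<^sub>R v)) has_real_derivative G' (x + t *\<^sub>R v)) (at t)" for t
    by (rule dir_C1_deriv[OF G])
   obtain t where t: "- s n < t" "t < 0" "G (x + 0 *\<^sub>R v) - G (x + (- s n) *\<^sub>R v) = (0 - - s n)*G' (x + t *\<^sub>R v)"
    using MVT2[of "- s n" 0 "%t. G (x + t *\<^sub>R v)" "%t. G' (x + t *\<^sub>R v)"] d s0(1)[of n] by auto
   have "norm (x - (-t) *\<^sub>R v)\<le>r + norm v" using near[of x "-t" n] w(2)[OF False] t by auto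
   then have "\<bar>(G x - G (x - s n *\<^sub>R v))/s n\<bar>\<le>BG'"
    using t(3) BG'(2)[of "x + t *\<^sub>R v"] s0(1)[of n] by simp
   then show ?thesis unfolding q_def abs_mult using wb[of x] Bw(1) BG'(1) by (intro mult_mono) auto
  qed (use Bw BG' in \<open>simp add: q_def\<close>)
  show "norm x\<le>r" if "q n x\<noteq>0" for n x using that w(2) by (auto simp: q_def)
  fix x
  have "((%t. G (x + t *\<^sub>R v)) has_real_derivative G' x) (at 0)" using G by (auto simp: dir_C1_def)
  then have "((%h. (G (x + h *\<^sub>R v) - G x)/h)\<longlongrightarrow>G' x) (at 0)" by (simp add: DERIV_def)
  moreover have "filterlim (%n. - s n) (at 0) sequentially"
  proof -
   have "s---->0" unfolding s_def by (rule LIMSEQ_Suc[OF lim_1_over_n])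
   then have "(%n. - s n)---->0" using tendsto_minus by fastforce
   then show ?thesis unfolding filterlim_at using s0 by (auto intro!: always_eventually simp: less_imp_neq[OF s0(1), symmetric])
  qed
  ultimately have "(%n. (G (x + (- s n) *\<^sub>R v) - G x)/(- s n))---->G' x"
   by (rule filterlim_compose)
  moreover have "(G (x + (- s n) *\<^sub>R v) - G x)/(- s n) = (G x - G (x - s n *\<^sub>R v))/s n" for n
   using s0(1)[of n] by (simp add: field_simps)
  ultimately show "(%n. q n x)---->w x*G' x"
   unfolding q_def by (intro tendsto_mult tendsto_const) simp
 qed measurable
 then have "(%n. - (LBINT x. q n x))---->- (LBINT x. w x*G' x)" by (rule tendsto_minus)
 then show ?thesis using qeq by (simp add: s_def)
qed

text \<open>Weights are Lipschitz instead of smooth because they are built from distances and from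
  Lipschitz charts. The constant \<open>L\<close> is tracked since its square is the price of every
  localization.\<close>

definition lip_bump :: "real => ('a::euclidean_space => real) => bool" where
 "lip_bump L p \<longleftrightarrow> L\<ge>0\<and>(\<forall>x. 0\<le>p x)\<and>(\<forall>x y. \<bar>p x - p y\<bar>\<le>L*norm (x - y))\<and>bounded {x. p x\<noteq>0}"

lemma lip_bumpD:
 assumes "lip_bump L p"
 shows "L\<ge>0" "p x\<ge>0" "\<bar>p x - p y\<bar>\<le>L*norm (x - y)" "continuous_on UNIV p"
  "p\<in>bmeas"
proof -
 show "L\<ge>0" "p x\<ge>0" "\<bar>p x - p y\<bar>\<le>L*norm (x - y)" using assms by (auto simp: lip_bump_def)
 have "L-lipschitz_on UNIV p"
  using assms by (auto simp: lip_bump_def dist_norm intro!: lipschitz_onI)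
 then show c: "continuous_on UNIV p" by (rule lipschitz_on_continuous_on)
 show "p\<in>bmeas" by (rule borel_measurable_continuous_onI[OF c])
qed

lemma lip_bump_bounds:
 assumes "lip_bump L p"
 obtains r B where "r > 0" "B\<ge>0" "\<And>x. p x\<noteq>0 ==> norm x\<le>r" "\<And>x. p x\<le>B"
proof -
 obtain r where r: "r > 0" "\<And>x. p x\<noteq>0 ==> norm x\<le>r"
  using assms unfolding lip_bump_def bounded_pos by auto
 obtain B where B: "B\<ge>0" "\<And>x. norm x\<le>r ==> \<bar>p x\<bar>\<le>B"
  using continuous_bounded_on_cball[OF lip_bumpD(4)[OF assms]] by blast
 have "p x\<le>B" for x using r(2)[of x] B by (cases "p x = 0") force+
 then show ?thesis using that r B by blast
qed

text \<open>The difference quotient of \<open>p^2\<close> along \<open>v\<close> factors into the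
  quotient of \<open>p\<close>, at most \<open>L\<close> in modulus because \<open>v\<close> has
  norm at most 1, and a sum of two values of \<open>p\<close>, which tends to
  \<open>2*p\<close>.\<close>

lemma lip_bump_ibp:
 fixes p G :: "'a::euclidean_space => real"
 assumes p: "lip_bump L p" and G: "dir_C1 v G G'" and v: "norm v\<le>1"
 shows "\<bar>LBINT x. (p x)^2*G' x\<bar>\<le>2*L*(LBINT x. p x*\<bar>G x\<bar>)"
proof -
 obtain r B where r: "r > 0" "B\<ge>0" "\<And>x. p x\<noteq>0 ==> norm x\<le>r" "\<And>x. p x\<le>B"
  using lip_bump_bounds[OF p] by blast
 note pD = lip_bumpD[OF p]
 note [measurable] = pD(5)
 have cG: "continuous_on UNIV G" "continuous_on UNIV G'" using G by (auto simp: dir_C1_def)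
 have [measurable]: "G\<in>bmeas" "G'\<in>bmeas"
  by (intro borel_measurable_continuous_onI cG)+
 obtain BG where BG: "BG\<ge>0" "\<And>x. norm x\<le>r + 1 ==> \<bar>G x\<bar>\<le>BG"
  using continuous_bounded_on_cball[OF cG(1)] by blast
 define s where "s n = 1/real (Suc n)" for n
 have s0: "0 < s n" "s n\<le>1" for n by (simp_all add: s_def)
 have sl: "s---->0" unfolding s_def by (rule LIMSEQ_Suc[OF lim_1_over_n])
 define R where "R n x = L*((p (x + s n *\<^sub>R v) + p x)*\<bar>G x\<bar>)" for n x
 have lim1: "(%n. LBINT x. ((p (x + s n *\<^sub>R v))^2 - (p x)^2)/s n*G x)---->- (LBINT x. (p x)^2*G' x)"
  unfolding s_def
  by (rule difference_quotient_by_parts[of "%x. (p x)^2" r]) (use r G in \<open>auto intro!: continuous_intros pD\<close>)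
 have near: "norm x\<le>r + 1" if "p (x + s n *\<^sub>R v)\<noteq>0\<or>p x\<noteq>0" for x n
 proof -
  have "norm (s n *\<^sub>R v)\<le>1*1" unfolding norm_scaleR using s0[of n] v by (intro mult_mono) auto
  moreover have "norm x\<le>norm (x + s n *\<^sub>R v) + norm (s n *\<^sub>R v)"
   using norm_triangle_ineq4[of "x + s n *\<^sub>R v" "s n *\<^sub>R v"] by simp
  ultimately show ?thesis using that r(3)[of x] r(3)[of "x + s n *\<^sub>R v"] by auto
 qed
 have Rb: "\<bar>R n x\<bar>\<le>L*((B + B)*BG)" for n x
 proof (cases "p (x + s n *\<^sub>R v)\<noteq>0\<or>p x\<noteq>0")
  case True
  have "0\<le>p (x + s n *\<^sub>R v) + p x" "p (x + s n *\<^sub>R v) + p x\<le>B + B"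
   using add_mono[OF r(4) r(4)] pD(2) by (auto intro: add_nonneg_nonneg)
  then have "\<bar>(p (x + s n *\<^sub>R v) + p x)*\<bar>G x\<bar>\<bar>\<le>(B + B)*BG"
   unfolding abs_mult using BG(2)[OF near[OF True]] by (intro mult_mono) auto
  then show ?thesis
   unfolding R_def abs_mult[of L] using pD(1) by (auto intro: mult_left_mono)
 qed (use pD(1) r BG in \<open>simp add: R_def\<close>)
 have lim2: "(%n. LBINT x. R n x)---->(LBINT x. L*((p x + p x)*\<bar>G x\<bar>))"
 proof (rule tendsto_integral_bounded_support[OF _ _ Rb])
  show "norm x\<le>r + 1" if "R n x\<noteq>0" for n x
   using that by (intro near[where n = n]) (auto simp: R_def)
  fix x
  have "(%n. x + s n *\<^sub>R v)---->x + 0 *\<^sub>R v" by (intro tendsto_intros sl)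
  from continuous_on_UNIV_LIMSEQ[OF pD(4) this]
  have "(%n. p (x + s n *\<^sub>R v))---->p x" by simp
  then show "(%n. R n x)---->L*((p x + p x)*\<bar>G x\<bar>)" unfolding R_def by (intro tendsto_intros)
 qed (auto simp: R_def)
 have "\<bar>- (LBINT x. (p x)^2*G' x)\<bar>\<le>(LBINT x. L*((p x + p x)*\<bar>G x\<bar>))"
 proof (rule LIMSEQ_le[OF tendsto_rabs[OF lim1] lim2], intro exI[of _ 0] allI impI)
  fix n
  have pt: "\<bar>((p (x + s n *\<^sub>R v))^2 - (p x)^2)/s n*G x\<bar>\<le>R n x" for x
  proof -
   have "\<bar>p (x + s n *\<^sub>R v) - p x\<bar>\<le>L*norm (s n *\<^sub>R v)"
    using pD(3)[of "x + s n *\<^sub>R v" x] by simp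
   also have "...\<le>L * s n" using pD(1) s0[of n] v by (intro mult_left_mono) (auto simp: mult_left_le)
   finally have "\<bar>(p (x + s n *\<^sub>R v) - p x)/s n\<bar>\<le>L" using s0(1)[of n] by (simp add: field_simps)
   then have "\<bar>(p (x + s n *\<^sub>R v) - p x)/s n\<bar>*((p (x + s n *\<^sub>R v) + p x)*\<bar>G x\<bar>)\<le>R n x"
    unfolding R_def using pD(2) by (intro mult_right_mono) auto
   moreover have "((p (x + s n *\<^sub>R v))^2 - (p x)^2)/s n*G x
    = (p (x + s n *\<^sub>R v) - p x)/s n*((p (x + s n *\<^sub>R v) + p x)*G x)"
    by (simp add: power2_eq_square field_simps)
   moreover have "0\<le>p (x + s n *\<^sub>R v) + p x" using pD(2) by (auto intro: add_nonneg_nonneg)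
   ultimately show ?thesis by (simp only: abs_mult[of _ "G x"] abs_mult[of "(p (x + s n *\<^sub>R v) - p x)/s n"]
     abs_mult[of "p (x + s n *\<^sub>R v) + p x"] abs_of_nonneg)
  qed
  have iR: "integ (R n)"
   by (rule integrable_bounded_support[OF _ Rb, of _ _ "r + 1"])
     (use near[where n=n] in \<open>auto simp: R_def\<close>)
  show "\<bar>LBINT x. ((p (x + s n *\<^sub>R v))^2 - (p x)^2)/s n*G x\<bar>\<le>(LBINT x. R n x)"
  proof (rule integral_abs_bound_integral[OF _ iR pt])
   show "integ (%x. ((p (x + s n *\<^sub>R v))^2 - (p x)^2)/s n*G x)"
    by (rule Bochner_Integration.integrable_bound[OF iR])
      (use order_trans[OF pt abs_ge_self] in auto)
  qed
 qed
 moreover have "(%x. L*((p x + p x)*\<bar>G x\<bar>)) = (%x. 2*L*(p x*\<bar>G x\<bar>))"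
  by (auto simp: algebra_simps)
 ultimately show ?thesis by (simp only: integral_mult_right_zero abs_minus_cancel)
qed

section \<open>Weighted inequalities for smooth functions\<close>

lemma lip_bump_integrable:
 fixes p G :: "'a::euclidean_space => real"
 assumes "lip_bump L p" "continuous_on UNIV G"
 shows "integ (%x. p x*G x)" "integ (%x. (p x)^2*G x)"
  "integ (%x. indicator {x. p x\<noteq>0} x*G x)"
proof -
 obtain r B where r: "r > 0" "B\<ge>0" "\<And>x. p x\<noteq>0 ==> norm x\<le>r" "\<And>x. p x\<le>B"
  using lip_bump_bounds[OF assms(1)] by blast
 note [measurable] = lip_bumpD(5)[OF assms(1)] borel_measurable_continuous_onI[OF assms(2)]
 have gen: "integ (%x. w x*F x)"
  if F: "continuous_on UNIV F" and w: "\<And>x. w x\<noteq>0 ==> p x\<noteq>0" "\<And>x. \<bar>w x\<bar>\<le>C" "C\<ge>0"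
   and [measurable]: "w\<in>bmeas" for w F :: "'a => real" and C
 proof -
  note [measurable] = borel_measurable_continuous_onI[OF F]
  obtain D where D: "D\<ge>0" "\<And>x. norm x\<le>r ==> \<bar>F x\<bar>\<le>D"
   using continuous_bounded_on_cball[OF F] by blast
  show ?thesis
  proof (rule integrable_bounded_support[of _ "C*D" r])
   show "\<bar>w x*F x\<bar>\<le>C*D" for x
   proof (cases "w x = 0")
    case False
    then show ?thesis using D(2)[of x] r(3)[OF w(1)[OF False]] w(2)[of x] w(3)
     by (auto simp: abs_mult intro!: mult_mono)
   qed (use D w in auto)
  qed (use w r in auto)
 qed
 show "integ (%x. p x*G x)"
  by (rule gen[OF assms(2), of _ B]) (use r lip_bumpD(2)[OF assms(1)] in auto)
 show "integ (%x. indicator {x. p x\<noteq>0} x*G x)"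
  by (rule gen[OF assms(2), of _ 1]) (auto simp: indicator_def split: if_splits)
 have "continuous_on UNIV (%x. p x*G x)" by (intro continuous_intros assms lip_bumpD(4)[OF assms(1)])
 then have "integ (%x. p x*(p x*G x))"
  by (rule gen[of _ _ B]) (use r lip_bumpD(2)[OF assms(1)] in auto)
 then show "integ (%x. (p x)^2*G x)" by (simp add: power2_eq_square mult.assoc)
qed

lemma young_weighted: "2*c*\<bar>a\<bar>*\<bar>b\<bar>\<le>(b^2)/2 + 2*c^2*(a^2)" for a b c :: real
proof -
 have "0\<le>(2*c*\<bar>a\<bar> - \<bar>b\<bar>)^2" by simp
 also have "... = 4*c^2*a^2 - 4*c*\<bar>a\<bar>*\<bar>b\<bar> + b^2"
  by (simp add: power2_eq_square algebra_simps)
 finally show ?thesis by linarith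
qed

text \<open>Testing with the fields \<open>S\<close> times its partial derivatives: their divergence
  is the squared gradient where \<open>S\<close> is harmonic. Each direction costs
  \<open>2*L^2\<close> and half of its own term by Young's inequality; absorbing the halves turns
  \<open>4*L^2\<close> into \<open>8*L^2\<close>.\<close>

lemma caccioppoli_smooth:
 fixes S :: "real^2 => real"
 assumes p: "lip_bump L p" and S: "smooth S"
  and harm: "\<And>x. p x\<noteq>0 ==> partial_derivs [1,1] S x + partial_derivs [2,2] S x = 0"
 shows "(LBINT x. (p x)^2*((pd 1 S x)^2 + (pd 2 S x)^2))
   \<le> 8*L^2*(LBINT x. indicator {x. p x\<noteq>0} x*(S x)^2)"
proof -
 note cont = smooth_continuous[OF S] smooth_continuous[OF smooth_partial_derivs[OF S]]
 note int = lip_bump_integrable[OF p]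
 define G where "G j x = S x*pd j S x" for j x
 define G' where "G' j x = pd j S x*pd j S x + S x*partial_derivs [j,j] S x" for j x
 have dG: "dir_C1 (axis j 1) (G j) (G' j)" for j
  unfolding G_def G'_def
  using dir_C1_mult[OF smooth_dir_C1_axis[OF S] smooth_dir_C1_axis[OF smooth_partial_derivs[OF S]], of j "[j]"]
  by (simp add: partial_derivs_append)
 have cG: "continuous_on UNIV (G j)" "continuous_on UNIV (G' j)" for j using dG[of j] by (auto simp: dir_C1_def)
 define X where "X j = (LBINT x. (p x)^2*(pd j S x)^2)" for j
 define Y where "Y = (LBINT x. indicator {x. p x\<noteq>0} x*(S x)^2)"
 have iX: "integ (%x. (p x)^2*(pd j S x)^2)" for j
  by (intro int continuous_intros cont)
 have iY: "integ (%x. indicator {x. p x\<noteq>0} x*(S x)^2)"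
  by (intro int continuous_intros cont)
 have bd: "\<bar>LBINT x. (p x)^2*G' j x\<bar>\<le>X j/2 + 2*(L^2*Y)" for j
 proof -
  have "\<bar>LBINT x. (p x)^2*G' j x\<bar>\<le>2*L*(LBINT x. p x*\<bar>G j x\<bar>)"
   by (rule lip_bump_ibp[OF p dG]) simp
  also have "... = (LBINT x. 2*L*(p x*\<bar>G j x\<bar>))" by simp
  also have "...\<le>(LBINT x. ((p x)^2*(pd j S x)^2)/2 + 2*L^2*(indicator {x. p x\<noteq>0} x*(S x)^2))"
  proof (rule integral_mono)
   show "integ (%x. 2*L*(p x*\<bar>G j x\<bar>))" by (intro integrable_mult_right int continuous_intros cG)
   show "integ (%x. ((p x)^2*(pd j S x)^2)/2 + 2*L^2*(indicator {x. p x\<noteq>0} x*(S x)^2))"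
    by (intro Bochner_Integration.integrable_add integrable_divide integrable_mult_right iX iY)
   fix x
   have "2*L*\<bar>S x\<bar>*\<bar>p x*pd j S x\<bar>\<le>(p x*pd j S x)^2/2 + 2*L^2*(S x)^2"
    by (rule young_weighted)
   then show "2*L*(p x*\<bar>G j x\<bar>)\<le>((p x)^2*(pd j S x)^2)/2 + 2*L^2*(indicator {x. p x\<noteq>0} x*(S x)^2)"
    using lip_bumpD(2)[OF p, of x] by (cases "p x = 0") (auto simp: G_def abs_mult mult_ac power_mult_distrib)
  qed
  also have "... = X j/2 + 2*(L^2*Y)"
   unfolding X_def Y_def using iX[of j] iY by (subst Bochner_Integration.integral_add) auto
  finally show ?thesis .
 qed
 have i2: "integ (%x. (p x)^2*G' j x)" for j by (intro int cG)
 have "(LBINT x. (p x)^2*((pd 1 S x)^2 + (pd 2 S x)^2))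
   = (LBINT x. (p x)^2*G' 1 x + (p x)^2*G' 2 x)"
 proof (rule Bochner_Integration.integral_cong)
  fix x
  show "(p x)^2*((pd 1 S x)^2 + (pd 2 S x)^2) = (p x)^2*G' 1 x + (p x)^2*G' 2 x"
  proof (cases "p x = 0")
   case False
   have "G' 1 x + G' 2 x = (pd 1 S x)^2 + (pd 2 S x)^2
     + S x*(partial_derivs [1,1] S x + partial_derivs [2,2] S x)"
    unfolding G'_def by (simp only: power2_eq_square) (simp add: algebra_simps)
   then show ?thesis by (simp only: harm[OF False] flip: distrib_left) simp
  qed simp
 qed simp
 also have "... = (LBINT x. (p x)^2*G' 1 x) + (LBINT x. (p x)^2*G' 2 x)"
  by (rule Bochner_Integration.integral_add[OF i2 i2])
 also have "...\<le>(X 1/2 + 2*(L^2*Y)) + (X 2/2 + 2*(L^2*Y))"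
  by (rule add_mono[OF abs_le_D1[OF bd] abs_le_D1[OF bd]])
 also have "... = (X 1 + X 2)/2 + 4*(L^2*Y)" by (simp add: add_divide_distrib)
 finally have le: "(LBINT x. (p x)^2*((pd 1 S x)^2 + (pd 2 S x)^2))
  \<le> (X 1 + X 2)/2 + 4*(L^2*Y)" .
 have eq: "(LBINT x. (p x)^2*((pd 1 S x)^2 + (pd 2 S x)^2)) = X 1 + X 2"
  unfolding X_def distrib_left by (rule Bochner_Integration.integral_add[OF iX iX])
 have "(LBINT x. (p x)^2*((pd 1 S x)^2 + (pd 2 S x)^2))
  \<le> 8*(L^2*Y)"
 proof -
  have "I\<le>T/2 + 4*K ==> I = T ==> I\<le>8*K" for I T K :: real by linarith
  from this[OF le eq] show ?thesis .
 qed
 then show ?thesis unfolding Y_def by (simp only: mult.assoc)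
qed

text \<open>Both \<open>a*b\<close> and \<open>E11*E22\<close> are divergences up to the same term:
  \<open>u1\<close> times the mixed derivative of \<open>u2\<close>. Hence their weighted integrals
  differ only by terms in which a derivative falls on the weight, and the product in
  \<open>a^2 + b^2 = (a + b)^2 - 2*a*b\<close> is traded for symmetric entries. In these terms only
  \<open>u1\<close> appears undifferentiated, so \<open>u2\<close> itself is absent from the
  bound.\<close>

lemma korn_local_smooth:
 fixes u1 u2 :: "real^2 => real"
 assumes p: "lip_bump L p" and u: "smooth u1" "smooth u2"
 defines "E11 \<equiv> pd 1 u1" and "E22 \<equiv> pd 2 u2"
  and "a \<equiv> pd 1 u2" and "b \<equiv> pd 2 u1"
 shows "(LBINT x. (p x)^2*((a x)^2 + (b x)^2))
   \<le> (LBINT x. (p x)^2*(2*(a x + b x)^2 + 2*(E11 x)^2 + 3*(E22 x)^2))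
    + 32*L^2*(LBINT x. indicator {x. p x\<noteq>0} x*(u1 x)^2)"
proof -
 note smp = smooth_partial_derivs[OF u(1)] smooth_partial_derivs[OF u(2)]
 have cont: "continuous_on UNIV u1" "continuous_on UNIV a" "continuous_on UNIV b"
  "continuous_on UNIV E11" "continuous_on UNIV E22"
  unfolding a_def b_def E11_def E22_def by (intro smooth_continuous u smp)+
 note int = lip_bump_integrable[OF p]
 define m where "m = partial_derivs [1,2] u2"
 have m: "partial_derivs [2,1] u2 = m" unfolding m_def using smooth_mixed_partials[OF u(2)] by (intro ext)
 have d1: "dir_C1 (axis 2 1) (%x. u1 x*a x) (%x. b x*a x + u1 x * m x)"
  unfolding a_def b_def m[symmetric]
  using dir_C1_mult[OF smooth_dir_C1_axis[OF u(1)] smooth_dir_C1_axis[OF smp(2)], of 2 "[1]"]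
  by (simp add: partial_derivs_append)
 have d2: "dir_C1 (axis 1 1) (%x. u1 x*E22 x) (%x. E11 x*E22 x + u1 x * m x)"
  unfolding E11_def E22_def m_def
  using dir_C1_mult[OF smooth_dir_C1_axis[OF u(1)] smooth_dir_C1_axis[OF smp(2)], of 1 "[2]"]
  by (simp add: partial_derivs_append)
 have cm: "continuous_on UNIV m" unfolding m_def by (intro smooth_continuous smp)
 have b1: "\<bar>LBINT x. (p x)^2*(b x*a x + u1 x * m x)\<bar>\<le>2*L*(LBINT x. p x*\<bar>u1 x*a x\<bar>)"
  by (rule lip_bump_ibp[OF p d1]) simp
 have b2: "\<bar>LBINT x. (p x)^2*(E11 x*E22 x + u1 x * m x)\<bar>\<le>2*L*(LBINT x. p x*\<bar>u1 x*E22 x\<bar>)"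
  by (rule lip_bump_ibp[OF p d2]) simp
 let ?I = "%f. (LBINT x. f x) :: real"
 define X where "X = ?I (%x. (p x)^2*((a x)^2 + (b x)^2))"
 define Q where "Q = ?I (%x. (p x)^2*((a x + b x)^2 + (E11 x)^2 + (E22 x)^2))"
 define Y where "Y = ?I (%x. indicator {x. p x\<noteq>0} x*(u1 x)^2)"
 define A where "A = ?I (%x. (p x)^2*(a x)^2)"
 define Z where "Z = ?I (%x. (p x)^2*(E22 x)^2)"
 have iA: "integ (%x. (p x)^2*(a x)^2)" "integ (%x. (p x)^2*(E22 x)^2)"
  "integ (%x. indicator {x. p x\<noteq>0} x*(u1 x)^2)"
  by (intro int continuous_intros cont)+
 have yg: "2*(2*L*?I (%x. p x*\<bar>u1 x*g x\<bar>))\<le>?I (%x. (p x)^2*(g x)^2)/2 + 8*(L^2*Y)"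
  if cg: "continuous_on UNIV g" for g
 proof -
  have ig: "integ (%x. (p x)^2*(g x)^2)" by (intro int continuous_intros cg)
  have "2*(2*L*?I (%x. p x*\<bar>u1 x*g x\<bar>)) = ?I (%x. 4*L*(p x*\<bar>u1 x*g x\<bar>))" by simp
  also have "...\<le>?I (%x. ((p x)^2*(g x)^2)/2 + 8*L^2*(indicator {x. p x\<noteq>0} x*(u1 x)^2))"
  proof (rule integral_mono)
   show "integ (%x. 4*L*(p x*\<bar>u1 x*g x\<bar>))" by (intro integrable_mult_right int continuous_intros cont cg)
   show "integ (%x. ((p x)^2*(g x)^2)/2 + 8*L^2*(indicator {x. p x\<noteq>0} x*(u1 x)^2))"
    by (intro Bochner_Integration.integrable_add integrable_divide integrable_mult_right ig iA)
   fix x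
   have "2*(2*L)*\<bar>u1 x\<bar>*\<bar>p x*g x\<bar>\<le>(p x*g x)^2/2 + 2*(2*L)^2*(u1 x)^2"
    by (rule young_weighted)
   then show "4*L*(p x*\<bar>u1 x*g x\<bar>)\<le>((p x)^2*(g x)^2)/2 + 8*L^2*(indicator {x. p x\<noteq>0} x*(u1 x)^2)"
    using lip_bumpD(2)[OF p, of x] by (cases "p x = 0") (auto simp: abs_mult mult_ac power_mult_distrib)
  qed
  also have "... = ?I (%x. (p x)^2*(g x)^2)/2 + 8*(L^2*Y)"
   unfolding Y_def using ig iA by (subst Bochner_Integration.integral_add) auto
  finally show ?thesis .
 qed
 have iQ: "integ (%x. (p x)^2*((a x + b x)^2 + (E11 x)^2 + (E22 x)^2))"
  by (intro int continuous_intros cont)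
 have iX: "integ (%x. (p x)^2*((a x)^2 + (b x)^2))"
  by (intro int continuous_intros cont)
 have i1: "integ (%x. (p x)^2*(b x*a x + u1 x * m x))"
  by (intro int continuous_intros cont cm)
 have i2: "integ (%x. (p x)^2*(E11 x*E22 x + u1 x * m x))"
  by (intro int continuous_intros cont cm)
 have "X\<le>?I (%x. (p x)^2*((a x + b x)^2 + (E11 x)^2 + (E22 x)^2)
   - 2*((p x)^2*(b x*a x + u1 x * m x)) + 2*((p x)^2*(E11 x*E22 x + u1 x * m x)))"
  unfolding X_def
 proof (rule integral_mono)
  show "integ (%x. (p x)^2*((a x + b x)^2 + (E11 x)^2 + (E22 x)^2)
   - 2*((p x)^2*(b x*a x + u1 x * m x)) + 2*((p x)^2*(E11 x*E22 x + u1 x * m x)))"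
   by (intro Bochner_Integration.integrable_add Bochner_Integration.integrable_diff integrable_mult_right iQ i1 i2)
  fix x
  \<comment> \<open>The terms with \<open>m\<close> cancel in the next inequality, and what remains
    is this square.\<close>
  have "0\<le>(E11 x + E22 x)^2" by simp
  then have "(a x)^2 + (b x)^2\<le>(a x + b x)^2 + (E11 x)^2 + (E22 x)^2 - 2*(b x*a x + u1 x * m x) + 2*(E11 x*E22 x + u1 x * m x)"
   by (simp add: power2_eq_square algebra_simps)
  from mult_left_mono[OF this, of "(p x)^2"]
  show "(p x)^2*((a x)^2 + (b x)^2)\<le>(p x)^2*((a x + b x)^2 + (E11 x)^2 + (E22 x)^2)
   - 2*((p x)^2*(b x*a x + u1 x * m x)) + 2*((p x)^2*(E11 x*E22 x + u1 x * m x))"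
   by (simp add: algebra_simps)
 qed (rule iX)
 also have "... = Q - 2*?I (%x. (p x)^2*(b x*a x + u1 x * m x)) + 2*?I (%x. (p x)^2*(E11 x*E22 x + u1 x * m x))"
  unfolding Q_def
  by (subst Bochner_Integration.integral_add Bochner_Integration.integral_diff;
    (intro Bochner_Integration.integrable_diff integrable_mult_right iQ i1 i2)?)+ simp
 also have "...\<le>Q + (A/2 + 8*(L^2*Y)) + (Z/2 + 8*(L^2*Y))"
  using b1 b2 yg[OF cont(2)] yg[OF cont(5)] unfolding A_def Z_def by linarith
 finally have "X\<le>Q + A/2 + Z/2 + 16*(L^2*Y)" by linarith
 moreover have "A\<le>X" unfolding A_def X_def
  by (rule integral_mono[OF iA(1) iX]) (simp add: distrib_left)
 ultimately have "X\<le>(2*Q + Z) + 32*(L^2*Y)" by linarith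
 also have "2*Q + Z = ?I (%x. 2*((p x)^2*((a x + b x)^2 + (E11 x)^2 + (E22 x)^2)) + (p x)^2*(E22 x)^2)"
  unfolding Q_def Z_def using iQ iA by (subst Bochner_Integration.integral_add) auto
 also have "... = ?I (%x. (p x)^2*(2*(a x + b x)^2 + 2*(E11 x)^2 + 3*(E22 x)^2))"
  by (rule Bochner_Integration.integral_cong) (auto simp: algebra_simps)
 finally show ?thesis unfolding X_def Y_def by (simp only: mult.assoc)
qed

text \<open>Along \<open>v\<close> the function \<open>g\<close> has slope 1 where it is positive,
  so \<open>q^2\<close> there is the derivative of \<open>g*q^2\<close> up to a term with the
  derivative of \<open>q\<close>. Integration by parts moves the derivative to \<open>h^2\<close>,
  and Young's inequality absorbs half of the left side, which doubles both constants.\<close>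

lemma hardy_smooth:
 fixes h :: "'a::euclidean_space => real"
 assumes q: "lip_bump L q" and h: "dir_C1 v h h'" and v: "norm v\<le>1"
  and \<rho>: "continuous_on UNIV \<rho>" "\<And>x t. t\<ge>0 ==> \<rho> (x + t *\<^sub>R v) = \<rho> x + t"
 defines "g \<equiv> %x. max 0 (\<rho> x)"
 shows "(LBINT x. indicator {x. \<rho> x > 0} x*((q x)^2*(h x)^2))
  \<le> 4*L*(LBINT x. g x*q x*(h x)^2) + 4*(LBINT x. (g x*q x)^2*(h' x)^2)"
proof -
 obtain r B where r: "r > 0" "B\<ge>0" "\<And>x. q x\<noteq>0 ==> norm x\<le>r" "\<And>x. q x\<le>B"
  using lip_bump_bounds[OF q] by blast
 note qD = lip_bumpD[OF q]
 have cg: "continuous_on UNIV g" unfolding g_def by (intro continuous_intros \<rho>)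
 have ch: "continuous_on UNIV h" "continuous_on UNIV h'" using h by (auto simp: dir_C1_def)
 note [measurable] = qD(5) borel_measurable_continuous_onI[OF cg] borel_measurable_continuous_onI[OF \<rho>(1)]
  borel_measurable_continuous_onI[OF ch(1)] borel_measurable_continuous_onI[OF ch(2)]
 have g0: "g x\<ge>0" for x by (simp add: g_def)
 note int = lip_bump_integrable[OF q]
 obtain BG where BG: "BG\<ge>0" "\<And>x. norm x\<le>r + 1 ==> \<bar>(h x)^2\<bar>\<le>BG"
  using continuous_bounded_on_cball[of "%x. (h x)^2" "r + 1"] ch by (auto intro: continuous_intros)
 obtain BP where BP: "BP\<ge>0" "\<And>x. norm x\<le>r + 1 ==> \<bar>g x\<bar>\<le>BP"
  using continuous_bounded_on_cball[OF cg] by blast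
 define s where "s n = 1/real (Suc n)" for n
 have s0: "0 < s n" "s n\<le>1" for n by (simp_all add: s_def)
 have sl: "s---->0" unfolding s_def by (rule LIMSEQ_Suc[OF lim_1_over_n])
 define w where "w x = g x*(q x)^2" for x
 have lim1: "(%n. LBINT x. (w (x + s n *\<^sub>R v) - w x)/s n*(h x)^2)---->- (LBINT x. w x*(2*(h x*h' x)))"
  unfolding s_def
  by (rule difference_quotient_by_parts[of w r])
    (use r dir_C1_power2[OF h] in \<open>auto simp: w_def[abs_def] intro!: continuous_intros qD cg\<close>)
 \<comment> \<open>A pointwise lower bound for the quotient of \<open>w\<close> times
   \<open>h^2\<close>: one step increases \<open>g\<close> by at least its length where
   \<open>\<rho>\<close> is positive, and the change of \<open>q^2\<close> is at most
   \<open>L\<close> times the step times the sum of the two values of \<open>q\<close>.\<close>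
 define R where "R n x = (indicator {x. \<rho> x > 0} x*(q (x + s n *\<^sub>R v))^2 - L*(g x*(q (x + s n *\<^sub>R v) + q x)))*(h x)^2" for n x
 define R0 where "R0 x = (indicator {x. \<rho> x > 0} x*(q x)^2 - L*(g x*(q x + q x)))*(h x)^2" for x
 have near: "norm x\<le>r + 1" if "q (x + s n *\<^sub>R v)\<noteq>0\<or>q x\<noteq>0" for x n
 proof -
  have "norm (s n *\<^sub>R v)\<le>1*1" unfolding norm_scaleR using s0[of n] v by (intro mult_mono) auto
  moreover have "norm x\<le>norm (x + s n *\<^sub>R v) + norm (s n *\<^sub>R v)"
   using norm_triangle_ineq4[of "x + s n *\<^sub>R v" "s n *\<^sub>R v"] by simp
  ultimately show ?thesis using that r(3)[of x] r(3)[of "x + s n *\<^sub>R v"] by auto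
 qed
 have Rb: "\<bar>R n x\<bar>\<le>(B^2 + L*(BP*(B + B)))*BG" for n x
 proof (cases "q (x + s n *\<^sub>R v)\<noteq>0\<or>q x\<noteq>0")
  case True
  let ?p = "q (x + s n *\<^sub>R v)"
  have 1: "0\<le>?p" "?p\<le>B" "0\<le>q x" "q x\<le>B" using qD(2) r(4) by auto
  have 2: "0\<le>g x*(?p + q x)" "g x*(?p + q x)\<le>BP*(B + B)"
   using 1 g0[of x] BP(2)[OF near[OF True]] BP(1) by (auto intro!: mult_nonneg_nonneg mult_mono)
  have 3: "0\<le>indicator {x. \<rho> x > 0} x*?p^2" "indicator {x. \<rho> x > 0} x*?p^2\<le>B^2"
   using power_mono[OF 1(2,1), of 2] by (auto simp: indicator_def)
  have "\<bar>indicator {x. \<rho> x > 0} x*?p^2 - L*(g x*(?p + q x))\<bar>\<le>B^2 + L*(BP*(B + B))"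
   using 3 mult_left_mono[OF 2(2) qD(1)] mult_nonneg_nonneg[OF qD(1) 2(1)] zero_le_power2[of B]
   unfolding abs_le_iff by linarith
  then show ?thesis unfolding R_def abs_mult using BG(2)[OF near[OF True]]
   by (intro mult_mono) auto
 next
  case False
  then show ?thesis using qD(1) r BP BG by (simp add: R_def)
 qed
 have ql: "(%n. q (x + s n *\<^sub>R v))---->q x" for x
 proof -
  have "(%n. x + s n *\<^sub>R v)---->x + 0 *\<^sub>R v" by (intro tendsto_intros sl)
  from continuous_on_UNIV_LIMSEQ[OF qD(4) this] show ?thesis by simp
 qed
 have Rn: "norm x\<le>r + 1" if "R n x\<noteq>0" for n x
  using that by (intro near[where n = n]) (auto simp: R_def)
 have Rm: "R n\<in>bmeas" for n unfolding R_def by measurable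
 have lim2: "(%n. LBINT x. R n x)---->(LBINT x. R0 x)"
 proof (rule tendsto_integral_bounded_support[OF Rm _ Rb Rn])
  show "(%n. R n x)---->R0 x" for x unfolding R_def R0_def by (intro tendsto_intros ql)
 qed (auto simp: R0_def)
 have "(LBINT x. R0 x)\<le>- (LBINT x. w x*(2*(h x*h' x)))"
 proof (rule LIMSEQ_le[OF lim2 lim1], intro exI[of _ 0] allI impI)
  fix n
  have pt: "R n x\<le>(w (x + s n *\<^sub>R v) - w x)/s n*(h x)^2" for x
  proof -
   let ?p = "q (x + s n *\<^sub>R v)"
   have "\<bar>?p - q x\<bar>\<le>L*norm (s n *\<^sub>R v)"
    using qD(3)[of "x + s n *\<^sub>R v" x] by simp
   also have "...\<le>L * s n" using qD(1) s0[of n] v by (intro mult_left_mono) (auto simp: mult_left_le)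
   finally have "\<bar>?p - q x\<bar>*(?p + q x)\<le>L * s n*(?p + q x)"
    using qD(2) by (intro mult_right_mono) (auto intro: add_nonneg_nonneg)
   moreover have "?p^2 - (q x)^2 = (?p - q x)*(?p + q x)" by (simp add: power2_eq_square algebra_simps)
   moreover have "- (\<bar>?p - q x\<bar>*(?p + q x))\<le>(?p - q x)*(?p + q x)"
   proof -
    have "- \<bar>?p - q x\<bar>*(?p + q x)\<le>(?p - q x)*(?p + q x)"
     using qD(2) by (intro mult_right_mono) (auto intro: add_nonneg_nonneg)
    then show ?thesis by simp
   qed
   ultimately have "- (L * s n*(?p + q x))\<le>?p^2 - (q x)^2" by linarith
   from mult_left_mono[OF this g0[of x]]
   have 1: "g x*(?p^2 - (q x)^2)\<ge>- s n*(L*(g x*(?p + q x)))" by (simp add: mult_ac)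
   have "g (x + s n *\<^sub>R v) - g x\<ge>indicator {x. \<rho> x > 0} x * s n"
    using \<rho>(2)[of "s n" x] s0[of n] by (auto simp: g_def indicator_def)
   from mult_right_mono[OF this, of "?p^2"]
   have 2: "(g (x + s n *\<^sub>R v) - g x)*?p^2\<ge>s n*(indicator {x. \<rho> x > 0} x*?p^2)" by (simp add: mult_ac)
   have "w (x + s n *\<^sub>R v) - w x = (g (x + s n *\<^sub>R v) - g x)*?p^2 + g x*(?p^2 - (q x)^2)"
    by (simp add: w_def algebra_simps)
   also have "...\<ge>s n*(indicator {x. \<rho> x > 0} x*?p^2) + (- s n)*(L*(g x*(?p + q x)))"
    using 1 2 by (intro add_mono)
   finally have "(indicator {x. \<rho> x > 0} x*?p^2 - L*(g x*(?p + q x)))\<le>(w (x + s n *\<^sub>R v) - w x)/s n"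
    unfolding pos_le_divide_eq[OF s0(1)] by (simp add: left_diff_distrib mult.commute[of "s n"])
   then show ?thesis unfolding R_def by (rule mult_right_mono) simp
  qed
  have iR: "integ (R n)"
   by (rule integrable_bounded_support[OF Rm Rb Rn])
  have iw: "integ (%x. (w (x + s n *\<^sub>R v) - w x)/s n*(h x)^2)"
  proof -
   have cw: "continuous_on UNIV w" unfolding w_def by (intro continuous_intros cg qD)
   have cws: "continuous_on UNIV (%x. w (x + s n *\<^sub>R v))"
    by (rule continuous_on_compose2[OF cw]) (auto intro!: continuous_intros)
   have cF: "continuous_on UNIV (%x. (w (x + s n *\<^sub>R v) - w x)/s n*(h x)^2)"
    using s0(1)[of n] by (intro continuous_intros cw cws ch) auto
   have sF: "norm x\<le>r + 1" if "(w (x + s n *\<^sub>R v) - w x)/s n*(h x)^2\<noteq>0" for x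
    using that by (intro near[where n = n]) (auto simp: w_def)
   obtain W where "W\<ge>0" "\<And>x. norm x\<le>r + 1 ==> \<bar>(w (x + s n *\<^sub>R v) - w x)/s n*(h x)^2\<bar>\<le>W"
    using continuous_bounded_on_cball[OF cF] by blast
   then show ?thesis
    using sF by (intro integrable_bounded_support[OF borel_measurable_continuous_onI[OF cF], of W "r + 1"]) force+
  qed
  show "(LBINT x. R n x)\<le>(LBINT x. (w (x + s n *\<^sub>R v) - w x)/s n*(h x)^2)"
   by (rule integral_mono[OF iR iw pt])
 qed
 note main = this
 let ?I = "%f. (LBINT x. f x) :: real"
 define X where "X = ?I (%x. indicator {x. \<rho> x > 0} x*((q x)^2*(h x)^2))"
 define Y where "Y = ?I (%x. g x*q x*(h x)^2)"
 define Z where "Z = ?I (%x. (g x*q x)^2*(h' x)^2)"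
 have iX: "integ (%x. indicator {x. \<rho> x > 0} x*((q x)^2*(h x)^2))"
  by (rule Bochner_Integration.integrable_bound[OF int(2), of "%x. (h x)^2"])
    (auto intro!: continuous_intros ch simp: indicator_def)
 have iY: "integ (%x. g x*q x*(h x)^2)"
  using int(1)[of "%x. g x*(h x)^2"] cg ch by (simp add: mult_ac continuous_intros)
 have iZ: "integ (%x. (g x*q x)^2*(h' x)^2)"
  using int(2)[of "%x. (g x)^2*(h' x)^2"] cg ch by (simp add: mult_ac continuous_intros power_mult_distrib)
 have iW: "integ (%x. w x*(2*(h x*h' x)))"
  using int(2)[of "%x. g x*(2*(h x*h' x))"] cg ch by (simp add: w_def mult_ac continuous_intros)
 have "?I R0 = ?I (%x. indicator {x. \<rho> x > 0} x*((q x)^2*(h x)^2) - 2*L*(g x*q x*(h x)^2))"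
  by (rule Bochner_Integration.integral_cong) (auto simp: R0_def algebra_simps)
 also have "... = X - 2*L*Y" unfolding X_def Y_def using iX iY by (subst Bochner_Integration.integral_diff) auto
 finally have X: "X\<le>2*(L*Y) + - ?I (%x. w x*(2*(h x*h' x)))" using main by simp
 have "- ?I (%x. w x*(2*(h x*h' x)))\<le>?I (%x. (indicator {x. \<rho> x > 0} x*((q x)^2*(h x)^2))/2 + 2*((g x*q x)^2*(h' x)^2))"
  unfolding Bochner_Integration.integral_minus[symmetric]
 proof (rule integral_mono)
  show "integ (%x. - (w x*(2*(h x*h' x))))" using iW by simp
  show "integ (%x. (indicator {x. \<rho> x > 0} x*((q x)^2*(h x)^2))/2 + 2*((g x*q x)^2*(h' x)^2))"
   by (intro Bochner_Integration.integrable_add integrable_divide integrable_mult_right iX iZ)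
  fix x
  show "- (w x*(2*(h x*h' x)))\<le>(indicator {x. \<rho> x > 0} x*((q x)^2*(h x)^2))/2 + 2*((g x*q x)^2*(h' x)^2)"
  proof (cases "\<rho> x > 0")
   case True
   have "0\<le>(q x*h x + 2*(g x*q x*h' x))^2" by simp
   then show ?thesis using True by (simp add: w_def power2_eq_square algebra_simps)
  next
   case False
   then have "g x = 0" by (simp add: g_def)
   then show ?thesis by (simp add: w_def)
  qed
 qed
 also have "... = X/2 + 2*Z" unfolding X_def Z_def using iX iZ by (subst Bochner_Integration.integral_add) auto
 finally have "X\<le>4*(L*Y) + 4*Z" using X by linarith
 then show ?thesis unfolding X_def Y_def Z_def by (simp only: mult.assoc)
qed

section \<open>Weak derivatives on a bounded domain\<close>

text \<open>Vanishing outside \<open>G\<close> is required at every point, not almost everywhere.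
  The functions can then be convolved and integrated on the whole space, and on a bounded
  \<open>G\<close> they are integrable.\<close>

definition L2z :: "'a::euclidean_space set => ('a => real) set" where
 "L2z G = {u\<in>sqi. \<forall>x. x\<notin>G --> u x = 0}"

lemma L2zD: "u\<in>L2z G ==> u\<in>sqi" "u\<in>L2z G ==> x\<notin>G ==> u x = 0"
 "u\<in>L2z G ==> u\<in>bmeas"
 by (auto simp: L2z_def dest: sq_int_measurable)

lemma L2z_add: "u\<in>L2z G ==> v\<in>L2z G ==> (%x. u x + v x)\<in>L2z G"
 by (auto simp: L2z_def sq_int_add)

lemma L2z_diff: "u\<in>L2z G ==> v\<in>L2z G ==> (%x. u x - v x)\<in>L2z G"
 by (auto simp: L2z_def sq_int_diff)

lemma L2z_cmult: "u\<in>L2z G ==> (%x. c*u x)\<in>L2z G"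
 by (auto simp: L2z_def sq_int_cmult)

lemma L2z_zero: "(%x. 0)\<in>L2z G"
 by (auto simp: L2z_def)

lemma L2z_integrable:
 assumes "bounded G" "u\<in>L2z G"
 shows "integ u"
proof -
 obtain r where r: "\<And>x. x\<in>G ==> norm x\<le>r" using assms(1) unfolding bounded_iff by auto
 have [measurable]: "cball (0::'a) r\<in>sets borel" by (rule borel_closed) simp
 have 1: "indicator (cball 0 r)\<in>sq_int (lborel :: 'a measure)"
  by (rule sq_int_bounded_support[of _ 1 r]) (auto simp: indicator_def split: if_splits)
 have "integ (%x. u x*indicator (cball 0 r) x)"
  by (rule sq_int_mult_integrable[OF L2zD(1)[OF assms(2)] 1])
 moreover have "u x*indicator (cball 0 r) x = u x" for x
  using L2zD(2)[OF assms(2), of x] r[of x] by (cases "x\<in>G") auto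
 ultimately show ?thesis by simp
qed

text \<open>Test functions are supported inside \<open>G\<close>, so the extension by 0 creates no
  boundary term: the relation concerns the derivative in \<open>G\<close> only and ignores the jump
  across the boundary.\<close>

definition wderiv :: "(real^2) set => 2 => (real^2 => real) => (real^2 => real) => bool" where
 "wderiv G i u v \<longleftrightarrow> u\<in>L2z G\<and>v\<in>L2z G \<and>
   (\<forall>p\<in>test_functions G. (LBINT x. u x*pd i p x) = - (LBINT x. v x*p x))"

lemma translated_kernel:
 fixes K :: "real^'n::finite => real"
 assumes K: "K\<in>test_functions UNIV" and supp: "\<forall>z. K z\<noteq>0 --> norm z\<le>e" and x: "cball x e\<subseteq>G"
 shows "(%y. K (x - y))\<in>test_functions G"
  "pd i (%y. K (x - y)) = (%y. - pd i K (x - y))"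
proof -
 have sm: "smooth K" using K by (simp add: test_functions_iff)
 have "smooth (%y. K (x + (-1) *\<^sub>R y))" by (rule smooth_affine[OF sm])
 then show "(%y. K (x - y))\<in>test_functions G"
  by (intro test_functionsI[of _ "cball x e"]) (use x supp in \<open>auto simp: dist_norm\<close>)
 show "pd i (%y. K (x - y)) = (%y. - pd i K (x - y))"
  using partial_derivs_affine[OF sm, of "[i]" x "-1"] by simp
qed

text \<open>Convolution with the derivative of a kernel is testing with the translated and reflected
  kernel, an admissible test function exactly because the ball around \<open>x\<close> stays in
  \<open>G\<close>.\<close>

lemma wderiv_conv:
 assumes w: "wderiv G i u v" and K: "K\<in>test_functions UNIV" "\<forall>z. K z\<noteq>0 --> norm z\<le>e" "cball x e\<subseteq>G"
 shows "conv u (pd i K) x = conv v K x"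
proof -
 note t = translated_kernel[OF K]
 have "(LBINT y. u y*pd i (%y. K (x - y)) y) = - (LBINT y. v y*K (x - y))"
  using w t(1) unfolding wderiv_def by blast
 then show ?thesis by (simp only: t(2) conv_def) simp
qed

section \<open>A fixed mollifying sequence and limits of weighted integrals\<close>

definition molseq :: "nat => real^'n::finite => real" where
 "molseq n = (SOME b. mollifier (1/Suc n) b)"

lemma mollifier_molseq: "mollifier (1/Suc n) (molseq n)"
 unfolding molseq_def by (rule someI_ex[OF mollifier_exists]) simp

abbreviation mol :: "(real^'n::finite => real) => nat => real^'n => real" where
 "mol u n \<equiv> conv u (molseq n)"

lemma molseq_test: "molseq n\<in>test_functions UNIV"
 by (rule mollifierD(1)[OF mollifier_molseq])

lemma molseq_support: "molseq n z\<noteq>0 ==> norm z\<le>1/Suc n"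
 using mollifierD(3)[OF mollifier_molseq, of n z] by force

lemma partial_molseq_support: "partial_derivs as (molseq n) z\<noteq>0 ==> norm z\<le>1/Suc n"
proof -
 assume "partial_derivs as (molseq n) z\<noteq>0"
 then have "z\<in>closure {y. molseq n y\<noteq>0}" using support_partial_derivs[of as "molseq n"] by blast
 also have "...\<subseteq>cball 0 (1/Suc n)"
  by (intro closure_minimal) (use molseq_support in \<open>auto\<close>)
 finally show ?thesis by simp
qed

lemma compact_cball_margin:
 fixes G :: "'a::euclidean_space set"
 assumes "open G" "compact K" "K\<subseteq>G"
 obtains N where "\<And>n x. n\<ge>N ==> x\<in>K ==> cball x (1/real (Suc n))\<subseteq>G"
proof -
 have "closed (- G)" "K\<inter>- G = {}" using assms by auto
 from separate_compact_closed[OF assms(2) this]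
 obtain d where d: "d > 0" "\<And>x y. x\<in>K ==> y\<in>- G ==> d\<le>dist x y" by blast
 obtain N where N: "1/real (Suc N) < d" using d(1) nat_approx_posE by blast
 show ?thesis
 proof (rule that, rule subsetI, rule ccontr)
  fix n x y assume "n\<ge>N" "x\<in>K" "y\<in>cball x (1/real (Suc n))" "y\<notin>G"
  then have "d\<le>1/real (Suc n)" using d(2)[of x y] by simp
  also have "...\<le>1/real (Suc N)" using \<open>n \<ge> N\<close> by (simp add: frac_le)
  finally show False using N by simp
 qed
qed

lemma mol_smooth: "integ u ==> smooth (mol u n)"
 by (rule smooth_conv[OF _ molseq_test])

lemma partial_derivs_mol: "integ u ==> partial_derivs as (mol u n) = conv u (partial_derivs as (molseq n))"
 by (rule partial_derivs_conv[OF _ molseq_test])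

lemma wderiv_mol:
 assumes "bounded G" "wderiv G i u v" "cball x (1/real (Suc n))\<subseteq>G"
 shows "pd i (mol u n) x = mol v n x"
proof -
 have "integ u" using assms(1,2) L2z_integrable by (auto simp: wderiv_def)
 then show ?thesis
  using wderiv_conv[OF assms(2) molseq_test _ assms(3)] molseq_support by (simp only: partial_derivs_mol) blast
qed

lemma mol_tendsto:
 assumes "bounded G" "u\<in>L2z G"
 shows "(%n. nrm (%x. mol u n x - u x))---->0"
proof (rule LIMSEQ_I)
 fix e :: real assume e: "e > 0"
 obtain d where d: "d > 0" "\<And>t b. t\<le>d ==> mollifier t b ==> nrm (%x. conv u b x - u x)\<le>e/2"
  using conv_mollifier_tendsto[OF L2z_integrable[OF assms] L2zD(1)[OF assms(2)], of "e/2"] e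
  by (metis half_gt_zero)
 obtain N where N: "1/real (Suc N) < d" using d(1) nat_approx_posE by blast
 have "norm (nrm (%x. mol u n x - u x) - 0) < e" if "n\<ge>N" for n
 proof -
  have "1/real (Suc n)\<le>1/real (Suc N)" using that by (simp add: frac_le)
  then have "nrm (%x. mol u n x - u x)\<le>e/2" using N by (intro d(2)[OF _ mollifier_molseq]) linarith
  then show ?thesis using e by simp
 qed
 then show "\<exists>N. \<forall>n\<ge>N. norm (nrm (%x. mol u n x - u x) - 0) < e" by blast
qed

lemma mol_sq_int:
 assumes "bounded G" "u\<in>L2z G"
 shows "mol u n\<in>sqi" "nrm (mol u n)\<le>nrm u"
 using conv_contraction[OF L2z_integrable[OF assms] L2zD(1)[OF assms(2)] mollifier_molseq] by auto

lemma ltwo_tendsto_inner2: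
 assumes "f\<in>sq_int M" "\<And>n. s n\<in>sq_int M" "(%n. ltwo M (%x. s n x - f x))---->0"
  and "g\<in>sq_int M" "\<And>n. t n\<in>sq_int M" "(%n. ltwo M (%x. t n x - g x))---->0"
 shows "(%n. \<integral>x. s n x*t n x \<partial>M)---->(\<integral>x. f x*g x \<partial>M)"
proof -
 have 1: "(%n. \<integral>x. s n x*g x \<partial>M)---->(\<integral>x. f x*g x \<partial>M)"
  by (rule ltwo_tendsto_inner[OF assms(1-4)])
 have 2: "(%n. (\<integral>x. s n x*t n x \<partial>M) - (\<integral>x. s n x*g x \<partial>M))---->0"
 proof (rule Lim_null_comparison[OF always_eventually, rule_format])
  fix n
  have "(\<integral>x. s n x*t n x \<partial>M) - (\<integral>x. s n x*g x \<partial>M) = (\<integral>x. s n x*(t n x - g x) \<partial>M)"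
   using sq_int_mult_integrable[OF assms(2)[of n] assms(5)[of n]] sq_int_mult_integrable[OF assms(2)[of n] assms(4)]
   by (simp add: right_diff_distrib)
  then show "norm ((\<integral>x. s n x*t n x \<partial>M) - (\<integral>x. s n x*g x \<partial>M))\<le>ltwo M (s n)*ltwo M (%x. t n x - g x)"
   using ltwo_CS[OF assms(2)[of n] sq_int_diff[OF assms(5)[of n] assms(4)]] by simp
 next
  show "(%n. ltwo M (s n)*ltwo M (%x. t n x - g x))---->0"
   using tendsto_mult[OF ltwo_tendsto_norm[OF assms(1-3)] assms(6)] by simp
 qed
 show ?thesis using tendsto_add[OF 2 1] by simp
qed

lemma ltwo_tendsto_weighted:
 assumes "f\<in>sq_int M" "\<And>n. s n\<in>sq_int M" "(%n. ltwo M (%x. s n x - f x))---->0"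
  and w: "w\<in>borel_measurable M" "\<And>x. \<bar>w x\<bar>\<le>C"
 shows "(%n. \<integral>x. w x*(s n x)^2 \<partial>M)---->(\<integral>x. w x*(f x)^2 \<partial>M)"
proof -
 have sq: "(%x. w x*f x)\<in>sq_int M" "\<And>n. (%x. w x * s n x)\<in>sq_int M"
  by (rule sq_int_bounded_mult[OF assms(1) w] sq_int_bounded_mult[OF assms(2) w])+
 have "(%n. ltwo M (%x. w x * s n x - w x*f x))---->0"
 proof (rule Lim_null_comparison[OF always_eventually, rule_format])
  fix n
  have "ltwo M (%x. w x * s n x - w x*f x)\<le>ltwo M (%x. C*(s n x - f x))"
  proof (rule ltwo_mono_AE)
   show "(%x. w x * s n x - w x*f x)\<in>borel_measurable M"
    by (rule sq_int_measurable[OF sq_int_diff[OF sq(2) sq(1)]])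
   show "(%x. C*(s n x - f x))\<in>sq_int M" by (intro sq_int_cmult sq_int_diff assms)
   have "\<bar>w x * s n x - w x*f x\<bar>\<le>\<bar>C*(s n x - f x)\<bar>" for x
    unfolding right_diff_distrib[symmetric] abs_mult using w(2)[of x] by (intro mult_right_mono) auto
   then show "AE x in M. \<bar>w x * s n x - w x*f x\<bar>\<le>\<bar>C*(s n x - f x)\<bar>" by simp
  qed
  also have "... = \<bar>C\<bar>*ltwo M (%x. s n x - f x)" by (rule ltwo_cmult)
  finally show "norm (ltwo M (%x. w x * s n x - w x*f x))\<le>\<bar>C\<bar>*ltwo M (%x. s n x - f x)" by simp
 next
  show "(%n. \<bar>C\<bar>*ltwo M (%x. s n x - f x))---->0" using tendsto_mult_right_zero[OF assms(3)] .
 qed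
 from ltwo_tendsto_inner2[OF assms(1-3) sq(1) sq(2) this] show ?thesis
  by (simp add: power2_eq_square mult_ac)
qed

lemma ltwo_tendsto_add:
 assumes "f\<in>sq_int M" "\<And>n. s n\<in>sq_int M" "(%n. ltwo M (%x. s n x - f x))---->0"
  and "g\<in>sq_int M" "\<And>n. t n\<in>sq_int M" "(%n. ltwo M (%x. t n x - g x))---->0"
 shows "(%n. ltwo M (%x. (a * s n x + b*t n x) - (a*f x + b*g x)))---->0"
proof (rule Lim_null_comparison[OF always_eventually, rule_format])
 fix n
 have "ltwo M (%x. a*(s n x - f x) + b*(t n x - g x))\<le>ltwo M (%x. a*(s n x - f x)) + ltwo M (%x. b*(t n x - g x))"
  by (intro ltwo_triangle sq_int_cmult sq_int_diff assms)
 moreover have "(%x. a*(s n x - f x) + b*(t n x - g x)) = (%x. (a * s n x + b*t n x) - (a*f x + b*g x))"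
  by (simp add: algebra_simps)
 ultimately show "norm (ltwo M (%x. (a * s n x + b*t n x) - (a*f x + b*g x)))
   \<le> \<bar>a\<bar>*ltwo M (%x. s n x - f x) + \<bar>b\<bar>*ltwo M (%x. t n x - g x)"
  by (simp add: ltwo_cmult)
next
 have "(%n. \<bar>a\<bar>*ltwo M (%x. s n x - f x) + \<bar>b\<bar>*ltwo M (%x. t n x - g x))---->\<bar>a\<bar>*0 + \<bar>b\<bar>*0"
  by (intro tendsto_intros assms)
 then show "(%n. \<bar>a\<bar>*ltwo M (%x. s n x - f x) + \<bar>b\<bar>*ltwo M (%x. t n x - g x))---->0" by simp
qed

section \<open>Local estimates\<close>

lemma sq_int_weighted_integrable:
 assumes "f\<in>sq_int M" "w\<in>borel_measurable M" "\<And>x. \<bar>w x\<bar>\<le>C"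
 shows "integrable M (%x. w x*(f x)^2)"
 using sq_int_mult_integrable[OF assms(1) sq_int_bounded_mult[OF assms]]
 by (simp add: power2_eq_square mult_ac)

lemma lip_bump_sq_bound:
 assumes "lip_bump L p"
 obtains C where "\<And>x. \<bar>(p x)^2\<bar>\<le>C"
proof -
 obtain r B where "\<And>x. p x\<le>B" using lip_bump_bounds[OF assms] by metis
 then have "\<bar>(p x)^2\<bar>\<le>B^2" for x using power_mono[of "p x" B 2] lip_bumpD(2)[OF assms, of x] by simp
 then show ?thesis using that by blast
qed

text \<open>The support of \<open>p\<close> is a compact subset of \<open>G\<close>, so for fine
  mollifiers the smooth inequality holds with the mollified weak derivatives in place of the
  derivatives; the weighted integrals converge.\<close>

lemma korn_local:
 assumes G: "open G" "bounded G" and p: "lip_bump L p" and supp: "closure {x. p x\<noteq>0}\<subseteq>G"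
  and w: "wderiv G 1 u1 e1" "wderiv G 2 u1 b" "wderiv G 1 u2 a" "wderiv G 2 u2 e2"
 shows "(LBINT x. (p x)^2*(a x)^2) + (LBINT x. (p x)^2*(b x)^2)
   \<le> 2*(LBINT x. (p x)^2*(a x + b x)^2) + 2*(LBINT x. (p x)^2*(e1 x)^2)
   + 3*(LBINT x. (p x)^2*(e2 x)^2) + 32*L^2*(nrm u1)^2"
proof -
 have z: "u1\<in>L2z G" "u2\<in>L2z G" "a\<in>L2z G" "b\<in>L2z G" "e1\<in>L2z G" "e2\<in>L2z G"
  using w by (auto simp: wderiv_def)
 note sq = z[THEN L2zD(1)]
 note iu = L2z_integrable[OF G(2)]
 obtain C where C: "\<And>x. \<bar>(p x)^2\<bar>\<le>C" using lip_bump_sq_bound[OF p] by blast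
 have mp [measurable]: "p\<in>bmeas" by (rule lip_bumpD(5)[OF p])
 have m2: "(%x. (p x)^2)\<in>borel_measurable lborel" by measurable
 have cpt: "compact (closure {x. p x\<noteq>0})" using p by (simp add: lip_bump_def)
 obtain N where N: "\<And>n x. n\<ge>N ==> x\<in>closure {x. p x\<noteq>0} ==> cball x (1/real (Suc n))\<subseteq>G"
  using compact_cball_margin[OF G(1) cpt supp] by blast
 let ?I = "%f. (LBINT x. (p x)^2*(f x)^2) :: real"
 have ii: "integ (%x. (p x)^2*(f x)^2)" if "f\<in>sqi" for f
  by (rule sq_int_weighted_integrable[OF that m2 C])
 note ms = mol_sq_int(1)[OF G(2)]
 have lim: "(%n. ?I (mol f n))---->?I f" if "f\<in>L2z G" for f
  by (rule ltwo_tendsto_weighted[OF L2zD(1)[OF that] ms[OF that] mol_tendsto[OF G(2) that] m2 C])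
 have sab: "(%n. nrm (%x. (1 * mol a n x + 1 * mol b n x) - (1*a x + 1*b x)))---->0"
  by (intro ltwo_tendsto_add sq z ms mol_tendsto[OF G(2)])
 have limab: "(%n. ?I (%x. mol a n x + mol b n x))---->?I (%x. a x + b x)"
  by (rule ltwo_tendsto_weighted[OF _ _ _ m2 C]) (use sab in \<open>auto intro!: sq_int_add sq z ms\<close>)
 have "?I a + ?I b\<le>2*?I (%x. a x + b x) + 2*?I e1 + 3*?I e2 + 32*L^2*(nrm u1)^2"
 proof (rule LIMSEQ_le)
  show "(%n. ?I (mol a n) + ?I (mol b n))---->?I a + ?I b" by (intro tendsto_add lim z)
  show "(%n. 2*?I (%x. mol a n x + mol b n x) + 2*?I (mol e1 n) + 3*?I (mol e2 n) + 32*L^2*(nrm u1)^2)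
    ----> 2*?I (%x. a x + b x) + 2*?I e1 + 3*?I e2 + 32*L^2*(nrm u1)^2"
   by (intro tendsto_add tendsto_mult tendsto_const lim limab z)
  show "\<exists>N. \<forall>n\<ge>N. ?I (mol a n) + ?I (mol b n)\<le>2*?I (%x. mol a n x + mol b n x) + 2*?I (mol e1 n)
    + 3*?I (mol e2 n) + 32*L^2*(nrm u1)^2"
  proof (intro exI[of _ N] allI impI)
   fix n assume n: "n\<ge>N"
   have eq: "pd 1 (mol u1 n) x = mol e1 n x" "pd 2 (mol u1 n) x = mol b n x"
    "pd 1 (mol u2 n) x = mol a n x" "pd 2 (mol u2 n) x = mol e2 n x" if "p x\<noteq>0" for x
   proof -
    have "cball x (1/real (Suc n))\<subseteq>G" using that closure_subset by (intro N[OF n]) fastforce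
    then show "pd 1 (mol u1 n) x = mol e1 n x" "pd 2 (mol u1 n) x = mol b n x"
     "pd 1 (mol u2 n) x = mol a n x" "pd 2 (mol u2 n) x = mol e2 n x"
     using wderiv_mol[OF G(2)] w by blast+
   qed
   have L: "(LBINT x. (p x)^2*((pd 1 (mol u2 n) x)^2 + (pd 2 (mol u1 n) x)^2))
     = ?I (mol a n) + ?I (mol b n)"
   proof -
    have "(%x. (p x)^2*((pd 1 (mol u2 n) x)^2 + (pd 2 (mol u1 n) x)^2))
     = (%x. (p x)^2*(mol a n x)^2 + (p x)^2*(mol b n x)^2)"
    proof
     fix x
     show "(p x)^2*((pd 1 (mol u2 n) x)^2 + (pd 2 (mol u1 n) x)^2)
      = (p x)^2*(mol a n x)^2 + (p x)^2*(mol b n x)^2"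
     proof (cases "p x = 0")
      case False
      show ?thesis by (simp only: eq[OF False] distrib_left)
     qed simp
    qed
    then show ?thesis using ii[OF ms[OF z(3)]] ii[OF ms[OF z(4)]] by simp
   qed
   have R: "(LBINT x. (p x)^2*(2*(pd 1 (mol u2 n) x + pd 2 (mol u1 n) x)^2
      + 2*(pd 1 (mol u1 n) x)^2 + 3*(pd 2 (mol u2 n) x)^2))
     = 2*?I (%x. mol a n x + mol b n x) + 2*?I (mol e1 n) + 3*?I (mol e2 n)"
   proof -
    have "(%x. (p x)^2*(2*(pd 1 (mol u2 n) x + pd 2 (mol u1 n) x)^2
      + 2*(pd 1 (mol u1 n) x)^2 + 3*(pd 2 (mol u2 n) x)^2))
     = (%x. 2*((p x)^2*(mol a n x + mol b n x)^2) + 2*((p x)^2*(mol e1 n x)^2) + 3*((p x)^2*(mol e2 n x)^2))"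
    proof
     fix x
     show "(p x)^2*(2*(pd 1 (mol u2 n) x + pd 2 (mol u1 n) x)^2
      + 2*(pd 1 (mol u1 n) x)^2 + 3*(pd 2 (mol u2 n) x)^2)
     = 2*((p x)^2*(mol a n x + mol b n x)^2) + 2*((p x)^2*(mol e1 n x)^2) + 3*((p x)^2*(mol e2 n x)^2)"
     proof (cases "p x = 0")
      case False
      show ?thesis by (simp only: eq[OF False] distrib_left mult.left_commute)
     qed simp
    qed
    then show ?thesis
     using ii[OF sq_int_add[OF ms[OF z(3)] ms[OF z(4)]]] ii[OF ms[OF z(5)]] ii[OF ms[OF z(6)]] by simp
   qed
   have U: "(LBINT x. indicator {x. p x\<noteq>0} x*(mol u1 n x)^2)\<le>(nrm u1)^2"
   proof -
    have "(LBINT x. indicator {x. p x\<noteq>0} x*(mol u1 n x)^2)\<le>(LBINT x. (mol u1 n x)^2)"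
    proof (rule integral_mono)
     show "integ (%x. indicator {x. p x\<noteq>0} x*(mol u1 n x)^2)"
      by (rule sq_int_weighted_integrable[OF ms[OF z(1)], of _ 1]) (auto simp: indicator_def)
    qed (use sq_int_integrable[OF ms[OF z(1)]] in \<open>auto simp: indicator_def\<close>)
    also have "...\<le>(nrm u1)^2"
     unfolding ltwo_sq[symmetric] by (intro power_mono mol_sq_int(2)[OF G(2) z(1)]) simp
    finally show ?thesis .
   qed
   have "32*L^2*(LBINT x. indicator {x. p x\<noteq>0} x*(mol u1 n x)^2)\<le>32*L^2*(nrm u1)^2"
    by (intro mult_left_mono U) simp
   with korn_local_smooth[OF p mol_smooth[OF iu[OF z(1)], of n] mol_smooth[OF iu[OF z(2)], of n]]
   show "?I (mol a n) + ?I (mol b n)\<le>2*?I (%x. mol a n x + mol b n x) + 2*?I (mol e1 n)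
    + 3*?I (mol e2 n) + 32*L^2*(nrm u1)^2"
    unfolding L R by (rule order_trans[OF _ add_left_mono])
  qed
 qed
 then show ?thesis .
qed

text \<open>Each row is divergence-free and curl-free in the sense of distributions. The relations
  are stated for convolutions with kernels whose ball stays in \<open>G\<close>, the form in which
  mollification consumes them.\<close>

definition harmonic_field :: "(real^2) set => (2 => 2 => real^2 => real) => bool" where
 "harmonic_field G H \<longleftrightarrow> (\<forall>i j. H i j\<in>L2z G) \<and>
  (\<forall>x e K i. K\<in>test_functions UNIV\<and>(\<forall>z. K z\<noteq>0 --> norm z\<le>e)\<and>cball x e\<subseteq>G -->
    conv (H i 1) (pd 1 K) x + conv (H i 2) (pd 2 K) x = 0 \<and>
    conv (H i 1) (pd 2 K) x = conv (H i 2) (pd 1 K) x)"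

text \<open>Hardy's inequality bounds the skew entry by its derivative along \<open>v\<close> with
  weight \<open>g*w\<close>. Curl-freeness expresses this derivative by derivatives of the symmetric
  part, whose entries are harmonic, and Caccioppoli's estimate with the same weight removes these
  derivatives. The constant is 4 from Hardy, 8 from the pointwise bound and 8 from
  Caccioppoli.\<close>

lemma harmonic_field_hardy:
 assumes G: "open G" "bounded G" and H: "harmonic_field G H" and w: "lip_bump L w"
  and v: "norm v\<le>1" and \<rho>: "continuous_on UNIV \<rho>" "\<And>x t. t\<ge>0 ==> \<rho> (x + t *\<^sub>R v) = \<rho> x + t"
  and w': "lip_bump L' (%x. max 0 (\<rho> x)*w x)" "closure {x. max 0 (\<rho> x)*w x\<noteq>0}\<subseteq>G"
 shows "(LBINT x. indicator {x. \<rho> x > 0} x*(w x)^2*(H 2 1 x - H 1 2 x)^2)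
  \<le> 4*L*(LBINT x. max 0 (\<rho> x)*w x*(H 2 1 x - H 1 2 x)^2)
   + 256*L'^2*((nrm (H 1 1))^2 + (nrm (%x. (H 1 2 x + H 2 1 x)/2))^2 + (nrm (H 2 2))^2)"
proof -
 have z: "H i j\<in>L2z G" for i j using H by (auto simp: harmonic_field_def)
 note sq = z[THEN L2zD(1)]
 note iu = L2z_integrable[OF G(2) z]
 note ms = mol_sq_int(1)[OF G(2) z]
 define g where "g x = max 0 (\<rho> x)" for x
 obtain B where B: "\<And>x. \<bar>(w x)^2\<bar>\<le>B" using lip_bump_sq_bound[OF w] by blast
 obtain r' B' where B': "\<And>x. g x*w x\<le>B'" using lip_bump_bounds[OF w'(1)] unfolding g_def by metis
 have gw0: "0\<le>g x*w x" for x using lip_bumpD(2)[OF w'(1)] by (simp add: g_def)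
 have [measurable]: "w\<in>bmeas" by (rule lip_bumpD(5)[OF w])
 have [measurable]: "\<rho>\<in>bmeas" by (rule borel_measurable_continuous_onI[OF \<rho>(1)])
 have [measurable]: "g\<in>bmeas" unfolding g_def by measurable
 have cpt: "compact (closure {x. g x*w x\<noteq>0})" using w'(1) by (simp add: lip_bump_def g_def)
 obtain N where N: "\<And>n x. n\<ge>N ==> x\<in>closure {x. g x*w x\<noteq>0} ==> cball x (1/real (Suc n))\<subseteq>G"
  using compact_cball_margin[OF G(1) cpt] w'(2) unfolding g_def by blast
 define h where "h x = H 2 1 x - H 1 2 x" for x
 define S where "S x = (H 1 2 x + H 2 1 x)/2" for x
 define hn where "hn n x = mol (H 2 1) n x + (-1) * mol (H 1 2) n x" for n x
 define Sn where "Sn n x = (1/2) * mol (H 1 2) n x + (1/2) * mol (H 2 1) n x" for n x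
 note msm = mol_smooth[OF iu]
 have smn: "smooth (hn n)" "smooth (Sn n)" for n
  unfolding hn_def Sn_def by (intro smooth_add smooth_cmult msm)+
 have pd: "partial_derivs as (hn n) x = partial_derivs as (mol (H 2 1) n) x - partial_derivs as (mol (H 1 2) n) x"
   "partial_derivs as (Sn n) x = (1/2)*partial_derivs as (mol (H 1 2) n) x + (1/2)*partial_derivs as (mol (H 2 1) n) x" for as n x
  unfolding hn_def[abs_def] Sn_def[abs_def]
  by (simp_all only: partial_derivs_add[OF msm smooth_cmult[OF msm]] partial_derivs_add[OF smooth_cmult[OF msm] smooth_cmult[OF msm]]
    partial_derivs_cmult[OF msm])
 have lims: "(%n. nrm (%x. hn n x - h x))---->0" "(%n. nrm (%x. Sn n x - S x))---->0"
  using ltwo_tendsto_add[OF sq ms mol_tendsto[OF G(2) z] sq ms mol_tendsto[OF G(2) z], of 1 2 1 "-1" 1 2]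
   ltwo_tendsto_add[OF sq ms mol_tendsto[OF G(2) z] sq ms mol_tendsto[OF G(2) z], of "1/2" 1 2 "1/2" 2 1]
  by (simp_all add: hn_def Sn_def h_def S_def add_divide_distrib algebra_simps)
 have hs: "h\<in>sqi" "S\<in>sqi" "hn n\<in>sqi" "Sn n\<in>sqi" for n
  unfolding h_def S_def hn_def Sn_def by (intro sq_int_diff sq_int_add sq_int_divide sq_int_cmult sq ms)+
 let ?D = "%f. (LBINT x. (g x*w x)^2*((pd 1 f x)^2 + (pd 2 f x)^2)) :: real"
 have "(LBINT x. (indicator {x. \<rho> x > 0} x*(w x)^2)*(h x)^2)
  \<le> 4*L*(LBINT x. (g x*w x)*(h x)^2)
   + 256*L'^2*((nrm (H 1 1))^2 + (nrm S)^2 + (nrm (H 2 2))^2)"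
 proof (rule LIMSEQ_le)
  show "(%n. LBINT x. (indicator {x. \<rho> x > 0} x*(w x)^2)*(hn n x)^2)---->(LBINT x. (indicator {x. \<rho> x > 0} x*(w x)^2)*(h x)^2)"
   by (rule ltwo_tendsto_weighted[OF hs(1) hs(3) lims(1), of _ "\<bar>B\<bar>"])
     (use B in \<open>auto simp: indicator_def intro: order_trans[OF _ abs_ge_self]\<close>)
  show "(%n. 4*L*(LBINT x. (g x*w x)*(hn n x)^2)
   + 256*L'^2*((nrm (mol (H 1 1) n))^2 + (nrm (Sn n))^2 + (nrm (mol (H 2 2) n))^2))
   ----> 4*L*(LBINT x. (g x*w x)*(h x)^2)
   + 256*L'^2*((nrm (H 1 1))^2 + (nrm S)^2 + (nrm (H 2 2))^2)"
  proof (intro tendsto_add tendsto_mult tendsto_const tendsto_power)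
   show "(%n. LBINT x. (g x*w x)*(hn n x)^2)---->(LBINT x. (g x*w x)*(h x)^2)"
    by (rule ltwo_tendsto_weighted[OF hs(1) hs(3) lims(1), of _ B'])
      (use B' gw0 in \<open>auto simp: abs_of_nonneg\<close>)
   show "(%n. nrm (Sn n))---->nrm S" by (rule ltwo_tendsto_norm[OF hs(2) hs(4) lims(2)])
   show "(%n. nrm (mol (H 1 1) n))---->nrm (H 1 1)"
    "(%n. nrm (mol (H 2 2) n))---->nrm (H 2 2)"
    by (rule ltwo_tendsto_norm[OF sq ms mol_tendsto[OF G(2) z]])+
  qed
  show "\<exists>N. \<forall>n\<ge>N. (LBINT x. (indicator {x. \<rho> x > 0} x*(w x)^2)*(hn n x)^2)
    \<le> 4*L*(LBINT x. (g x*w x)*(hn n x)^2)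
   + 256*L'^2*((nrm (mol (H 1 1) n))^2 + (nrm (Sn n))^2 + (nrm (mol (H 2 2) n))^2)"
  proof (intro exI[of _ N] allI impI)
   fix n assume n: "n\<ge>N"
   define P where "P i j k x = pd k (mol (H i j) n) x" for i j k x
   have eqK: "conv (H i 1) (pd 1 K) x + conv (H i 2) (pd 2 K) x = 0
     \<and> conv (H i 1) (pd 2 K) x = conv (H i 2) (pd 1 K) x"
    if "g x*w x\<noteq>0" "K = partial_derivs as (molseq n)" for x i K as
   proof -
    have "cball x (1/real (Suc n))\<subseteq>G" using that(1) closure_subset by (intro N[OF n]) fastforce
    moreover have "K\<in>test_functions UNIV" unfolding that(2) by (rule test_functions_partial_derivs[OF molseq_test])
    moreover have "\<forall>z. K z\<noteq>0 --> norm z\<le>1/real (Suc n)" unfolding that(2) using partial_molseq_support by blast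
    ultimately show ?thesis using H unfolding harmonic_field_def by blast
   qed
   have curl: "P i 1 2 x = P i 2 1 x" if "g x*w x\<noteq>0" for i x
    using eqK[OF that, of "molseq n" "[]" i] by (simp_all only: P_def partial_derivs_mol[OF iu] partial_derivs.simps(1))
   \<comment> \<open>The divergence and curl relations are tested with first derivatives of the
     kernel. As its mixed second derivatives agree, the combination gives the Laplace equation for
     each entry.\<close>
   have harm: "partial_derivs [1,1] (mol (H i j) n) x + partial_derivs [2,2] (mol (H i j) n) x = 0"
    if "g x*w x\<noteq>0" for i j x
   proof -
    have e: "conv (H i 1) (partial_derivs [1,k] (molseq n)) x + conv (H i 2) (partial_derivs [2,k] (molseq n)) x = 0"
     "conv (H i 1) (partial_derivs [2,k] (molseq n)) x = conv (H i 2) (partial_derivs [1,k] (molseq n)) x" for k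
     using eqK[OF that, of "pd k (molseq n)" "[k]" i] by (simp_all add: partial_derivs_append)
    have "smooth (molseq n :: real^2 => real)" using molseq_test by (auto simp: test_functions_iff)
    then have sm: "partial_derivs [2,1] (molseq n) = partial_derivs [1,2] (molseq n :: real^2 => real)"
     by (intro ext smooth_mixed_partials)
    have "j = 1\<or>j = 2" using exhaust_2 by auto
    then show ?thesis
    proof
     assume "j = 1"
     then show ?thesis
      unfolding partial_derivs_mol[OF iu] using e[of 1] e[of 2] sm by (simp only:)
    next
     assume "j = 2"
     then show ?thesis
      unfolding partial_derivs_mol[OF iu] using e[of 1] e[of 2] sm by (simp only:)
    qed
   qed
   have harmS: "partial_derivs [1,1] (Sn n) x + partial_derivs [2,2] (Sn n) x = 0" if "g x*w x\<noteq>0" for x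
   proof -
    have "partial_derivs [1,1] (Sn n) x + partial_derivs [2,2] (Sn n) x =
     (1/2)*(partial_derivs [1,1] (mol (H 1 2) n) x + partial_derivs [2,2] (mol (H 1 2) n) x)
     + (1/2)*(partial_derivs [1,1] (mol (H 2 1) n) x + partial_derivs [2,2] (mol (H 2 1) n) x)"
     unfolding pd by (simp only: distrib_left add_ac)
    then show ?thesis by (simp only: harm[OF that])
   qed
   have w'': "lip_bump L' (%x. g x*w x)" using w'(1) by (simp add: g_def)
   have cac: "?D f\<le>8*L'^2*(nrm f)^2"
    if f: "smooth f" "f\<in>sqi" "\<And>x. g x*w x\<noteq>0 ==> partial_derivs [1,1] f x + partial_derivs [2,2] f x = 0" for f
   proof -
    have "?D f\<le>8*L'^2*(LBINT x. indicator {x. g x*w x\<noteq>0} x*(f x)^2)"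
     by (rule caccioppoli_smooth[OF w'' f(1) f(3)])
    also have "...\<le>8*L'^2*(LBINT x. (f x)^2)"
    proof (intro mult_left_mono integral_mono)
     show "integ (%x. indicator {x. g x*w x\<noteq>0} x*(f x)^2)"
      by (rule sq_int_weighted_integrable[OF f(2), of _ 1]) (auto simp: indicator_def)
    qed (use sq_int_integrable[OF f(2)] in \<open>auto simp: indicator_def\<close>)
    finally show ?thesis by (simp add: ltwo_sq)
   qed
   define h' where "h' x = (\<Sum>i\<in>UNIV. v $ i*pd i (hn n) x)" for x
   have dh: "dir_C1 v (hn n) h'" unfolding h'_def by (rule smooth_dir_C1[OF smn(1)])
   have ch: "continuous_on UNIV h'" using dh by (simp add: dir_C1_def)
   have ip: "integ (%x. (g x*w x)^2*((pd 1 f x)^2 + (pd 2 f x)^2))" if "smooth f" for f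
    by (intro lip_bump_integrable[OF w''] continuous_intros smooth_continuous smooth_partial_derivs that)
   have pt: "(h' x)^2\<le>8*(((pd 1 (mol (H 1 1) n) x)^2 + (pd 2 (mol (H 1 1) n) x)^2)
     + ((pd 1 (Sn n) x)^2 + (pd 2 (Sn n) x)^2)
     + ((pd 1 (mol (H 2 2) n) x)^2 + (pd 2 (mol (H 2 2) n) x)^2))"
    if "g x*w x\<noteq>0" for x
   proof -
    define s1 s2 where "s1 = pd 1 (Sn n) x" and "s2 = pd 2 (Sn n) x"
    have s: "s1 = (P 1 2 1 x + P 2 1 1 x)/2" "s2 = (P 1 2 2 x + P 2 1 2 x)/2"
     unfolding s1_def s2_def P_def pd by simp_all
    have h1: "pd 1 (hn n) x = P 2 1 1 x - P 1 2 1 x" "pd 2 (hn n) x = P 2 1 2 x - P 1 2 2 x"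
     unfolding pd P_def by simp_all
    \<comment> \<open>This and the next line are the decisive identity: a derivative of the skew
      entry is a derivative of \<open>S\<close> minus one of a diagonal entry, because the rows are
      curl-free.\<close>
    have d1: "P 2 1 1 x - P 1 2 1 x = 2 * s1 - 2*P 1 1 2 x" using curl[OF that, of 1] unfolding s by (simp add: field_simps)
    have d2: "P 2 1 2 x - P 1 2 2 x = 2*P 2 2 1 x - 2 * s2" using curl[OF that, of 2] unfolding s by (simp add: field_simps)
    have e: "h' x = v $ 1*(2 * s1 - 2*P 1 1 2 x) + v $ 2*(2*P 2 2 1 x - 2 * s2)"
     unfolding h'_def by (simp only: sum_2 h1 d1 d2)
    have n1: "(v $ 1)^2 + (v $ 2)^2\<le>1"
    proof -
     have "(norm v)^2\<le>1" using v by (simp add: power_le_one)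
     then show ?thesis unfolding power2_norm_eq_inner by (simp add: inner_vec_def sum_2 power2_eq_square)
    qed
    have cs: "(n1*p + n2*q)^2\<le>(n1^2 + n2^2)*(p^2 + q^2)" for n1 n2 p q :: real
    proof -
     have "0\<le>(n1*q - n2*p)^2" by simp
     then show ?thesis by (simp add: power2_eq_square algebra_simps)
    qed
    have "(h' x)^2\<le>((v $ 1)^2 + (v $ 2)^2)*((2 * s1 - 2*P 1 1 2 x)^2 + (2*P 2 2 1 x - 2 * s2)^2)"
     unfolding e by (rule cs)
    also have "...\<le>1*((2 * s1 - 2*P 1 1 2 x)^2 + (2*P 2 2 1 x - 2 * s2)^2)"
     by (rule mult_right_mono[OF n1]) simp
    finally have "(h' x)^2\<le>(2 * s1 - 2*P 1 1 2 x)^2 + (2*P 2 2 1 x - 2 * s2)^2" by simp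
    also have "...\<le>(8 * s1^2 + 8*(P 1 1 2 x)^2) + (8*(P 2 2 1 x)^2 + 8 * s2^2)"
    proof -
     have "(2*p - 2*q)^2\<le>8*p^2 + 8*q^2" for p q :: real
     proof -
      have "0\<le>(2*p + 2*q)^2" by simp
      then show ?thesis by (simp add: power2_eq_square algebra_simps)
     qed
     then show ?thesis by (intro add_mono)
    qed
    also have "...\<le>8*(((P 1 1 1 x)^2 + (P 1 1 2 x)^2) + (s1^2 + s2^2) + ((P 2 2 1 x)^2 + (P 2 2 2 x)^2))"
     by simp
    finally show ?thesis unfolding s1_def s2_def P_def .
   qed
   have "(LBINT x. (g x*w x)^2*(h' x)^2)\<le>8*(?D (mol (H 1 1) n) + ?D (Sn n) + ?D (mol (H 2 2) n))"
   proof -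
    have "(LBINT x. (g x*w x)^2*(h' x)^2)\<le>(LBINT x. 8*(
      (g x*w x)^2*((pd 1 (mol (H 1 1) n) x)^2 + (pd 2 (mol (H 1 1) n) x)^2)
     + (g x*w x)^2*((pd 1 (Sn n) x)^2 + (pd 2 (Sn n) x)^2)
     + (g x*w x)^2*((pd 1 (mol (H 2 2) n) x)^2 + (pd 2 (mol (H 2 2) n) x)^2)))"
    proof (rule integral_mono)
     show "integ (%x. (g x*w x)^2*(h' x)^2)"
      by (intro lip_bump_integrable[OF w''] continuous_intros ch)
    next
     fix x
     show "(g x*w x)^2*(h' x)^2\<le>8*(
      (g x*w x)^2*((pd 1 (mol (H 1 1) n) x)^2 + (pd 2 (mol (H 1 1) n) x)^2)
     + (g x*w x)^2*((pd 1 (Sn n) x)^2 + (pd 2 (Sn n) x)^2)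
     + (g x*w x)^2*((pd 1 (mol (H 2 2) n) x)^2 + (pd 2 (mol (H 2 2) n) x)^2))"
     proof (cases "g x*w x = 0")
      case True
      then show ?thesis by (simp only:) simp
     next
      case False
      from mult_left_mono[OF pt[OF False], of "(g x*w x)^2"] show ?thesis
       by (simp only: distrib_left mult.left_commute[of 8]) simp
     qed
    qed (intro integrable_mult_right Bochner_Integration.integrable_add ip msm smn)
    also have "... = 8*(?D (mol (H 1 1) n) + ?D (Sn n) + ?D (mol (H 2 2) n))"
     by (simp only: integral_mult_right_zero Bochner_Integration.integral_add Bochner_Integration.integrable_add ip msm smn)
    finally show ?thesis .
   qed
   also have "...\<le>8*(8*L'^2*(nrm (mol (H 1 1) n))^2 + 8*L'^2*(nrm (Sn n))^2 + 8*L'^2*(nrm (mol (H 2 2) n))^2)"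
    by (intro mult_left_mono add_mono cac msm smn ms hs harm harmS) auto
   finally have fin: "(LBINT x. (g x*w x)^2*(h' x)^2)\<le>64*L'^2*((nrm (mol (H 1 1) n))^2 + (nrm (Sn n))^2 + (nrm (mol (H 2 2) n))^2)"
    by (simp add: algebra_simps)
   have "(LBINT x. indicator {x. \<rho> x > 0} x*((w x)^2*(hn n x)^2))
    \<le> 4*L*(LBINT x. g x*w x*(hn n x)^2) + 4*(LBINT x. (g x*w x)^2*(h' x)^2)"
    unfolding g_def by (rule hardy_smooth[OF w dh v \<rho>])
   with fin show "(LBINT x. (indicator {x. \<rho> x > 0} x*(w x)^2)*(hn n x)^2)
    \<le> 4*L*(LBINT x. (g x*w x)*(hn n x)^2)
   + 256*L'^2*((nrm (mol (H 1 1) n))^2 + (nrm (Sn n))^2 + (nrm (mol (H 2 2) n))^2)"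
    unfolding mult.assoc by linarith
  qed
 qed
 then show ?thesis unfolding h_def S_def g_def .
qed

section \<open>Boundary charts\<close>

text \<open>The function \<open>\<rho>\<close> lives on the whole plane but describes
  \<open>G\<close> only inside the closed ball. Unit growth along \<open>v\<close> is what Hardy's
  inequality integrates; the Lipschitz bound makes \<open>\<rho>\<close> times a cut-off an
  admissible weight.\<close>

definition bchart ::
 "(real^2) set => real^2 => real => (real^2 => real) => real => real^2 => bool" where
 "bchart G x r \<rho> \<Lambda> v \<longleftrightarrow> r > 0\<and>\<Lambda>\<ge>0\<and>(\<forall>y z. \<bar>\<rho> y - \<rho> z\<bar>\<le>\<Lambda>*norm (y - z))\<and>norm v\<le>1 \<and>
   (\<forall>y t. t\<ge>0 --> \<rho> (y + t *\<^sub>R v) = \<rho> y + t)\<and>G\<inter>cball x r = {y\<in>cball x r. 0 < \<rho> y}"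

text \<open>The chart for integration along rays: two independent directions never decrease
  \<open>\<rho>\<close>, so rays stay in every superlevel set. A constant \<open>\<rho>\<close>
  covers interior points.\<close>

definition gchart ::
 "(real^2) set => real^2 => real => (real^2 => real) => real^2 => real^2 => bool" where
 "gchart G x r \<rho> d1 d2 \<longleftrightarrow> r > 0\<and>continuous_on UNIV \<rho> \<and>
   (\<forall>y t. t\<ge>0 --> \<rho> y\<le>\<rho> (y + t *\<^sub>R d1)\<and>\<rho> y\<le>\<rho> (y + t *\<^sub>R d2)) \<and>
   d1 $ 1*d2 $ 2 - d1 $ 2*d2 $ 1\<noteq>0\<and>G\<inter>cball x r = {y\<in>cball x r. 0 < \<rho> y}"

lemma inner_real2: "(u :: real^2) \<bullet> v = u $ 1 * v $ 1 + u $ 2 * v $ 2"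
 by (simp add: inner_vec_def sum_2)

lemma lipschitz_charts:
 assumes "lipschitz_boundary G" "x\<in>frontier G"
 obtains r \<rho> \<Lambda> \<nu> d1 d2 where "bchart G x r \<rho> \<Lambda> \<nu>" "gchart G x r \<rho> d1 d2"
proof -
 from assms(1)[unfolded lipschitz_boundary_def, rule_format, OF assms(2)]
 obtain U and T :: "real^2 => real^2" and a :: "real => real" and C
  where U: "open U" "x\<in>U" and T: "orthogonal_transformation T"
  and a: "C-lipschitz_on UNIV a" and eq: "G\<inter>U = {y\<in>U. a (T y $ 1) < T y $ 2}"
  by (elim exE conjE) (rule that)
 have C: "C\<ge>0" by (rule lipschitz_on_nonneg[OF a])
 have aL: "\<bar>a s - a t\<bar>\<le>C*\<bar>s - t\<bar>" for s t
  using lipschitz_onD[OF a, of s t] by (simp add: dist_real_def)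
 have lin: "linear T" and nT: "norm (T v) = norm v" and iT: "T v \<bullet> T w = v \<bullet> w" for v w
  using T by (auto simp: orthogonal_transformation_def orthogonal_transformation_norm)
 have surj: "\<exists>v. T v = w" for w
  using orthogonal_transformation_surj[OF T] unfolding surj_def by metis
 obtain r where r: "r > 0" "cball x r\<subseteq>U" using U open_contains_cball by blast
 define \<rho> where "\<rho> y = T y $ 2 - a (T y $ 1)" for y
 have \<rho>L: "\<bar>\<rho> y - \<rho> z\<bar>\<le>(1 + C)*norm (y - z)" for y z
 proof -
  have d: "\<bar>T y $ i - T z $ i\<bar>\<le>norm (y - z)" for i
   using component_le_norm_cart[of "T (y - z)" i] by (simp add: linear_diff[OF lin] nT[of "y - z", unfolded linear_diff[OF lin]])
  have "\<bar>\<rho> y - \<rho> z\<bar>\<le>\<bar>T y $ 2 - T z $ 2\<bar> + \<bar>a (T y $ 1) - a (T z $ 1)\<bar>"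
   unfolding \<rho>_def by linarith
  also have "...\<le>norm (y - z) + C*norm (y - z)"
   using d[of 2] aL[of "T y $ 1" "T z $ 1"] mult_left_mono[OF d[of 1] C] by linarith
  finally show ?thesis by (simp add: algebra_simps)
 qed
 have "(1 + C)-lipschitz_on UNIV \<rho>"
  using \<rho>L C by (intro lipschitz_onI) (auto simp: dist_norm)
 then have c\<rho>: "continuous_on UNIV \<rho>" by (rule lipschitz_on_continuous_on)
 obtain \<nu> where \<nu>: "T \<nu> = axis 2 1" using surj by blast
 have n\<nu>: "norm \<nu> = 1" using nT[of \<nu>] by (simp add: \<nu>)
 have sh: "T (y + t *\<^sub>R v) = T y + t *\<^sub>R T v" for y t v by (simp add: linear_add[OF lin] linear_scale[OF lin])
 have \<rho>\<nu>: "\<rho> (y + t *\<^sub>R \<nu>) = \<rho> y + t" for y t by (simp add: \<rho>_def sh \<nu> axis_def)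
 \<comment> \<open>The directions have to be steeper than the graph, whose slope is at most
   \<open>C\<close>.\<close>
 define k where "k = C + 1"
 obtain d1 where d1: "T d1 = axis 1 1 + k *\<^sub>R axis 2 1" using surj by blast
 obtain d2 where d2: "T d2 = (-1) *\<^sub>R axis 1 1 + k *\<^sub>R axis 2 1" using surj by blast
 have up: "\<rho> y\<le>\<rho> (y + t *\<^sub>R v)" if t: "t\<ge>0" and v: "T v = s *\<^sub>R axis 1 1 + k *\<^sub>R axis 2 1" and s: "\<bar>s\<bar> = 1" for y t v s
 proof -
  have 1: "T (y + t *\<^sub>R v) $ 2 = T y $ 2 + t * k" "T (y + t *\<^sub>R v) $ 1 = T y $ 1 + t * s"
   unfolding sh v by (simp_all add: axis_def)
  have "a (T y $ 1 + t * s) - a (T y $ 1)\<le>C*\<bar>t * s\<bar>" using aL[of "T y $ 1 + t * s" "T y $ 1"] by simp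
  also have "... = C*t" using t s by (simp add: abs_mult)
  also have "...\<le>t * k" using t by (simp add: k_def algebra_simps)
  finally show ?thesis unfolding \<rho>_def 1 by linarith
 qed
 have det: "d1 $ 1*d2 $ 2 - d1 $ 2*d2 $ 1\<noteq>0"
 proof
  assume z: "d1 $ 1*d2 $ 2 - d1 $ 2*d2 $ 1 = 0"
  \<comment> \<open>The square of the determinant is the Gram determinant, which is invariant under
    \<open>T\<close> and can be evaluated on the images.\<close>
  have "(d1 $ 1*d2 $ 2 - d1 $ 2*d2 $ 1)^2 = (d1 \<bullet> d1)*(d2 \<bullet> d2) - (d1 \<bullet> d2)^2"
   unfolding inner_real2 by (simp add: power2_eq_square algebra_simps)
  also have "... = (T d1 \<bullet> T d1)*(T d2 \<bullet> T d2) - (T d1 \<bullet> T d2)^2" by (simp add: iT)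
  also have "... = 4 * k^2"
   unfolding d1 d2 inner_real2 by (simp add: axis_def power2_eq_square algebra_simps)
  finally show False using z C by (simp add: k_def)
 qed
 have set: "G\<inter>cball x r = {y\<in>cball x r. 0 < \<rho> y}" using eq r(2) by (auto simp: \<rho>_def)
 have "bchart G x r \<rho> (1 + C) \<nu>"
  unfolding bchart_def using r \<rho>L n\<nu> \<rho>\<nu> C set by auto
 moreover have "gchart G x r \<rho> d1 d2"
  unfolding gchart_def using r c\<rho> det set up[OF _ d2] up[of _ d1 1] d1 by auto
 ultimately show ?thesis by (rule that)
qed

lemma gchart_interior:
 assumes "open G" "x\<in>G"
 obtains r R d1 d2 where "gchart G x r R d1 d2"
proof -
 obtain r where r: "r > 0" "cball x r\<subseteq>G" using assms open_contains_cball by blast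
 have "gchart G x r (%_. 1) (axis 1 1) (axis 2 1)"
  unfolding gchart_def using r by (auto simp: axis_def)
 then show ?thesis by (rule that)
qed

subsection \<open>Lipschitz cut-off functions\<close>

definition tent :: "real^2 => real => real^2 => real" where
 "tent x r y = max 0 (r - norm (y - x))"

lemma abs_max0_diff: "\<bar>max 0 a - max 0 b\<bar>\<le>\<bar>a - b\<bar>" for a b :: real
 by auto

lemma tent_props:
 assumes "r > 0"
 shows "lip_bump 1 (tent x r)" "tent x r y\<le>r" "tent x r y\<noteq>0 ==> y\<in>cball x r" "0\<le>tent x r y"
proof -
 show 3: "tent x r y\<noteq>0 ==> y\<in>cball x r" for y
  by (auto simp: tent_def dist_norm norm_minus_commute max_def split: if_splits)
 have "bounded {y. tent x r y\<noteq>0}" by (rule bounded_subset[of "cball x r"]) (use 3 in auto)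
 moreover have "\<bar>tent x r y - tent x r z\<bar>\<le>1*norm (y - z)" for y z
 proof -
  have "\<bar>tent x r y - tent x r z\<bar>\<le>\<bar>(r - norm (y - x)) - (r - norm (z - x))\<bar>"
   unfolding tent_def by (rule abs_max0_diff)
  also have "...\<le>norm ((z - x) - (y - x))" using norm_triangle_ineq3[of "z - x" "y - x"] by simp
  finally show ?thesis by (simp add: norm_minus_commute)
 qed
 ultimately show "lip_bump 1 (tent x r)" by (auto simp: lip_bump_def tent_def)
 show "tent x r y\<le>r" "0\<le>tent x r y" using assms by (auto simp: tent_def)
qed

text \<open>The first factor is bounded only where the tent is positive. In the product rule it is
  therefore evaluated at a point where the tent does not vanish, which symmetry allows. The constant
  is independent of the shift \<open>d\<close>.\<close>

lemma lip_bump_tent_weight: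
 assumes b: "bchart G x r R \<Lambda> v" and M: "\<And>y. y\<in>cball x r ==> \<bar>R y\<bar>\<le>M" "M\<ge>0" and d: "d\<ge>0"
 shows "lip_bump (M + r*\<Lambda>) (%y. max 0 (R y - d)*tent x r y)"
proof -
 have r: "r > 0" and \<Lambda>: "\<Lambda>\<ge>0" and R: "\<bar>R y - R z\<bar>\<le>\<Lambda>*norm (y - z)" for y z using b by (auto simp: bchart_def)
 note t = tent_props[OF r, of x]
 define q where "q y = max 0 (R y - d)" for y
 have q0: "q y\<ge>0" for y by (simp add: q_def)
 have qM: "q y\<le>M" if "tent x r y\<noteq>0" for y
  using M(1)[OF t(3)[OF that]] M(2) d by (auto simp: q_def)
 have qL: "\<bar>q y - q z\<bar>\<le>\<Lambda>*norm (y - z)" for y z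
  unfolding q_def using abs_max0_diff[of "R y - d" "R z - d"] R[of y z] by simp
 have tL: "\<bar>tent x r y - tent x r z\<bar>\<le>norm (y - z)" for y z using lip_bumpD(3)[OF t(1)] by simp
 have half: "\<bar>q y*tent x r y - q z*tent x r z\<bar>\<le>(M + r*\<Lambda>)*norm (y - z)" if "tent x r y\<noteq>0" for y z
 proof -
  have "q y*tent x r y - q z*tent x r z = q y*(tent x r y - tent x r z) + tent x r z*(q y - q z)"
   by (simp add: algebra_simps)
  also have "\<bar>...\<bar>\<le>\<bar>q y\<bar>*\<bar>tent x r y - tent x r z\<bar> + \<bar>tent x r z\<bar>*\<bar>q y - q z\<bar>"
   by (metis abs_mult abs_triangle_ineq)
  also have "...\<le>M*norm (y - z) + r*(\<Lambda>*norm (y - z))"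
   using qM[OF that] q0[of y] tL[of y z] qL[of y z] t(2,4)[of z] M(2) r \<Lambda>
   by (intro add_mono mult_mono) auto
  finally show ?thesis by (simp add: algebra_simps)
 qed
 have "\<bar>q y*tent x r y - q z*tent x r z\<bar>\<le>(M + r*\<Lambda>)*norm (y - z)" for y z
 proof (cases "tent x r y = 0")
  case False then show ?thesis by (rule half)
 next
  case y: True
  show ?thesis
  proof (cases "tent x r z = 0")
   case True then show ?thesis using y M(2) r \<Lambda> by simp
  next
   case False
   from half[OF this, of y] show ?thesis by (simp add: abs_minus_commute norm_minus_commute)
  qed
 qed
 moreover have "bounded {y. q y*tent x r y\<noteq>0}" by (rule bounded_subset[of "cball x r"]) (use t(3) in auto)
 ultimately show ?thesis unfolding lip_bump_def q_def[symmetric] using M(2) r \<Lambda> q0 t(4) by auto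
qed

lemma compact_cutoff:
 fixes G :: "(real^2) set"
 assumes "open G" "compact K" "K\<subseteq>G"
 obtains L p where "lip_bump L p" "closure {x. p x\<noteq>0}\<subseteq>G" "\<And>x. x\<in>K ==> p x = 1" "\<And>x. p x\<le>1"
proof (cases "K = {}")
 case True
 have "lip_bump 0 (%_::real^2. 0)" by (simp add: lip_bump_def)
 then show ?thesis by (rule that) (use True in auto)
next
 case False
 have "closed (- G)" "K\<inter>- G = {}" using assms by auto
 from separate_compact_closed[OF assms(2) this]
 obtain d where d: "d > 0" "\<And>x y. x\<in>K ==> y\<in>- G ==> d\<le>dist x y" by blast
 define p where "p y = max 0 (1 - (2/d)*infdist y K)" for y
 have supp: "infdist y K\<le>d/2" if "p y\<noteq>0" for y
  using that d(1) by (auto simp: p_def max_def field_simps split: if_splits)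
 have cl: "closed {y. infdist y K\<le>d/2}" by (intro closed_Collect_le continuous_intros)
 have near: "\<exists>x\<in>K. dist y x\<le>d/2" if "infdist y K\<le>d/2" for y
  using infdist_attains_inf[OF compact_imp_closed[OF assms(2)] False, of y] that by metis
 obtain B where B: "\<And>x. x\<in>K ==> norm x\<le>B" using compact_imp_bounded[OF assms(2)] unfolding bounded_iff by blast
 have "norm y\<le>B + d/2" if y: "p y\<noteq>0" for y
 proof -
  obtain x where "x\<in>K" "dist y x\<le>d/2" using near[OF supp[OF y]] by blast
  then show ?thesis using B[of x] norm_triangle_ineq4[of "y - x" "-x"] by (simp add: dist_norm)
 qed
 then have bd: "bounded {y. p y\<noteq>0}" unfolding bounded_iff by blast
 have lip: "\<bar>p y - p z\<bar>\<le>(2/d)*norm (y - z)" for y z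
 proof -
  have "\<bar>p y - p z\<bar>\<le>\<bar>(1 - (2/d)*infdist y K) - (1 - (2/d)*infdist z K)\<bar>" unfolding p_def by (rule abs_max0_diff)
  also have "... = (2/d)*\<bar>infdist z K - infdist y K\<bar>"
  proof -
   have "(1 - (2/d)*infdist y K) - (1 - (2/d)*infdist z K) = (2/d)*(infdist z K - infdist y K)"
    by (simp add: right_diff_distrib)
   then show ?thesis using d(1) by (simp only: abs_mult) simp
  qed
  also have "...\<le>(2/d)*norm (y - z)"
   using infdist_triangle_abs[of z K y] d(1) by (intro mult_left_mono) (auto simp: dist_norm norm_minus_commute)
  finally show ?thesis .
 qed
 have "lip_bump (2/d) p" using d(1) lip bd by (auto simp: lip_bump_def p_def)
 moreover have "closure {y. p y\<noteq>0}\<subseteq>G"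
 proof -
  have "closure {y. p y\<noteq>0}\<subseteq>{y. infdist y K\<le>d/2}" by (rule closure_minimal[OF _ cl]) (use supp in auto)
  moreover have "y\<in>G" if y: "infdist y K\<le>d/2" for y
  proof (rule ccontr)
   assume "y\<notin>G"
   obtain x where "x\<in>K" "dist y x\<le>d/2" using near[OF y] by blast
   then show False using d(2)[of x y] d(1) \<open>y \<notin> G\<close> by (simp add: dist_commute)
  qed
  ultimately show ?thesis by blast
 qed
 moreover have "p x = 1" if "x\<in>K" for x using that by (simp add: p_def)
 moreover have "p x\<le>1" for x using d(1) by (simp add: p_def infdist_nonneg)
 ultimately show ?thesis by (rule that)
qed

section \<open>Hardy's inequality for harmonic fields\<close>

definition skew_sq :: "(2 => 2 => real^2 => real) => real^2 => real" where
 "skew_sq H x = (H 2 1 x - H 1 2 x)^2"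

definition sym_norm_sq :: "(2 => 2 => real^2 => real) => real" where
 "sym_norm_sq H = (nrm (H 1 1))^2 + (nrm (%x. (H 1 2 x + H 2 1 x)/2))^2 + (nrm (H 2 2))^2"

lemma skew_sq_weighted_integrable:
 assumes "harmonic_field G H" "w\<in>bmeas" "\<And>x. \<bar>w x\<bar>\<le>C"
 shows "integ (%x. w x * skew_sq H x)"
proof -
 have z: "H i j\<in>L2z G" for i j using assms(1) by (auto simp: harmonic_field_def)
 have "(%x. H 2 1 x - H 1 2 x)\<in>sqi" by (intro sq_int_diff L2zD(1)[OF z])
 then show ?thesis unfolding skew_sq_def by (rule sq_int_weighted_integrable) (use assms in auto)
qed

lemma skew_sq_outside: "harmonic_field G H ==> x\<notin>G ==> skew_sq H x = 0"
 by (simp add: harmonic_field_def skew_sq_def L2zD(2)[of _ G])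

text \<open>The weight built from \<open>\<rho>\<close> reaches the boundary and is not supported
  inside \<open>G\<close>. Replacing \<open>\<rho>\<close> by \<open>\<rho> - d\<close> repairs this
  with constants that do not depend on \<open>d\<close>, and dominated convergence lets
  \<open>d\<close> tend to 0.\<close>

lemma harmonic_field_boundary:
 assumes G: "open G" "bounded G" and b: "bchart G x r \<rho> \<Lambda> v"
 obtains C where "C\<ge>0" "\<And>H. harmonic_field G H ==> (LBINT y. (tent x r y)^2 * skew_sq H y)
  \<le> 4*(LBINT y. max 0 (\<rho> y)*tent x r y * skew_sq H y) + C * sym_norm_sq H"
proof -
 have r: "r > 0" and \<Lambda>: "\<Lambda>\<ge>0" and \<rho>: "\<bar>\<rho> y - \<rho> z\<bar>\<le>\<Lambda>*norm (y - z)" and nv: "norm v\<le>1"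
  and up: "t\<ge>0 ==> \<rho> (y + t *\<^sub>R v) = \<rho> y + t" and set: "G\<inter>cball x r = {y\<in>cball x r. 0 < \<rho> y}" for y z t
  using b by (auto simp: bchart_def)
 note t = tent_props[OF r, of x]
 have "\<Lambda>-lipschitz_on UNIV \<rho>" using \<rho> \<Lambda> by (intro lipschitz_onI) (auto simp: dist_norm)
 then have c\<rho>: "continuous_on UNIV \<rho>" by (rule lipschitz_on_continuous_on)
 have "compact (\<rho> ` cball x r)" by (intro compact_continuous_image continuous_on_subset[OF c\<rho>]) auto
 then obtain M where M: "M > 0" "\<And>y. y\<in>cball x r ==> \<bar>\<rho> y\<bar>\<le>M"
  using compact_imp_bounded bounded_pos by (metis imageI real_norm_def)
 have [measurable]: "tent x r\<in>bmeas" by (rule lip_bumpD(5)[OF t(1)])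
 have [measurable]: "\<rho>\<in>bmeas" by (rule borel_measurable_continuous_onI[OF c\<rho>])
 have wb: "\<bar>max 0 (\<rho> y - d)*tent x r y\<bar>\<le>M*r" if "d\<ge>0" for d y
 proof (cases "tent x r y = 0")
  case False
  then show ?thesis using M(2)[OF t(3)[OF False]] t(2,4)[of y] M(1) that unfolding abs_mult
   by (intro mult_mono) auto
 qed (use M(1) r in auto)
 show ?thesis
 proof (rule that)
  show "0\<le>256*(M + r*\<Lambda>)^2" by simp
  fix H assume H: "harmonic_field G H"
  note int = skew_sq_weighted_integrable[OF H]
  have s0: "skew_sq H y\<ge>0" for y by (simp add: skew_sq_def)
  define d where "d n = 1/real (Suc n)" for n
  have d0: "d n > 0" for n by (simp add: d_def)
  have dl: "d---->0" unfolding d_def by (rule LIMSEQ_Suc[OF lim_1_over_n])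
  let ?R = "4*(LBINT y. max 0 (\<rho> y)*tent x r y * skew_sq H y) + 256*(M + r*\<Lambda>)^2 * sym_norm_sq H"
  have bd: "(LBINT y. (indicator {y. \<rho> y - d n > 0} y*(tent x r y)^2) * skew_sq H y)\<le>?R" for n
  proof -
   have sub: "closure {y. max 0 (\<rho> y - d n)*tent x r y\<noteq>0}\<subseteq>G"
   proof -
    have "closed ({y. d n\<le>\<rho> y}\<inter>cball x r)"
     by (intro closed_Int closed_Collect_le continuous_intros c\<rho>) auto
    then have "closure {y. max 0 (\<rho> y - d n)*tent x r y\<noteq>0}\<subseteq>{y. d n\<le>\<rho> y}\<inter>cball x r"
     by (intro closure_minimal) (use t(3) in \<open>auto simp: max_def split: if_splits\<close>)
    also have "...\<subseteq>G" using set d0[of n] by force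
    finally show ?thesis .
   qed
   have "(LBINT y. (indicator {y. \<rho> y - d n > 0} y*(tent x r y)^2) * skew_sq H y)
    \<le> 4*1*(LBINT y. max 0 (\<rho> y - d n)*tent x r y * skew_sq H y) + 256*(M + r*\<Lambda>)^2 * sym_norm_sq H"
    unfolding skew_sq_def sym_norm_sq_def
   proof (rule harmonic_field_hardy[OF G H t(1) nv])
    show "lip_bump (M + r*\<Lambda>) (%y. max 0 (\<rho> y - d n)*tent x r y)"
     by (rule lip_bump_tent_weight[OF b M(2)]) (use M(1) d0[of n] in auto)
   qed (use up sub in \<open>auto intro!: continuous_intros c\<rho>\<close>)
   also have "(LBINT y. max 0 (\<rho> y - d n)*tent x r y * skew_sq H y)\<le>(LBINT y. max 0 (\<rho> y)*tent x r y * skew_sq H y)"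
   proof (rule integral_mono)
    show "integ (%y. max 0 (\<rho> y - d n)*tent x r y * skew_sq H y)"
     by (rule int[OF _ wb]) (use d0[of n] in auto)
    show "integ (%y. max 0 (\<rho> y)*tent x r y * skew_sq H y)"
     using int[OF _ wb[of 0]] by simp
    show "max 0 (\<rho> y - d n)*tent x r y * skew_sq H y\<le>max 0 (\<rho> y)*tent x r y * skew_sq H y" for y
     using d0[of n] by (intro mult_right_mono t(4) s0) auto
   qed
   finally show ?thesis by simp
  qed
  have t2: "\<bar>(tent x r y)^2\<bar>\<le>r^2" for y using power_mono[OF t(2) t(4), of y 2] by simp
  have lim: "(%n. LBINT y. (indicator {y. \<rho> y - d n > 0} y*(tent x r y)^2) * skew_sq H y)
    ----> (LBINT y. (tent x r y)^2 * skew_sq H y)"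
  proof (rule integral_dominated_convergence)
   show iw: "integ (%y. (tent x r y)^2 * skew_sq H y)" by (rule int[OF _ t2]) measurable
   show "AE y in lborel. norm ((indicator {y. \<rho> y - d n > 0} y*(tent x r y)^2) * skew_sq H y)\<le>(tent x r y)^2 * skew_sq H y" for n
    using s0 by (auto simp: indicator_def)
   show "(%y. (indicator {y. \<rho> y - d n > 0} y*(tent x r y)^2) * skew_sq H y)\<in>borel_measurable lborel" for n
   proof (rule borel_measurable_integrable, rule int)
    show "\<bar>indicator {y. \<rho> y - d n > 0} y*(tent x r y)^2\<bar>\<le>r^2" for y
     using t2[of y] by (auto simp: indicator_def)
   qed measurable
   show "(%y. (tent x r y)^2 * skew_sq H y)\<in>borel_measurable lborel" by (rule borel_measurable_integrable[OF iw])
   show "AE y in lborel. (%n. (indicator {y. \<rho> y - d n > 0} y*(tent x r y)^2) * skew_sq H y)---->(tent x r y)^2 * skew_sq H y"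
   proof (rule AE_I2)
    fix y
    show "(%n. (indicator {y. \<rho> y - d n > 0} y*(tent x r y)^2) * skew_sq H y)---->(tent x r y)^2 * skew_sq H y"
    proof (cases "tent x r y\<noteq>0\<and>y\<in>G")
     case True
     then have "\<rho> y > 0" using set t(3) by blast
     from order_tendstoD(2)[OF dl this] show ?thesis
      by (intro tendsto_eventually) (auto elim!: eventually_mono simp: indicator_def)
    next
     case False
     then show ?thesis using skew_sq_outside[OF H] by auto
    qed
   qed
  qed
  show "(LBINT y. (tent x r y)^2 * skew_sq H y)\<le>?R"
   by (rule LIMSEQ_le_const2[OF lim]) (use bd in auto)
 qed
qed

text \<open>On the right side of the boundary estimate the integrand carries the factor
  \<open>\<rho>\<close>. Where this factor is below \<tau> the contribution is a small multiple of
  the full integral and is absorbed; where it is at least \<tau> the chart ball meets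
  \<open>G\<close> in a compact set, which is put into \<open>K\<close>.\<close>

lemma harmonic_field_estimate:
 assumes G: "open G" "bounded G" and lip: "lipschitz_boundary G"
 obtains C K where "C\<ge>0" "compact K" "K\<subseteq>G" "\<And>H. harmonic_field G H ==>
  (LBINT y. skew_sq H y)\<le>C * sym_norm_sq H + C*(LBINT y. indicator K y * skew_sq H y)"
proof -
 have "\<forall>x\<in>frontier G. \<exists>p. case p of (r, \<rho>, \<Lambda>, v, C) => bchart G x r \<rho> \<Lambda> v\<and>C\<ge>0 \<and>
   (\<forall>H. harmonic_field G H --> (LBINT y. (tent x r y)^2 * skew_sq H y)
   \<le> 4*(LBINT y. max 0 (\<rho> y)*tent x r y * skew_sq H y) + C * sym_norm_sq H)"
 proof
  fix x assume x: "x\<in>frontier G"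
  obtain r \<rho> \<Lambda> v d1 d2 where b: "bchart G x r \<rho> \<Lambda> v" "gchart G x r \<rho> d1 d2"
   by (rule lipschitz_charts[OF lip x])
  obtain C where "C\<ge>0" "\<And>H. harmonic_field G H ==> (LBINT y. (tent x r y)^2 * skew_sq H y)
   \<le> 4*(LBINT y. max 0 (\<rho> y)*tent x r y * skew_sq H y) + C * sym_norm_sq H"
   by (rule harmonic_field_boundary[OF G b(1)]) (rule that)
  with b(1) show "\<exists>p. case p of (r, \<rho>, \<Lambda>, v, C) => bchart G x r \<rho> \<Lambda> v\<and>C\<ge>0 \<and>
   (\<forall>H. harmonic_field G H --> (LBINT y. (tent x r y)^2 * skew_sq H y)
   \<le> 4*(LBINT y. max 0 (\<rho> y)*tent x r y * skew_sq H y) + C * sym_norm_sq H)"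
   by (intro exI[of _ "(r, \<rho>, \<Lambda>, v, C)"]) simp
 qed
 from bchoice[OF this] obtain p where p: "\<forall>x\<in>frontier G. case p x of (r, \<rho>, \<Lambda>, v, C) => bchart G x r \<rho> \<Lambda> v\<and>C\<ge>0 \<and>
   (\<forall>H. harmonic_field G H --> (LBINT y. (tent x r y)^2 * skew_sq H y)
   \<le> 4*(LBINT y. max 0 (\<rho> y)*tent x r y * skew_sq H y) + C * sym_norm_sq H)" ..
 define r where "r x = fst (p x)" for x
 define \<rho> where "\<rho> x = fst (snd (p x))" for x
 define \<Lambda> where "\<Lambda> x = fst (snd (snd (p x)))" for x
 define v where "v x = fst (snd (snd (snd (p x))))" for x
 define C where "C x = snd (snd (snd (snd (p x))))" for x
 have b: "bchart G x (r x) (\<rho> x) (\<Lambda> x) (v x)" and C0: "C x\<ge>0"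
  and est: "harmonic_field G H ==> (LBINT y. (tent x (r x) y)^2 * skew_sq H y)
   \<le> 4*(LBINT y. max 0 (\<rho> x y)*tent x (r x) y * skew_sq H y) + C x * sym_norm_sq H"
  if "x\<in>frontier G" for x H
  using p[rule_format, OF that] by (auto simp: r_def \<rho>_def \<Lambda>_def v_def C_def split: prod.splits)
 have r0: "r x > 0" if "x\<in>frontier G" for x using b[OF that] by (simp add: bchart_def)
 have set: "G\<inter>cball x (r x) = {y\<in>cball x (r x). 0 < \<rho> x y}" if "x\<in>frontier G" for x
  using b[OF that] by (simp add: bchart_def)
 have c\<rho>: "continuous_on UNIV (\<rho> x)" if "x\<in>frontier G" for x
 proof -
  have "(\<Lambda> x)-lipschitz_on UNIV (\<rho> x)"
   using b[OF that] by (intro lipschitz_onI) (auto simp: dist_norm bchart_def)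
  then show ?thesis by (rule lipschitz_on_continuous_on)
 qed
 have "\<forall>x\<in>frontier G. \<exists>M. M\<ge>0\<and>(\<forall>y\<in>cball x (r x). \<bar>\<rho> x y\<bar>\<le>M)"
 proof
  fix x assume x: "x\<in>frontier G"
  have "compact (\<rho> x ` cball x (r x))" by (intro compact_continuous_image continuous_on_subset[OF c\<rho>[OF x]]) auto
  then obtain M where "M > 0" "\<And>z. z\<in>\<rho> x ` cball x (r x) ==> norm z\<le>M"
   using compact_imp_bounded bounded_pos by metis
  then show "\<exists>M. M\<ge>0\<and>(\<forall>y\<in>cball x (r x). \<bar>\<rho> x y\<bar>\<le>M)" by (intro exI[of _ M]) auto
 qed
 from bchoice[OF this] obtain M where M: "\<And>x. x\<in>frontier G ==> M x\<ge>0"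
  "\<And>x y. x\<in>frontier G ==> y\<in>cball x (r x) ==> \<bar>\<rho> x y\<bar>\<le>M x" by blast
 have cf: "compact (frontier G)" by (rule compact_frontier_bounded[OF G(2)])
 have cov: "frontier G\<subseteq>(\<Union>x\<in>frontier G. ball x (r x/2))" using r0 by force
 obtain X where X: "X\<subseteq>frontier G" "finite X" "frontier G\<subseteq>(\<Union>x\<in>X. ball x (r x/2))"
  by (rule compactE_image[OF cf _ cov]) (rule open_ball, rule that)
 define N where "N = real (card X)"
 have N: "N\<ge>0" by (simp add: N_def)
 \<comment> \<open>Chosen so that \<open>16*\<tau> x/r x = 1/(2*(N + 1))\<close>: the
   \<open>N\<close> boundary balls together give back at most half of the full integral.\<close>
 define \<tau> where "\<tau> x = r x/(32*(N + 1))" for x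
 have \<tau>0: "\<tau> x > 0" if "x\<in>X" for x using r0 X that N by (auto simp: \<tau>_def intro!: divide_pos_pos)
 \<comment> \<open>What the half balls leave of the closure. They cover the frontier, so this set is
   a compact subset of \<open>G\<close>.\<close>
 define K0 where "K0 = closure G - (\<Union>x\<in>X. ball x (r x/2))"
 define Kx where "Kx x = cball x (r x)\<inter>{y. \<tau> x\<le>\<rho> x y}" for x
 define K where "K = K0 \<union> (\<Union>x\<in>X. Kx x)"
 have "compact K0" unfolding K0_def using G(2) by (intro compact_diff) (auto simp: compact_closure)
 moreover have "K0\<subseteq>G" using X(3) unfolding K0_def closure_Un_frontier by auto
 moreover have "compact (Kx x)" "Kx x\<subseteq>G" if "x\<in>X" for x
 proof -
  have x: "x\<in>frontier G" using that X by blast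
  show "compact (Kx x)" unfolding Kx_def
   by (intro compact_Int_closed closed_Collect_le continuous_intros c\<rho>[OF x]) auto
  show "Kx x\<subseteq>G" using set[OF x] \<tau>0[OF that] unfolding Kx_def by force
 qed
 ultimately have K: "compact K" "K\<subseteq>G" unfolding K_def using X(2) by (auto intro!: compact_Un compact_UN)
 define A where "A = (\<Sum>x\<in>X. 16*M x/r x)"
 define B where "B = (\<Sum>x\<in>X. 4*C x/(r x)^2)"
 have A0: "A\<ge>0" unfolding A_def using M r0 X by (intro sum_nonneg divide_nonneg_pos) auto
 have B0: "B\<ge>0" unfolding B_def using C0 X by (intro sum_nonneg divide_nonneg_nonneg) auto
 have mK: "K\<in>sets borel" using K(1) by (intro borel_closed compact_imp_closed)
 show ?thesis
 proof (rule that[OF _ K])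
  show "2*(A + B + 1)\<ge>0" using A0 B0 by simp
  fix H assume H: "harmonic_field G H"
  note int = skew_sq_weighted_integrable[OF H]
  have s0: "skew_sq H y\<ge>0" for y by (simp add: skew_sq_def)
  let ?I = "%w. (LBINT y. w y * skew_sq H y) :: real"
  define I where "I = ?I (%_. 1)"
  define J where "J = ?I (indicator K)"
  define S where "S = sym_norm_sq H"
  have S0: "S\<ge>0" by (simp add: S_def sym_norm_sq_def)
  have J0: "J\<ge>0" unfolding J_def using s0 by (intro integral_nonneg_AE) auto
  have i1: "integ (%y. 1 * skew_sq H y)" by (rule int[of _ 1]) auto
  have iK: "integ (%y. indicator K y * skew_sq H y)"
   by (rule int[of _ 1]) (use mK in \<open>auto simp: indicator_def\<close>)
  have iB: "integ (%y. indicator (ball x (r x/2)) y * skew_sq H y)" for x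
   by (rule int[of _ 1]) (auto simp: indicator_def)
  have loc: "?I (indicator (ball x (r x/2)))\<le>I/(2*(N + 1)) + (16*M x/r x)*J + (4*C x/(r x)^2)*S"
   if "x\<in>X" for x
  proof -
   have x: "x\<in>frontier G" using that X by blast
   note R = r0[OF x]
   note t = tent_props[OF R, of x]
   have [measurable]: "tent x (r x)\<in>bmeas" by (rule lip_bumpD(5)[OF t(1)])
   have [measurable]: "\<rho> x\<in>bmeas" by (rule borel_measurable_continuous_onI[OF c\<rho>[OF x]])
   have t2: "\<bar>(tent x (r x) y)^2\<bar>\<le>(r x)^2" for y using power_mono[OF t(2) t(4), of y 2] by simp
   have it: "integ (%y. (tent x (r x) y)^2 * skew_sq H y)" by (rule int[OF _ t2]) measurable
   have "?I (indicator (ball x (r x/2)))\<le>(LBINT y. (4/(r x)^2)*((tent x (r x) y)^2 * skew_sq H y))"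
   proof (rule integral_mono[OF iB integrable_mult_right[OF it]])
    fix y
    show "indicator (ball x (r x/2)) y * skew_sq H y\<le>(4/(r x)^2)*((tent x (r x) y)^2 * skew_sq H y)"
    proof (cases "y\<in>ball x (r x/2)")
     case True
     then have "norm (y - x) < r x/2" by (simp add: dist_norm norm_minus_commute)
     then have "r x/2\<le>r x - norm (y - x)" by linarith
     then have "r x/2\<le>tent x (r x) y" unfolding tent_def by (rule max.coboundedI2)
     then have "(r x/2)^2\<le>(tent x (r x) y)^2" using R by (intro power_mono) auto
     then have "1\<le>(4/(r x)^2)*(tent x (r x) y)^2" using R by (simp add: field_simps power2_eq_square)
     from mult_right_mono[OF this s0[of y]] show ?thesis using True by (simp add: mult.assoc)
    next
     case False
     then show ?thesis using s0[of y] by simp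
    qed
   qed
   also have "...\<le>(4/(r x)^2)*(4*(LBINT y. max 0 (\<rho> x y)*tent x (r x) y * skew_sq H y) + C x*S)"
    unfolding integral_mult_right_zero S_def by (intro mult_left_mono est[OF x H]) simp
   also have "(LBINT y. max 0 (\<rho> x y)*tent x (r x) y * skew_sq H y)
    \<le> (LBINT y. r x*(\<tau> x*(1 * skew_sq H y) + M x*(indicator K y * skew_sq H y)))"
   proof (rule integral_mono)
    have wb: "\<bar>max 0 (\<rho> x y)*tent x (r x) y\<bar>\<le>M x*r x" for y
    proof (cases "tent x (r x) y = 0")
     case False
     then show ?thesis using M(2)[OF x t(3)[OF False]] t(2,4)[of y] M(1)[OF x] unfolding abs_mult
      by (intro mult_mono) auto
    qed (use M(1)[OF x] R in auto)
    show "integ (%y. max 0 (\<rho> x y)*tent x (r x) y * skew_sq H y)" by (rule int[OF _ wb]) measurable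
    show "integ (%y. r x*(\<tau> x*(1 * skew_sq H y) + M x*(indicator K y * skew_sq H y)))"
     by (intro integrable_mult_right Bochner_Integration.integrable_add i1 iK)
    fix y
    have "max 0 (\<rho> x y)*tent x (r x) y\<le>r x*(\<tau> x + M x*indicator K y)"
    proof (cases "tent x (r x) y = 0")
     case True
     then show ?thesis using R \<tau>0[OF that] M(1)[OF x] by (auto intro!: mult_nonneg_nonneg add_nonneg_nonneg)
    next
     case False
     have y: "y\<in>cball x (r x)" by (rule t(3)[OF False])
     have "max 0 (\<rho> x y)\<le>\<tau> x + M x*indicator K y"
     proof (cases "\<tau> x\<le>\<rho> x y")
      case True
      then have "y\<in>K" using y that by (auto simp: K_def Kx_def)
      then show ?thesis using M(2)[OF x y] \<tau>0[OF that] M(1)[OF x] by auto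
     next
      case False
      then show ?thesis using \<tau>0[OF that] M(1)[OF x] by (auto simp: indicator_def)
     qed
     then have "max 0 (\<rho> x y)*tent x (r x) y\<le>(\<tau> x + M x*indicator K y)*r x"
      using t(2,4)[of y] M(1)[OF x] \<tau>0[OF that] by (intro mult_mono) auto
     then show ?thesis by (simp add: mult.commute)
    qed
    from mult_right_mono[OF this s0[of y]]
    show "max 0 (\<rho> x y)*tent x (r x) y * skew_sq H y\<le>r x*(\<tau> x*(1 * skew_sq H y) + M x*(indicator K y * skew_sq H y))"
     by (simp add: algebra_simps)
   qed
   also have "... = r x*(\<tau> x*I + M x*J)"
    unfolding I_def J_def
    by (simp only: integral_mult_right_zero Bochner_Integration.integral_add[OF integrable_mult_right[OF i1] integrable_mult_right[OF iK]])
   finally have "?I (indicator (ball x (r x/2)))\<le>(4/(r x)^2)*(4*(r x*(\<tau> x*I + M x*J)) + C x*S)"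
    using R by (simp add: mult_left_mono divide_right_mono)
   also have "... = (16*\<tau> x/r x)*I + (16*M x/r x)*J + (4*C x/(r x)^2)*S"
    using R by (simp add: field_simps power2_eq_square)
   also have "16*\<tau> x/r x = 1/(2*(N + 1))"
   proof -
    have *: "16*(R/(32*Q))/R = 1/(2*Q)" if "R > 0" "Q > 0" for R Q :: real using that by (simp add: field_simps)
    show ?thesis unfolding \<tau>_def by (rule *) (use R N in auto)
   qed
   finally show ?thesis by simp
  qed
  have "I\<le>(LBINT y. (\<Sum>x\<in>X. indicator (ball x (r x/2)) y * skew_sq H y) + indicator K y * skew_sq H y)"
   unfolding I_def
  proof (rule integral_mono[OF i1])
   show "integ (%y. (\<Sum>x\<in>X. indicator (ball x (r x/2)) y * skew_sq H y) + indicator K y * skew_sq H y)"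
    by (intro Bochner_Integration.integrable_add Bochner_Integration.integrable_sum iB iK)
   fix y
   have nn: "0\<le>(\<Sum>x\<in>X. indicator (ball x (r x/2)) y * skew_sq H y)" using s0 by (intro sum_nonneg) auto
   consider "y\<notin>G" | "y\<in>K" | x where "x\<in>X" "y\<in>ball x (r x/2)"
    unfolding K_def K0_def using closure_subset[of G] by blast
   then show "1 * skew_sq H y\<le>(\<Sum>x\<in>X. indicator (ball x (r x/2)) y * skew_sq H y) + indicator K y * skew_sq H y"
   proof cases
    case 1 then show ?thesis using skew_sq_outside[OF H] by simp
   next
    case 2 then show ?thesis using nn by simp
   next
    case 3
    then have "skew_sq H y\<le>(\<Sum>x\<in>X. indicator (ball x (r x/2)) y * skew_sq H y)"
     using member_le_sum[of x X "%x. indicator (ball x (r x/2)) y * skew_sq H y"] X(2) s0 by auto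
    then show ?thesis using s0[of y] by (auto simp: indicator_def)
   qed
  qed
  also have "... = (\<Sum>x\<in>X. ?I (indicator (ball x (r x/2)))) + J"
   unfolding J_def using iB iK by (subst Bochner_Integration.integral_add) auto
  also have "...\<le>(\<Sum>x\<in>X. I/(2*(N + 1)) + (16*M x/r x)*J + (4*C x/(r x)^2)*S) + J"
   by (intro add_mono sum_mono loc) auto
  also have "... = N*(I/(2*(N + 1))) + A*J + B*S + J"
   unfolding A_def B_def N_def by (simp add: sum.distrib sum_distrib_right)
  finally have le: "I\<le>N*(I/(2*(N + 1))) + A*J + B*S + J" .
  have "N*(I/(2*(N + 1)))\<le>I/2"
  proof -
   have "I\<ge>0" unfolding I_def using s0 by (intro integral_nonneg_AE) auto
   moreover have "N/(N + 1)\<le>1" using N by simp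
   ultimately have "(N/(N + 1))*(I/2)\<le>1*(I/2)" by (intro mult_right_mono) auto
   then show ?thesis using N by (simp add: field_simps)
  qed
  with le have "I\<le>2*(A*J + B*S + J)" by argo
  also have "...\<le>2*(A + B + 1)*S + 2*(A + B + 1)*J"
   using mult_nonneg_nonneg[OF A0 S0] mult_nonneg_nonneg[OF B0 J0] S0 J0 by (simp add: algebra_simps)
  finally show "(LBINT y. skew_sq H y)\<le>2*(A + B + 1) * sym_norm_sq H + 2*(A + B + 1)*(LBINT y. indicator K y * skew_sq H y)"
   by (simp add: I_def J_def S_def)
 qed
qed

section \<open>Gradients of test functions\<close>

lemma integral_dir_deriv_zero:
 fixes F :: "'a::euclidean_space => real"
 assumes F: "dir_C1 v F F'" and v: "norm v\<le>1" and supp: "\<And>x. F x\<noteq>0 ==> norm x\<le>r" "\<And>x. F' x\<noteq>0 ==> norm x\<le>r"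
 shows "(LBINT x. F' x) = 0"
proof -
 \<comment> \<open>A plateau equal to 1 on the ball of radius \<open>r + 1\<close>: steps of length
   at most 1 from the support of \<open>F\<close> do not leave it, so all its difference quotients
   vanish there.\<close>
 define w :: "'a => real" where "w x = max 0 (min 1 (r + 2 - norm x))" for x
 have w1: "w x = 1" if "norm x\<le>r + 1" for x using that by (simp add: w_def)
 have cw: "continuous_on UNIV w" unfolding w_def by (intro continuous_intros)
 have "(%n. LBINT x. (w (x + (1/Suc n) *\<^sub>R v) - w x)/(1/Suc n)*F x)---->- (LBINT x. w x*F' x)"
  by (rule difference_quotient_by_parts[OF cw _ F, of "r + 2"]) (auto simp: w_def max_def min_def split: if_splits)
 moreover have "(w (x + (1/Suc n) *\<^sub>R v) - w x)/(1/Suc n)*F x = 0" for n x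
 proof (cases "F x = 0")
  case False
  then have x: "norm x\<le>r" by (rule supp)
  have "norm ((1/Suc n) *\<^sub>R v)\<le>1*1" unfolding norm_scaleR using v by (intro mult_mono) auto
  then have "norm (x + (1/Suc n) *\<^sub>R v)\<le>r + 1"
   using norm_triangle_ineq[of x "(1/Suc n) *\<^sub>R v"] x by linarith
  then show ?thesis using x by (simp add: w1)
 qed simp
 moreover have "w x*F' x = F' x" for x using supp(2)[of x] w1[of x] by (cases "F' x = 0") auto
 ultimately have "(%n. 0)---->- (LBINT x. F' x)" by (simp only: integral_zero)
 then show ?thesis using LIMSEQ_unique[OF tendsto_const] by fastforce
qed

lemma test_functions_ibp:
 fixes p q :: "real^'n::finite => real"
 assumes "p\<in>test_functions UNIV" "q\<in>test_functions UNIV"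
 shows "(LBINT x. p x*pd i q x) = - (LBINT x. pd i p x*q x)"
proof -
 have sm: "smooth p" "smooth q" using assms by (auto simp: test_functions_iff)
 obtain r where r: "r > 0" "\<And>x. p x\<noteq>0 ==> norm x\<le>r" using test_function_support[OF assms(1)] by blast
 have r': "norm x\<le>r" if "pd i p x\<noteq>0" for x
 proof -
  have "x\<in>closure {y. p y\<noteq>0}" using that support_partial_derivs[of "[i]" p] by blast
  also have "...\<subseteq>cball 0 r" by (intro closure_minimal) (use r in auto)
  finally show ?thesis by simp
 qed
 have "(LBINT x. pd i p x*q x + p x*pd i q x) = 0"
 proof (rule integral_dir_deriv_zero)
  show "dir_C1 (axis i 1) (%x. p x*q x) (%x. pd i p x*q x + p x*pd i q x)"
   by (intro dir_C1_mult smooth_dir_C1_axis sm)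
  show "norm x\<le>r" if "p x*q x\<noteq>0" for x using that r by auto
  show "norm x\<le>r" if "pd i p x*q x + p x*pd i q x\<noteq>0" for x
   using that r(2)[of x] r'[of x] by (cases "p x = 0"; cases "pd i p x = 0") (simp_all only: mult_zero_left add_0 simp_thms not_True_eq_False)
 qed simp
 moreover note tp = test_functions_partial_derivs[OF assms(1)] test_functions_partial_derivs[OF assms(2)]
 have "integ (%x. pd i p x*q x)" "integ (%x. p x*pd i q x)"
  by (intro sq_int_mult_integrable test_functions_sq_int[OF assms(1)] test_functions_sq_int[OF assms(2)]
    test_functions_sq_int[OF tp(1)] test_functions_sq_int[OF tp(2)])+
 ultimately show ?thesis by (simp only: Bochner_Integration.integral_add)
qed

lemma test_functions_L2z: "p\<in>test_functions G ==> p\<in>L2z G"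
 unfolding L2z_def using test_functions_sq_int closure_subset[of "{y. p y\<noteq>0}"]
 by (fastforce simp: test_functions_iff)

lemma test_functions_UNIV: "p\<in>test_functions G ==> p\<in>test_functions UNIV"
 using test_functions_mono by blast

lemma test_functions_wderiv:
 assumes "p\<in>test_functions G"
 shows "wderiv G i p (pd i p)"
 unfolding wderiv_def
 using test_functions_ibp[OF test_functions_UNIV[OF assms] test_functions_UNIV]
 by (auto intro: test_functions_L2z test_functions_partial_derivs[OF assms] assms simp del: partial_derivs.simps)

lemma test_functions_add_scaled:
 assumes "p\<in>test_functions G" "q\<in>test_functions G"
 shows "(%x. a*p x + b*q x)\<in>test_functions G"
  "partial_derivs as (%x. a*p x + b*q x) = (%x. a*partial_derivs as p x + b*partial_derivs as q x)"
proof -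
 have sm: "smooth p" "smooth q" using assms by (auto simp: test_functions_iff)
 show "(%x. a*p x + b*q x)\<in>test_functions G"
 proof (rule test_functionsI)
  show "smooth (%x. a*p x + b*q x)" by (intro smooth_add smooth_cmult sm)
  show "compact (closure {y. p y\<noteq>0} \<union> closure {y. q y\<noteq>0})" "closure {y. p y\<noteq>0} \<union> closure {y. q y\<noteq>0}\<subseteq>G"
   using assms by (auto simp: test_functions_iff simp del: compact_closure intro!: compact_Un)
  show "y\<in>closure {y. p y\<noteq>0} \<union> closure {y. q y\<noteq>0}" if "a*p y + b*q y\<noteq>0" for y
   using that closure_subset[of "{y. p y\<noteq>0}"] closure_subset[of "{y. q y\<noteq>0}"] by (cases "p y = 0") auto
 qed
 show "partial_derivs as (%x. a*p x + b*q x) = (%x. a*partial_derivs as p x + b*partial_derivs as q x)"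
  by (simp add: partial_derivs_add[OF smooth_cmult[OF sm(1)] smooth_cmult[OF sm(2)]] partial_derivs_cmult[OF sm(1)] partial_derivs_cmult[OF sm(2)])
qed

lemma L2z_limit:
 assumes G: "G\<in>sets borel" and s: "\<And>n. s n\<in>L2z G" and C: "ltwo_Cauchy lborel s"
 obtains f where "f\<in>L2z G" "(%n. nrm (%x. s n x - f x))---->0"
proof -
 obtain f where f: "f\<in>sqi" "(%n. nrm (%x. s n x - f x))---->0"
  using ltwo_complete[OF L2zD(1)[OF s] C] by blast
 define g where "g x = indicator G x*f x" for x
 have g: "g\<in>sqi" unfolding g_def
  by (rule sq_int_bounded_mult[OF f(1), of _ 1]) (use G in \<open>auto simp: indicator_def\<close>)
 have "g\<in>L2z G" using g by (simp add: L2z_def g_def)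
 moreover have "(%n. nrm (%x. s n x - g x))---->0"
 proof (rule Lim_null_comparison[OF always_eventually f(2)], rule)
  fix n
  have "nrm (%x. s n x - g x)\<le>nrm (%x. s n x - f x)"
  proof (rule ltwo_mono_AE)
   show "(%x. s n x - g x)\<in>borel_measurable lborel" by (intro sq_int_measurable sq_int_diff L2zD(1)[OF s] g)
   show "(%x. s n x - f x)\<in>sqi" by (intro sq_int_diff L2zD(1)[OF s] f)
   show "AE x in lborel. \<bar>s n x - g x\<bar>\<le>\<bar>s n x - f x\<bar>"
    using L2zD(2)[OF s] by (auto simp: g_def indicator_def)
  qed
  then show "norm (nrm (%x. s n x - g x))\<le>nrm (%x. s n x - f x)" by simp
 qed
 ultimately show ?thesis by (rule that)
qed

lemma ltwo_expand:
 assumes "f\<in>sq_int M" "g\<in>sq_int M"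
 shows "(ltwo M (%x. f x - t*g x))^2 = (ltwo M f)^2 - 2*t*(\<integral>x. f x*g x \<partial>M) + t^2*(ltwo M g)^2"
proof -
 have "(%x. (f x - t*g x)^2) = (%x. (f x)^2 - 2*t*(f x*g x) + t^2*(g x)^2)"
  by (auto simp: power2_eq_square algebra_simps)
 then show ?thesis
  using sq_int_integrable[OF assms(1)] sq_int_integrable[OF assms(2)] sq_int_mult_integrable[OF assms]
  by (simp add: ltwo_sq)
qed

lemma ltwo_add_sq:
 assumes "f\<in>sq_int M" "g\<in>sq_int M"
 shows "(ltwo M (%x. f x + g x))^2\<le>2*(ltwo M f)^2 + 2*(ltwo M g)^2"
proof -
 have "(ltwo M (%x. f x + g x))^2\<le>(ltwo M f + ltwo M g)^2"
  by (intro power_mono ltwo_triangle assms) simp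
 also have "...\<le>2*(ltwo M f)^2 + 2*(ltwo M g)^2"
  using sum_squares_bound[of "ltwo M f" "ltwo M g"] by (simp add: power2_sum)
 finally show ?thesis .
qed

lemma ltwo_diff_sq:
 assumes "f\<in>sq_int M" "g\<in>sq_int M"
 shows "(ltwo M (%x. f x - g x))^2\<le>2*(ltwo M f)^2 + 2*(ltwo M g)^2"
 using ltwo_add_sq[OF assms(1) sq_int_uminus[OF assms(2)]] by simp

lemma quadratic_nonneg_imp_zero:
 fixes X Y :: real
 assumes "Y\<ge>0" "\<And>t. 0\<le>t^2*Y - 2*t*X"
 shows "X = 0"
proof (rule ccontr)
 assume "X\<noteq>0"
 define t where "t = X/(Y + 1)"
 have Y1: "Y + 1 > 0" using assms(1) by simp
 have X: "X = t*(Y + 1)" using Y1 by (simp add: t_def)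
 have "t\<noteq>0" using \<open>X \<noteq> 0\<close> X by auto
 then have "t^2 > 0" by simp
 have "t^2*Y - 2*t*X = - (t^2*(Y + 2))" unfolding X by (simp add: power2_eq_square algebra_simps)
 also have "... < 0" using \<open>t^2 > 0\<close> assms(1) by (simp add: mult_pos_pos)
 finally show False using assms(2)[of t] by simp
qed

lemma LIMSEQ_near_Inf:
 fixes q :: "nat => real"
 assumes "\<And>n. d\<le>q n" "\<And>n. q n\<le>d + 1/real (Suc n)"
 shows "q---->d"
proof (rule tendsto_sandwich[of "%_. d" _ _ "%n. d + 1/real (Suc n)"])
 show "(%n. d + 1/real (Suc n))---->d"
  using tendsto_add[OF tendsto_const[of d] LIMSEQ_Suc[OF lim_1_over_n]] by simp
qed (use assms in auto)

text \<open>Uniform convexity in abstract form: \<open>d\<close> bounds the value at the midpoint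
  from below and \<open>c\<close> times the squared distance is the gain of convexity. The values
  \<open>q\<close> may contain error terms as long as they tend to \<open>d\<close>.\<close>

lemma ltwo_CauchyI_minimizing:
 assumes q: "q---->d" and D: "\<And>m n. d + c*(ltwo M (%x. s m x - s n x))^2\<le>(q m + q n)/2" and c: "c > 0"
 shows "ltwo_Cauchy M s"
 unfolding ltwo_Cauchy_def
proof (intro allI impI)
 fix e :: real assume e: "e > 0"
 have "eventually (%n. q n < d + c*e^2) sequentially"
  using q e c by (intro order_tendstoD(2)) auto
 then obtain N where N: "\<And>n. n\<ge>N ==> q n < d + c*e^2" by (auto simp: eventually_sequentially)
 have "ltwo M (%x. s m x - s n x) < e" if "m\<ge>N" "n\<ge>N" for m n
 proof -
  have "c*(ltwo M (%x. s m x - s n x))^2 < c*e^2" using D[of m n] N[OF that(1)] N[OF that(2)] by argo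
  then have "(ltwo M (%x. s m x - s n x))^2 < e^2" using c by simp
  then show ?thesis using e by (auto intro: power2_less_imp_less)
 qed
 then show "\<exists>N. \<forall>m\<ge>N. \<forall>n\<ge>N. ltwo M (%x. s m x - s n x) < e" by blast
qed

text \<open>Orthogonal projection onto the closure of the gradients of test functions, obtained from
  a minimizing sequence and the parallelogram identity. Only the gradients are shown to converge;
  the sequence \<open>f\<close> is returned because curl-freeness of the limit is read off from it.
  The last bound compares with the zero function.\<close>

lemma gradient_projection:
 fixes G :: "(real^2) set"
 assumes G: "open G" and b: "b1\<in>L2z G" "b2\<in>L2z G"
 obtains p1 p2 f where "p1\<in>L2z G" "p2\<in>L2z G" "\<And>n. f n\<in>test_functions G"
  "(%n. nrm (%x. pd 1 (f n) x - p1 x))---->0"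
  "(%n. nrm (%x. pd 2 (f n) x - p2 x))---->0"
  "\<And>g. g\<in>test_functions G ==>
    (LBINT x. (b1 x - p1 x)*pd 1 g x) + (LBINT x. (b2 x - p2 x)*pd 2 g x) = 0"
  "(nrm (%x. b1 x - p1 x))^2 + (nrm (%x. b2 x - p2 x))^2\<le>(nrm b1)^2 + (nrm b2)^2"
proof -
 define q where "q f = (nrm (%x. b1 x - pd 1 f x))^2 + (nrm (%x. b2 x - pd 2 f x))^2" for f
 let ?T = "test_functions G"
 have q0: "q f\<ge>0" for f by (simp add: q_def)
 have zero: "(%x. 0)\<in>?T"
  using bump_class_smooth[OF bump_class.const[of 0]] by (intro test_functionsI[of _ "{}"]) auto
 have pz: "pd i (%x. 0) = (%x. 0)" for i :: 2
  by (simp add: fun_eq_iff)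
 define d where "d = (INF f\<in>?T. q f)"
 have bdd: "bdd_below (q ` ?T)" using q0 by (intro bdd_belowI[of _ 0]) auto
 have dle: "d\<le>q f" if "f\<in>?T" for f unfolding d_def by (rule cINF_lower[OF bdd that])
 have "\<exists>f\<in>?T. q f\<le>d + 1/real (Suc n)" for n
 proof (rule ccontr)
  assume "\<not> ?thesis"
  then have "d + 1/real (Suc n)\<le>q f" if "f\<in>?T" for f using that by force
  then have "d + 1/real (Suc n)\<le>d" unfolding d_def using zero by (intro cINF_greatest) auto
  moreover have "0 < 1/real (Suc n)" by simp
  ultimately show False by linarith
 qed
 then obtain f where f: "\<And>n. f n\<in>?T" "\<And>n. q (f n)\<le>d + 1/real (Suc n)" by metis
 have ql: "(%n. q (f n))---->d" by (rule LIMSEQ_near_Inf) (use dle f in auto)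
 have tz: "pd i g\<in>L2z G" if "g\<in>?T" for i g
  by (rule test_functions_L2z[OF test_functions_partial_derivs[OF that]])
 note tsq = L2zD(1)[OF tz] L2zD(1)[OF b(1)] L2zD(1)[OF b(2)]
 have mid: "d + 1/4*((nrm (%x. pd 1 (f m) x - pd 1 (f n) x))^2
   + (nrm (%x. pd 2 (f m) x - pd 2 (f n) x))^2)\<le>(q (f m) + q (f n))/2" for m n
 proof -
  note cmb = test_functions_add_scaled[OF f(1)[of m] f(1)[of n], where a="1/2" and b="1/2"]
  have par: "(nrm (%x. bb x - (1/2*pd i (f m) x + 1/2*pd i (f n) x)))^2
    + 1/4*(nrm (%x. pd i (f m) x - pd i (f n) x))^2
   = ((nrm (%x. bb x - pd i (f m) x))^2 + (nrm (%x. bb x - pd i (f n) x))^2)/2"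
   if bb: "bb\<in>sqi" for bb i
  proof -
   note pl = ltwo_parallelogram[OF sq_int_diff[OF bb tsq(1)[OF f(1)]] sq_int_diff[OF bb tsq(1)[OF f(1)]], of i m i n]
   have e1: "(%x. (bb x - pd i (f m) x + (bb x - pd i (f n) x))/2)
    = (%x. bb x - (1/2*pd i (f m) x + 1/2*pd i (f n) x))"
    by (rule ext) argo
   have e2: "(%x. bb x - pd i (f m) x - (bb x - pd i (f n) x))
    = (%x. pd i (f n) x - pd i (f m) x)" by (rule ext) argo
   from pl show ?thesis unfolding e1 e2
    by (subst ltwo_diff_commute[of _ "pd i (f m)"]) argo
  qed
  have "d\<le>q (%x. 1/2*f m x + 1/2*f n x)" by (rule dle[OF cmb(1)])
  then show ?thesis using par[OF tsq(2), of 1] par[OF tsq(3), of 2] unfolding q_def cmb(2) by argo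
 qed
 have C1: "ltwo_Cauchy lborel (%n. pd 1 (f n))"
 proof (rule ltwo_CauchyI_minimizing[OF ql])
  fix m n
  have "0\<le>(nrm (%x. pd 2 (f m) x - pd 2 (f n) x))^2" by simp
  with mid[of m n] show "d + 1/4*(nrm (%x. pd 1 (f m) x - pd 1 (f n) x))^2\<le>(q (f m) + q (f n))/2"
   by argo
 qed simp
 have C2: "ltwo_Cauchy lborel (%n. pd 2 (f n))"
 proof (rule ltwo_CauchyI_minimizing[OF ql])
  fix m n
  have "0\<le>(nrm (%x. pd 1 (f m) x - pd 1 (f n) x))^2" by simp
  with mid[of m n] show "d + 1/4*(nrm (%x. pd 2 (f m) x - pd 2 (f n) x))^2\<le>(q (f m) + q (f n))/2"
   by argo
 qed simp
 have mG: "G\<in>sets borel" using G by simp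
 obtain p1 where p1: "p1\<in>L2z G" "(%n. nrm (%x. pd 1 (f n) x - p1 x))---->0"
  using L2z_limit[OF mG tz[OF f(1)] C1] by blast
 obtain p2 where p2: "p2\<in>L2z G" "(%n. nrm (%x. pd 2 (f n) x - p2 x))---->0"
  using L2z_limit[OF mG tz[OF f(1)] C2] by blast
 note psq = L2zD(1)[OF p1(1)] L2zD(1)[OF p2(1)]
 have lim: "(%n. nrm (%x. (bb x - pd i (f n) x) - (bb x - p x)))---->0"
  if "(%n. nrm (%x. pd i (f n) x - p x))---->0" for bb p :: "real^2 => real" and i
 proof -
  have "(%x. (bb x - pd i (f n) x) - (bb x - p x)) = (%x. p x - pd i (f n) x)" for n by auto
  then show ?thesis using that by (simp only: ltwo_diff_commute[of _ p])
 qed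
 have dq: "d = (nrm (%x. b1 x - p1 x))^2 + (nrm (%x. b2 x - p2 x))^2"
 proof (rule LIMSEQ_unique[OF ql])
  show "(%n. q (f n))---->(nrm (%x. b1 x - p1 x))^2 + (nrm (%x. b2 x - p2 x))^2"
   unfolding q_def
   by (intro tendsto_add tendsto_power ltwo_tendsto_norm[OF _ _ lim[OF p1(2)]] ltwo_tendsto_norm[OF _ _ lim[OF p2(2)]]
     sq_int_diff tsq psq f(1))
 qed
 show ?thesis
 proof (rule that[OF p1(1) p2(1) f(1) p1(2) p2(2)])
  show "(nrm (%x. b1 x - p1 x))^2 + (nrm (%x. b2 x - p2 x))^2\<le>(nrm b1)^2 + (nrm b2)^2"
   using dle[OF zero] unfolding dq[symmetric] q_def pz by simp
  fix g assume g: "g\<in>?T"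
  let ?X1 = "%p. LBINT x. (b1 x - p x)*pd 1 g x"
  let ?X2 = "%p. LBINT x. (b2 x - p x)*pd 2 g x"
  define Y where "Y = (nrm (pd 1 g))^2 + (nrm (pd 2 g))^2"
  show "?X1 p1 + ?X2 p2 = 0"
  proof (rule quadratic_nonneg_imp_zero[of Y])
   show "Y\<ge>0" by (simp add: Y_def)
   fix t
   have ge: "d\<le>q (f n) - 2*t*(?X1 (pd 1 (f n)) + ?X2 (pd 2 (f n))) + t^2*Y" for n
   proof -
    note cmb = test_functions_add_scaled[OF f(1)[of n] g, where a=1 and b=t]
    have e: "(%x. bb x - (1*pd i (f n) x + t*pd i g x))
     = (%x. (bb x - pd i (f n) x) - t*pd i g x)" for bb :: "real^2 => real" and i by auto
    have "d\<le>q (%x. 1*f n x + t*g x)" by (rule dle[OF cmb(1)])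
    also have "... = q (f n) - 2*t*(?X1 (pd 1 (f n)) + ?X2 (pd 2 (f n))) + t^2*Y"
     unfolding q_def cmb(2) e Y_def
     by (simp only: ltwo_expand[OF sq_int_diff[OF tsq(2) tsq(1)[OF f(1)]] tsq(1)[OF g]]
       ltwo_expand[OF sq_int_diff[OF tsq(3) tsq(1)[OF f(1)]] tsq(1)[OF g]] distrib_left)
    finally show ?thesis .
   qed
   have "(%n. q (f n) - 2*t*(?X1 (pd 1 (f n)) + ?X2 (pd 2 (f n))) + t^2*Y)
    ----> d - 2*t*(?X1 p1 + ?X2 p2) + t^2*Y"
    by (intro tendsto_add tendsto_diff tendsto_mult tendsto_const ql
      ltwo_tendsto_inner[OF _ _ lim[OF p1(2)]] ltwo_tendsto_inner[OF _ _ lim[OF p2(2)]] sq_int_diff tsq psq f(1) g)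
   then have "d\<le>d - 2*t*(?X1 p1 + ?X2 p2) + t^2*Y" by (rule LIMSEQ_le_const) (use ge in auto)
   then show "0\<le>t^2*Y - 2*t*(?X1 p1 + ?X2 p2)" by linarith
  qed
 qed
qed

section \<open>Korn's inequality\<close>

lemma conv_via_translate:
 fixes K :: "real^2 => real"
 assumes K: "K\<in>test_functions UNIV" "\<forall>z. K z\<noteq>0 --> norm z\<le>e" "cball x e\<subseteq>G"
 shows "conv f (pd i K) x = - (LBINT y. f y*pd i (%y. K (x - y)) y)"
 unfolding conv_def translated_kernel(2)[OF K] by simp

text \<open>Both sides equal minus the integral of \<open>u\<close> against a mixed derivative of
  \<open>q\<close>: weak gradients are curl-free.\<close>

lemma wderiv_cross:
 assumes w: "wderiv G 1 u a" "wderiv G 2 u b" and q: "q\<in>test_functions G"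
 shows "(LBINT x. a x*pd 2 q x) = (LBINT x. b x*pd 1 q x)"
proof -
 have sm: "smooth q" using q by (simp add: test_functions_iff)
 note tp = test_functions_partial_derivs[OF q]
 have 1: "(LBINT x. u x*pd 1 (pd 2 q) x) = - (LBINT x. a x*pd 2 q x)"
  using w(1) tp[of "[2]"] unfolding wderiv_def by blast
 have 2: "(LBINT x. u x*pd 2 (pd 1 q) x) = - (LBINT x. b x*pd 1 q x)"
  using w(2) tp[of "[1]"] unfolding wderiv_def by blast
 have "pd 1 (pd 2 q) = pd 2 (pd 1 q)"
  using smooth_mixed_partials[OF sm, of 1 2] by (simp only: partial_derivs_append append.simps) (rule ext)
 then show ?thesis using 1 2 by simp
qed

text \<open>The matrix field \<open>(a - d, b + c; b + c, d - a)\<close> is \<open>2 e - tr(e) I\<close>; it differs from the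
 gradient \<open>(a, b; c, d)\<close> of \<open>(u, v)\<close> by a divergence-free field. Subtracting its projection
 onto the gradients of test functions therefore leaves a harmonic field.\<close>

lemma korn_harmonic_remainder:
 assumes G: "open G" "bounded G"
  and w: "wderiv G 1 u a" "wderiv G 2 u b" "wderiv G 1 v c" "wderiv G 2 v d"
 obtains P :: "2 => 2 => real^2 => real" where "\<And>i j. P i j\<in>L2z G"
  "harmonic_field G (%i j x. (if i = 1 then if j = 1 then a else b else if j = 1 then c else d) x - P i j x)"
  "\<And>i j. (nrm (P i j))^2\<le>8*((nrm a)^2 + (nrm d)^2 + (nrm (%x. b x + c x))^2)"
proof -
 have z: "u\<in>L2z G" "v\<in>L2z G" "a\<in>L2z G" "b\<in>L2z G" "c\<in>L2z G" "d\<in>L2z G"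
  using w by (auto simp: wderiv_def)
 note sq = z[THEN L2zD(1)]
 define s where "s x = b x + c x" for x
 define e where "e x = a x - d x" for x
 define e' where "e' x = d x - a x" for x
 have zs: "s\<in>L2z G" "e\<in>L2z G" "e'\<in>L2z G"
  unfolding s_def e_def e'_def by (intro L2z_add L2z_diff z)+
 define E where "E = (nrm a)^2 + (nrm d)^2 + (nrm s)^2"
 have nE: "(nrm e)^2 + (nrm s)^2\<le>2*E" "(nrm s)^2 + (nrm e')^2\<le>2*E"
  using ltwo_diff_sq[OF sq(3,6)] ltwo_diff_sq[OF sq(6,3)] zero_le_power2[of "nrm s"]
  unfolding E_def e_def e'_def distrib_left by linarith+
 have nP: "(nrm p)^2\<le>8*E"
  if "f\<in>sqi" "p\<in>sqi" "(nrm (%x. f x - p x))^2\<le>2*E" "(nrm f)^2\<le>2*E" for f p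
  using ltwo_diff_sq[OF that(1) sq_int_diff[OF that(1,2)]] that(3,4) by simp
 obtain p11 p12 q where r1: "p11\<in>L2z G" "p12\<in>L2z G" "\<And>n. q n\<in>test_functions G"
  "(%n. nrm (%x. pd 1 (q n) x - p11 x))---->0"
  "(%n. nrm (%x. pd 2 (q n) x - p12 x))---->0"
  "\<And>\<psi>. \<psi>\<in>test_functions G ==>
    (LBINT x. (e x - p11 x)*pd 1 \<psi> x) + (LBINT x. (s x - p12 x)*pd 2 \<psi> x) = 0"
  "(nrm (%x. e x - p11 x))^2 + (nrm (%x. s x - p12 x))^2\<le>(nrm e)^2 + (nrm s)^2"
  by (rule gradient_projection[OF G(1) zs(2,1)]) (rule that)
 obtain p21 p22 q' where r2: "p21\<in>L2z G" "p22\<in>L2z G" "\<And>n. q' n\<in>test_functions G"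
  "(%n. nrm (%x. pd 1 (q' n) x - p21 x))---->0"
  "(%n. nrm (%x. pd 2 (q' n) x - p22 x))---->0"
  "\<And>\<psi>. \<psi>\<in>test_functions G ==>
    (LBINT x. (s x - p21 x)*pd 1 \<psi> x) + (LBINT x. (e' x - p22 x)*pd 2 \<psi> x) = 0"
  "(nrm (%x. s x - p21 x))^2 + (nrm (%x. e' x - p22 x))^2\<le>(nrm s)^2 + (nrm e')^2"
  by (rule gradient_projection[OF G(1) zs(1,3)]) (rule that)
 define P :: "2 => 2 => real^2 => real" where
  "P i j = (if i = 1 then if j = 1 then p11 else p12 else if j = 1 then p21 else p22)" for i j
 note pz = r1(1,2) r2(1,2)
 note psq = pz[THEN L2zD(1)] and zsq = zs[THEN L2zD(1)]
 have sep: "X\<le>T\<and>Y\<le>T" if "X + Y\<le>U" "U\<le>T" "0\<le>X" "0\<le>Y" for X Y U T :: real using that by linarith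
 note b1 = sep[OF r1(7) nE(1) zero_le_power2 zero_le_power2] sep[OF r2(7) nE(2) zero_le_power2 zero_le_power2]
  sep[OF order_refl nE(1) zero_le_power2 zero_le_power2] sep[OF order_refl nE(2) zero_le_power2 zero_le_power2]
 have bounds: "(nrm p11)^2\<le>8*E" "(nrm p12)^2\<le>8*E" "(nrm p21)^2\<le>8*E" "(nrm p22)^2\<le>8*E"
  using nP[OF zsq(2) psq(1)] nP[OF zsq(1) psq(2)] nP[OF zsq(1) psq(3)] nP[OF zsq(3) psq(4)] b1 by blast+
 have harm: "harmonic_field G (%i j x. (if i = 1 then if j = 1 then a else b else if j = 1 then c else d) x - P i j x)" (is "harmonic_field G ?H")
  unfolding harmonic_field_def
 proof (intro conjI allI impI)
  show "?H i j\<in>L2z G" for i j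
   by (cases "i = 1"; cases "j = 1") (auto simp: P_def intro!: L2z_diff z pz)
  fix x :: "real^2" and t and K :: "real^2 => real" and i :: 2
  assume "K\<in>test_functions UNIV\<and>(\<forall>z. K z\<noteq>0 --> norm z\<le>t)\<and>cball x t\<subseteq>G"
  then have K: "K\<in>test_functions UNIV" "\<forall>z. K z\<noteq>0 --> norm z\<le>t" "cball x t\<subseteq>G" by auto
  define \<psi> where "\<psi> = (%y. K (x - y))"
  have \<psi>: "\<psi>\<in>test_functions G" unfolding \<psi>_def by (rule translated_kernel(1)[OF K])
  note cv = conv_via_translate[OF K, folded \<psi>_def]
  have tsq: "pd k \<psi>\<in>sqi" for k
   by (rule L2zD(1)[OF test_functions_L2z[OF test_functions_partial_derivs[OF \<psi>]]])
  note mi = sq_int_mult_integrable[OF _ tsq]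
  have idf: "(LBINT x. (f x - g x)*pd k \<psi> x)
    = (LBINT x. f x*pd k \<psi> x) - (LBINT x. g x*pd k \<psi> x)"
   if "f\<in>sqi" "g\<in>sqi" for f g k
   using mi[OF that(1)] mi[OF that(2)] by (simp only: left_diff_distrib Bochner_Integration.integral_diff)
  have iadd: "(LBINT x. (f x + g x)*pd k \<psi> x)
    = (LBINT x. f x*pd k \<psi> x) + (LBINT x. g x*pd k \<psi> x)"
   if "f\<in>sqi" "g\<in>sqi" for f g k
   using mi[OF that(1)] mi[OF that(2)] by (simp only: distrib_right Bochner_Integration.integral_add)
  have O1: "(LBINT x. e x*pd 1 \<psi> x) - (LBINT x. p11 x*pd 1 \<psi> x)
    + ((LBINT x. s x*pd 2 \<psi> x) - (LBINT x. p12 x*pd 2 \<psi> x)) = 0"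
   using r1(6)[OF \<psi>] unfolding idf[OF zsq(2) psq(1)] idf[OF zsq(1) psq(2)] .
  have O2: "(LBINT x. s x*pd 1 \<psi> x) - (LBINT x. p21 x*pd 1 \<psi> x)
    + ((LBINT x. e' x*pd 2 \<psi> x) - (LBINT x. p22 x*pd 2 \<psi> x)) = 0"
   using r2(6)[OF \<psi>] unfolding idf[OF zsq(1) psq(3)] idf[OF zsq(3) psq(4)] .
  note es = idf[OF sq(3,6), folded e_def] idf[OF sq(6,3), folded e'_def] iadd[OF sq(4,5), folded s_def]
  note cu = wderiv_cross[OF w(1,2) \<psi>] and cv' = wderiv_cross[OF w(3,4) \<psi>]
  \<comment> \<open>The rows \<open>(a, b)\<close> and \<open>(e, s)\<close> differ by
    \<open>(d, -c)\<close>, which is divergence-free by the cross relation for \<open>v\<close>. The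
    second row works in the same way with \<open>(-b, a)\<close> and the relation for
    \<open>u\<close>.\<close>
  have D1: "(LBINT x. (a x - p11 x)*pd 1 \<psi> x) + (LBINT x. (b x - p12 x)*pd 2 \<psi> x) = 0"
   using O1 cu cv' unfolding idf[OF sq(3) psq(1)] idf[OF sq(4) psq(2)] es by argo
  have D2: "(LBINT x. (c x - p21 x)*pd 1 \<psi> x) + (LBINT x. (d x - p22 x)*pd 2 \<psi> x) = 0"
   using O2 cu cv' unfolding idf[OF sq(5) psq(3)] idf[OF sq(6) psq(4)] es by argo
  show "conv (?H i 1) (pd 1 K) x + conv (?H i 2) (pd 2 K) x = 0"
   unfolding cv using D1 D2 by (cases "i = 1") (simp_all add: P_def del: partial_derivs.simps)
  have curlP: "(LBINT x. p x*pd 2 \<psi> x) = (LBINT x. p' x*pd 1 \<psi> x)"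
   if p: "p\<in>L2z G" "p'\<in>L2z G" and f: "\<And>n. f n\<in>test_functions G"
    "(%n. nrm (%x. pd 1 (f n) x - p x))---->0"
    "(%n. nrm (%x. pd 2 (f n) x - p' x))---->0" for p p' f
  proof (rule LIMSEQ_unique)
   have fs: "pd k (f n)\<in>sqi" for k n
    by (rule L2zD(1)[OF test_functions_L2z[OF test_functions_partial_derivs[OF f(1)]]])
   show "(%n. LBINT x. pd 1 (f n) x*pd 2 \<psi> x)---->(LBINT x. p x*pd 2 \<psi> x)"
    by (rule ltwo_tendsto_inner[OF L2zD(1)[OF p(1)] fs f(2) tsq])
   have "(%n. LBINT x. pd 2 (f n) x*pd 1 \<psi> x)---->(LBINT x. p' x*pd 1 \<psi> x)"
    by (rule ltwo_tendsto_inner[OF L2zD(1)[OF p(2)] fs f(3) tsq])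
   moreover have "(LBINT x. pd 1 (f n) x*pd 2 \<psi> x) = (LBINT x. pd 2 (f n) x*pd 1 \<psi> x)" for n
    by (rule wderiv_cross[OF test_functions_wderiv[OF f(1)] test_functions_wderiv[OF f(1)] \<psi>])
   ultimately show "(%n. LBINT x. pd 1 (f n) x*pd 2 \<psi> x)---->(LBINT x. p' x*pd 1 \<psi> x)"
    by (simp only:)
  qed
  have "(LBINT x. (a x - p11 x)*pd 2 \<psi> x) = (LBINT x. (b x - p12 x)*pd 1 \<psi> x)"
   unfolding idf[OF sq(3) psq(1)] idf[OF sq(4) psq(2)] using cu curlP[OF r1(1-5)] by argo
  moreover have "(LBINT x. (c x - p21 x)*pd 2 \<psi> x) = (LBINT x. (d x - p22 x)*pd 1 \<psi> x)"
   unfolding idf[OF sq(5) psq(3)] idf[OF sq(6) psq(4)] using cv' curlP[OF r2(1-5)] by argo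
  ultimately show "conv (?H i 1) (pd 2 K) x = conv (?H i 2) (pd 1 K) x"
   unfolding cv by (cases "i = 1") (simp_all add: P_def del: partial_derivs.simps)
 qed
 have Pz: "P i j\<in>L2z G" for i j by (simp add: P_def pz)
 have "(nrm (P i j))^2\<le>8*E" for i j using bounds by (simp add: P_def)
 from that[OF Pz harm this[unfolded E_def s_def]] show ?thesis .
qed

text \<open>The skew entry \<open>c - b\<close> splits into the skew entry \<open>p\<close> of the
  projection, bounded by the symmetric data, and the skew entry \<open>h\<close> of a harmonic
  field. The global estimate for \<open>h\<close> leaves an integral over a compact set, to which
  the interior inequality applies; the norm of \<open>u\<close> enters only there.\<close>

theorem korn_inequality:
 assumes G: "open G" "bounded G" and lip: "lipschitz_boundary G"
 obtains C where "C\<ge>0" "\<And>u v a b c d. wderiv G 1 u a ==> wderiv G 2 u b ==> wderiv G 1 v c ==> wderiv G 2 v d ==>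
   (nrm b)^2 + (nrm c)^2
   \<le> C*((nrm u)^2 + (nrm a)^2 + (nrm d)^2 + (nrm (%x. b x + c x))^2)"
proof -
 obtain C K where CK: "C\<ge>0" "compact K" "K\<subseteq>G" "\<And>H. harmonic_field G H ==>
  (LBINT y. skew_sq H y)\<le>C * sym_norm_sq H + C*(LBINT y. indicator K y * skew_sq H y)"
  by (rule harmonic_field_estimate[OF G lip]) (rule that)
 obtain L q where q: "lip_bump L q" "closure {x. q x\<noteq>0}\<subseteq>G" "\<And>x. x\<in>K ==> q x = 1" "\<And>x. q x\<le>1"
  by (rule compact_cutoff[OF G(1) CK(2,3)]) (rule that)
 have [measurable]: "q\<in>bmeas" by (rule lip_bumpD(5)[OF q(1)])
 have q1: "\<bar>(q x)^2\<bar>\<le>1" for x using q(4)[of x] lip_bumpD(2)[OF q(1), of x] by (simp add: power_le_one)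
 have mK: "K\<in>sets borel" using CK(2) by (intro borel_closed compact_imp_closed)
 \<comment> \<open>Here \<open>129 = 53 + 76\<close>: the first number is
   \<open>18 + 17 + 18\<close> from the symmetric part of the harmonic field, while 76 and 128 come
   from the interior estimate on \<open>K\<close>. The 34 arises when \<open>b\<close> and
   \<open>c\<close> are recovered from \<open>s\<close>, \<open>h\<close> and
   \<open>p\<close>.\<close>
 define D where "D = 34 + 2*C*(129 + 128*L^2)"
 show ?thesis
 proof (rule that)
  show "D\<ge>0" using CK(1) by (simp add: D_def)
  fix u v a b c d
  assume w: "wderiv G 1 u a" "wderiv G 2 u b" "wderiv G 1 v c" "wderiv G 2 v d"
  have z: "u\<in>L2z G" "v\<in>L2z G" "a\<in>L2z G" "b\<in>L2z G" "c\<in>L2z G" "d\<in>L2z G"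
   using w by (auto simp: wderiv_def)
  note sq = z[THEN L2zD(1)]
  let ?n = "%f. (nrm f)^2"
  define s where "s x = b x + c x" for x
  have ssq: "s\<in>sqi" unfolding s_def by (intro sq_int_add sq)
  define E where "E = ?n a + ?n d + ?n s"
  define U where "U = ?n u"
  have E: "?n a\<le>E" "?n d\<le>E" "?n s\<le>E" "E\<ge>0" "U\<ge>0" by (simp_all add: E_def U_def)
  obtain P :: "2 => 2 => real^2 => real" where P: "\<And>i j. P i j\<in>L2z G"
   "harmonic_field G (%i j x. (if i = 1 then if j = 1 then a else b else if j = 1 then c else d) x - P i j x)"
   "\<And>i j. ?n (P i j)\<le>8*(?n a + ?n d + ?n (%x. b x + c x))"
   by (rule korn_harmonic_remainder[OF G w]) (rule that)
  note Psq = L2zD(1)[OF P(1)]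
  have PE: "?n (P i j)\<le>8*E" for i j using P(3)[of i j] by (simp add: E_def s_def[abs_def])
  define H :: "2 => 2 => real^2 => real" where
   "H = (%i j x. (if i = 1 then if j = 1 then a else b else if j = 1 then c else d) x - P i j x)"
  have hH: "harmonic_field G H" using P(2) by (simp add: H_def)
  have Hij: "H 1 1 = (%x. a x - P 1 1 x)" "H 1 2 = (%x. b x - P 1 2 x)" "H 2 1 = (%x. c x - P 2 1 x)" "H 2 2 = (%x. d x - P 2 2 x)"
   by (simp_all add: H_def)
  define p where "p x = P 2 1 x - P 1 2 x" for x
  have psq: "p\<in>sqi" unfolding p_def by (intro sq_int_diff Psq)
  have pE: "?n p\<le>32*E" unfolding p_def using ltwo_diff_sq[OF Psq Psq, of 2 1 1 2] PE[of 2 1] PE[of 1 2] by linarith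
  define h where "h x = c x - b x - p x" for x
  have hsq: "h\<in>sqi" unfolding h_def by (intro sq_int_diff sq psq)
  have hh: "skew_sq H x = (h x)^2" for x by (simp add: skew_sq_def Hij h_def p_def algebra_simps)
  have S: "sym_norm_sq H\<le>53*E"
  proof -
   have 1: "?n (H 1 1)\<le>18*E" unfolding Hij using ltwo_diff_sq[OF sq(3) Psq, of 1 1] PE[of 1 1] E by linarith
   have 2: "?n (H 2 2)\<le>18*E" unfolding Hij using ltwo_diff_sq[OF sq(6) Psq, of 2 2] PE[of 2 2] E by linarith
   have 3: "?n (%x. (H 1 2 x + H 2 1 x)/2)\<le>17*E"
   proof -
    have eq: "(%x. (H 1 2 x + H 2 1 x)/2) = (%x. 1/2*(s x - (P 1 2 x + P 2 1 x)))"
     by (simp add: Hij s_def fun_eq_iff)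
    have "?n (%x. s x - (P 1 2 x + P 2 1 x))\<le>66*E"
     using ltwo_diff_sq[OF ssq sq_int_add[OF Psq Psq], of 1 2 2 1] ltwo_add_sq[OF Psq Psq, of 1 2 2 1] PE[of 1 2] PE[of 2 1] E
     by linarith
    then show ?thesis unfolding eq ltwo_cmult using E(4) by (simp add: power_mult_distrib power_divide)
   qed
   show ?thesis unfolding sym_norm_sq_def using 1 2 3 by linarith
  qed
  have I: "?n h\<le>C*(53*E) + C*(76*E + 128*L^2*U)"
  proof -
   have ii: "integ (%x. (q x)^2*(f x)^2)" if "f\<in>sqi" for f
    by (rule sq_int_weighted_integrable[OF that _ q1]) measurable
   have le: "(LBINT x. (q x)^2*(f x)^2)\<le>?n f" if f: "f\<in>sqi" for f
    unfolding ltwo_sq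
   proof (rule integral_mono[OF ii[OF f] sq_int_integrable[OF f]])
    show "(q x)^2*(f x)^2\<le>(f x)^2" for x using mult_right_mono[of "(q x)^2" 1 "(f x)^2"] q1[of x] by simp
   qed
   have "(LBINT y. indicator K y * skew_sq H y)
     \<le> (LBINT x. 4*((q x)^2*(c x)^2) + 4*((q x)^2*(b x)^2) + 2*((q x)^2*(p x)^2))"
   proof (rule integral_mono)
    show "integ (%y. indicator K y * skew_sq H y)"
     by (rule skew_sq_weighted_integrable[OF hH, of _ 1]) (use mK in \<open>auto simp: indicator_def\<close>)
    show "integ (%x. 4*((q x)^2*(c x)^2) + 4*((q x)^2*(b x)^2) + 2*((q x)^2*(p x)^2))"
     by (intro Bochner_Integration.integrable_add integrable_mult_right ii sq psq)
    fix x
    have "(h x)^2\<le>4*(c x)^2 + 4*(b x)^2 + 2*(p x)^2"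
    proof -
     have "0\<le>(c x - b x + p x)^2 + 2*(c x + b x)^2" by simp
     then show ?thesis unfolding h_def by (simp add: power2_eq_square algebra_simps)
    qed
    from mult_left_mono[OF this, of "(q x)^2"]
    have "(q x)^2*(h x)^2\<le>4*((q x)^2*(c x)^2) + 4*((q x)^2*(b x)^2) + 2*((q x)^2*(p x)^2)"
     by (simp add: algebra_simps)
    moreover have "indicator K x*(h x)^2\<le>(q x)^2*(h x)^2" using q(3)[of x] by (auto simp: indicator_def)
    ultimately show "indicator K x * skew_sq H x\<le>4*((q x)^2*(c x)^2) + 4*((q x)^2*(b x)^2) + 2*((q x)^2*(p x)^2)"
     unfolding hh by linarith
   qed
   also have "... = 4*((LBINT x. (q x)^2*(c x)^2) + (LBINT x. (q x)^2*(b x)^2)) + 2*(LBINT x. (q x)^2*(p x)^2)"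
    using ii[OF sq(4)] ii[OF sq(5)] ii[OF psq] by simp
   also have "...\<le>76*E + 128*L^2*U"
   proof -
    have k: "(LBINT x. (q x)^2*(c x)^2) + (LBINT x. (q x)^2*(b x)^2)
     \<le> 2*(LBINT x. (q x)^2*(s x)^2) + 2*(LBINT x. (q x)^2*(a x)^2)
      + 3*(LBINT x. (q x)^2*(d x)^2) + 32*L^2*U"
     using korn_local[OF G q(1,2) w] by (simp only: s_def U_def add.commute[of "c _"])
    have "?n a + ?n d + ?n s = E" by (simp add: E_def)
    then show ?thesis unfolding distrib_left using k le[OF ssq] le[OF sq(3)] le[OF sq(6)] le[OF psq] pE E zero_le_power2[of "nrm a"] zero_le_power2[of "nrm s"] by linarith
   qed
   finally have "(LBINT y. indicator K y * skew_sq H y)\<le>76*E + 128*L^2*U" .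
   from mult_left_mono[OF this CK(1)] mult_left_mono[OF S CK(1)] CK(4)[OF hH]
   show ?thesis unfolding hh ltwo_sq by linarith
  qed
  \<comment> \<open>Since \<open>c + b = s\<close> and \<open>c - b = h + p\<close>, the two signs
    of \<open>\<sigma>\<close> give \<open>2*c\<close> and \<open>2*b\<close>.\<close>
  have c2: "4*?n f\<le>4*E + 4*?n h + 64*E"
   if "\<And>x. 2*f x = s x + \<sigma>*h x + \<sigma>*p x" "\<bar>\<sigma>\<bar> = 1" for f \<sigma>
  proof -
   have "4*?n f = ?n (%x. 2*f x)" unfolding ltwo_cmult by (simp add: power_mult_distrib)
   also have "... = ?n (%x. (s x + \<sigma>*h x) + \<sigma>*p x)" by (simp only: that(1))
   also have "...\<le>2*?n (%x. s x + \<sigma>*h x) + 2*?n (%x. \<sigma>*p x)"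
    by (intro ltwo_add_sq sq_int_add sq_int_cmult ssq hsq psq)
   also have "?n (%x. s x + \<sigma>*h x)\<le>2*?n s + 2*?n (%x. \<sigma>*h x)"
    by (intro ltwo_add_sq sq_int_cmult ssq hsq)
   finally show ?thesis using that(2) pE E(3) unfolding ltwo_cmult by simp
  qed
  have "4*?n c\<le>4*E + 4*?n h + 64*E" by (rule c2[of _ 1]) (auto simp: s_def h_def)
  moreover have "4*?n b\<le>4*E + 4*?n h + 64*E" by (rule c2[of _ "-1"]) (auto simp: s_def h_def)
  ultimately have "?n b + ?n c\<le>34*E + 2*?n h" by linarith
  also have "...\<le>34*E + 2*(C*(53*E) + C*(76*E + 128*L^2*U))" using I by (intro add_mono mult_left_mono) auto
  also have "...\<le>D*(U + E)"
  proof -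
   have "0\<le>34*U" "0\<le>2*C*129*U" "0\<le>2*C*(128*L^2)*E" using E CK(1) by auto
   then show ?thesis unfolding D_def by (simp add: algebra_simps)
  qed
  finally show "?n b + ?n c\<le>D*(?n u + ?n a + ?n d + ?n (%x. b x + c x))"
   by (simp add: U_def E_def s_def[abs_def] add.assoc)
 qed
qed

section \<open>The Ladyzhenskaya inequality\<close>

subsection \<open>Oblique coordinates in the plane\<close>

definition vec2 :: "real\<times>real => real^2" where
 "vec2 p = fst p *\<^sub>R axis 1 1 + snd p *\<^sub>R axis 2 1"

lemma vec2_component [simp]: "vec2 p $ 1 = fst p" "vec2 p $ 2 = snd p"
 by (simp_all add: vec2_def axis_def)

lemma vec2_measurable [measurable]: "vec2\<in>bmeas"
 unfolding vec2_def[abs_def] by (intro borel_measurable_continuous_onI continuous_intros)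

lemma distr_vec2: "distr (lborel \<Otimes>\<^sub>M lborel) borel vec2 = (lborel :: (real^2) measure)"
proof (rule lborel_eqI[symmetric])
 fix l u :: "real^2"
 assume le: "\<And>b. b\<in>Basis ==> l \<bullet> b\<le>u \<bullet> b"
 have le': "l $ i\<le>u $ i" for i using le[of "axis i 1"] by (simp add: inner_axis)
 have B: "(Basis :: (real^2) set) = {axis 1 1, axis 2 1}"
  by (auto simp: Basis_vec_def exhaust_2 UNIV_2)
 have ne: "axis 1 1\<noteq>(axis 2 1 :: real^2)" by (simp add: axis_eq_axis)
 have pre: "vec2 -` box l u\<inter>space (lborel \<Otimes>\<^sub>M lborel) = {l $ 1 <..< u $ 1}\<times>{l $ 2 <..< u $ 2}"
  by (auto simp: box_def B inner_axis space_pair_measure)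
 have "vec2\<in>measurable (lborel \<Otimes>\<^sub>M lborel) borel"
  unfolding lborel_prod by simp
 then have "emeasure (distr (lborel \<Otimes>\<^sub>M lborel) borel vec2) (box l u) = emeasure (lborel \<Otimes>\<^sub>M lborel) ({l $ 1 <..< u $ 1}\<times>{l $ 2 <..< u $ 2})"
  by (subst emeasure_distr) (auto simp: pre)
 also have "... = ennreal (u $ 1 - l $ 1)*ennreal (u $ 2 - l $ 2)"
  using le' by (subst lborel.emeasure_pair_measure_Times) auto
 also have "... = (\<Prod>b\<in>Basis. (u - l) \<bullet> b)"
  using le' ne by (simp add: B inner_axis ennreal_mult)
 finally show "emeasure (distr (lborel \<Otimes>\<^sub>M lborel) borel vec2) (box l u) = (\<Prod>b\<in>Basis. (u - l) \<bullet> b)" .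
qed simp

lemma nn_integral_vec2:
 fixes G :: "real^2 => ennreal"
 assumes [measurable]: "G\<in>bmeas"
 shows "(NN x. G x) = (NN t. NN s. G (vec2 (s, t)))"
proof -
 have m: "vec2\<in>measurable (lborel \<Otimes>\<^sub>M lborel) borel" unfolding lborel_prod by simp
 have "(NN x. G x) = (\<integral>\<^sup>+p. G (vec2 p) \<partial>(lborel \<Otimes>\<^sub>M lborel))"
  unfolding distr_vec2[symmetric] by (rule nn_integral_distr[OF m]) simp
 also have "... = (NN t. NN s. G (vec2 (s, t)))"
 proof (rule lborel_pair.nn_integral_snd[symmetric])
  show "(%p. G (vec2 p))\<in>borel_measurable (lborel \<Otimes>\<^sub>M lborel)" unfolding lborel_prod by measurable
 qed
 finally show ?thesis .
qed

lemma nn_integral_real_scale: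
 fixes f :: "real => ennreal"
 assumes [measurable]: "f\<in>bmeas" and c: "c\<noteq>0"
 shows "(NN s. f (t + c * s)) = ennreal (1/\<bar>c\<bar>)*(NN x. f x)"
proof -
 have "ennreal (1/\<bar>c\<bar>)*(NN x. f x) = ennreal (1/\<bar>c\<bar>)*(ennreal \<bar>c\<bar>*(NN s. f (t + c * s)))"
  by (subst nn_integral_real_affine[OF assms, of t]) simp
 also have "... = (NN s. f (t + c * s))"
  using c by (simp add: mult.assoc[symmetric] flip: ennreal_mult)
 finally show ?thesis ..
qed

text \<open>Two one-dimensional substitutions and Tonelli's theorem; the order of elimination
  depends on whether \<open>p\<close> vanishes. In both cases the constant works out as the inverse
  modulus of the determinant.\<close>

lemma nn_integral_oblique_aux:
 fixes G :: "real^2 => ennreal"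
 assumes [measurable]: "G\<in>bmeas" and det: "p*q' - p'*q\<noteq>0"
 shows "\<exists>c\<ge>0. (\<forall>G\<in>bmeas. (NN t. NN s. G (vec2 (s*p + t*p', s*q + t*q'))) = ennreal c*(NN x. G x))"
proof (cases "p = 0")
 case True
 then have q: "q\<noteq>0" "p'\<noteq>0" using det by auto
 show ?thesis
 proof (intro exI[of _ "1/\<bar>p'\<bar>*(1/\<bar>q\<bar>)"] conjI ballI)
  fix G :: "real^2 => ennreal" assume [measurable]: "G\<in>bmeas"
  have "(NN t. NN s. G (vec2 (s*p + t*p', s*q + t*q')))
   = (NN t. NN s. G (vec2 (t*p', t*q' + q * s)))"
   using True by (simp add: mult.commute add.commute)
  also have "... = (NN t. ennreal (1/\<bar>q\<bar>)*(NN b. G (vec2 (t*p', b))))"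
  proof (intro nn_integral_cong)
   fix t
   show "(NN s. G (vec2 (t*p', t*q' + q * s))) = ennreal (1/\<bar>q\<bar>)*(NN b. G (vec2 (t*p', b)))"
    by (rule nn_integral_real_scale[OF _ q(1)]) measurable
  qed
  also have "... = ennreal (1/\<bar>q\<bar>)*(NN t. NN b. G (vec2 (0 + p'*t, b)))"
   by (subst nn_integral_cmult) (auto simp: mult.commute)
  also have "(NN t. NN b. G (vec2 (0 + p'*t, b))) = ennreal (1/\<bar>p'\<bar>)*(NN a. NN b. G (vec2 (a, b)))"
   by (rule nn_integral_real_scale[OF _ q(2)]) measurable
  also have "(NN a. NN b. G (vec2 (a, b))) = (NN b. NN a. G (vec2 (a, b)))"
   by (rule lborel_pair.Fubini') measurable
  also have "... = (NN x. G x)" by (rule nn_integral_vec2[symmetric]) simp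
  finally show "(NN t. NN s. G (vec2 (s*p + t*p', s*q + t*q'))) = ennreal (1/\<bar>p'\<bar>*(1/\<bar>q\<bar>))*(NN x. G x)"
   by (simp only: ennreal_mult zero_le_divide_1_iff abs_ge_zero mult_ac)
 qed simp
next
 case False
 define c where "c = (p*q' - p'*q)/p"
 have c: "c\<noteq>0" using det False by (simp add: c_def)
 show ?thesis
 proof (intro exI[of _ "1/\<bar>p\<bar>*(1/\<bar>c\<bar>)"] conjI ballI)
  fix G :: "real^2 => ennreal" assume [measurable]: "G\<in>bmeas"
  have "(NN t. NN s. G (vec2 (s*p + t*p', s*q + t*q')))
   = (NN t. NN s. G (vec2 (t*p' + p * s, (t*p' + p * s)*(q/p) + c*t)))"
  proof (intro nn_integral_cong)
   fix s t
   have 1: "s*p + t*p' = t*p' + p * s" by simp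
   have 2: "s*q + t*q' = (t*p' + p * s)*(q/p) + c*t" using False by (simp add: c_def field_simps)
   show "G (vec2 (s*p + t*p', s*q + t*q')) = G (vec2 (t*p' + p * s, (t*p' + p * s)*(q/p) + c*t))"
    unfolding 2[symmetric] 1 ..
  qed
  also have "... = (NN t. ennreal (1/\<bar>p\<bar>)*(NN a. G (vec2 (a, a*(q/p) + c*t))))"
  proof (intro nn_integral_cong)
   fix t
   have "(NN s. (%a. G (vec2 (a, a*(q/p) + c*t))) (t*p' + p * s)) = ennreal (1/\<bar>p\<bar>)*(NN a. G (vec2 (a, a*(q/p) + c*t)))"
    by (rule nn_integral_real_scale[OF _ False]) measurable
   then show "(NN s. G (vec2 (t*p' + p * s, (t*p' + p * s)*(q/p) + c*t))) = ennreal (1/\<bar>p\<bar>)*(NN a. G (vec2 (a, a*(q/p) + c*t)))" by simp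
  qed
  also have "... = ennreal (1/\<bar>p\<bar>)*(NN t. NN a. G (vec2 (a, a*(q/p) + c*t)))"
   by (subst nn_integral_cmult) auto
  also have "(NN t. NN a. G (vec2 (a, a*(q/p) + c*t))) = (NN a. NN t. G (vec2 (a, a*(q/p) + c*t)))"
   by (rule lborel_pair.Fubini') measurable
  also have "... = (NN a. ennreal (1/\<bar>c\<bar>)*(NN b. G (vec2 (a, b))))"
  proof (intro nn_integral_cong)
   fix a
   show "(NN t. G (vec2 (a, a*(q/p) + c*t))) = ennreal (1/\<bar>c\<bar>)*(NN b. G (vec2 (a, b)))"
    by (rule nn_integral_real_scale[OF _ c]) measurable
  qed
  also have "... = ennreal (1/\<bar>c\<bar>)*(NN a. NN b. G (vec2 (a, b)))"
   by (subst nn_integral_cmult) auto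
  also have "(NN a. NN b. G (vec2 (a, b))) = (NN b. NN a. G (vec2 (a, b)))"
   by (rule lborel_pair.Fubini') measurable
  also have "... = (NN x. G x)" by (rule nn_integral_vec2[symmetric]) simp
  finally show "(NN t. NN s. G (vec2 (s*p + t*p', s*q + t*q'))) = ennreal (1/\<bar>p\<bar>*(1/\<bar>c\<bar>))*(NN x. G x)"
   by (simp only: ennreal_mult zero_le_divide_1_iff abs_ge_zero mult_ac)
 qed simp
qed

lemma nn_integral_oblique:
 fixes d1 d2 :: "real^2"
 assumes "d1 $ 1*d2 $ 2 - d1 $ 2*d2 $ 1\<noteq>0"
 obtains c where "c\<ge>0" "\<And>G y. G\<in>bmeas ==>
  (NN t. NN s. G (y + s *\<^sub>R d2 - t *\<^sub>R d1)) = ennreal c*(NN x. G x)"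
proof -
 have "d2 $ 1*(- (d1 $ 2)) - (- (d1 $ 1))*d2 $ 2\<noteq>0" using assms by (simp add: mult.commute)
 from nn_integral_oblique_aux[OF borel_measurable_const this] obtain c where c: "c\<ge>0"
  "\<And>G. G\<in>bmeas ==>
   (NN t. NN s. G (vec2 (s*d2 $ 1 + t*- d1 $ 1, s*d2 $ 2 + t*- d1 $ 2))) = ennreal c*(NN x. G x)"
  by auto
 show ?thesis
 proof (rule that[OF c(1)])
  fix G :: "real^2 => ennreal" and y assume [measurable]: "G\<in>bmeas"
  have e: "y + s *\<^sub>R d2 - t *\<^sub>R d1 = vec2 (s*d2 $ 1 + t*- d1 $ 1, s*d2 $ 2 + t*- d1 $ 2) + y" for s t
   by (simp add: vec_eq_iff forall_2)
  have "(NN t. NN s. G (y + s *\<^sub>R d2 - t *\<^sub>R d1))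
   = (NN t. NN s. G (vec2 (s*d2 $ 1 + t*- d1 $ 1, s*d2 $ 2 + t*- d1 $ 2) + y))"
   by (simp only: e)
  also have "... = ennreal c*(NN x. G (x + y))" by (rule c(2)) measurable
  also have "(NN x. G (x + y)) = (NN x. G x)" by (rule nn_integral_lborel_shift) simp
  finally show "(NN t. NN s. G (y + s *\<^sub>R d2 - t *\<^sub>R d1)) = ennreal c*(NN x. G x)" .
 qed
qed

text \<open>One-sided form of the Gagliardo inequality: the square of \<open>W\<close> at a point of \<open>D\<close> is
 recovered by integrating along two rays that never leave \<open>D\<close>, so no extension is needed.\<close>

lemma one_sided_bound:
 fixes W W' :: "'a::euclidean_space => real"
 assumes W: "dir_C1 d W W'" and supp: "\<And>x. W x\<noteq>0 ==> norm x\<le>r" and d: "d\<noteq>0"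
  and D: "\<And>x t. x\<in>D ==> t\<ge>0 ==> x + t *\<^sub>R d\<in>D" and x: "x\<in>D"
 shows "ennreal ((W x)^2)\<le>(NN t. indicator D (x + t *\<^sub>R d)*ennreal (2*\<bar>W (x + t *\<^sub>R d)*W' (x + t *\<^sub>R d)\<bar>))"
proof -
 \<comment> \<open>Long enough for the ray from \<open>x\<close> to have left the ball that contains
   the support of \<open>W\<close>.\<close>
 define T where "T = (\<bar>r\<bar> + norm x + 1)/norm d"
 have T: "T\<ge>0" by (simp add: T_def)
 have end0: "W (x + T *\<^sub>R d) = 0"
 proof (rule ccontr)
  assume "W (x + T *\<^sub>R d)\<noteq>0"
  then have "norm (x + T *\<^sub>R d)\<le>r" by (rule supp)
  moreover have "norm (T *\<^sub>R d)\<le>norm (x + T *\<^sub>R d) + norm x"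
   using norm_triangle_ineq4[of "x + T *\<^sub>R d" x] by simp
  moreover have "norm (T *\<^sub>R d) = \<bar>r\<bar> + norm x + 1" using d by (simp add: T_def)
  ultimately show False by linarith
 qed
 define f where "f t = 2*(W (x + t *\<^sub>R d)*W' (x + t *\<^sub>R d))" for t
 have c: "continuous_on UNIV W" "continuous_on UNIV W'" using W by (auto simp: dir_C1_def)
 have cf: "continuous_on UNIV f" unfolding f_def
  by (intro continuous_intros continuous_on_compose2[OF c(1)] continuous_on_compose2[OF c(2)]) auto
 have der: "((%t. (W (x + t *\<^sub>R d))^2) has_real_derivative f t) (at t)" for t
  unfolding f_def by (rule dir_C1_deriv[OF dir_C1_power2[OF W]])
 have eq: "(LBINT t. f t*indicator {0..T} t) = (W (x + T *\<^sub>R d))^2 - (W (x + 0 *\<^sub>R d))^2"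
  by (rule integral_FTC_Icc_real[OF T der]) (use cf in \<open>auto simp: continuous_on_eq_continuous_at\<close>)
 have "(W x)^2\<le>\<bar>LBINT t. f t*indicator {0..T} t\<bar>" unfolding eq end0 by simp
 also have "...\<le>(LBINT t. \<bar>f t*indicator {0..T} t\<bar>)" by (rule integral_abs_bound)
 finally have "ennreal ((W x)^2)\<le>ennreal (LBINT t. \<bar>f t*indicator {0..T} t\<bar>)" by (rule ennreal_leI)
 also have "... = (NN t. ennreal \<bar>f t*indicator {0..T} t\<bar>)"
 proof (rule nn_integral_eq_integral[symmetric])
  have "set_integrable lborel {0..T} f"
   by (rule borel_integrable_atLeastAtMost') (rule continuous_on_subset[OF cf], simp)
  then show "integ (%t. \<bar>f t*indicator {0..T} t\<bar>)"
   by (intro integrable_abs) (simp add: set_integrable_def mult.commute)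
 qed simp
 also have "...\<le>(NN t. indicator D (x + t *\<^sub>R d)*ennreal (2*\<bar>W (x + t *\<^sub>R d)*W' (x + t *\<^sub>R d)\<bar>))"
 proof (rule nn_integral_mono)
  fix t
  show "ennreal \<bar>f t*indicator {0..T} t\<bar>\<le>indicator D (x + t *\<^sub>R d)*ennreal (2*\<bar>W (x + t *\<^sub>R d)*W' (x + t *\<^sub>R d)\<bar>)"
   using D[OF x, of t] by (auto simp: f_def indicator_def abs_mult)
 qed
 finally show ?thesis .
qed

text \<open>The fourth power is a product of two squares, each bounded by an integral along one of
  the two rays. Integrated over \<open>x\<close>, the product of ray integrals becomes a product of
  area integrals, as the two directions are independent.\<close>

lemma gagliardo_one_sided:
 fixes d1 d2 :: "real^2"
 assumes "d1 $ 1*d2 $ 2 - d1 $ 2*d2 $ 1\<noteq>0"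
 shows "\<exists>c\<ge>0. \<forall>W W1 W2 D r. dir_C1 d1 W W1 --> dir_C1 d2 W W2 --> (\<forall>x. W x\<noteq>0 --> norm x\<le>r) -->
   D\<in>sets borel --> (\<forall>x\<in>D. \<forall>t\<ge>0. x + t *\<^sub>R d1\<in>D\<and>x + t *\<^sub>R d2\<in>D) -->
   (NN x. indicator D x*ennreal ((W x)^4))
   \<le> ennreal c*((NN x. indicator D x*ennreal (2*\<bar>W x*W1 x\<bar>))*(NN x. indicator D x*ennreal (2*\<bar>W x*W2 x\<bar>)))"
proof -
 obtain c where c: "c\<ge>0" "\<And>G y. G\<in>bmeas ==>
  (NN t. NN s. G (y + s *\<^sub>R d2 - t *\<^sub>R d1)) = ennreal c*(NN x. G x)"
  by (rule nn_integral_oblique[OF assms]) (rule that)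
 have dn: "d1\<noteq>0" "d2\<noteq>0" using assms by auto
 show ?thesis
 proof (intro exI[of _ c] conjI c(1) allI impI)
  fix W W1 W2 :: "real^2 => real" and D :: "(real^2) set" and r
  assume W: "dir_C1 d1 W W1" "dir_C1 d2 W W2" and "\<forall>x. W x\<noteq>0 --> norm x\<le>r"
   and D [measurable]: "D\<in>sets borel"
   and up: "\<forall>x\<in>D. \<forall>t\<ge>0. x + t *\<^sub>R d1\<in>D\<and>x + t *\<^sub>R d2\<in>D"
  then have supp: "\<And>x. W x\<noteq>0 ==> norm x\<le>r" by blast
  have [measurable]: "W\<in>bmeas" "W1\<in>bmeas" "W2\<in>bmeas"
   using W by (auto simp: dir_C1_def intro: borel_measurable_continuous_onI)
  define g1 where "g1 x = indicator D x*ennreal (2*\<bar>W x*W1 x\<bar>)" for x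
  define g2 where "g2 x = indicator D x*ennreal (2*\<bar>W x*W2 x\<bar>)" for x
  have [measurable]: "g1\<in>bmeas" "g2\<in>bmeas"
   unfolding g1_def g2_def by measurable
  have "(NN x. indicator D x*ennreal ((W x)^4))
   \<le> (NN x. (NN t. g1 (x + t *\<^sub>R d1))*(NN s. g2 (x + s *\<^sub>R d2)))"
  proof (rule nn_integral_mono)
   fix x
   show "indicator D x*ennreal ((W x)^4)\<le>(NN t. g1 (x + t *\<^sub>R d1))*(NN s. g2 (x + s *\<^sub>R d2))"
   proof (cases "x\<in>D")
    case True
    have "ennreal ((W x)^4) = ennreal ((W x)^2)*ennreal ((W x)^2)"
     by (simp add: ennreal_mult[symmetric] power_add[symmetric])
    also have "...\<le>(NN t. g1 (x + t *\<^sub>R d1))*(NN s. g2 (x + s *\<^sub>R d2))"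
     unfolding g1_def g2_def
     using up by (intro mult_mono one_sided_bound[OF W(1) supp dn(1) _ True] one_sided_bound[OF W(2) supp dn(2) _ True]) auto
    finally show ?thesis using True by simp
   qed simp
  qed
  also have "... = (NN x. NN t. NN s. g1 (x + t *\<^sub>R d1)*g2 (x + s *\<^sub>R d2))"
   by (simp add: nn_integral_cmult nn_integral_multc)
  also have "... = (NN t. NN x. NN s. g1 (x + t *\<^sub>R d1)*g2 (x + s *\<^sub>R d2))"
   by (rule lborel_pair.Fubini') measurable
  \<comment> \<open>Shifting \<open>x\<close> along the first ray frees \<open>g1\<close> from
    \<open>t\<close>. The double integral over \<open>s\<close> and \<open>t\<close> is then an area
    integral of \<open>g2\<close> in oblique coordinates.\<close>
  also have "... = (NN t. NN x. NN s. g1 x*g2 (x + s *\<^sub>R d2 - t *\<^sub>R d1))"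
  proof (rule nn_integral_cong)
   fix t
   have "(NN x. NN s. g1 x*g2 (x + s *\<^sub>R d2 - t *\<^sub>R d1))
    = (NN x. (%x. NN s. g1 x*g2 (x + s *\<^sub>R d2 - t *\<^sub>R d1)) (x + t *\<^sub>R d1))"
    by (rule nn_integral_lborel_shift[symmetric]) measurable
   also have "... = (NN x. NN s. g1 (x + t *\<^sub>R d1)*g2 (x + s *\<^sub>R d2))"
    by (simp add: algebra_simps)
   finally show "(NN x. NN s. g1 (x + t *\<^sub>R d1)*g2 (x + s *\<^sub>R d2))
    = (NN x. NN s. g1 x*g2 (x + s *\<^sub>R d2 - t *\<^sub>R d1))" by simp
  qed
  also have "... = (NN x. NN t. NN s. g1 x*g2 (x + s *\<^sub>R d2 - t *\<^sub>R d1))"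
   by (rule lborel_pair.Fubini'[symmetric]) measurable
  also have "... = (NN x. g1 x*(NN t. NN s. g2 (x + s *\<^sub>R d2 - t *\<^sub>R d1)))"
   by (simp add: nn_integral_cmult)
  also have "... = (NN x. g1 x*(ennreal c*(NN x. g2 x)))"
   by (simp add: c(2))
  also have "... = ennreal c*((NN x. g1 x)*(NN x. g2 x))"
   by (simp add: mult.left_commute[of _ "ennreal c"] nn_integral_cmult nn_integral_multc)
  finally show "(NN x. indicator D x*ennreal ((W x)^4))
   \<le> ennreal c*((NN x. indicator D x*ennreal (2*\<bar>W x*W1 x\<bar>))*(NN x. indicator D x*ennreal (2*\<bar>W x*W2 x\<bar>)))"
   by (simp add: g1_def g2_def)
 qed
qed

subsection \<open>The inequality on Lipschitz domains\<close>

text \<open>Squaring the positive part makes the cut-off continuously differentiable, the regularity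
  demanded by \<open>dir_C1\<close>, with explicit bounds for values and derivatives.\<close>

definition bump2 :: "real^2 => real => real^2 => real" where
 "bump2 x r y = (max 0 (r^2 - (y - x) \<bullet> (y - x)))^2"

lemma max0_sq_deriv: "((%s::real. (max 0 s)^2) has_real_derivative 2 * max 0 s) (at s)"
proof -
 consider "s > 0" | "s < 0" | "s = 0" by linarith
 then show ?thesis
 proof cases
  case 1
  have "((%s. s^2) has_real_derivative 2 * max 0 s) (at s)" using 1 by (auto intro!: derivative_eq_intros)
  then show ?thesis by (rule has_field_derivative_transform_within_open[of _ _ _ "{0<..}"]) (use 1 in auto)
 next
  case 2
  have "((%s. 0) has_real_derivative 2 * max 0 s) (at s)" using 2 by auto
  then show ?thesis by (rule has_field_derivative_transform_within_open[of _ _ _ "{..<0}"]) (use 2 in auto)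
 next
  case 3
  have "((%h::real. (max 0 h)^2/h)\<longlongrightarrow>0) (at 0)"
   by (rule Lim_null_comparison[where g = "%h. \<bar>h\<bar>"])
     (auto intro!: tendsto_eq_intros always_eventually simp: max_def power2_eq_square)
  then show ?thesis using 3 by (simp add: DERIV_def)
 qed
qed

lemma bump2_dir_C1: "dir_C1 v (bump2 x r) (%y. - 4 * max 0 (r^2 - (y - x) \<bullet> (y - x))*((y - x) \<bullet> v))"
 unfolding dir_C1_def
proof (intro conjI allI)
 fix y
 have "((%t. r^2 - (y + t *\<^sub>R v - x) \<bullet> (y + t *\<^sub>R v - x)) has_real_derivative - 2*((y - x) \<bullet> v)) (at 0)"
 proof -
  have "(%t. r^2 - (y + t *\<^sub>R v - x) \<bullet> (y + t *\<^sub>R v - x)) = (%t. r^2 - ((y - x) \<bullet> (y - x) + t*(2*((y - x) \<bullet> v)) + t*t*(v \<bullet> v)))"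
   by (simp add: fun_eq_iff inner_simps inner_commute algebra_simps)
  then show ?thesis by (simp only:) (auto intro!: derivative_eq_intros)
 qed
 from DERIV_chain2[OF max0_sq_deriv this]
 show "((%t. bump2 x r (y + t *\<^sub>R v)) has_real_derivative - 4 * max 0 (r^2 - (y - x) \<bullet> (y - x))*((y - x) \<bullet> v)) (at 0)"
  by (simp add: bump2_def mult_ac)
qed (auto simp: bump2_def[abs_def] intro!: continuous_intros)

lemma bump2_bounds:
 assumes "r > 0"
 shows "0\<le>bump2 x r y" "bump2 x r y\<le>r^4" "y\<notin>cball x r ==> bump2 x r y = 0"
  "\<bar>- 4 * max 0 (r^2 - (y - x) \<bullet> (y - x))*((y - x) \<bullet> v)\<bar>\<le>4*r^3*norm v"
  "y\<in>ball x (r/2) ==> r^4/4\<le>bump2 x r y"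
proof -
 have n: "(y - x) \<bullet> (y - x) = (norm (y - x))^2" by (simp add: power2_norm_eq_inner)
 have le: "max 0 (r^2 - (y - x) \<bullet> (y - x))\<le>r^2" "0\<le>max 0 (r^2 - (y - x) \<bullet> (y - x))" by auto
 show "0\<le>bump2 x r y" by (simp add: bump2_def)
 show "bump2 x r y\<le>r^4" using power_mono[OF le, of 2] by (simp add: bump2_def)
 have out: "max 0 (r^2 - (y - x) \<bullet> (y - x)) = 0" if "norm (y - x) > r" for y
  using power_strict_mono[OF that, of 2] assms unfolding power2_norm_eq_inner by simp
 then show "y\<notin>cball x r ==> bump2 x r y = 0" by (simp add: bump2_def dist_norm norm_minus_commute)
 show "\<bar>- 4 * max 0 (r^2 - (y - x) \<bullet> (y - x))*((y - x) \<bullet> v)\<bar>\<le>4*r^3*norm v"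
 proof (cases "norm (y - x) > r")
  case True then show ?thesis using out[OF True] assms by simp
 next
  case False
  have "\<bar>(y - x) \<bullet> v\<bar>\<le>r*norm v"
   using Cauchy_Schwarz_ineq2[of "y - x" v] False mult_right_mono[of "norm (y - x)" r "norm v"] by simp
  then have "max 0 (r^2 - (y - x) \<bullet> (y - x))*\<bar>(y - x) \<bullet> v\<bar>\<le>r^2*(r*norm v)" using le by (intro mult_mono) auto
  then show ?thesis by (simp add: abs_mult power2_eq_square power3_eq_cube mult_ac)
 qed
 assume "y\<in>ball x (r/2)"
 then have "(norm (y - x))^2\<le>(r/2)^2" by (intro power_mono) (auto simp: dist_norm norm_minus_commute)
 then have "(norm (y - x))^2\<le>r^2/4" by (simp add: power_divide)
 then have "r^2/2\<le>r^2 - (norm (y - x))^2" using zero_le_power2[of r] by linarith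
 then have "r^2/2\<le>max 0 (r^2 - (y - x) \<bullet> (y - x))" unfolding n by (rule max.coboundedI2)
 from power_mono[OF this, of 2] show "r^4/4\<le>bump2 x r y" by (simp add: bump2_def power_divide)
qed

lemma nn_integral_le_ltwo_mult:
 assumes "f\<in>sq_int M" "g\<in>sq_int M"
 shows "(\<integral>\<^sup>+x. ennreal (\<bar>f x\<bar>*\<bar>g x\<bar>) \<partial>M)\<le>ennreal (ltwo M f*ltwo M g)"
proof -
 note i = sq_int_mult_integrable[OF sq_int_abs[OF assms(1)] sq_int_abs[OF assms(2)]]
 have "(\<integral>\<^sup>+x. ennreal (\<bar>f x\<bar>*\<bar>g x\<bar>) \<partial>M) = ennreal (\<integral>x. \<bar>f x\<bar>*\<bar>g x\<bar> \<partial>M)"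
  by (rule nn_integral_eq_integral[OF i]) simp
 also have "...\<le>ennreal (ltwo M f*ltwo M g)"
  using ltwo_CS[OF sq_int_abs[OF assms(1)] sq_int_abs[OF assms(2)]] by (intro ennreal_leI) (simp add: ltwo_def)
 finally show ?thesis .
qed

text \<open>The one-sided inequality is applied to the cut-off mollified function on the region
  \<open>\<rho> > \<delta>\<close>. Fatou's lemma removes the mollification for fixed \<delta>, and
  a second time it lets \<delta> tend to 0.\<close>

lemma ladyzhenskaya_local:
 assumes G: "open G" "bounded G" and g: "gchart G x r \<rho> d1 d2"
 obtains C where "C\<ge>0" "\<And>u v1 v2. wderiv G 1 u v1 ==> wderiv G 2 u v2 ==>
  (NN y. ennreal ((bump2 x r y*u y)^4))
   \<le> ennreal (C*(nrm u*(nrm u + nrm v1 + nrm v2))^2)"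
proof -
 have r: "r > 0" and c\<rho>: "continuous_on UNIV \<rho>" and det: "d1 $ 1*d2 $ 2 - d1 $ 2*d2 $ 1\<noteq>0"
  and up: "\<And>y t. t\<ge>0 ==> \<rho> y\<le>\<rho> (y + t *\<^sub>R d1)" "\<And>y t. t\<ge>0 ==> \<rho> y\<le>\<rho> (y + t *\<^sub>R d2)"
  and set: "G\<inter>cball x r = {y\<in>cball x r. 0 < \<rho> y}" using g by (auto simp: gchart_def)
 note bb = bump2_bounds[OF r]
 from gagliardo_one_sided[OF det] obtain c where c: "c\<ge>0" "\<forall>W W1 W2 D r. dir_C1 d1 W W1 --> dir_C1 d2 W W2 --> (\<forall>x. W x\<noteq>0 --> norm x\<le>r) -->
   D\<in>sets borel --> (\<forall>x\<in>D. \<forall>t\<ge>0. x + t *\<^sub>R d1\<in>D\<and>x + t *\<^sub>R d2\<in>D) -->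
   (NN x. indicator D x*ennreal ((W x)^4))
   \<le> ennreal c*((NN x. indicator D x*ennreal (2*\<bar>W x*W1 x\<bar>))*(NN x. indicator D x*ennreal (2*\<bar>W x*W2 x\<bar>)))"
  by (elim exE conjE)
 define B where "B = (4*r^3 + r^4)*(norm d1 + norm d2)"
 have B0: "B\<ge>0" using r by (simp add: B_def)
 define A where "A = 2*(r^4*B)"
 have A0: "A\<ge>0" using r B0 by (simp add: A_def)
 have [measurable]: "\<rho>\<in>bmeas" by (rule borel_measurable_continuous_onI[OF c\<rho>])
 have cb: "continuous_on UNIV (bump2 x r)" using bump2_dir_C1 by (auto simp: dir_C1_def)
 have [measurable]: "bump2 x r\<in>bmeas" by (rule borel_measurable_continuous_onI[OF cb])
 show ?thesis
 proof (rule that)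
  show "c*A^2\<ge>0" using c(1) by simp
  fix u v1 v2 assume w: "wderiv G 1 u v1" "wderiv G 2 u v2"
  have z: "u\<in>L2z G" "v1\<in>L2z G" "v2\<in>L2z G" using w by (auto simp: wderiv_def)
  note [measurable] = z[THEN L2zD(3)]
  note ms = mol_sq_int[OF G(2)]
  note iu = L2z_integrable[OF G(2) z(1)]
  have [measurable]: "mol u n\<in>bmeas" for n using sq_int_measurable[OF ms(1)[OF z(1)]] by simp
  define Z where "Z = nrm u*(nrm u + nrm v1 + nrm v2)"
  have Z0: "Z\<ge>0" by (simp add: Z_def)
  obtain k where k: "strict_mono k" "AE y in lborel. (%n. mol u (k n) y)---->u y"
   using ltwo_tendsto_AE_subseq[OF ms(1)[OF z(1)] L2zD(1)[OF z(1)] mol_tendsto[OF G(2) z(1)]] by blast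
  have step: "(NN y. indicator {y. \<rho> y > \<delta>} y*ennreal ((bump2 x r y*u y)^4))\<le>ennreal (c*A^2*Z^2)"
   if \<delta>: "\<delta> > 0" for \<delta>
  proof -
   define D where "D = {y. \<rho> y > \<delta>}"
   have mD [measurable]: "D\<in>sets borel" unfolding D_def by measurable
   have upD: "\<forall>x\<in>D. \<forall>t\<ge>0. x + t *\<^sub>R d1\<in>D\<and>x + t *\<^sub>R d2\<in>D"
    unfolding D_def using up by (auto intro: less_le_trans)
   \<comment> \<open>\<open>D\<close> is invariant under the rays but need not lie in
     \<open>G\<close>. As \<open>bump2\<close> vanishes outside the ball, only this compact subset
     of \<open>G\<close> matters, where mollification commutes with the weak derivatives.\<close>
   have "compact (cball x r\<inter>{y. \<delta>\<le>\<rho> y})" by (intro compact_Int_closed closed_Collect_le continuous_intros c\<rho>) auto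
   moreover have "cball x r\<inter>{y. \<delta>\<le>\<rho> y}\<subseteq>G" using set \<delta> by force
   ultimately obtain N where N: "\<And>n y. n\<ge>N ==> y\<in>cball x r\<inter>{y. \<delta>\<le>\<rho> y} ==> cball y (1/real (Suc n))\<subseteq>G"
    using compact_cball_margin[OF G(1)] by blast
   have main: "(NN y. indicator D y*ennreal ((bump2 x r y * mol u n y)^4))\<le>ennreal (c*A^2*Z^2)" if n: "n\<ge>N" for n
   proof -
    define m where "m = mol u n"
    define W' where "W' d y = (- 4 * max 0 (r^2 - (y - x) \<bullet> (y - x))*((y - x) \<bullet> d)) * m y
      + bump2 x r y*(\<Sum>i\<in>UNIV. d $ i*pd i m y)" for d y
    have dW: "dir_C1 d (%y. bump2 x r y * m y) (W' d)" for d
     unfolding W'_def m_def by (intro dir_C1_mult bump2_dir_C1 smooth_dir_C1 mol_smooth iu)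
    have pt: "\<bar>(bump2 x r y * m y)*W' d y\<bar>\<le>r^4*B*(\<bar>m y\<bar>*\<bar>m y\<bar> + \<bar>m y\<bar>*\<bar>mol v1 n y\<bar> + \<bar>m y\<bar>*\<bar>mol v2 n y\<bar>)"
     if "y\<in>D" and d: "norm d\<le>norm d1 + norm d2" for y d
    proof (cases "y\<in>cball x r")
     case False then show ?thesis using bb(3)[OF False] r B0 by simp
    next
     case True
     have sub: "cball y (1/real (Suc n))\<subseteq>G" by (rule N[OF n]) (use True that(1) in \<open>auto simp: D_def\<close>)
     have e: "pd 1 m y = mol v1 n y" "pd 2 m y = mol v2 n y"
      unfolding m_def by (rule wderiv_mol[OF G(2) w(1) sub] wderiv_mol[OF G(2) w(2) sub])+
     let ?q = "norm d1 + norm d2"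
     have "\<bar>W' d y\<bar>\<le>(4*r^3*?q)*\<bar>m y\<bar> + r^4*(?q*\<bar>mol v1 n y\<bar> + ?q*\<bar>mol v2 n y\<bar>)"
     proof -
      have "\<bar>W' d y\<bar>\<le>\<bar>- 4 * max 0 (r^2 - (y - x) \<bullet> (y - x))*((y - x) \<bullet> d)\<bar>*\<bar>m y\<bar>
        + \<bar>bump2 x r y\<bar>*(\<bar>d $ 1\<bar>*\<bar>mol v1 n y\<bar> + \<bar>d $ 2\<bar>*\<bar>mol v2 n y\<bar>)"
       unfolding W'_def sum_2 e abs_mult[symmetric]
       by (rule order_trans[OF abs_triangle_ineq], rule add_left_mono) (simp only: abs_mult, intro mult_left_mono, metis abs_mult abs_triangle_ineq, simp)
      also have "...\<le>(4*r^3*?q)*\<bar>m y\<bar> + r^4*(?q*\<bar>mol v1 n y\<bar> + ?q*\<bar>mol v2 n y\<bar>)"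
      proof (intro add_mono mult_mono mult_right_mono)
       show "\<bar>- 4 * max 0 (r^2 - (y - x) \<bullet> (y - x))*((y - x) \<bullet> d)\<bar>\<le>4*r^3*?q"
        by (rule order_trans[OF bb(4)]) (use mult_left_mono[OF d, of "4*r^3"] r in simp)
       show "\<bar>d $ 1\<bar>\<le>?q" "\<bar>d $ 2\<bar>\<le>?q" using component_le_norm_cart[of d] d order_trans by blast+
      qed (use bb(1,2)[of x y] r in auto)
      finally show ?thesis .
     qed
     also have "...\<le>B*(\<bar>m y\<bar> + \<bar>mol v1 n y\<bar> + \<bar>mol v2 n y\<bar>)"
     proof -
      have "0\<le>r^4*?q*\<bar>m y\<bar>" "0\<le>4*r^3*?q*\<bar>mol v1 n y\<bar>" "0\<le>4*r^3*?q*\<bar>mol v2 n y\<bar>" using r by auto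
      then show ?thesis unfolding B_def distrib_left distrib_right by (simp only: mult_ac)
     qed
     finally have "\<bar>bump2 x r y * m y\<bar>*\<bar>W' d y\<bar>\<le>(r^4*\<bar>m y\<bar>)*(B*(\<bar>m y\<bar> + \<bar>mol v1 n y\<bar> + \<bar>mol v2 n y\<bar>))"
      using bb(1,2)[of x y] r by (intro mult_mono) (auto simp: abs_mult mult_right_mono)
     then show ?thesis by (simp only: abs_mult distrib_left mult_ac)
    qed
    have ub: "(NN y. indicator D y*ennreal (2*\<bar>(bump2 x r y * m y)*W' d y\<bar>))\<le>ennreal (A*Z)"
     if d: "norm d\<le>norm d1 + norm d2" for d
    proof -
     have "(NN y. indicator D y*ennreal (2*\<bar>(bump2 x r y * m y)*W' d y\<bar>))
      \<le> (NN y. ennreal A*(ennreal (\<bar>m y\<bar>*\<bar>m y\<bar>) + ennreal (\<bar>m y\<bar>*\<bar>mol v1 n y\<bar>) + ennreal (\<bar>m y\<bar>*\<bar>mol v2 n y\<bar>)))"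
     proof (rule nn_integral_mono)
      fix y
      show "indicator D y*ennreal (2*\<bar>(bump2 x r y * m y)*W' d y\<bar>)
       \<le> ennreal A*(ennreal (\<bar>m y\<bar>*\<bar>m y\<bar>) + ennreal (\<bar>m y\<bar>*\<bar>mol v1 n y\<bar>) + ennreal (\<bar>m y\<bar>*\<bar>mol v2 n y\<bar>))"
      proof (cases "y\<in>D")
       case True
       have "2*\<bar>(bump2 x r y * m y)*W' d y\<bar>\<le>A*(\<bar>m y\<bar>*\<bar>m y\<bar> + \<bar>m y\<bar>*\<bar>mol v1 n y\<bar> + \<bar>m y\<bar>*\<bar>mol v2 n y\<bar>)"
        using pt[OF True d] by (simp add: A_def)
       then show ?thesis using True A0 by (simp add: ennreal_leI flip: ennreal_plus ennreal_mult)
      qed simp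
     qed
     also have "... = ennreal A*((NN y. ennreal (\<bar>m y\<bar>*\<bar>m y\<bar>)) + (NN y. ennreal (\<bar>m y\<bar>*\<bar>mol v1 n y\<bar>)) + (NN y. ennreal (\<bar>m y\<bar>*\<bar>mol v2 n y\<bar>)))"
      using sq_int_measurable[OF ms(1)[OF z(1), of n]] sq_int_measurable[OF ms(1)[OF z(2), of n]] sq_int_measurable[OF ms(1)[OF z(3), of n]]
      unfolding m_def by (simp add: nn_integral_cmult nn_integral_add)
     also have "...\<le>ennreal A*(ennreal (nrm u*nrm u) + ennreal (nrm u*nrm v1) + ennreal (nrm u*nrm v2))"
     proof (intro mult_left_mono add_mono)
      have "(NN y. ennreal (\<bar>m y\<bar>*\<bar>mol f n y\<bar>))\<le>ennreal (nrm u*nrm f)" if f: "f\<in>L2z G" for f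
       unfolding m_def
       by (rule order_trans[OF nn_integral_le_ltwo_mult[OF ms(1)[OF z(1)] ms(1)[OF f]]])
         (intro ennreal_leI mult_mono ms(2) z f; simp)
      from this[OF z(1)] this[OF z(2)] this[OF z(3)]
      show "(NN y. ennreal (\<bar>m y\<bar>*\<bar>m y\<bar>))\<le>ennreal (nrm u*nrm u)"
       "(NN y. ennreal (\<bar>m y\<bar>*\<bar>mol v1 n y\<bar>))\<le>ennreal (nrm u*nrm v1)"
       "(NN y. ennreal (\<bar>m y\<bar>*\<bar>mol v2 n y\<bar>))\<le>ennreal (nrm u*nrm v2)" by (simp_all add: m_def)
     qed simp
     also have "... = ennreal A*ennreal Z" by (simp add: Z_def distrib_left flip: ennreal_plus)
     also have "... = ennreal (A*Z)" by (simp only: ennreal_mult[OF A0 Z0])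
     finally show ?thesis .
    qed
    have "(NN y. indicator D y*ennreal ((bump2 x r y * m y)^4))\<le>ennreal c*(ennreal (A*Z)*ennreal (A*Z))"
    proof (rule order_trans[OF c(2)[rule_format, OF dW dW _ mD upD[rule_format]]])
     fix y assume nz: "bump2 x r y * m y\<noteq>0"
     show "norm y\<le>norm x + r"
     proof -
      have "y\<in>cball x r" using nz bb(3)[of y x] by auto
      then show ?thesis using norm_triangle_ineq2[of y x] by (simp add: dist_norm norm_minus_commute)
     qed
    next
     show "ennreal c*((NN y. indicator D y*ennreal (2*\<bar>bump2 x r y * m y*W' d1 y\<bar>))*(NN y. indicator D y*ennreal (2*\<bar>bump2 x r y * m y*W' d2 y\<bar>)))
      \<le> ennreal c*(ennreal (A*Z)*ennreal (A*Z))" by (intro mult_left_mono mult_mono ub) auto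
    qed
    also have "... = ennreal (c*A^2*Z^2)" using c(1) A0 Z0 by (simp add: power2_eq_square mult_ac flip: ennreal_mult)
    finally show ?thesis by (simp add: m_def)
   qed
   have "(NN y. indicator D y*ennreal ((bump2 x r y*u y)^4))
     = (NN y. liminf (%n. indicator D y*ennreal ((bump2 x r y * mol u (k n) y)^4)))"
   proof (rule nn_integral_cong_AE, use k(2) in eventually_elim)
    case (elim y)
    have "(%n. ennreal (indicator D y*(bump2 x r y * mol u (k n) y)^4))---->ennreal (indicator D y*(bump2 x r y*u y)^4)"
     by (intro tendsto_intros elim)
    then have "(%n. indicator D y*ennreal ((bump2 x r y * mol u (k n) y)^4))---->indicator D y*ennreal ((bump2 x r y*u y)^4)"
     by (cases "y\<in>D") auto
    from lim_imp_Liminf[OF _ this] show ?case by simp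
   qed
   also have "...\<le>liminf (%n. NN y. indicator D y*ennreal ((bump2 x r y * mol u (k n) y)^4))"
    by (rule nn_integral_liminf) measurable
   also have "...\<le>ennreal (c*A^2*Z^2)"
   proof -
    have "eventually (%n. (NN y. indicator D y*ennreal ((bump2 x r y * mol u (k n) y)^4))\<le>ennreal (c*A^2*Z^2)) sequentially"
     using main seq_suble[OF k(1)] by (intro eventually_sequentiallyI[of N]) (meson order_trans)
    then show ?thesis by (intro Liminf_le) auto
   qed
   finally show ?thesis unfolding D_def .
  qed
  define \<delta> where "\<delta> n = 1/real (Suc n)" for n
  have \<delta>: "\<delta> n > 0" "\<delta>---->0" for n unfolding \<delta>_def by (simp, rule LIMSEQ_Suc[OF lim_1_over_n])
  have "(NN y. ennreal ((bump2 x r y*u y)^4))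
    = (NN y. liminf (%n. indicator {y. \<rho> y > \<delta> n} y*ennreal ((bump2 x r y*u y)^4)))"
  proof (rule nn_integral_cong)
   fix y
   have "(%n. indicator {y. \<rho> y > \<delta> n} y*ennreal ((bump2 x r y*u y)^4))---->ennreal ((bump2 x r y*u y)^4)"
   proof (cases "y\<in>cball x r\<and>y\<in>G")
    case True
    then have "\<rho> y > 0" using set by blast
    from order_tendstoD(2)[OF \<delta>(2) this]
    have "eventually (%n. indicator {y. \<rho> y > \<delta> n} y*ennreal ((bump2 x r y*u y)^4) = ennreal ((bump2 x r y*u y)^4)) sequentially"
     by eventually_elim simp
    then show ?thesis by (rule tendsto_eventually)
   next
    case False
    then have "bump2 x r y*u y = 0" using bb(3) L2zD(2)[OF z(1)] by auto
    then show ?thesis by (simp only:) simp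
   qed
   from lim_imp_Liminf[OF _ this] show "ennreal ((bump2 x r y*u y)^4) = liminf (%n. indicator {y. \<rho> y > \<delta> n} y*ennreal ((bump2 x r y*u y)^4))" by simp
  qed
  also have "...\<le>liminf (%n. NN y. indicator {y. \<rho> y > \<delta> n} y*ennreal ((bump2 x r y*u y)^4))"
   by (rule nn_integral_liminf) measurable
  also have "...\<le>ennreal (c*A^2*Z^2)" by (rule Liminf_le) (use step[OF \<delta>(1)] in auto)
  finally show "(NN y. ennreal ((bump2 x r y*u y)^4))
   \<le> ennreal (c*A^2*(nrm u*(nrm u + nrm v1 + nrm v2))^2)" by (simp add: Z_def)
 qed
qed

text \<open>Local estimates are added over a finite cover by half balls, on which
  \<open>4/r^4\<close> times the bump is at least 1. The norm of \<open>u^2\<close> is the square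
  root of the integral of the fourth power, hence \<open>sqrt K\<close>.\<close>

theorem ladyzhenskaya:
 assumes G: "open G" "bounded G" and lip: "lipschitz_boundary G"
 obtains C where "C\<ge>0" "\<And>u v1 v2. wderiv G 1 u v1 ==> wderiv G 2 u v2 ==> (%x. (u x)^2)\<in>sqi \<and>
  nrm (%x. (u x)^2)\<le>C*(nrm u*(nrm u + nrm v1 + nrm v2))"
proof -
 let ?Q = "%u v1 v2. (nrm u*(nrm u + nrm v1 + nrm v2))"
 have "\<forall>x\<in>closure G. \<exists>p. fst p > 0\<and>snd p\<ge>0\<and>(\<forall>u v1 v2. wderiv G 1 u v1\<and>wderiv G 2 u v2 -->
  (NN y. ennreal ((bump2 x (fst p) y*u y)^4))\<le>ennreal (snd p*(?Q u v1 v2)^2))"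
 proof
  fix x assume "x\<in>closure G"
  then consider "x\<in>G" | "x\<in>frontier G" unfolding closure_Un_frontier by blast
  then obtain r \<rho> d1 d2 where g: "gchart G x r \<rho> d1 d2"
  proof cases
   case 1
   from that show thesis by (rule gchart_interior[OF G(1) 1])
  next
   case 2
   from that show thesis by (rule lipschitz_charts[OF lip 2])
  qed
  obtain C where "C\<ge>0" "\<And>u v1 v2. wderiv G 1 u v1 ==> wderiv G 2 u v2 ==>
   (NN y. ennreal ((bump2 x r y*u y)^4))\<le>ennreal (C*(?Q u v1 v2)^2)"
   by (rule ladyzhenskaya_local[OF G g]) (rule that)
  moreover have "r > 0" using g by (simp add: gchart_def)
  ultimately show "\<exists>p. fst p > 0\<and>snd p\<ge>0\<and>(\<forall>u v1 v2. wderiv G 1 u v1\<and>wderiv G 2 u v2 -->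
   (NN y. ennreal ((bump2 x (fst p) y*u y)^4))\<le>ennreal (snd p*(?Q u v1 v2)^2))"
   by (intro exI[of _ "(r, C)"]) auto
 qed
 from bchoice[OF this] obtain p where p: "\<forall>x\<in>closure G. fst (p x) > 0\<and>snd (p x)\<ge>0\<and>(\<forall>u v1 v2. wderiv G 1 u v1\<and>wderiv G 2 u v2 -->
  (NN y. ennreal ((bump2 x (fst (p x)) y*u y)^4))\<le>ennreal (snd (p x)*(?Q u v1 v2)^2))" ..
 define r where "r x = fst (p x)" for x
 define C where "C x = snd (p x)" for x
 have r0: "r x > 0" and C0: "C x\<ge>0" and est: "wderiv G 1 u v1 ==> wderiv G 2 u v2 ==>
  (NN y. ennreal ((bump2 x (r x) y*u y)^4))\<le>ennreal (C x*(?Q u v1 v2)^2)" if "x\<in>closure G" for x u v1 v2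
  using p[rule_format, OF that] by (auto simp: r_def C_def)
 have cc: "compact (closure G)" using G(2) by (simp add: compact_closure)
 have cov: "closure G\<subseteq>(\<Union>x\<in>closure G. ball x (r x/2))" using r0 by force
 obtain X where X: "X\<subseteq>closure G" "finite X" "closure G\<subseteq>(\<Union>x\<in>X. ball x (r x/2))"
  by (rule compactE_image[OF cc _ cov]) (rule open_ball, rule that)
 define K where "K = (\<Sum>x\<in>X. (4/r x^4)^4*C x)"
 have K0: "K\<ge>0" unfolding K_def using C0 r0 X by (intro sum_nonneg mult_nonneg_nonneg) auto
 show ?thesis
 proof (rule that)
  show "sqrt K\<ge>0" using K0 by simp
  fix u v1 v2 assume w: "wderiv G 1 u v1" "wderiv G 2 u v2"
  have z: "u\<in>L2z G" using w by (auto simp: wderiv_def)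
  note [measurable] = L2zD(3)[OF z]
  have [measurable]: "bump2 x (r x)\<in>bmeas" for x
   using bump2_dir_C1[of 0 x "r x"] by (intro borel_measurable_continuous_onI) (auto simp: dir_C1_def)
  have "(NN y. ennreal (((u y)^2)^2))\<le>(NN y. (\<Sum>x\<in>X. ennreal ((4/r x^4)^4)*ennreal ((bump2 x (r x) y*u y)^4)))"
  proof (rule nn_integral_mono)
   fix y
   show "ennreal (((u y)^2)^2)\<le>(\<Sum>x\<in>X. ennreal ((4/r x^4)^4)*ennreal ((bump2 x (r x) y*u y)^4))"
   proof (cases "y\<in>G")
    case True
    then obtain x where x: "x\<in>X" "y\<in>ball x (r x/2)" using X(3) closure_subset by blast
    have R: "r x > 0" using r0 X(1) x(1) by blast
    have "1\<le>(4/r x^4)*bump2 x (r x) y" using bump2_bounds(5)[OF R x(2)] R by (simp add: field_simps)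
    from power_mono[OF this, of 4] have "1\<le>(4/r x^4)^4*bump2 x (r x) y^4" by (simp only: power_mult_distrib) simp
    from mult_right_mono[OF this, of "u y^4"] have "((u y)^2)^2\<le>(4/r x^4)^4*(bump2 x (r x) y*u y)^4"
     by (simp add: power_mult_distrib mult.assoc)
    then have "ennreal (((u y)^2)^2)\<le>ennreal ((4/r x^4)^4)*ennreal ((bump2 x (r x) y*u y)^4)"
     using R by (simp add: ennreal_leI flip: ennreal_mult)
    also have "...\<le>(\<Sum>x\<in>X. ennreal ((4/r x^4)^4)*ennreal ((bump2 x (r x) y*u y)^4))"
     by (rule member_le_sum[OF x(1)]) (use X(2) in auto)
    finally show ?thesis .
   next
    case False
    then show ?thesis using L2zD(2)[OF z] by simp
   qed
  qed
  also have "... = (\<Sum>x\<in>X. ennreal ((4/r x^4)^4)*(NN y. ennreal ((bump2 x (r x) y*u y)^4)))"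
   by (subst nn_integral_sum) (auto simp: nn_integral_cmult)
  also have "...\<le>(\<Sum>x\<in>X. ennreal ((4/r x^4)^4)*ennreal (C x*(?Q u v1 v2)^2))"
   using X(1) by (intro sum_mono mult_left_mono est w) auto
  also have "... = (\<Sum>x\<in>X. ennreal ((4/r x^4)^4*C x*(?Q u v1 v2)^2))"
   using X(1) r0 C0 by (intro sum.cong) (auto simp: mult.assoc simp flip: ennreal_mult)
  also have "... = ennreal (\<Sum>x\<in>X. (4/r x^4)^4*C x*(?Q u v1 v2)^2)"
   using X(1) r0 C0 by (intro sum_ennreal) (auto intro!: mult_nonneg_nonneg)
  also have "... = ennreal ((sqrt K*?Q u v1 v2)^2)"
   using K0 unfolding power_mult_distrib real_sqrt_pow2[OF K0] K_def by (simp add: sum_distrib_right power_mult_distrib)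
  finally show "(%x. (u x)^2)\<in>sqi\<and>nrm (%x. (u x)^2)\<le>sqrt K*?Q u v1 v2"
   using K0 by (subst (asm) sq_int_nn_integral) auto
 qed
qed

section \<open>Rellich's theorem\<close>

lemma dir_C1_increment_sq:
 assumes G: "dir_C1 v G G'"
 shows "ennreal ((G (x + v) - G x)^2)\<le>(NN t. indicator {0..1} t*ennreal ((G' (x + t *\<^sub>R v))^2))"
proof -
 define f where "f t = G' (x + t *\<^sub>R v)" for t
 have "continuous_on UNIV G'" using G by (simp add: dir_C1_def)
 then have cf: "continuous_on UNIV f" unfolding f_def
  by (rule continuous_on_compose2) (auto intro!: continuous_intros)
 note [measurable] = borel_measurable_continuous_onI[OF cf]
 have eq: "(LBINT t. f t*indicator {0..1} t) = G (x + 1 *\<^sub>R v) - G (x + 0 *\<^sub>R v)"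
  by (rule integral_FTC_Icc_real) (use cf dir_C1_deriv[OF G] in \<open>auto simp: continuous_on_eq_continuous_at f_def\<close>)
 have int: "integ (%t. f t*indicator {0..1} t)"
  using borel_integrable_atLeastAtMost'[of 0 1 f] continuous_on_subset[OF cf]
  by (simp add: set_integrable_def mult.commute)
 have "\<bar>G (x + v) - G x\<bar>\<le>(LBINT t. \<bar>f t*indicator {0..1} t\<bar>)"
  using integral_abs_bound[of lborel "%t. f t*indicator {0..1} t"] unfolding eq by simp
 then have "ennreal \<bar>G (x + v) - G x\<bar>\<le>ennreal (LBINT t. \<bar>f t*indicator {0..1} t\<bar>)" by (rule ennreal_leI)
 also have "... = (NN t. ennreal \<bar>f t\<bar>*indicator {0..1} t*indicator {0..1} t)"
  by (subst nn_integral_eq_integral[symmetric, OF integrable_abs[OF int]])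
    (auto intro!: nn_integral_cong simp: indicator_def)
 finally have "(ennreal \<bar>G (x + v) - G x\<bar>)^2\<le>(NN t. ennreal \<bar>f t\<bar>*indicator {0..1} t*indicator {0..1} t)^2"
  by (rule power_mono) simp
 also have "...\<le>(NN t. (ennreal \<bar>f t\<bar>*indicator {0..1} t)^2)*(\<integral>\<^sup>+t. (indicator {0..1} t)^2 \<partial>(lborel :: real measure))"
  by (rule Cauchy_Schwarz_nn_integral) auto
 also have "(\<integral>\<^sup>+t. (indicator {0..1} t)^2 \<partial>(lborel :: real measure)) = (\<integral>\<^sup>+t. indicator {0..1} t \<partial>(lborel :: real measure))"
  by (intro nn_integral_cong) (simp add: indicator_def)
 also have "(NN t. (ennreal \<bar>f t\<bar>*indicator {0..1} t)^2) = (NN t. indicator {0..1} t*ennreal ((f t)^2))"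
  by (intro nn_integral_cong) (auto simp: indicator_def ennreal_power)
 finally show ?thesis by (simp add: ennreal_power f_def)
qed

lemma indicator_sq_int:
 assumes "A\<in>sets M" "emeasure M A < \<infinity>"
 shows "indicator A\<in>sq_int M"
proof -
 have "(%x. (indicator A x)^2) = (indicator A :: _ => real)" by (auto simp: indicator_def)
 then show ?thesis using assms by (auto simp: sq_int_def)
qed

lemma sq_int_nn_eq: "f\<in>sq_int M ==> (\<integral>\<^sup>+x. ennreal ((f x)^2) \<partial>M) = ennreal ((ltwo M f)^2)"
 using nn_integral_eq_integral[OF sq_int_integrable] by (simp add: ltwo_sq)

lemma sq_int_nn_indicator:
 assumes "f\<in>sqi" "A\<in>sets borel"
 shows "(NN x. indicator A x*ennreal ((f x)^2)) = ennreal (LBINT x. indicator A x*(f x)^2)"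
  "integ (%x. indicator A x*(f x)^2)"
proof -
 show i: "integ (%x. indicator A x*(f x)^2)"
  by (rule sq_int_weighted_integrable[OF assms(1), of _ 1]) (use assms(2) in \<open>auto simp: indicator_def\<close>)
 have "(NN x. indicator A x*ennreal ((f x)^2)) = (NN x. ennreal (indicator A x*(f x)^2))"
  by (intro nn_integral_cong) (auto simp: indicator_def)
 then show "(NN x. indicator A x*ennreal ((f x)^2)) = ennreal (LBINT x. indicator A x*(f x)^2)"
  using nn_integral_eq_integral[OF i] by simp
qed

text \<open>The increment is the integral of the derivative along the segment. The margin
  \<open>2*\<eta>\<close> is spent half on the segment and half on the radius of the mollifier used
  in the proof.\<close>

lemma translation_estimate:
 assumes D: "open D" "bounded D" and A [measurable]: "A\<in>sets borel" and \<eta>: "\<eta> > 0"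
  and sub: "\<And>x. x\<in>A ==> cball x (2*\<eta>)\<subseteq>D"
  and w: "wderiv D 1 u v1" "wderiv D 2 u v2" and z: "norm z\<le>\<eta>"
 shows "(LBINT x. indicator A x*(u (x - z) - u x)^2)\<le>\<eta>^2*((nrm v1)^2 + (nrm v2)^2)"
proof -
 have L: "u\<in>L2z D" "v1\<in>L2z D" "v2\<in>L2z D" using w by (auto simp: wderiv_def)
 note ms = mol_sq_int[OF D(2)]
 note us = L2zD(1)[OF L(1)]
 let ?d = "%f x. f (x - z) - f x"
 let ?R = "\<eta>^2*((nrm v1)^2 + (nrm v2)^2)"
 have ds: "?d (mol u n)\<in>sqi" "?d u\<in>sqi" for n
  by (intro sq_int_diff sq_int_shift us ms L)+
 have dl: "(%n. nrm (%x. ?d (mol u n) x - ?d u x))---->0"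
 proof (rule Lim_null_comparison[OF always_eventually, rule_format])
  fix n
  have e: "(%x. ?d (mol u n) x - ?d u x) = (%x. (mol u n (x - z) - u (x - z)) - (mol u n x - u x))" by auto
  note s = sq_int_diff[OF ms(1)[OF L(1)] us]
  show "norm (nrm (%x. ?d (mol u n) x - ?d u x))\<le>2*nrm (%x. mol u n x - u x)"
   unfolding e using ltwo_triangle_diff[OF sq_int_shift(1)[OF s, of n z] s, of n] sq_int_shift(2)[OF s, of n z] by simp
 next
  show "(%n. 2*nrm (%x. mol u n x - u x))---->0"
   using tendsto_mult_right_zero[OF mol_tendsto[OF D(2) L(1)]] .
 qed
 have lim: "(%n. LBINT x. indicator A x*(?d (mol u n) x)^2)---->(LBINT x. indicator A x*(?d u x)^2)"
  by (rule ltwo_tendsto_weighted[OF ds(2) ds(1) dl, of _ 1]) (auto simp: indicator_def)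
 obtain N where N: "1/real (Suc N) < \<eta>" using \<eta> nat_approx_posE by blast
 have "(LBINT x. indicator A x*(?d (mol u n) x)^2)\<le>?R" if n: "n\<ge>N" for n
 proof -
  have nN: "1/real (Suc n)\<le>\<eta>" using N n by (smt (verit) frac_le of_nat_0_less_iff of_nat_le_iff zero_less_Suc Suc_le_mono)
  define m where "m = mol u n"
  define q where "q x = ennreal ((mol v1 n x)^2) + ennreal ((mol v2 n x)^2)" for x
  have [measurable]: "mol v1 n\<in>bmeas" "mol v2 n\<in>bmeas" "m\<in>bmeas"
   using sq_int_measurable[OF ms(1)[OF L(2)]] sq_int_measurable[OF ms(1)[OF L(3)]] sq_int_measurable[OF ms(1)[OF L(1)]] by (auto simp: m_def)
  have [measurable]: "q\<in>bmeas" unfolding q_def by measurable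
  define m' where "m' y = (\<Sum>i\<in>UNIV. (- z) $ i*pd i m y)" for y
  have G: "dir_C1 (- z) m m'" unfolding m'_def m_def by (intro smooth_dir_C1 mol_smooth L2z_integrable[OF D(2) L(1)])
  have [measurable]: "m'\<in>bmeas" using G by (auto simp: dir_C1_def intro: borel_measurable_continuous_onI)
  have pt: "ennreal ((m' (x + t *\<^sub>R (- z)))^2)\<le>ennreal (\<eta>^2)*q (x + t *\<^sub>R (- z))" if x: "x\<in>A" and t: "t\<in>{0..1}" for x t
  proof -
   let ?y = "x + t *\<^sub>R (- z)"
   have "cball ?y (1/real (Suc n))\<subseteq>cball x (2*\<eta>)"
   proof -
    have "dist x ?y\<le>\<eta>" using z t mult_mono[of t 1 "norm z" \<eta>] by (simp add: dist_norm)
    then show ?thesis using nN by (auto simp: cball_subset_cball_iff dist_commute)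
   qed
   then have s: "cball ?y (1/real (Suc n))\<subseteq>D" using sub[OF x] by blast
   have e: "pd 1 m ?y = mol v1 n ?y" "pd 2 m ?y = mol v2 n ?y"
    unfolding m_def by (rule wderiv_mol[OF D(2) w(1) s] wderiv_mol[OF D(2) w(2) s])+
   define a b where "a = mol v1 n ?y" and "b = mol v2 n ?y"
   have "m' ?y = - (z $ 1*a + z $ 2*b)" unfolding m'_def sum_2 e a_def b_def by simp
   then have "(m' ?y)^2 = (z $ 1*a + z $ 2*b)^2" by (simp only: power2_minus)
   also have "...\<le>((z $ 1)^2 + (z $ 2)^2)*(a^2 + b^2)"
    using zero_le_power2[of "z $ 1*b - z $ 2*a"] by (simp add: power2_eq_square algebra_simps)
   also have "(z $ 1)^2 + (z $ 2)^2 = (norm z)^2" unfolding power2_norm_eq_inner by (simp add: inner_real2 power2_eq_square)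
   also have "(norm z)^2*(a^2 + b^2)\<le>\<eta>^2*(a^2 + b^2)" using z by (intro mult_right_mono power_mono) auto
   finally show ?thesis unfolding q_def a_def[symmetric] b_def[symmetric]
    by (simp add: ennreal_leI flip: ennreal_plus ennreal_mult)
  qed
  have "(NN x. indicator A x*ennreal ((?d m x)^2))
   \<le> (NN x. NN t. indicator {0..1} t*(ennreal (\<eta>^2)*q (x + t *\<^sub>R (- z))))"
  proof (rule nn_integral_mono)
   fix x
   show "indicator A x*ennreal ((?d m x)^2)\<le>(NN t. indicator {0..1} t*(ennreal (\<eta>^2)*q (x + t *\<^sub>R (- z))))"
   proof (cases "x\<in>A")
    case True
    have "ennreal ((?d m x)^2)\<le>(NN t. indicator {0..1} t*ennreal ((m' (x + t *\<^sub>R (- z)))^2))"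
     using dir_C1_increment_sq[OF G, of x] by simp
    also have "...\<le>(NN t. indicator {0..1} t*(ennreal (\<eta>^2)*q (x + t *\<^sub>R (- z))))"
    proof (rule nn_integral_mono)
     fix t :: real
     show "indicator {0..1} t*ennreal ((m' (x + t *\<^sub>R (- z)))^2)\<le>indicator {0..1} t*(ennreal (\<eta>^2)*q (x + t *\<^sub>R (- z)))"
      using pt[OF True, of t] by (cases "t\<in>{0..1}") auto
    qed
    finally show ?thesis using True by simp
   qed simp
  qed
  also have "... = (NN t. NN x. indicator {0..1} t*(ennreal (\<eta>^2)*q (x + t *\<^sub>R (- z))))"
   by (rule lborel_pair.Fubini') measurable
  also have "... = (\<integral>\<^sup>+t. indicator {0..1} t*(ennreal (\<eta>^2)*(NN x. q x)) \<partial>(lborel :: real measure))"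
  proof (rule nn_integral_cong)
   fix t :: real
   have "(NN x. q (x + t *\<^sub>R (- z))) = (NN x. q x)" by (rule nn_integral_lborel_shift) simp
   then show "(NN x. indicator {0..1} t*(ennreal (\<eta>^2)*q (x + t *\<^sub>R (- z)))) = indicator {0..1} t*(ennreal (\<eta>^2)*(NN x. q x))"
    by (simp add: nn_integral_cmult)
  qed
  also have "... = ennreal (\<eta>^2)*(NN x. q x)" by (simp add: nn_integral_multc)
  also have "(NN x. q x) = ennreal ((nrm (mol v1 n))^2) + ennreal ((nrm (mol v2 n))^2)"
   unfolding q_def using sq_int_nn_eq[OF ms(1)[OF L(2)]] sq_int_nn_eq[OF ms(1)[OF L(3)]] by (simp add: nn_integral_add)
  also have "ennreal (\<eta>^2)*...\<le>ennreal (\<eta>^2)*(ennreal ((nrm v1)^2) + ennreal ((nrm v2)^2))"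
   by (intro mult_left_mono add_mono ennreal_leI power_mono ms(2) L) auto
  finally have "(NN x. indicator A x*ennreal ((?d m x)^2))\<le>ennreal (\<eta>^2)*(ennreal ((nrm v1)^2) + ennreal ((nrm v2)^2))"
   .
  also have "... = ennreal ?R" by (simp flip: ennreal_plus ennreal_mult)
  finally show ?thesis unfolding m_def sq_int_nn_indicator(1)[OF ds(1) A] by (subst (asm) ennreal_le_iff) auto
 qed
 then show ?thesis by (intro LIMSEQ_le_const2[OF lim]) auto
qed

lemma mol_estimate:
 assumes G: "open G" "bounded G" and A: "A\<in>sets borel"
  and sub: "\<And>x. x\<in>A ==> cball x (2*(1/real (Suc n)))\<subseteq>G"
  and w: "wderiv G 1 u v1" "wderiv G 2 u v2"
 shows "(LBINT x. indicator A x*(mol u n x - u x)^2)\<le>(1/real (Suc n))^2*((nrm v1)^2 + (nrm v2)^2)" (is "_\<le>?R")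
proof -
 have L: "u\<in>L2z G" using w by (auto simp: wderiv_def)
 note us = L2zD(1)[OF L]
 have "(NN x. indicator A x*ennreal ((conv u (molseq n) x - 1*u x)^2))\<le>ennreal ?R"
 proof (rule conv_Jensen_integral[OF L2z_integrable[OF G(2) L] mollifier_molseq A])
  fix z :: "real^2" assume z: "norm z < 1/real (Suc n)"
  have s: "(%x. u (x - z) - 1*u x)\<in>sqi" by (intro sq_int_diff sq_int_shift sq_int_cmult us)
  show "(NN x. indicator A x*ennreal ((u (x - z) - 1*u x)^2))\<le>ennreal ?R"
   unfolding sq_int_nn_indicator(1)[OF s A] using translation_estimate[OF G A _ sub w, of z] z by (auto intro!: ennreal_leI)
 qed
 then show ?thesis
  using sq_int_nn_indicator(1)[OF sq_int_diff[OF mol_sq_int(1)[OF G(2) L] us] A, of n] by (simp add: ennreal_le_iff)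
qed

text \<open>Near the boundary the bound on \<open>u^2\<close> in the mean excludes concentration: by
  Cauchy-Schwarz the mass on \<open>G - K\<close> is small when its measure is. On \<open>K\<close>
  the functions are close to their mollifications at one fixed scale, and these are equicontinuous,
  so that the Arzela-Ascoli theorem applies.\<close>

lemma rellich_step:
 assumes G: "open G" "bounded G" and lip: "lipschitz_boundary G" and \<epsilon>: "\<epsilon> > 0"
  and w: "\<And>i. wderiv G 1 (u i) (v1 i)" "\<And>i. wderiv G 2 (u i) (v2 i)"
  and M: "\<And>i. nrm (u i)\<le>M" "\<And>i. nrm (v1 i)\<le>M" "\<And>i. nrm (v2 i)\<le>M"
 obtains r where "strict_mono (r :: nat => nat)" "\<And>i j. (nrm (%x. u (r i) x - u (r j) x))^2\<le>\<epsilon>"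
proof -
 have L: "u i\<in>L2z G" for i using w by (auto simp: wderiv_def)
 note us = L2zD(1)[OF L] and iu = L2z_integrable[OF G(2) L]
 have M0: "M\<ge>0" using order_trans[OF ltwo_nonneg M(1)] .
 obtain C where C: "C\<ge>0" "\<And>u v1 v2. wderiv G 1 u v1 ==> wderiv G 2 u v2 ==> (%x. (u x)^2)\<in>sqi \<and>
  nrm (%x. (u x)^2)\<le>C*(nrm u*(nrm u + nrm v1 + nrm v2))"
  by (rule ladyzhenskaya[OF G lip]) (rule that)
 define Q where "Q = C*(M*(M + M + M)) + 1"
 have Q: "Q > 0" using C(1) M0 by (simp add: Q_def add_nonneg_pos)
 have uQ: "(%x. (u i x)^2)\<in>sqi" "nrm (%x. (u i x)^2)\<le>Q" for i
 proof -
  have "C*(nrm (u i)*(nrm (u i) + nrm (v1 i) + nrm (v2 i)))\<le>C*(M*(M + M + M))"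
   by (intro mult_left_mono mult_mono add_mono M C(1)) (auto simp: M0)
  then show "(%x. (u i x)^2)\<in>sqi" "nrm (%x. (u i x)^2)\<le>Q"
   using C(2)[OF w(1)[of i] w(2)[of i]] unfolding Q_def by (simp, linarith)
 qed
 \<comment> \<open>Cauchy-Schwarz on \<open>G - K\<close> gives at most
   \<open>sqrt \<kappa>*Q\<close>, which equals \<open>\<epsilon>/12\<close>.\<close>
 define \<kappa> where "\<kappa> = (\<epsilon>/(12*Q))^2"
 have \<kappa>: "\<kappa> > 0" using \<epsilon> Q by (simp add: \<kappa>_def)
 have GL: "G\<in>sets lebesgue" using G(1) by simp
 obtain K where K: "closed K" "K\<subseteq>G" "emeasure lebesgue (G - K) < ennreal \<kappa>"
  by (rule sets_lebesgue_inner_closed[OF GL \<kappa>])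
 have cK: "compact K" using K G(2) by (meson bounded_subset compact_eq_bounded_closed)
 have mK [measurable]: "K\<in>sets borel" "G\<in>sets borel" "G - K\<in>sets borel" using K(1) G(1) by auto
 have out: "(LBINT x. indicator (G - K) x*(u i x)^2)\<le>\<epsilon>/12" for i
 proof -
  have fin: "emeasure lborel (G - K) < \<infinity>" by (rule emeasure_bounded_finite) (use G(2) in \<open>auto intro: bounded_subset\<close>)
  have s: "indicator (G - K)\<in>sqi" using fin mK by (intro indicator_sq_int) auto
  have "nrm (indicator (G - K))\<le>\<epsilon>/(12*Q)"
  proof -
   have "(NN x. ennreal ((indicator (G - K) x)^2)) = (NN x. indicator (G - K) x)"
    by (intro nn_integral_cong) (auto simp: indicator_def)
   also have "...\<le>ennreal ((\<epsilon>/(12*Q))^2)" using K(3) mK(3) by (simp add: \<kappa>_def)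
   finally show ?thesis using \<epsilon> Q by (subst (asm) sq_int_nn_integral) auto
  qed
  then have "nrm (indicator (G - K))*nrm (%x. (u i x)^2)\<le>\<epsilon>/(12*Q)*Q"
   using uQ(2)[of i] \<epsilon> Q by (intro mult_mono) auto
  then show ?thesis using ltwo_CS[OF s uQ(1)[of i]] Q by simp
 qed
 obtain N where N: "\<And>n x. n\<ge>N ==> x\<in>K ==> cball x (1/real (Suc n))\<subseteq>G"
  using compact_cball_margin[OF G(1) cK K(2)] by blast
 have "0 < sqrt (\<epsilon>/(72*(M^2 + 1)))" using \<epsilon> by (simp add: add_nonneg_pos)
 then obtain N' where N': "1/real (Suc N') < sqrt (\<epsilon>/(72*(M^2 + 1)))" using nat_approx_posE by blast
 \<comment> \<open>With \<open>n\<close> at least \<open>2*N + 1\<close>, twice the mollification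
   radius is at most \<open>1/Suc N\<close>, the margin available around \<open>K\<close>.\<close>
 define n where "n = max (2*N + 1) N'"
 have sub: "cball x (2*(1/real (Suc n)))\<subseteq>G" if "x\<in>K" for x
 proof -
  have "2*(1/real (Suc n))\<le>2*(1/real (Suc (2*N + 1)))" unfolding n_def by (intro mult_left_mono frac_le) auto
  also have "... = 1/real (Suc N)" by (simp add: field_simps)
  finally show ?thesis using N[OF order_refl that] by auto
 qed
 have app: "(LBINT x. indicator K x*(mol (u i) n x - u i x)^2)\<le>\<epsilon>/36" for i
 proof -
  have "(1/real (Suc n))^2\<le>(sqrt (\<epsilon>/(72*(M^2 + 1))))^2"
  proof (rule power_mono)
   have "1/real (Suc n)\<le>1/real (Suc N')" unfolding n_def by (intro frac_le) auto
   then show "1/real (Suc n)\<le>sqrt (\<epsilon>/(72*(M^2 + 1)))" using N' by simp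
  qed simp
  then have h: "(1/real (Suc n))^2\<le>\<epsilon>/(72*(M^2 + 1))" using \<epsilon> by (simp add: add_nonneg_pos)
  have "(nrm (v1 i))^2 + (nrm (v2 i))^2\<le>M^2 + M^2" by (intro add_mono power_mono M) auto
  then have "(1/real (Suc n))^2*((nrm (v1 i))^2 + (nrm (v2 i))^2)\<le>\<epsilon>/(72*(M^2 + 1))*(2*(M^2 + 1))"
   using \<epsilon> by (intro mult_mono h) auto
  also have "... = \<epsilon>/36"
  proof -
   have "M^2 + 1 > 0" by (simp add: add_nonneg_pos)
   then show ?thesis by (simp add: divide_simps)
  qed
  finally show ?thesis using mol_estimate[OF G mK(1) sub w, of i] by linarith
 qed
 have l1: "(LBINT x. \<bar>u i x\<bar>)\<le>M*nrm (indicator G)" for i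
 proof -
  have fin: "emeasure lborel G < \<infinity>" by (rule emeasure_bounded_finite[OF G(2)])
  have s: "indicator G\<in>sqi" using fin mK by (intro indicator_sq_int) auto
  have "(LBINT x. \<bar>u i x\<bar>) = (LBINT x. \<bar>u i x\<bar>*indicator G x)"
   using L2zD(2)[OF L, of _ i] by (intro Bochner_Integration.integral_cong) (auto simp: indicator_def)
  also have "...\<le>nrm (u i)*nrm (indicator G)"
   using ltwo_CS[OF sq_int_abs[OF us] s, of i] by (simp add: ltwo_def)
  also have "...\<le>M*nrm (indicator G)" by (intro mult_right_mono M) simp
  finally show ?thesis .
 qed
 define T where "T = M*nrm (indicator G :: real^2 => real) + 1"
 have T: "T > 0" using M0 by (simp add: T_def add_nonneg_pos)
 obtain B where B: "\<And>x :: real^2. \<bar>molseq n x\<bar>\<le>B" "B\<ge>0" using test_functions_bounded[OF molseq_test[of n]] by blast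
 obtain Lc where Lc: "Lc\<ge>0" "\<And>x y. \<bar>molseq n x - molseq n y\<bar>\<le>Lc*norm (x - y :: real^2)"
  using smooth_Lipschitz[OF molseq_test[of n]] by metis
 have mm: "molseq n\<in>borel_measurable (borel :: (real^2) measure)" by (rule test_functions_measurable[OF molseq_test])
 have Lip: "\<bar>mol (u i) n x - mol (u i) n y\<bar>\<le>Lc*norm (x - y)*T" for i x y
 proof -
  have "mol (u i) n x - mol (u i) n y = conv (u i) (%z. molseq n z - molseq n (z + (y - x))) x"
   unfolding conv_def using conv_integrand_integrable[OF iu mm B(1), of i]
   by (simp add: right_diff_distrib Bochner_Integration.integral_diff)
  also have "\<bar>...\<bar>\<le>(Lc*norm (x - y))*(LBINT z. \<bar>u i z\<bar>)"
  proof (rule conv_abs_le[OF iu])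
   show "\<bar>molseq n z - molseq n (z + (y - x))\<bar>\<le>Lc*norm (x - y)" for z using Lc(2)[of z "z + (y - x)"] by simp
  qed (use mm in measurable)
  also have "...\<le>Lc*norm (x - y)*T" using l1[of i] Lc(1) by (intro mult_left_mono) (auto simp: T_def)
  finally show ?thesis .
 qed
 obtain g k where gk: "strict_mono (k :: nat => nat)" "\<And>e. 0 < e ==> \<exists>N. \<forall>i x. i\<ge>N\<and>x\<in>K --> norm (mol (u (k i)) n x - g x) < e"
 proof (rule Arzela_Ascoli[OF cK, of "%i. mol (u i) n" "B*T"])
  fix i x
  show "norm (mol (u i) n x)\<le>B*T"
   using conv_abs_le[OF iu mm B(1), of i x] mult_left_mono[OF l1[of i] B(2)] B(2) by (simp add: T_def algebra_simps)
 next
  fix x e assume "0 < (e :: real)"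
  define d where "d = e/((Lc + 1)*T)"
  have LT: "(Lc + 1)*T > 0" using Lc(1) T by simp
  have "norm (mol (u i) n x - mol (u i) n y) < e" if "norm (x - y) < d" for i y
  proof -
   have "Lc*norm (x - y)*T\<le>(Lc + 1)*T*norm (x - y)" using T by (simp add: algebra_simps)
   also have "... < e" using that LT by (simp add: d_def pos_less_divide_eq mult.commute)
   finally show ?thesis using Lip[of i x y] by simp
  qed
  moreover have "d > 0" using \<open>0 < e\<close> LT by (simp add: d_def)
  ultimately show "\<exists>d>0. \<forall>i y. y\<in>K\<and>norm (x - y) < d --> norm (mol (u i) n x - mol (u i) n y) < e" by blast
 qed (rule that)
 define m where "m = measure lborel K + 1"
 have m: "m > 0" by (simp add: m_def add_nonneg_pos)
 \<comment> \<open>Two mollified functions within \<open>s\<close> of \<open>g\<close> differ by at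
   most \<open>2*s\<close> on \<open>K\<close>; its square times the measure of \<open>K\<close> is
   at most \<open>\<epsilon>/18\<close>. The added 1 in \<open>m\<close> excludes a zero
   denominator.\<close>
 define s where "s = sqrt (\<epsilon>/(18 * m))/2"
 have s: "s > 0" using \<epsilon> m by (simp add: s_def)
 obtain N0 where N0: "\<And>i x. i\<ge>N0 ==> x\<in>K ==> norm (mol (u (k i)) n x - g x) < s" using gk(2)[OF s] by blast
 define r where "r i = k (N0 + i)" for i
 have "strict_mono r" using gk(1) by (simp add: r_def strict_mono_def)
 moreover have "(nrm (%x. u (r i) x - u (r j) x))^2\<le>\<epsilon>" for i j
 proof -
  let ?a = "%i. LBINT x. indicator (G - K) x*(u i x)^2" and ?b = "%i. LBINT x. indicator K x*(mol (u i) n x - u i x)^2"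
  have bs: "(%x. mol (u i) n x - u i x)\<in>sqi" for i by (intro sq_int_diff us mol_sq_int(1)[OF G(2) L])
  note ia = sq_int_nn_indicator(2)[OF us mK(3)] and ib = sq_int_nn_indicator(2)[OF bs mK(1)]
  have iK: "integ (indicator K :: real^2 => real)" using emeasure_bounded_finite[OF compact_imp_bounded[OF cK]] mK by simp
  have "(nrm (%x. u (r i) x - u (r j) x))^2\<le>(LBINT x. 2*(indicator (G - K) x*(u (r i) x)^2) + 2*(indicator (G - K) x*(u (r j) x)^2)
   + 3*(indicator K x*(mol (u (r i)) n x - u (r i) x)^2) + 3*(indicator K x*(mol (u (r j)) n x - u (r j) x)^2) + 3*((\<epsilon>/(18 * m))*indicator K x))"
   unfolding ltwo_sq
  proof (rule integral_mono[OF sq_int_integrable[OF sq_int_diff[OF us us]]])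
   fix x
   show "(u (r i) x - u (r j) x)^2\<le>2*(indicator (G - K) x*(u (r i) x)^2) + 2*(indicator (G - K) x*(u (r j) x)^2)
   + 3*(indicator K x*(mol (u (r i)) n x - u (r i) x)^2) + 3*(indicator K x*(mol (u (r j)) n x - u (r j) x)^2) + 3*((\<epsilon>/(18 * m))*indicator K x)"
   proof (cases "x\<in>K")
    case False
    have "(p - q)^2\<le>2*p^2 + 2*q^2" for p q :: real using zero_le_power2[of "p + q"] by (simp add: power2_eq_square algebra_simps)
    then show ?thesis using False L2zD(2)[OF L, of x] by (cases "x\<in>G") auto
   next
    case True
    define a b c where "a = mol (u (r i)) n x - u (r i) x" and "b = mol (u (r j)) n x - u (r j) x" and "c = mol (u (r i)) n x - mol (u (r j)) n x"
    have "\<bar>c\<bar>\<le>2 * s" using N0[of "N0 + i" x] N0[of "N0 + j" x] True unfolding c_def r_def real_norm_def by linarith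
    from power_mono[OF this, of 2] have c: "c^2\<le>\<epsilon>/(18 * m)" using \<epsilon> m by (simp add: s_def)
    have "(u (r i) x - u (r j) x)^2 = (c - a + b)^2" by (simp add: a_def b_def c_def)
    also have "...\<le>3*a^2 + 3*b^2 + 3*c^2"
     using zero_le_power2[of "a + c"] zero_le_power2[of "a + b"] zero_le_power2[of "b - c"] by (simp add: power2_eq_square algebra_simps)
    finally show ?thesis using True c unfolding a_def b_def by simp
   qed
  qed (intro Bochner_Integration.integrable_add integrable_mult_right ia ib iK)
  also have "... = 2*?a (r i) + 2*?a (r j) + 3*?b (r i) + 3*?b (r j) + 3*(\<epsilon>/(18 * m) * measure lborel K)"
   using ia ib iK by simp
  also have "\<epsilon>/(18 * m) * measure lborel K\<le>\<epsilon>/18"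
  proof -
   have "\<epsilon>/(18 * m) * measure lborel K\<le>\<epsilon>/(18 * m) * m" using \<epsilon> m by (intro mult_left_mono) (auto simp: m_def)
   then show ?thesis using m by simp
  qed
  \<comment> \<open>The contributions add up to at most
    \<open>\<epsilon>/3 + \<epsilon>/6 + \<epsilon>/6\<close>.\<close>
  finally show ?thesis using out[of "r i"] out[of "r j"] app[of "r i"] app[of "r j"] \<epsilon> by simp
 qed
 ultimately show ?thesis by (rule that)
qed

text \<open>Each step only makes all distances along a subsequence smaller than a prescribed bound;
  the diagonal sequence satisfies the bound of every step after finitely many terms.\<close>

theorem rellich:
 assumes G: "open G" "bounded G" and lip: "lipschitz_boundary G"
  and w: "\<And>i. wderiv G 1 (u i) (v1 i)" "\<And>i. wderiv G 2 (u i) (v2 i)"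
  and M: "\<And>i. nrm (u i)\<le>M" "\<And>i. nrm (v1 i)\<le>M" "\<And>i. nrm (v2 i)\<le>M"
 obtains r where "strict_mono (r :: nat => nat)" "ltwo_Cauchy lborel (%i. u (r i))"
proof -
 define P where "P n s \<longleftrightarrow> (\<forall>i j. (nrm (%x. u (s i) x - u (s j) x))^2\<le>1/real (Suc n))" for n and s :: "nat => nat"
 interpret subseqs P
 proof
  fix n and s :: "nat => nat"
  obtain r :: "nat => nat" where "strict_mono r" "\<And>i j. (nrm (%x. u (s (r i)) x - u (s (r j)) x))^2\<le>1/real (Suc n)"
   by (rule rellich_step[of G "1/real (Suc n)" "%i. u (s i)" "%i. v1 (s i)" "%i. v2 (s i)" M]) (use G lip w M in \<open>auto simp del: of_nat_Suc intro: that\<close>)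
  then show "\<exists>r'. strict_mono r'\<and>P n (s \<circ> r')" by (auto simp: P_def)
 qed
 have hold: "P n (diagseq \<circ> ((+) (Suc n)))" for n by (rule diagseq_holds) (simp add: P_def)
 show ?thesis
 proof (rule that[OF subseq_diagseq])
  show "ltwo_Cauchy lborel (%i. u (diagseq i))"
   unfolding ltwo_Cauchy_def
  proof (intro allI impI)
   fix e :: real assume e: "e > 0"
   then obtain n where n: "1/real (Suc n) < e^2" using nat_approx_posE[of "e^2"] by auto
   have "nrm (%x. u (diagseq p) x - u (diagseq q) x) < e" if "p\<ge>Suc n" "q\<ge>Suc n" for p q
   proof -
    have "(nrm (%x. u (diagseq p) x - u (diagseq q) x))^2\<le>1/real (Suc n)"
     using P_def[THEN iffD1, OF hold[of n], rule_format, of "p - Suc n" "q - Suc n"] that by simp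
    then have "(nrm (%x. u (diagseq p) x - u (diagseq q) x))^2 < e^2" using n by linarith
    then show ?thesis using e by (auto intro: power2_less_imp_less)
   qed
   then show "\<exists>N. \<forall>m\<ge>N. \<forall>n\<ge>N. nrm (%x. u (diagseq m) x - u (diagseq n) x) < e" by blast
  qed
 qed
qed

section \<open>Borel representatives of Sobolev functions\<close>

text \<open>The bridge between the two settings: functions in the theorem are arbitrary outside the
  domain and Lebesgue measurable inside, whereas the analysis uses Borel functions on the whole
  space that vanish outside.\<close>

definition rep :: "'a::euclidean_space set => ('a => real) => ('a => real) => bool" where
 "rep S f f' \<longleftrightarrow> f'\<in>bmeas\<and>(\<forall>x. x\<notin>S --> f' x = 0)\<and>(AE x in lborel. x\<in>S --> f x = f' x)"

lemma AE_lebesgue_on_iff: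
 assumes "S\<in>sets borel"
 shows "(AE x in lebesgue_on S. P x) \<longleftrightarrow> (AE x in lborel. x\<in>S --> P x)"
 using assms by (subst AE_restrict_space_iff) (auto simp: AE_completion_iff)

lemma rep_exists:
 fixes f :: "'a::euclidean_space => real"
 assumes S: "S\<in>sets borel" and f: "f\<in>borel_measurable (lebesgue_on S)"
 obtains f' where "rep S f f'"
proof -
 have "(%x. if x\<in>S then f x else 0)\<in>borel_measurable lebesgue"
  by (rule borel_measurable_if_I[OF f]) (use S in auto)
 from completion_ex_borel_measurable_real[OF this] obtain g where
  g: "g\<in>borel_measurable lborel" "AE x in lborel. (if x\<in>S then f x else 0) = g x" by blast
 have "rep S f (%x. indicator S x*g x)" unfolding rep_def
 proof (intro conjI)
  show "AE x in lborel. x\<in>S --> f x = indicator S x*g x" using g(2) by eventually_elim auto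
 qed (use S g(1) in auto)
 then show ?thesis by (rule that)
qed

lemma rep_self: "f\<in>bmeas ==> (\<And>x. x\<notin>S ==> f x = 0) ==> rep S f f"
 by (simp add: rep_def)

text \<open>The operation may depend on the point, which covers multiplication by test functions and
  weights; one-place operations use the same function twice. Preserving 0 keeps the representative
  null outside the domain.\<close>

lemma rep_apply2:
 assumes "rep S f f'" "rep S g g'" "(%x. h x (f' x) (g' x))\<in>bmeas" "\<And>x. h x 0 0 = 0"
 shows "rep S (%x. h x (f x) (g x)) (%x. h x (f' x) (g' x))"
proof -
 have "AE x in lborel. x\<in>S --> f x = f' x" "AE x in lborel. x\<in>S --> g x = g' x" using assms by (auto simp: rep_def)
 then have "AE x in lborel. x\<in>S --> h x (f x) (g x) = h x (f' x) (g' x)" by eventually_elim auto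
 then show ?thesis using assms by (auto simp: rep_def)
qed

lemma rep_restrict:
 assumes "rep S f f'" "T\<subseteq>S" "T\<in>sets borel"
 shows "rep T f (%x. indicator T x*f' x)"
proof -
 have "AE x in lborel. x\<in>S --> f x = f' x" using assms by (simp add: rep_def)
 then have "AE x in lborel. x\<in>T --> f x = indicator T x*f' x" by eventually_elim (use assms(2) in auto)
 then show ?thesis using assms by (auto simp: rep_def)
qed

lemma rep_measurable:
 assumes r: "rep S f f'" and S: "S\<in>sets borel"
 shows "f\<in>borel_measurable (lebesgue_on S)"
proof (rule borel_measurable_if_D)
 show "(%x. if x\<in>S then f x else 0)\<in>borel_measurable lebesgue"
 proof (rule borel_measurable_AE)
  show "f'\<in>borel_measurable lebesgue" using r by (auto simp: rep_def intro: measurable_completion)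
  show "AE x in lebesgue. f' x = (if x\<in>S then f x else 0)"
   using r unfolding AE_completion_iff rep_def by (auto elim!: AE_mp)
 qed
qed

lemma rep_integral:
 assumes r: "rep S f f'" and S: "S\<in>sets borel"
 shows "integrable (lebesgue_on S) f \<longleftrightarrow> integ f'" "(\<integral>x. f x \<partial>lebesgue_on S) = (LBINT x. f' x)"
proof -
 have e: "AE x in lebesgue. indicator S x *\<^sub>R f x = f' x"
  unfolding AE_completion_iff using r unfolding rep_def by (auto elim!: AE_mp intro!: AE_I2 simp: indicator_def)
 have m: "f'\<in>bmeas" using r by (simp add: rep_def)
 then have m': "f'\<in>borel_measurable lebesgue" by (auto intro: measurable_completion)
 have m2: "(%x. indicator S x *\<^sub>R f x)\<in>borel_measurable lebesgue"
  using rep_measurable[OF r S] S by (subst borel_measurable_restrict_space_iff[symmetric]) auto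
 have S': "S\<inter>space lebesgue\<in>sets lebesgue" using S by simp
 show "integrable (lebesgue_on S) f \<longleftrightarrow> integ f'"
  unfolding integrable_restrict_space[OF S'] integrable_cong_AE[OF m2 m' e] using m by (intro integrable_completion) simp
 show "(\<integral>x. f x \<partial>lebesgue_on S) = (LBINT x. f' x)"
  unfolding integral_restrict_space[OF S'] integral_cong_AE[OF m2 m' e] using m by (intro integral_completion) simp
qed

lemma L2z_rep: "u\<in>L2z S ==> rep S u u"
 by (auto intro: rep_self L2zD)

lemma rep_L2:
 assumes r: "rep S f f'" and S: "S\<in>sets borel"
 shows "f\<in>L2 S \<longleftrightarrow> f'\<in>L2z S"
proof -
 have m: "f'\<in>bmeas" using r by (simp add: rep_def)
 have "rep S (%x. (f x)^2) (%x. (f' x)^2)"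
  by (rule rep_apply2[OF r r, of "%x a b. a^2"]) (use m in auto)
 from rep_integral(1)[OF this S] show ?thesis
  using rep_measurable[OF r S] r by (auto simp: L2_def L2z_def sq_int_def rep_def)
qed

lemma rep_AE_unique:
 assumes "rep S f f'" "rep S g g'" "AE x in lborel. x\<in>S --> f x = g x"
 shows "AE x in lborel. f' x = g' x"
proof -
 have "AE x in lborel. x\<in>S --> f x = f' x" "AE x in lborel. x\<in>S --> g x = g' x" using assms by (auto simp: rep_def)
 with assms(3) show ?thesis
 proof eventually_elim
  case (elim x)
  then show ?case using assms(1,2) by (cases "x\<in>S") (auto simp: rep_def)
 qed
qed

lemma mol_bounded:
 fixes u :: "real^'n::finite => real"
 assumes u: "u\<in>bmeas" "\<And>x. \<bar>u x\<bar>\<le>1"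
 shows "\<bar>mol u n x\<bar>\<le>1"
proof -
 note b = mollifierD[OF mollifier_molseq]
 have "\<bar>mol u n x\<bar>\<le>(LBINT z. \<bar>u (x - z) * molseq n z\<bar>)"
  unfolding conv_commute[OF u(1) b(6)] by (rule integral_abs_bound)
 also have "...\<le>(\<integral>z. molseq n z \<partial>(lborel :: (real^'n) measure))"
 proof (rule Bochner_Integration.integral_mono')
  fix z show "\<bar>u (x - z) * molseq n z\<bar>\<le>molseq n z"
   using mult_right_mono[OF u(2) abs_ge_zero, of "x - z" "molseq n z"] mollifierD(2)[OF mollifier_molseq[of n], of z] by (simp add: abs_mult)
 qed (use b in auto)
 also have "... = 1" by (rule mollifierD(4)[OF mollifier_molseq])
 finally show ?thesis .
qed

text \<open>The test functions are mollifications of \<open>sgn h\<close> on \<open>K\<close>.\<close>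

lemma fundamental_lemma_compact:
 fixes h :: "real^'n::finite => real"
 assumes h: "integ h" and G: "open G" and K: "compact K" "K\<subseteq>G"
  and z: "\<And>f. f\<in>test_functions G ==> (LBINT x. h x*f x) = 0"
 shows "AE x in lborel. x\<in>K --> h x = 0"
proof -
 have [measurable]: "h\<in>bmeas" "K\<in>sets borel" using h K(1) by (auto simp: borel_compact)
 define g where "g x = indicator K x * sgn (h x)" for x
 have gm [measurable]: "g\<in>bmeas" unfolding g_def by measurable
 have g1: "\<bar>g x\<bar>\<le>1" for x by (auto simp: g_def indicator_def sgn_if)
 have bK: "bounded K" by (rule compact_imp_bounded[OF K(1)])
 have gL: "g\<in>L2z K" unfolding L2z_def
 proof (intro CollectI conjI allI impI)
  show "g\<in>sqi"
   by (rule sq_int_bound[OF _ indicator_sq_int[of K]]) (use emeasure_bounded_finite[OF bK] in \<open>auto simp: g_def indicator_def sgn_if\<close>)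
 qed (simp add: g_def)
 note L = gL mol_sq_int(1)[OF bK gL] mol_tendsto[OF bK gL]
 obtain r where r: "strict_mono r" "AE x in lborel. (%k. mol g (r k) x)---->g x"
  by (rule ltwo_tendsto_AE_subseq[OF L(2) L2zD(1)[OF gL] L(3)])
 obtain N where N: "\<And>n x. n\<ge>N ==> x\<in>K ==> cball x (1/real (Suc n))\<subseteq>G"
  using compact_cball_margin[OF G K] by blast
 have test: "mol g n\<in>test_functions G" if n: "n\<ge>N" for n
 proof (rule test_functionsI)
  show "smooth (mol g n)" by (rule mol_smooth[OF L2z_integrable[OF bK gL]])
  let ?S = "{x + y |x y. x\<in>K\<and>y\<in>cball 0 (1/real (Suc n))}"
  show "compact ?S" by (rule compact_sums[OF K(1)]) simp
  show "?S\<subseteq>G"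
  proof
   fix p assume "p\<in>?S"
   then obtain x y where "p = x + y" "x\<in>K" "y\<in>cball 0 (1/real (Suc n))" by blast
   then show "p\<in>G" using N[OF n, of x] by (auto simp: dist_norm)
  qed
  fix y assume "mol g n y\<noteq>0"
  then have "\<exists>x. g x * molseq n (y - x)\<noteq>0" unfolding conv_def by (metis (no_types, lifting) Bochner_Integration.integral_zero Bochner_Integration.integral_cong)
  then obtain x where "g x\<noteq>0" "molseq n (y - x)\<noteq>0" by auto
  then show "y\<in>?S" using molseq_support[of n "y - x"] by (intro CollectI exI[of _ x] exI[of _ "y - x"] conjI) (auto simp: g_def indicator_def split: if_splits)
 qed
 have l: "(%k. LBINT x. h x * mol g (r k) x)---->(LBINT x. h x*g x)"
 proof (rule integral_dominated_convergence[of _ _ _ "%x. \<bar>h x\<bar>"])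
  show "AE x in lborel. (%k. h x * mol g (r k) x)---->h x*g x"
   using r(2) by eventually_elim (intro tendsto_intros)
  show "AE x in lborel. norm (h x * mol g (r k) x)\<le>\<bar>h x\<bar>" for k
   using mol_bounded[OF gm g1] by (intro AE_I2) (simp add: abs_mult mult_left_le)
 qed (use h sq_int_measurable[OF L(2)] in auto)
 have ev: "eventually (%k. (LBINT x. h x * mol g (r k) x) = 0) sequentially"
  using z[OF test] seq_suble[OF r(1)] by (intro eventually_sequentiallyI[of N]) (meson order_trans)
 have 0: "(LBINT x. h x*g x) = 0" by (rule LIMSEQ_unique[OF l tendsto_eventually[OF ev]])
 have e: "h x*g x = \<bar>indicator K x*h x\<bar>" for x by (auto simp: g_def indicator_def abs_if sgn_if)
 have "integ (%x. indicator K x*h x)" using integrable_real_mult_indicator[of K, OF _ h] by (simp add: mult.commute)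
 from integral_nonneg_eq_0_iff_AE[OF integrable_abs[OF this]] 0
 have "AE x in lborel. indicator K x*h x = 0" unfolding e by simp
 then show ?thesis by eventually_elim auto
qed

lemma locally_integrable_rep:
 assumes "locally_integrable G v" "compact K" "K\<subseteq>G"
 obtains h where "rep K v h" "integ h"
proof -
 have i: "integrable (lebesgue_on K) v" and b: "K\<in>sets borel" using assms by (auto simp: locally_integrable_def borel_compact)
 obtain h where h: "rep K v h" by (rule rep_exists[OF b borel_measurable_integrable[OF i]])
 then show ?thesis using rep_integral(1)[OF h b] i that by blast
qed

lemma locally_integrable_test:
 assumes v: "locally_integrable G v" and G: "open G" and p: "p\<in>test_functions G"
  and K: "compact K" "K\<subseteq>G" "\<And>x. p x\<noteq>0 ==> x\<in>K" and h: "rep K v h"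
 shows "rep G (%x. v x*p x) (%x. h x*p x)"
proof -
 have "AE x in lborel. x\<in>K --> v x = h x" using h by (simp add: rep_def)
 then have "AE x in lborel. x\<in>G --> v x*p x = h x*p x" by eventually_elim (use K(3) in auto)
 then show ?thesis using h K test_functions_measurable[OF p] by (auto simp: rep_def)
qed

text \<open>Around a compact \<open>K\<close> a slightly larger compact set is chosen, on which both
  derivatives have integrable representatives; the test functions live in the open neighbourhood
  between them. Countably many compact sets exhaust \<open>G\<close>. Statements about
  \<open>weak_deriv\<close>, an arbitrary choice, rest on this.\<close>

lemma weak_deriv_unique:
 fixes G :: "(real^'n::finite) set"
 assumes G: "open G" and w: "is_weak_deriv G as u v" "is_weak_deriv G as u v'"
 shows "AE x in lborel. x\<in>G --> v x = v' x"
proof -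
 have li: "locally_integrable G v" "locally_integrable G v'" using w by (auto simp: is_weak_deriv_def)
 let ?d = "%x. v x - v' x"
 have K: "AE x in lborel. x\<in>K --> ?d x = 0" if K: "compact K" "K\<subseteq>G" for K
 proof -
  obtain e where e: "e > 0" "(\<Union>x\<in>K. cball x e)\<subseteq>G"
  proof -
   obtain N where "\<And>n x. n\<ge>N ==> x\<in>K ==> cball x (1/real (Suc n))\<subseteq>G"
    using compact_cball_margin[OF G K] by blast
   then show ?thesis by (intro that[of "1/real (Suc N)"]) auto
  qed
  let ?S = "{x + y |x y. x\<in>K\<and>y\<in>cball 0 e}"
  have S: "compact ?S" by (rule compact_sums[OF K(1)]) simp
  have SG: "?S\<subseteq>G" using e(2) by (force simp: dist_norm)
  have KS: "(\<Union>x\<in>K. ball x e)\<subseteq>?S"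
  proof
   fix p assume "p\<in>(\<Union>x\<in>K. ball x e)"
   then obtain x where "x\<in>K" "dist x p < e" by auto
   then show "p\<in>?S" by (intro CollectI exI[of _ x] exI[of _ "p - x"] conjI) (auto simp: dist_norm norm_minus_commute)
  qed
  obtain h where h: "rep ?S v h" "integ h" by (rule locally_integrable_rep[OF li(1) S SG])
  obtain h' where h': "rep ?S v' h'" "integ h'" by (rule locally_integrable_rep[OF li(2) S SG])
  have "AE x in lborel. x\<in>K --> h x - h' x = 0"
  proof (rule fundamental_lemma_compact[of _ "\<Union>x\<in>K. ball x e"])
   fix f assume p: "f\<in>test_functions (\<Union>x\<in>K. ball x e)"
   have p': "f\<in>test_functions G" using test_functions_mono[OF order_trans[OF KS SG]] p by blast
   have s: "x\<in>?S" if "f x\<noteq>0" for x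
    using p that KS closure_subset[of "{y. f y\<noteq>0}"] unfolding test_functions_def by blast
   obtain B where B: "\<And>x. \<bar>f x\<bar>\<le>B" using test_functions_bounded[OF p] by blast
   have m: "G\<in>sets borel" using G by simp
   have i: "integ (%x. h x*f x)" "integ (%x. h' x*f x)"
    using integrable_mult_bounded[OF h(2) _ B] integrable_mult_bounded[OF h'(2) _ B] test_functions_measurable[OF p] by auto
   have "(- 1)^length as*(\<integral>y. v y*f y \<partial>lebesgue_on G) = (- 1)^length as*(\<integral>y. v' y*f y \<partial>lebesgue_on G)"
    using bspec[OF w(1)[unfolded is_weak_deriv_def, THEN conjunct2, THEN conjunct2] p'] bspec[OF w(2)[unfolded is_weak_deriv_def, THEN conjunct2, THEN conjunct2] p'] by (rule trans[OF sym])
   then have "(LBINT x. h x*f x) = (LBINT x. h' x*f x)"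
    using rep_integral(2)[OF locally_integrable_test[OF li(1) G p' S SG s h(1)] m]
     rep_integral(2)[OF locally_integrable_test[OF li(2) G p' S SG s h'(1)] m] by simp
   then show "(LBINT x. (h x - h' x)*f x) = 0" using i by (simp add: left_diff_distrib)
  qed (use h h' K e in auto)
  moreover have "AE x in lborel. x\<in>?S --> v x = h x" "AE x in lborel. x\<in>?S --> v' x = h' x" using h h' by (auto simp: rep_def)
  ultimately show ?thesis
  proof eventually_elim
   case (elim x)
   show ?case using elim e(1) KS by force
  qed
 qed
 obtain C where C: "\<And>n :: nat. compact (C n)" "(\<Union>n. C n) = G"
  by (rule open_Union_compact_subsets[OF G]) (rule that)
 have "AE x in lborel. \<forall>n. x\<in>C n --> ?d x = 0"
  unfolding AE_all_countable using K C by blast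
 then show ?thesis by eventually_elim (use C(2) in auto)
qed

text \<open>A simultaneous choice of Borel representatives for all weak derivatives up to order
  \<open>m\<close>; the empty list stands for the function itself, which \<open>u\<close> equals
  only almost everywhere.\<close>

definition jet :: "(real^2) set => nat => (real^2 => real) => (2 list => real^2 => real) => bool" where
 "jet G m u j \<longleftrightarrow> u\<in>sobolev m G\<and>(\<forall>as. length as\<le>m --> j as\<in>L2z G\<and>rep G (weak_deriv G as u) (j as))"

lemma locally_integrable_L2z:
 assumes "bounded G" "G\<in>sets borel" "rep G u u'" "u'\<in>L2z G"
 shows "locally_integrable G u"
 unfolding locally_integrable_def
proof (intro allI impI)
 fix K assume K: "compact K\<and>K\<subseteq>G"
 then have b: "K\<in>sets borel" by (simp add: borel_compact)
 have "integ (%x. indicator K x*u' x)"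
  using integrable_real_mult_indicator[of K, OF _ L2z_integrable[OF assms(1,4)]] b by (simp add: mult.commute)
 then show "integrable (lebesgue_on K) u" using rep_integral(1)[OF rep_restrict[OF assms(3) _ b] b] K by simp
qed

lemma is_weak_deriv_rep:
 assumes G: "open G" "bounded G" and u: "rep G u u'" "u'\<in>L2z G" and v: "rep G v v'" "v'\<in>L2z G"
 shows "is_weak_deriv G as u v \<longleftrightarrow> (\<forall>p\<in>test_functions G.
  (LBINT x. u' x*partial_derivs as p x) = (-1)^length as*(LBINT x. v' x*p x))"
proof -
 have b: "G\<in>sets borel" using G by simp
 have "(\<integral>x. f x*p x \<partial>lebesgue_on G) = (LBINT x. f' x*p x)" if "rep G f f'" "p\<in>test_functions G" for f f' p
  by (rule rep_integral(2)[OF rep_apply2[OF that(1,1), of "%x a b. a*p x"] b])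
   (use that test_functions_measurable[OF that(2)] in \<open>auto simp: rep_def\<close>)
 note e = this[OF u(1) test_functions_partial_derivs] this[OF v(1)]
 show ?thesis unfolding is_weak_deriv_def
  using locally_integrable_L2z[OF G(2) b u] locally_integrable_L2z[OF G(2) b v] by (simp add: e)
qed

lemma jetI:
 assumes G: "open G" "bounded G" and u: "rep G u (j [])" and j: "\<And>as. length as\<le>m ==> j as\<in>L2z G"
  and d: "\<And>as p. length as\<le>m ==> p\<in>test_functions G ==>
   (LBINT x. j [] x*partial_derivs as p x) = (-1)^length as*(LBINT x. j as x*p x)"
 shows "jet G m u j"
proof -
 have b: "G\<in>sets borel" using G by simp
 note j0 = j[of "[]", simplified]
 have wd: "is_weak_deriv G as u (j as)" if "length as\<le>m" for as
  unfolding is_weak_deriv_rep[OF G u j0 L2z_rep[OF j[OF that]] j[OF that]] using d that by blast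
 have "u\<in>L2 G" using rep_L2[OF u b] j0 by simp
 moreover have "j as\<in>L2 G" if "length as\<le>m" for as using rep_L2[OF L2z_rep[OF j[OF that]] b] j[OF that] by simp
 ultimately have "u\<in>sobolev m G" unfolding sobolev_def using wd by blast
 moreover have "rep G (weak_deriv G as u) (j as)" if "length as\<le>m" for as
  using weak_deriv_unique[OF G(1) someI[where P = "is_weak_deriv G as u", OF wd[OF that]] wd[OF that]] j[OF that]
  unfolding weak_deriv_def by (auto simp: rep_def L2zD)
 ultimately show ?thesis using j by (simp add: jet_def)
qed

lemma jet_D:
 assumes "jet G m u j"
 shows "u\<in>sobolev m G" "length as\<le>m ==> j as\<in>L2z G" "length as\<le>m ==> rep G (weak_deriv G as u) (j as)"
  "length as\<le>m ==> is_weak_deriv G as u (weak_deriv G as u)"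
proof -
 show u: "u\<in>sobolev m G" "length as\<le>m ==> j as\<in>L2z G" "length as\<le>m ==> rep G (weak_deriv G as u) (j as)"
  using assms by (auto simp: jet_def)
 assume "length as\<le>m"
 then obtain v where "is_weak_deriv G as u v" using u(1) by (auto simp: sobolev_def)
 then show "is_weak_deriv G as u (weak_deriv G as u)" unfolding weak_deriv_def by (rule someI[where P = "is_weak_deriv G as u"])
qed

lemma jet_exists:
 assumes G: "open G" and u: "u\<in>sobolev m G"
 obtains j where "jet G m u j"
proof -
 have b: "G\<in>sets borel" using G by simp
 have "\<exists>f. f\<in>L2z G\<and>rep G (weak_deriv G as u) f" if as: "length as\<le>m" for as
 proof -
  obtain v where v: "v\<in>L2 G" "is_weak_deriv G as u v" using u as by (auto simp: sobolev_def)
  obtain f where f: "rep G v f" by (rule rep_exists[OF b]) (use v in \<open>auto simp: L2_def\<close>)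
  have "AE x in lborel. x\<in>G --> weak_deriv G as u x = v x" unfolding weak_deriv_def
   by (rule weak_deriv_unique[OF G someI[where P = "is_weak_deriv G as u", OF v(2)] v(2)])
  moreover have "AE x in lborel. x\<in>G --> v x = f x" using f by (simp add: rep_def)
  ultimately have "AE x in lborel. x\<in>G --> weak_deriv G as u x = f x" by eventually_elim auto
  then show ?thesis using f rep_L2[OF f b] v(1) by (auto simp: rep_def)
 qed
 then obtain j where "\<And>as. length as\<le>m ==> j as\<in>L2z G\<and>rep G (weak_deriv G as u) (j as)" by metis
 then show ?thesis using u by (intro that[of j]) (simp add: jet_def)
qed

lemma jet_rep:
 assumes G: "open G" "bounded G" and j: "jet G m u j"
 shows "rep G u (j [])"
proof -
 have b: "G\<in>sets borel" using G by simp
 have u: "u\<in>L2 G" using jet_D(1)[OF j] by (simp add: sobolev_def)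
 obtain f where f: "rep G u f" by (rule rep_exists[OF b]) (use u in \<open>auto simp: L2_def\<close>)
 then have L: "f\<in>L2z G" using rep_L2[OF f b] u by simp
 have "is_weak_deriv G [] u u" unfolding is_weak_deriv_rep[OF G f L f L] by simp
 from weak_deriv_unique[OF G(1) this jet_D(4)[OF j]]
 have "AE x in lborel. x\<in>G --> u x = weak_deriv G [] u x" by simp
 moreover have r: "rep G (weak_deriv G [] u) (j [])" using jet_D(3)[OF j] by simp
 then have "AE x in lborel. x\<in>G --> weak_deriv G [] u x = j [] x" by (simp add: rep_def)
 ultimately have "AE x in lborel. x\<in>G --> u x = j [] x" by eventually_elim auto
 then show ?thesis using r by (simp add: rep_def)
qed

lemma jet_by_parts:
 assumes G: "open G" "bounded G" and j: "jet G m u j" and as: "length as\<le>m" and p: "p\<in>test_functions G"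
 shows "(LBINT x. j [] x*partial_derivs as p x) = (-1)^length as*(LBINT x. j as x*p x)"
 using jet_D(4)[OF j as] p unfolding is_weak_deriv_rep[OF G jet_rep[OF G j] jet_D(2)[OF j, of "[]", simplified] jet_D(3,2)[OF j as]] by blast

text \<open>The list grows at its end because in \<open>partial_derivs\<close> the last entry acts
  first, that is, directly on the test function.\<close>

lemma jet_wderiv:
 assumes G: "open G" "bounded G" and j: "jet G m u j" and as: "length as < m"
 shows "wderiv G i (j as) (j (as @ [i]))"
 unfolding wderiv_def
proof (intro conjI ballI)
 fix f assume p: "f\<in>test_functions G"
 have "(-1)^length as*(LBINT x. j as x*pd i f x) = (LBINT x. j [] x*partial_derivs (as @ [i]) f x)"
  unfolding partial_derivs_append[symmetric]
  by (rule jet_by_parts[OF G j _ test_functions_partial_derivs[OF p], symmetric]) (use as in simp)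
 also have "... = (-1)^length as*(- (LBINT x. j (as @ [i]) x*f x))"
  using jet_by_parts[OF G j _ p, of "as @ [i]"] as by simp
 finally show "(LBINT x. j as x*pd i f x) = - (LBINT x. j (as @ [i]) x*f x)"
  by (simp only: mult_cancel_left power_eq_0_iff neg_equal_0_iff_equal one_neq_zero simp_thms)
qed (use jet_D(2)[OF j] as in auto)

lemma jet_linear:
 assumes G: "open G" "bounded G" and j: "jet G m u j" "jet G m v k"
 shows "jet G m (%y. a*u y + b * v y) (%as y. a*j as y + b * k as y)"
proof (rule jetI[OF G])
 note L = jet_D(2)[OF j(1)] jet_D(2)[OF j(2)]
 show "rep G (%y. a*u y + b * v y) (%y. a*j [] y + b * k [] y)"
  by (rule rep_apply2[OF jet_rep[OF G j(1)] jet_rep[OF G j(2)], of "%x p q. a*p + b*q"])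
   (use L2zD(3)[OF L(1)] L2zD(3)[OF L(2)] in auto)
 show "(%y. a*j as y + b * k as y)\<in>L2z G" if "length as\<le>m" for as
  by (intro L2z_add L2z_cmult L that)
 fix as :: "2 list" and w assume as: "length as\<le>m" and p: "w\<in>test_functions G"
 have i: "integ (%x. f x*\<psi> x)" if "f\<in>L2z G" "\<psi>\<in>test_functions G" for f \<psi>
  by (intro sq_int_mult_integrable L2zD(1)[OF that(1)] test_functions_sq_int[OF that(2)])
 have "(LBINT x. (a*f x + b*g x)*\<psi> x) = a*(LBINT x. f x*\<psi> x) + b*(LBINT x. g x*\<psi> x)"
  if "f\<in>L2z G" "g\<in>L2z G" "\<psi>\<in>test_functions G" for f g \<psi>
  using i[OF that(1,3)] i[OF that(2,3)] by (simp add: distrib_right mult.assoc)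
 then show "(LBINT x. (a*j [] x + b * k [] x)*partial_derivs as w x) = (-1)^length as*(LBINT x. (a*j as x + b * k as x)*w x)"
  using jet_by_parts[OF G j(1) as p] jet_by_parts[OF G j(2) as p] L as p test_functions_partial_derivs[OF p, of as]
  by (simp add: distrib_left mult.left_commute)
qed

text \<open>Completeness of the Sobolev space, phrased for representatives: both sides of the
  integration by parts identity are continuous under convergence in the mean.\<close>

lemma jet_limit:
 assumes G: "open G" "bounded G" and j: "\<And>n. jet G m (s n) (J n)"
  and C: "\<And>as. length as\<le>m ==> ltwo_Cauchy lborel (%n. J n as)"
 obtains u j where "jet G m u j" "\<And>as. length as\<le>m ==> (%n. nrm (%x. J n as x - j as x))---->0"
proof -
 have b: "G\<in>sets borel" using G by simp
 note L = jet_D(2)[OF j]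
 have "\<exists>f\<in>L2z G. (%n. nrm (%x. J n as x - f x))---->0" if "length as\<le>m" for as
  by (rule L2z_limit[OF b L[OF that] C[OF that]]) blast
 then have "\<forall>as\<in>{as. length as\<le>m}. \<exists>f. f\<in>L2z G\<and>(%n. nrm (%x. J n as x - f x))---->0" by blast
 from bchoice[OF this] obtain j where
  j': "\<And>as. length as\<le>m ==> j as\<in>L2z G\<and>(%n. nrm (%x. J n as x - j as x))---->0" by auto
 have "jet G m (j []) j"
 proof (rule jetI[OF G])
  fix as :: "2 list" and q assume as: "length as\<le>m" and p: "q\<in>test_functions G"
  have t: "(%n. LBINT x. J n bs x*g x)---->(LBINT x. j bs x*g x)" if "length bs\<le>m" "g\<in>test_functions G" for bs g
   using j'[OF that(1)] L[OF that(1)] test_functions_sq_int[OF that(2)] by (intro ltwo_tendsto_inner) (auto dest: L2zD)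
  have "(%n. LBINT x. J n [] x*partial_derivs as q x)---->(-1)^length as*(LBINT x. j as x*q x)"
   unfolding jet_by_parts[OF G j as p] by (intro tendsto_intros t as p)
  with t[of "[]", OF _ test_functions_partial_derivs[OF p, of as]]
  show "(LBINT x. j [] x*partial_derivs as q x) = (-1)^length as*(LBINT x. j as x*q x)"
   using LIMSEQ_unique by simp
 qed (use j' in \<open>auto intro: L2z_rep\<close>)
 then show ?thesis using j' that by blast
qed

lemma sobolev_norm_jet:
 assumes G: "open G" and j: "jet G m u j"
 shows "sobolev_norm m G u = sqrt (\<Sum>as | length as\<le>m. (nrm (j as))^2)"
proof -
 have b: "G\<in>sets borel" using G by simp
 have "(\<integral>y. (weak_deriv G as u y)^2 \<partial>lebesgue_on G) = (nrm (j as))^2" if "length as\<le>m" for as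
  unfolding ltwo_sq
  by (rule rep_integral(2)[OF rep_apply2[OF jet_D(3)[OF j that] jet_D(3)[OF j that], of "%x a b. a^2"] b])
   (use L2zD(3)[OF jet_D(2)[OF j that]] in auto)
 then show ?thesis unfolding sobolev_norm_def by (auto intro!: sum.cong arg_cong[where f = sqrt])
qed

lemma jet_zero:
 assumes G: "open G" "bounded G" and j: "jet G m u j" and z: "AE x in lebesgue_on G. u x = 0" and as: "length as\<le>m"
 shows "nrm (j as) = 0"
proof -
 have b: "G\<in>sets borel" using G by simp
 have r: "rep G u (%x. 0)" using z unfolding AE_lebesgue_on_iff[OF b] by (simp add: rep_def)
 have r0: "rep G (%x. 0) (%x. 0)" by (simp add: rep_def)
 have "is_weak_deriv G as u (%x. 0)" unfolding is_weak_deriv_rep[OF G r L2z_zero r0 L2z_zero] by simp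
 from rep_AE_unique[OF jet_D(3)[OF j as] r0 weak_deriv_unique[OF G(1) jet_D(4)[OF j as] this]]
 show ?thesis using ltwo_eq_0_iff[OF L2zD(1)[OF jet_D(2)[OF j as]]] by simp
qed

section \<open>Energy minimization in an abstract space of displacement jets\<close>

text \<open>Being Cauchy becomes a limit along a product filter, so estimates stated for an
  arbitrary filter serve single sequences and pairs of indices alike.\<close>

lemma ltwo_Cauchy_iff:
 "ltwo_Cauchy M s \<longleftrightarrow> ((%p. ltwo M (%x. s (fst p) x - s (snd p) x))\<longlongrightarrow>0) (sequentially \<times>\<^sub>F sequentially)"
 unfolding ltwo_Cauchy_def tendsto_iff eventually_prod_sequentially by (force simp: dist_real_def)

lemma ltwo_Cauchy_subseq:
 assumes "ltwo_Cauchy M s" "strict_mono r"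
 shows "ltwo_Cauchy M (%n. s (r n))"
 using assms unfolding ltwo_Cauchy_def by (meson order_trans seq_suble)

lemma ltwo_mult:
 assumes f: "(%x. (f x)^2)\<in>sq_int M" "f\<in>borel_measurable M" and g: "(%x. (g x)^2)\<in>sq_int M" "g\<in>borel_measurable M"
 shows "(%x. f x*g x)\<in>sq_int M" "(ltwo M (%x. f x*g x))^2\<le>ltwo M (%x. (f x)^2)*ltwo M (%x. (g x)^2)"
proof -
 show "(%x. f x*g x)\<in>sq_int M"
  using sq_int_mult_integrable[OF f(1) g(1)] f(2) g(2) by (intro sq_intI) (auto simp: power_mult_distrib)
 show "(ltwo M (%x. f x*g x))^2\<le>ltwo M (%x. (f x)^2)*ltwo M (%x. (g x)^2)"
  using ltwo_CS[OF f(1) g(1)] unfolding ltwo_sq by (simp add: power_mult_distrib)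
qed

text \<open>A state collects \<open>w\<^sub>1, \<partial>\<^sub>1w\<^sub>1, \<partial>\<^sub>2w\<^sub>1\<close> (indices 0 to 2), \<open>w\<^sub>2, \<partial>\<^sub>1w\<^sub>2, \<partial>\<^sub>2w\<^sub>2\<close> (3 to 5),
 \<open>z, \<partial>\<^sub>1z, \<partial>\<^sub>2z\<close> (6 to 8) and the second derivatives of \<open>z\<close> (9 to 12).\<close>

type_synonym state = "nat => real^2 => real"

text \<open>The index \<open>k\<close> runs through the four squares of the elastic energy: both
  diagonal entries, twice the off-diagonal entry, and the trace. This is the part of the strain that
  is quadratic in the slopes; \<open>ml\<close> is the linear part.\<close>

definition mq :: "nat => state => real^2 => real" where
 "mq k U y = (if k = 0 then (U 7 y)^2/2 else if k = 1 then (U 8 y)^2/2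
   else if k = 2 then U 7 y*U 8 y else (U 7 y)^2/2 + (U 8 y)^2/2)"

definition ml :: "nat => state => real^2 => real" where
 "ml k U y = (if k = 0 then U 1 y else if k = 1 then U 5 y else if k = 2 then U 2 y + U 4 y else U 1 y + U 5 y)"

definition cf :: "nat => state => real^2 => real" where
 "cf k U y = (if k = 0 then U 9 y else if k = 1 then U 12 y else if k = 2 then U 10 y + U 11 y else U 9 y + U 12 y)"

definition st :: "nat => state => real^2 => real" where
 "st k U y = ml k U y + mq k U y"

text \<open>A triple \<open>(p, e, q)\<close> says that component \<open>q\<close> is the weak
  derivative of component \<open>p\<close> in direction \<open>e\<close>. The two mixed second
  derivatives are separate components.\<close>

definition deriv_table :: "(nat\<times>2\<times>nat) set" where
 "deriv_table = {(0, 1, 1), (0, 2, 2), (3, 1, 4), (3, 2, 5), (6, 1, 7), (6, 2, 8), (7, 1, 9), (7, 2, 10), (8, 1, 11), (8, 2, 12)}"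

text \<open>What the minimization uses of the function spaces. Linear combinations may have
  different coefficients on the in-plane and transverse components, as the space is a product; the
  anisotropic scaling depends on it. Vanishing is expressed by seminorms, since states are functions
  and not classes. The coefficient of the trace may be 0, as for \<open>lam = 0\<close>.\<close>

locale plate =
 fixes \<Omega> :: "(real^2) set" and X :: "state set" and P :: state and \<alpha> \<beta> :: "nat => real"
 assumes \<Omega>: "open \<Omega>" "bounded \<Omega>" "lipschitz_boundary \<Omega>"
  and deriv: "U\<in>X ==> (p, e, q)\<in>deriv_table ==> wderiv \<Omega> e (U p) (U q)"
  and lin: "U\<in>X ==> W\<in>X ==> (%i y. (if i < 6 then a else a')*U i y + (if i < 6 then b else b')*W i y)\<in>X"
  and nonempty: "X\<noteq>{}"
  and closed: "(\<And>n. s n\<in>X) ==> (\<And>i. i < 13 ==> ltwo_Cauchy lborel (%n. s n i)) ==>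
   \<exists>W\<in>X. \<forall>i<13. (%n. nrm (%x. s n i x - W i x))---->0"
  and rigid: "U\<in>X ==> (\<And>k. k < 3 ==> nrm (st k U) = 0) ==> i < 13 ==> nrm (U i) = 0"
  and P: "\<And>i. i < 9 ==> P i\<in>sqi"
  and \<alpha>: "\<And>k. \<alpha> k\<ge>0" "\<And>k. k < 3 ==> \<alpha> k > 0" and \<beta>: "\<And>k. \<beta> k\<ge>0" "\<And>k. k < 3 ==> \<beta> k > 0"
begin

abbreviation N :: "(real^2 => real) => real" where "N \<equiv> nrm"
abbreviation dif :: "state => state => state" where "dif U W \<equiv> (%i y. U i y - W i y)"
abbreviation mid :: "state => state => state" where "mid U W \<equiv> (%i y. (U i y + W i y)/2)"

text \<open>In-plane and transverse size are kept apart because they scale with different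
  powers.\<close>

definition hw :: "state => real" where "hw U = (\<Sum>i<6. N (U i))"
definition hz :: "state => real" where "hz U = (\<Sum>i=6..<13. N (U i))"
definition h :: "state => real" where "h U = hw U + hz U"

definition load :: "state => real" where "load U = (\<Sum>i<9. LBINT y. P i y*U i y)"

definition en :: "state => real" where
 "en U = (\<Sum>k<4. \<alpha> k*(N (st k U))^2) + (\<Sum>k<4. \<beta> k*(N (cf k U))^2) - load U"

lemma sq:
 assumes U: "U\<in>X" and i: "i < 13"
 shows "U i\<in>L2z \<Omega>" "U i\<in>sqi"
proof -
 have "i = 0\<or>i = 1\<or>i = 2\<or>i = 3\<or>i = 4\<or>i = 5\<or>i = 6\<or>i = 7\<or>i = 8\<or>i = 9\<or>i = 10\<or>i = 11\<or>i = 12"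
  using i by (auto simp: eval_nat_numeral less_Suc_eq)
 moreover have "wderiv \<Omega> 1 (U 0) (U 1)" "wderiv \<Omega> 2 (U 0) (U 2)" "wderiv \<Omega> 1 (U 3) (U 4)" "wderiv \<Omega> 2 (U 3) (U 5)"
  "wderiv \<Omega> 1 (U 6) (U 7)" "wderiv \<Omega> 2 (U 6) (U 8)" "wderiv \<Omega> 1 (U 7) (U 9)" "wderiv \<Omega> 2 (U 7) (U 10)"
  "wderiv \<Omega> 1 (U 8) (U 11)" "wderiv \<Omega> 2 (U 8) (U 12)"
  by (rule deriv[OF U], simp add: deriv_table_def)+
 ultimately show "U i\<in>L2z \<Omega>" unfolding wderiv_def by (elim disjE) auto
 then show "U i\<in>sqi" by (rule L2zD)
qed

lemma dif_X: "U\<in>X ==> W\<in>X ==> dif U W\<in>X"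
 using lin[of U W 1 1 "-1" "-1"] by simp

lemma mid_X: "U\<in>X ==> W\<in>X ==> mid U W\<in>X"
 using lin[of U W "1/2" "1/2" "1/2" "1/2"] by (simp add: add_divide_distrib)

lemma zero_X: "(%i y. 0)\<in>X"
 using nonempty lin[of _ _ 0 0 0 0] by auto

lemma h_eq: "h U = (\<Sum>i<13. N (U i))"
 unfolding h_def hw_def hz_def by (subst sum.atLeastLessThan_concat[of 0 6 13, symmetric, unfolded atLeast0LessThan]) auto

lemma hw_nonneg: "hw U\<ge>0" and hz_nonneg: "hz U\<ge>0" and h_nonneg: "h U\<ge>0"
 by (auto simp: hw_def hz_def h_def intro!: sum_nonneg add_nonneg_nonneg)

lemma N_le_h: "i < 13 ==> N (U i)\<le>h U"
 unfolding h_eq by (rule member_le_sum) auto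

lemma h_dif: assumes "U\<in>X" "W\<in>X" shows "h (dif U W)\<le>h U + h W"
 unfolding h_eq sum.distrib[symmetric] by (intro sum_mono ltwo_triangle_diff sq assms) auto

text \<open>Cauchy-Schwarz and the Ladyzhenskaya inequality for the slopes, whose derivatives belong
  to the state. The point is the factor with the norms of the slopes alone: it makes products small
  when the slopes are small in the mean while the full norm is only bounded.\<close>

lemma prod_bound:
 obtains C where "C\<ge>0" "\<And>U W p q. U\<in>X ==> W\<in>X ==> p\<in>{7, 8} ==> q\<in>{7, 8} ==>
  (%y. U p y*W q y)\<in>sqi\<and>N (%y. U p y*W q y)\<le>C*(sqrt (h U*(N (U 7) + N (U 8)))*h W)"
proof -
 obtain C where C: "C\<ge>0" "\<And>u v1 v2. wderiv \<Omega> 1 u v1 ==> wderiv \<Omega> 2 u v2 ==> (%x. (u x)^2)\<in>sqi \<and>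
  N (%x. (u x)^2)\<le>C*(N u*(N u + N v1 + N v2))"
  by (rule ladyzhenskaya[OF \<Omega>]) (rule that)
 have s: "(%y. (U p y)^2)\<in>sqi\<and>N (%y. (U p y)^2)\<le>C*(h U*N (U p))" if U: "U\<in>X" and p: "p\<in>{7, 8}" for U p
 proof -
  obtain a b where ab: "(p, 1, a)\<in>deriv_table" "(p, 2, b)\<in>deriv_table" "p < 13" "a < 13" "b < 13" "p\<noteq>a" "p\<noteq>b" "a\<noteq>b"
   using p by (auto simp: deriv_table_def)
  have "(\<Sum>i\<in>{p, a, b}. N (U i))\<le>h U" unfolding h_eq by (rule sum_mono2) (use ab in auto)
  then have "N (U p) + N (U a) + N (U b)\<le>h U" using ab by simp
  then have "C*(N (U p)*(N (U p) + N (U a) + N (U b)))\<le>C*(N (U p)*h U)" by (intro mult_left_mono C(1)) auto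
  then show ?thesis using C(2)[OF deriv[OF U ab(1)] deriv[OF U ab(2)]] by (auto simp: mult.commute)
 qed
 have "(%y. U p y*W q y)\<in>sqi\<and>N (%y. U p y*W q y)\<le>C*(sqrt (h U*(N (U 7) + N (U 8)))*h W)"
  if U: "U\<in>X" and W: "W\<in>X" and p: "p\<in>{7, 8}" and q: "q\<in>{7, 8}" for U W p q
 proof
  have m: "U p\<in>borel_measurable lborel" "W q\<in>borel_measurable lborel"
   using sq_int_measurable[OF sq(2)[OF U, of p]] sq_int_measurable[OF sq(2)[OF W, of q]] p q by auto
  note l = ltwo_mult[OF conjunct1[OF s[OF U p]] m(1) conjunct1[OF s[OF W q]] m(2)]
  show "(%y. U p y*W q y)\<in>sqi" by (rule l)
  have "N (W q)\<le>h W" using q by (intro N_le_h) auto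
  then have "C*(h W*N (W q))\<le>C*(h W*h W)" by (intro mult_left_mono C(1) h_nonneg)
  then have 2: "N (%y. (W q y)^2)\<le>C*(h W*h W)" using s[OF W q] by linarith
  have "N (U p)\<le>N (U 7) + N (U 8)" using p by auto
  then have "C*(h U*N (U p))\<le>C*(h U*(N (U 7) + N (U 8)))" by (intro mult_left_mono C(1) h_nonneg)
  then have 1: "N (%y. (U p y)^2)\<le>C*(h U*(N (U 7) + N (U 8)))" using s[OF U p] by linarith
  have "(N (%y. U p y*W q y))^2\<le>(C*(h U*(N (U 7) + N (U 8))))*(C*(h W*h W))"
   by (rule order_trans[OF l(2)], intro mult_mono 1 2) (use C(1) h_nonneg[of U] in auto)
  also have "... = (C*(sqrt (h U*(N (U 7) + N (U 8)))*h W))^2"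
   using h_nonneg[of U] by (simp add: power_mult_distrib power2_eq_square)
  finally show "N (%y. U p y*W q y)\<le>C*(sqrt (h U*(N (U 7) + N (U 8)))*h W)"
   by (rule power2_le_imp_le) (use C(1) h_nonneg[of U] h_nonneg[of W] in auto)
 qed
 then show ?thesis by (rule that[OF C(1)])
qed

lemma mq_dif:
 obtains C where "C\<ge>0" "\<And>U W k. U\<in>X ==> W\<in>X ==>
  N (%y. mq k U y - mq k W y)\<le>C*(sqrt (h (dif U W)*(N (dif U W 7) + N (dif U W 8)))*(h U + h W))"
proof -
 obtain C where C: "C\<ge>0" "\<And>U W p q. U\<in>X ==> W\<in>X ==> p\<in>{7, 8} ==> q\<in>{7, 8} ==>
  (%y. U p y*W q y)\<in>sqi\<and>N (%y. U p y*W q y)\<le>C*(sqrt (h U*(N (U 7) + N (U 8)))*h W)"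
  by (rule prod_bound) (rule that)
 have "N (%y. mq k U y - mq k W y)\<le>C*(sqrt (h (dif U W)*(N (dif U W 7) + N (dif U W 8)))*(h U + h W))"
  if U: "U\<in>X" and W: "W\<in>X" for U W k
 proof -
  let ?D = "dif U W" and ?s = "C * sqrt (h (dif U W)*(N (dif U W 7) + N (dif U W 8)))"
  note D = dif_X[OF U W]
  have d: "(%y. ?D p y*U q y)\<in>sqi" "N (%y. ?D p y*U q y)\<le>?s*h U"
   "(%y. ?D p y*W q y)\<in>sqi" "N (%y. ?D p y*W q y)\<le>?s*h W" if "p\<in>{7, 8}" "q\<in>{7, 8}" for p q
   using C(2)[OF D U that] C(2)[OF D W that] by (auto simp: mult.assoc)
  have sum: "N (%y. ?D p y*U q y + ?D p' y*W q' y)\<le>?s*(h U + h W)"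
   if "p\<in>{7, 8}" "q\<in>{7, 8}" "p'\<in>{7, 8}" "q'\<in>{7, 8}" for p q p' q'
   using ltwo_triangle[OF d(1)[OF that(1,2)] d(3)[OF that(3,4)]] d(2)[OF that(1,2)] d(4)[OF that(3,4)]
   unfolding distrib_left by linarith
  have half: "N (%y. (?D p y*U p y + ?D p y*W p y)/2) = N (%y. ?D p y*U p y + ?D p y*W p y)/2" for p
   using ltwo_cmult[of lborel "1/2" "%y. ?D p y*U p y + ?D p y*W p y"] by simp
  have e: "(%y. (U p y)^2/2 - (W p y)^2/2) = (%y. (?D p y*U p y + ?D p y*W p y)/2)" for p
   by (auto simp: power2_eq_square field_simps)
  have s0: "0\<le>?s*(h U + h W)" using C(1) h_nonneg[of U] h_nonneg[of W] h_nonneg[of ?D] by auto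
  have "(%y. (?D p y*U p y + ?D p y*W p y)/2)\<in>sqi" if "p\<in>{7, 8}" for p
   by (intro sq_int_divide sq_int_add d that)
  then have sqs': "(%y. (U p y)^2/2 - (W p y)^2/2)\<in>sqi" if "p\<in>{7, 8}" for p
   unfolding e using that .
  have k: "N (%y. (U p y)^2/2 - (W p y)^2/2)\<le>?s*(h U + h W)/2" if "p\<in>{7, 8}" for p
   unfolding e half using sum[OF that that that that] by simp
  have k2: "N (%y. U 7 y*U 8 y - W 7 y*W 8 y)\<le>?s*(h U + h W)"
  proof -
   have "(%y. U 7 y*U 8 y - W 7 y*W 8 y) = (%y. ?D 7 y*U 8 y + ?D 8 y*W 7 y)" by (auto simp: algebra_simps)
   then show ?thesis using sum[of 7 8 8 7] by simp
  qed
  have k3: "N (%y. ((U 7 y)^2/2 + (U 8 y)^2/2) - ((W 7 y)^2/2 + (W 8 y)^2/2))\<le>?s*(h U + h W)"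
  proof -
   have "(%y. ((U 7 y)^2/2 + (U 8 y)^2/2) - ((W 7 y)^2/2 + (W 8 y)^2/2)) = (%y. ((U 7 y)^2/2 - (W 7 y)^2/2) + ((U 8 y)^2/2 - (W 8 y)^2/2))" by auto
   moreover have "N (%y. ((U 7 y)^2/2 - (W 7 y)^2/2) + ((U 8 y)^2/2 - (W 8 y)^2/2))\<le>N (%y. (U 7 y)^2/2 - (W 7 y)^2/2) + N (%y. (U 8 y)^2/2 - (W 8 y)^2/2)"
    by (intro ltwo_triangle sqs') auto
   ultimately show ?thesis using k[of 7] k[of 8] by simp
  qed
  have k7: "N (%y. (U 7 y)^2/2 - (W 7 y)^2/2)\<le>?s*(h U + h W)" and k8: "N (%y. (U 8 y)^2/2 - (W 8 y)^2/2)\<le>?s*(h U + h W)"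
   using k[of 7, OF insertI1] k[of 8, OF insertI2, OF insertI1] s0 by linarith+
  let ?m = "%y. mq k U y - mq k W y"
  have "?m = (%y. (U 7 y)^2/2 - (W 7 y)^2/2)\<or>?m = (%y. (U 8 y)^2/2 - (W 8 y)^2/2)\<or>?m = (%y. U 7 y*U 8 y - W 7 y*W 8 y) \<or>
   ?m = (%y. ((U 7 y)^2/2 + (U 8 y)^2/2) - ((W 7 y)^2/2 + (W 8 y)^2/2))"
   by (cases "k = 0"; cases "k = 1"; cases "k = 2") (simp_all add: mq_def)
  then have "N ?m\<le>?s*(h U + h W)"
   by (elim disjE) (simp_all only: k7 k8 k2 k3)
  then show ?thesis by (simp only: mult.assoc)
 qed
 then show ?thesis by (rule that[OF C(1)])
qed

lemma form_sq:
 assumes U: "U\<in>X"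
 shows "ml k U\<in>sqi" "cf k U\<in>sqi" "mq k U\<in>sqi" "st k U\<in>sqi"
proof -
 obtain C where C: "\<And>p q. p\<in>{7, 8} ==> q\<in>{7, 8} ==> (%y. U p y*U q y)\<in>sqi"
  by (rule prod_bound) (use U that in blast)
 note s = sq(2)[OF U]
 show 1: "ml k U\<in>sqi" unfolding ml_def[abs_def]
  by (cases "k = 0"; cases "k = 1"; cases "k = 2") (auto intro!: sq_int_add s)
 show "cf k U\<in>sqi" unfolding cf_def[abs_def]
  by (cases "k = 0"; cases "k = 1"; cases "k = 2") (auto intro!: sq_int_add s)
 show 2: "mq k U\<in>sqi" unfolding mq_def[abs_def] power2_eq_square using C[of 7 7] C[of 8 8] C[of 7 8]
  by (cases "k = 0"; cases "k = 1"; cases "k = 2") (auto intro!: sq_int_add sq_int_divide)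
 show "st k U\<in>sqi" unfolding st_def[abs_def] by (intro sq_int_add 1 2)
qed

lemma ml_dif: "(%y. ml k U y - ml k W y) = ml k (dif U W)"
 and cf_dif: "(%y. cf k U y - cf k W y) = cf k (dif U W)"
 by (auto simp: ml_def cf_def)

text \<open>The linear part has no defect, and for a quadratic form the value at the midpoint is the
  mean of the values minus a quarter of the value at the difference.\<close>

lemma st_mid: "st k (mid U W) y = (st k U y + st k W y)/2 - mq k (dif U W) y/4"
 by (simp add: st_def ml_def mq_def power2_eq_square field_simps)

lemma mq_tendsto:
 assumes X: "eventually (%p. U p\<in>X\<and>W p\<in>X) F" and b: "eventually (%p. h (U p)\<le>R\<and>h (W p)\<le>R) F"
  and l: "((%p. N (dif (U p) (W p) 7))\<longlongrightarrow>0) F" "((%p. N (dif (U p) (W p) 8))\<longlongrightarrow>0) F"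
 shows "((%p. N (%y. mq k (U p) y - mq k (W p) y))\<longlongrightarrow>0) F"
proof -
 obtain C where C: "C\<ge>0" "\<And>U W k. U\<in>X ==> W\<in>X ==>
  N (%y. mq k U y - mq k W y)\<le>C*(sqrt (h (dif U W)*(N (dif U W 7) + N (dif U W 8)))*(h U + h W))"
  by (rule mq_dif) (rule that)
 show ?thesis
 proof (rule Lim_null_comparison)
  show "eventually (%p. norm (N (%y. mq k (U p) y - mq k (W p) y)) \<le>
   C*(sqrt ((2 * R)*(N (dif (U p) (W p) 7) + N (dif (U p) (W p) 8)))*(2 * R))) F"
   using X b
  proof eventually_elim
   case (elim p)
   have "h (dif (U p) (W p))\<le>2 * R" using h_dif[of "U p" "W p"] elim by linarith
   then have "sqrt (h (dif (U p) (W p))*(N (dif (U p) (W p) 7) + N (dif (U p) (W p) 8)))\<le>sqrt ((2 * R)*(N (dif (U p) (W p) 7) + N (dif (U p) (W p) 8)))"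
    by (intro real_sqrt_le_mono mult_right_mono) auto
   moreover have "h (U p) + h (W p)\<le>2 * R" using elim by linarith
   ultimately have "C*(sqrt (h (dif (U p) (W p))*(N (dif (U p) (W p) 7) + N (dif (U p) (W p) 8)))*(h (U p) + h (W p)))
     \<le> C*(sqrt ((2 * R)*(N (dif (U p) (W p) 7) + N (dif (U p) (W p) 8)))*(2 * R))"
    by (intro mult_left_mono mult_mono C(1)) (use h_nonneg[of "U p"] h_nonneg[of "W p"] elim in auto)
   then show ?case using C(2)[of "U p" "W p" k] elim by simp
  qed
  have "((%p. C*(sqrt ((2 * R)*(N (dif (U p) (W p) 7) + N (dif (U p) (W p) 8)))*(2 * R)))\<longlongrightarrow>C*(sqrt ((2 * R)*(0 + 0))*(2 * R))) F"
   by (intro tendsto_intros l)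
  then show "((%p. C*(sqrt ((2 * R)*(N (dif (U p) (W p) 7) + N (dif (U p) (W p) 8)))*(2 * R)))\<longlongrightarrow>0) F" by simp
 qed
qed

text \<open>Stated for any pair of components with derivatives in the table, since it is applied to
  the in-plane displacement \<open>(0, 3)\<close> and to the gradient of the deflection
  \<open>(7, 8)\<close>.\<close>

lemma korn_tendsto:
 assumes X: "\<And>p. D p\<in>X" and t: "(a, 1, a1)\<in>deriv_table" "(a, 2, a2)\<in>deriv_table" "(b, 1, b1)\<in>deriv_table" "(b, 2, b2)\<in>deriv_table"
  and l: "((%p. N (D p a))\<longlongrightarrow>0) F" "((%p. N (D p a1))\<longlongrightarrow>0) F" "((%p. N (D p b2))\<longlongrightarrow>0) F" "((%p. N (%y. D p a2 y + D p b1 y))\<longlongrightarrow>0) F"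
 shows "((%p. N (D p a2))\<longlongrightarrow>0) F" "((%p. N (D p b1))\<longlongrightarrow>0) F"
proof -
 obtain C where C: "C\<ge>0" "\<And>u v a b c d. wderiv \<Omega> 1 u a ==> wderiv \<Omega> 2 u b ==> wderiv \<Omega> 1 v c ==> wderiv \<Omega> 2 v d ==>
   (N b)^2 + (N c)^2\<le>C*((N u)^2 + (N a)^2 + (N d)^2 + (N (%x. b x + c x))^2)"
  by (rule korn_inequality[OF \<Omega>]) (rule that)
 let ?r = "%p. sqrt (C*((N (D p a))^2 + (N (D p a1))^2 + (N (D p b2))^2 + (N (%x. D p a2 x + D p b1 x))^2))"
 have "(?r\<longlongrightarrow>sqrt (C*(0^2 + 0^2 + 0^2 + 0^2))) F" by (intro tendsto_intros l)
 then have r: "(?r\<longlongrightarrow>0) F" by simp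
 have key: "(N (D p a2))^2 + (N (D p b1))^2\<le>(?r p)^2" for p
  using C(2)[OF deriv[OF X[of p] t(1)] deriv[OF X[of p] t(2)] deriv[OF X[of p] t(3)] deriv[OF X[of p] t(4)]] C(1) by simp
 have r0: "0\<le>?r p" for p using C(1) by simp
 have "N (D p a2)\<le>?r p" "N (D p b1)\<le>?r p" for p
  by (rule power2_le_imp_le[OF order_trans[OF _ key[of p]] r0], simp)+
 then have b: "\<forall>p. norm (N (D p a2))\<le>?r p" "\<forall>p. norm (N (D p b1))\<le>?r p" by simp_all
 show "((%p. N (D p a2))\<longlongrightarrow>0) F" by (rule Lim_null_comparison[OF always_eventually[OF b(1)] r])
 show "((%p. N (D p b1))\<longlongrightarrow>0) F" by (rule Lim_null_comparison[OF always_eventually[OF b(2)] r])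
qed

text \<open>These are the components whose two first derivatives are again components of the state;
  one extraction is made for each.\<close>

lemma rellich_states:
 assumes U: "\<And>n. U n\<in>X" and R: "\<And>n. h (U n)\<le>R"
 shows "\<exists>r. strict_mono (r :: nat => nat)\<and>(\<forall>i\<in>{0, 3, 6, 7, 8}. ltwo_Cauchy lborel (%n. U (r n) i))"
proof -
 have "finite I ==> I\<subseteq>{0, 3, 6, 7, 8} ==> \<exists>r. strict_mono (r :: nat => nat)\<and>(\<forall>i\<in>I. ltwo_Cauchy lborel (%n. U (r n) i))" for I :: "nat set"
 proof (induction I rule: finite_induct)
  case empty
  show ?case by (intro exI[of _ id]) (simp add: strict_mono_def)
 next
  case (insert i I)
  then obtain r where r: "strict_mono (r :: nat => nat)" "\<forall>i\<in>I. ltwo_Cauchy lborel (%n. U (r n) i)" by auto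
  obtain a b where ab: "(i, 1, a)\<in>deriv_table" "(i, 2, b)\<in>deriv_table" "i < 13" "a < 13" "b < 13"
   using insert(4) by (auto simp: deriv_table_def)
  obtain r' where r': "strict_mono (r' :: nat => nat)" "ltwo_Cauchy lborel (%n. U (r (r' n)) i)"
   by (rule rellich[OF \<Omega>, of "%n. U (r n) i" "%n. U (r n) a" "%n. U (r n) b" R])
    (use deriv[OF U ab(1)] deriv[OF U ab(2)] order_trans[OF N_le_h R] ab in auto)
  show ?case
  proof (intro exI[of _ "r \<circ> r'"] conjI)
   show "strict_mono (r \<circ> r')" using r r' by (simp add: strict_mono_o)
   show "\<forall>i\<in>insert i I. ltwo_Cauchy lborel (%n. U ((r \<circ> r') n) i)"
    using r(2) r' ltwo_Cauchy_subseq[of lborel "%n. U (r n) _" r'] by auto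
  qed
 qed
 from this[of "{0, 3, 6, 7, 8}"] show ?thesis by auto
qed

text \<open>A bounded sequence in \<open>X\<close> need not converge in the second derivatives; elements of \<open>X\<close>
 that are close to the limit and nearly minimize the second-order part do.\<close>

lemma second_order_limit:
 assumes V: "\<And>n. V n\<in>X" and R: "\<And>n. h (V n)\<le>R" and C: "\<And>i. i < 9 ==> ltwo_Cauchy lborel (%n. V n i)"
 shows "\<exists>W\<in>X. \<forall>i<9. (%n. N (%x. V n i x - W i x))---->0"
proof -
 have "\<forall>i\<in>{..<9}. \<exists>f. f\<in>sqi\<and>(%n. N (%x. V n i x - f x))---->0"
 proof
  fix i :: nat assume "i\<in>{..<9}"
  then have i: "i < 9" by simp
  show "\<exists>f. f\<in>sqi\<and>(%n. N (%x. V n i x - f x))---->0"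
   by (rule ltwo_complete[OF sq(2)[OF V] C[OF i]]) (use i in auto)
 qed
 from bchoice[OF this] obtain g where g: "\<And>i. i < 9 ==> g i\<in>sqi" "\<And>i. i < 9 ==> (%n. N (%x. V n i x - g i x))---->0"
  by auto
 \<comment> \<open>The sets \<open>K n\<close> shrink, contain members of \<open>V\<close> and are
   closed under midpoints. The infimum of \<open>\<phi>\<close> over them increases to a finite
   limit, so near-minimizers are Cauchy in the second derivatives while the other components are
   pinned to \<open>g\<close>.\<close>
 define K where "K n = {Y\<in>X. \<forall>i<9. N (%x. Y i x - g i x)\<le>1/real (Suc n)}" for n
 define \<phi> where "\<phi> Y = (\<Sum>i=9..<13. (N (Y i))^2)" for Y :: state
 define d where "d n = Inf (\<phi> ` K n)" for n
 have \<phi>0: "\<phi> Y\<ge>0" for Y by (simp add: \<phi>_def sum_nonneg)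
 have bdd: "bdd_below (\<phi> ` K n)" for n using \<phi>0 by (intro bdd_belowI2[of _ 0])
 have inK: "\<exists>m. V m\<in>K n" for n
 proof -
  have "eventually (%m. \<forall>i\<in>{..<9}. N (%x. V m i x - g i x) < 1/real (Suc n)) sequentially"
   by (intro eventually_ball_finite ballI order_tendstoD(2)[OF g(2)]) auto
  then obtain m where "\<forall>i\<in>{..<9}. N (%x. V m i x - g i x) < 1/real (Suc n)" by (auto simp: eventually_sequentially)
  then show ?thesis using V by (intro exI[of _ m]) (auto simp: K_def intro: less_imp_le)
 qed
 have ne: "\<phi> ` K n\<noteq>{}" for n using inK by blast
 have anti: "K n\<subseteq>K m" if "m\<le>n" for m n
 proof -
  have "1/real (Suc n)\<le>1/real (Suc m)" using that by (intro frac_le) auto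
  then show ?thesis unfolding K_def by (blast intro: order_trans)
 qed
 have inc: "d m\<le>d n" if "m\<le>n" for m n unfolding d_def
  by (rule cInf_superset_mono[OF ne bdd]) (use anti[OF that] in auto)
 have up: "d n\<le>4 * R^2" for n
 proof -
  obtain m where m: "V m\<in>K n" using inK by blast
  have "\<phi> (V m)\<le>(\<Sum>i=9..<(13::nat). R^2)" unfolding \<phi>_def
   by (intro sum_mono power_mono order_trans[OF N_le_h R]) auto
  moreover have "d n\<le>\<phi> (V m)" unfolding d_def by (rule cInf_lower[OF _ bdd]) (use m in auto)
  ultimately show ?thesis by simp
 qed
 obtain L where L: "d---->L" "\<And>n. d n\<le>L"
  by (rule incseq_convergent[of d "4 * R^2"]) (use inc up in \<open>auto simp: incseq_def\<close>)
 have "\<exists>Y\<in>K n. \<phi> Y < d n + 1/real (Suc n)" for n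
  using cInf_lessD[OF ne, of n "d n + 1/real (Suc n)"] by (auto simp: d_def)
 then have "\<forall>n. \<exists>Y. Y\<in>K n\<and>\<phi> Y < d n + 1/real (Suc n)" by blast
 from choice[OF this] obtain Y where Y: "\<And>n. Y n\<in>K n" "\<And>n. \<phi> (Y n) < d n + 1/real (Suc n)" by auto
 have YX: "Y n\<in>X" for n using Y(1)[of n] by (simp add: K_def)
 have "(%n. 1/real (Suc n))---->0" by (rule LIMSEQ_Suc[OF lim_1_over_n])
 then have inv: "(%n. 1/real (Suc n))---->0" .
 have g': "(%n. N (%x. Y n i x - g i x))---->0" if "i < 9" for i
  by (rule Lim_null_comparison[OF always_eventually inv]) (use Y(1) that in \<open>auto simp: K_def\<close>)
 \<comment> \<open>The midpoint of \<open>Y m\<close> and \<open>Y n\<close> is only known to lie in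
   the larger of the two sets, so \<open>d\<close> at the smaller index bounds it from below. The
   term \<open>2*(L - d n)\<close> pays for replacing this bound by \<open>L\<close>.\<close>
 define q where "q n = d n + 1/real (Suc n) + 2*(L - d n)" for n
 have "q---->L + 0 + 2*(L - L)" unfolding q_def[abs_def] by (intro tendsto_intros L(1) inv)
 then have q: "q---->L" by simp
 have Cau: "ltwo_Cauchy lborel (%n. Y n i)" if i: "i\<in>{9..<13}" for i
 proof (rule ltwo_CauchyI_minimizing[OF q, of "1/4"])
  fix m n :: nat
  define p where "p = min m n"
  have Yp: "Y m\<in>K p" "Y n\<in>K p" using Y(1) anti[of p m] anti[of p n] by (auto simp: p_def)
  have "mid (Y m) (Y n)\<in>K p" unfolding K_def
  proof (intro CollectI conjI allI impI mid_X YX)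
   fix i :: nat assume i: "i < 9"
   let ?a = "%n x. Y n i x - g i x"
   have s: "?a n\<in>sqi" for n using sq(2)[OF YX] g(1) i by (intro sq_int_diff) auto
   have "(%x. mid (Y m) (Y n) i x - g i x) = (%x. (1/2)*(?a m x + ?a n x))" by (auto simp: field_simps)
   then have "N (%x. mid (Y m) (Y n) i x - g i x)\<le>(1/2)*(N (?a m) + N (?a n))"
    using ltwo_triangle[OF s s, of m n] by (simp only: ltwo_cmult) simp
   also have "...\<le>(1/2)*(1/real (Suc p) + 1/real (Suc p))" using Yp i by (intro mult_left_mono add_mono) (auto simp: K_def)
   finally show "N (%x. mid (Y m) (Y n) i x - g i x)\<le>1/real (Suc p)" by simp
  qed
  then have "d p\<le>\<phi> (mid (Y m) (Y n))" unfolding d_def by (intro cInf_lower bdd imageI)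
  also have "... = (\<phi> (Y m) + \<phi> (Y n))/2 - (\<Sum>i=9..<13. (N (dif (Y m) (Y n) i))^2/4)"
  proof -
   have "(N (mid (Y m) (Y n) i))^2 = ((N (Y m i))^2 + (N (Y n i))^2)/2 - (N (dif (Y m) (Y n) i))^2/4" if "i\<in>{9..<13}" for i
    using ltwo_parallelogram[OF sq(2)[OF YX[of m], of i] sq(2)[OF YX[of n], of i]] that by (simp only: atLeastLessThan_iff) argo
   then show ?thesis unfolding \<phi>_def
    by (simp add: sum_subtractf sum.distrib flip: sum_divide_distrib)
  qed
  finally have 1: "d p + (\<Sum>i=9..<13. (N (dif (Y m) (Y n) i))^2/4)\<le>(\<phi> (Y m) + \<phi> (Y n))/2" by (simp only: le_diff_eq)
  have "(N (dif (Y m) (Y n) i))^2/4\<le>(\<Sum>i=9..<13. (N (dif (Y m) (Y n) i))^2/4)"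
   using i by (intro member_le_sum) auto
  moreover have "d m + d n\<le>L + d p" using L(2)[of m] L(2)[of n] by (cases "m\<le>n") (auto simp: p_def min_def)
  ultimately show "L + 1/4*(N (%x. Y m i x - Y n i x))^2\<le>(q m + q n)/2"
   using 1 Y(2)[of m] Y(2)[of n] unfolding q_def by argo
 qed simp
 have "ltwo_Cauchy lborel (%n. Y n i)" if "i < 13" for i
 proof (cases "i < 9")
  case True
  then show ?thesis using ltwo_tendsto_imp_Cauchy[OF sq(2)[OF YX] g(1) g'] that by blast
 qed (use Cau that in auto)
 from closed[OF YX this] obtain W where W: "W\<in>X" "\<And>i. i < 13 ==> (%n. N (%x. Y n i x - W i x))---->0" by blast
 have "(%n. N (%x. V n i x - W i x))---->0" if i: "i < 9" for i
 proof (rule Lim_null_comparison[OF always_eventually])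
  have i13: "i < 13" using i by simp
  show "\<forall>n. norm (N (%x. V n i x - W i x))\<le>N (%x. V n i x - g i x) + (N (%x. Y n i x - g i x) + N (%x. Y n i x - W i x))"
  proof
   fix n
   show "norm (N (%x. V n i x - W i x))\<le>N (%x. V n i x - g i x) + (N (%x. Y n i x - g i x) + N (%x. Y n i x - W i x))"
    using ltwo_triangle3[OF sq(2)[OF V i13] g(1)[OF i] sq(2)[OF W(1) i13], of n]
     ltwo_triangle3[OF g(1)[OF i] sq(2)[OF YX i13] sq(2)[OF W(1) i13], of n] ltwo_diff_commute[of lborel "g i" "Y n i"] by simp
  qed
  show "(%n. N (%x. V n i x - g i x) + (N (%x. Y n i x - g i x) + N (%x. Y n i x - W i x)))---->0"
   using tendsto_add[OF g(2)[OF i] tendsto_add[OF g'[OF i] W(2)[OF i13]]] by simp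
 qed
 then show ?thesis using W(1) by blast
qed

end

lemma ltwo_null_Cauchy:
 assumes "\<And>n. s n\<in>sq_int M" "(%n. ltwo M (s n))---->0"
 shows "ltwo_Cauchy M s"
 using ltwo_tendsto_imp_Cauchy[of s M "%x. 0"] assms by simp

lemma null_sequence_of_squares:
 fixes x :: "nat => real"
 assumes "c > 0" "\<And>n. c*(x n)^2\<le>y n" "y---->0"
 shows "x---->0"
proof -
 have "(%n. (x n)^2)---->0"
 proof (rule Lim_null_comparison[OF always_eventually])
  show "\<forall>n. norm ((x n)^2)\<le>y n/c" using assms by (simp add: pos_le_divide_eq mult.commute)
  show "(%n. y n/c)---->0" using tendsto_divide_zero[OF assms(3)] .
 qed
 from tendsto_real_sqrt[OF this] show ?thesis by (simp add: tendsto_rabs_zero_iff)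
qed

section \<open>Cauchy criteria for states and continuity of the strain\<close>

context plate
begin

text \<open>Converging slopes make the quadratic part of the strain Cauchy; subtracting it leaves
  the linearized strain of the in-plane displacement, from which Korn's inequality recovers the full
  gradient.\<close>

lemma first_order_Cauchy:
 assumes U: "\<And>n. U n\<in>X" and R: "\<And>n. h (U n)\<le>R" and C: "\<And>i. i\<in>{0, 3, 6, 7, 8} ==> ltwo_Cauchy lborel (%n. U n i)"
  and S: "\<And>k. k < 3 ==> ltwo_Cauchy lborel (%n. st k (U n))" and i: "i < 9"
 shows "ltwo_Cauchy lborel (%n. U n i)"
proof -
 let ?F = "sequentially \<times>\<^sub>F sequentially :: (nat\<times>nat) filter"
 let ?D = "%p. dif (U (fst p)) (U (snd p))"
 have DX: "?D p\<in>X" for p by (intro dif_X U)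
 have c: "((%p. N (?D p i))\<longlongrightarrow>0) ?F" if "i\<in>{0, 3, 6, 7, 8}" for i
  using C[OF that] unfolding ltwo_Cauchy_iff .
 have ml: "((%p. N (ml k (?D p)))\<longlongrightarrow>0) ?F" if k: "k < 3" for k
 proof (rule Lim_null_comparison[OF always_eventually])
  let ?b = "%p. N (%y. st k (U (fst p)) y - st k (U (snd p)) y) + N (%y. mq k (U (fst p)) y - mq k (U (snd p)) y)"
  have "((%p. N (%y. mq k (U (fst p)) y - mq k (U (snd p)) y))\<longlongrightarrow>0) ?F"
   by (rule mq_tendsto[of _ _ _ R]) (use U R c[of 7] c[of 8] in auto)
  from tendsto_add[OF S[OF k, unfolded ltwo_Cauchy_iff] this] show "(?b\<longlongrightarrow>0) ?F" by simp
  show "\<forall>p. norm (N (ml k (?D p)))\<le>?b p"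
  proof
   fix p
   have "ml k (?D p) = (%y. (st k (U (fst p)) y - st k (U (snd p)) y) - (mq k (U (fst p)) y - mq k (U (snd p)) y))"
    unfolding ml_dif[symmetric] by (auto simp: st_def)
   then show "norm (N (ml k (?D p)))\<le>?b p"
    using ltwo_triangle_diff[OF sq_int_diff sq_int_diff, OF form_sq(4)[OF U] form_sq(4)[OF U] form_sq(3)[OF U] form_sq(3)[OF U]] by simp
  qed
 qed
 have m: "((%p. N (?D p 1))\<longlongrightarrow>0) ?F" "((%p. N (?D p 5))\<longlongrightarrow>0) ?F" "((%p. N (%y. ?D p 2 y + ?D p 4 y))\<longlongrightarrow>0) ?F"
  using ml[of 0] ml[of 1] ml[of 2] by (simp_all add: ml_def[abs_def])
 note k = korn_tendsto[of ?D 0 1 2 3 4 5 ?F, OF DX _ _ _ _ c[of 0] m, unfolded deriv_table_def, simplified]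
 have "i\<in>{0, 3, 6, 7, 8}\<or>i = 1\<or>i = 2\<or>i = 4\<or>i = 5" using i by (auto simp: eval_nat_numeral less_Suc_eq)
 then show ?thesis unfolding ltwo_Cauchy_iff using c m k by blast
qed

text \<open>The curvature entries control only the sum of the two mixed derivatives. Korn's
  inequality for the field of slopes recovers each of them.\<close>

lemma second_order_Cauchy:
 assumes U: "\<And>n. U n\<in>X" and C: "\<And>i. i < 9 ==> ltwo_Cauchy lborel (%n. U n i)"
  and S: "\<And>k. k < 3 ==> ltwo_Cauchy lborel (%n. cf k (U n))" and i: "i < 13"
 shows "ltwo_Cauchy lborel (%n. U n i)"
proof -
 let ?F = "sequentially \<times>\<^sub>F sequentially :: (nat\<times>nat) filter"
 let ?D = "%p. dif (U (fst p)) (U (snd p))"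
 have DX: "?D p\<in>X" for p by (intro dif_X U)
 have "((%p. N (cf k (?D p)))\<longlongrightarrow>0) ?F" if "k < 3" for k
  using S[OF that] unfolding ltwo_Cauchy_iff cf_dif .
 from this[of 0] this[of 1] this[of 2]
 have m: "((%p. N (?D p 9))\<longlongrightarrow>0) ?F" "((%p. N (?D p 12))\<longlongrightarrow>0) ?F" "((%p. N (%y. ?D p 10 y + ?D p 11 y))\<longlongrightarrow>0) ?F"
  by (simp_all add: cf_def[abs_def])
 have c: "((%p. N (?D p 7))\<longlongrightarrow>0) ?F" using C[of 7] unfolding ltwo_Cauchy_iff by simp
 note k = korn_tendsto[of ?D 7 9 10 8 11 12 ?F, OF DX _ _ _ _ c m, unfolded deriv_table_def, simplified]
 have "i < 9\<or>i = 9\<or>i = 10\<or>i = 11\<or>i = 12" using i by (auto simp: eval_nat_numeral less_Suc_eq)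
 then show ?thesis
 proof
  assume "i < 9"
  then show ?thesis by (rule C)
 next
  assume "i = 9\<or>i = 10\<or>i = 11\<or>i = 12"
  then show ?thesis unfolding ltwo_Cauchy_iff using m k by blast
 qed
qed

lemma ml_null:
 assumes U: "\<And>n. U n\<in>X" and l: "\<And>i. i < 9 ==> (%n. N (U n i))---->0"
 shows "(%n. N (ml k (U n)))---->0"
proof (rule Lim_null_comparison[OF always_eventually])
 note s = sq(2)[OF U]
 show "\<forall>n. norm (N (ml k (U n)))\<le>N (U n 1) + N (U n 5) + (N (U n 2) + N (U n 4))"
 proof
  fix n
  have "N (ml k (U n)) = N (U n 1)\<or>N (ml k (U n)) = N (U n 5)\<or>N (ml k (U n)) = N (%y. U n 2 y + U n 4 y)\<or>N (ml k (U n)) = N (%y. U n 1 y + U n 5 y)"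
   by (cases "k = 0"; cases "k = 1"; cases "k = 2") (simp_all add: ml_def[abs_def])
  moreover have "N (%y. U n 2 y + U n 4 y)\<le>N (U n 2) + N (U n 4)" "N (%y. U n 1 y + U n 5 y)\<le>N (U n 1) + N (U n 5)"
   by (intro ltwo_triangle s; simp)+
  moreover have "0\<le>N (U n 1)" "0\<le>N (U n 5)" "0\<le>N (U n 2)" "0\<le>N (U n 4)" by auto
  ultimately show "norm (N (ml k (U n)))\<le>N (U n 1) + N (U n 5) + (N (U n 2) + N (U n 4))"
   unfolding real_norm_def abs_of_nonneg[OF ltwo_nonneg] by linarith
 qed
 have "(%n. N (U n 1) + N (U n 5) + (N (U n 2) + N (U n 4)))---->0 + 0 + (0 + 0)" by (intro tendsto_add l) auto
 then show "(%n. N (U n 1) + N (U n 5) + (N (U n 2) + N (U n 4)))---->0" by simp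
qed

lemma st_tendsto:
 assumes U: "\<And>n. U n\<in>X" and R: "\<And>n. h (U n)\<le>R" and Z: "Z\<in>X" and l: "\<And>i. i < 9 ==> (%n. N (dif (U n) Z i))---->0"
 shows "(%n. N (st k (U n)))---->N (st k Z)"
proof (rule ltwo_tendsto_norm[OF form_sq(4)[OF Z] form_sq(4)[OF U]], rule Lim_null_comparison[OF always_eventually])
 let ?b = "%n. N (ml k (dif (U n) Z)) + N (%y. mq k (U n) y - mq k Z y)"
 have "(%n. N (%y. mq k (U n) y - mq k Z y))---->0"
  by (rule mq_tendsto[of _ _ _ "max R (h Z)"]) (use U R Z l[of 7] l[of 8] in \<open>auto simp: le_max_iff_disj\<close>)
 from tendsto_add[OF ml_null[OF dif_X[OF U Z] l] this] show "?b---->0" by simp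
 show "\<forall>n. norm (N (%x. st k (U n) x - st k Z x))\<le>?b n"
 proof
  fix n
  have "(%x. st k (U n) x - st k Z x) = (%y. ml k (dif (U n) Z) y + (mq k (U n) y - mq k Z y))"
   unfolding ml_dif[symmetric] by (auto simp: st_def)
  then show "norm (N (%x. st k (U n) x - st k Z x))\<le>?b n"
   using ltwo_triangle[OF form_sq(1)[OF dif_X[OF U Z]] sq_int_diff[OF form_sq(3)[OF U] form_sq(3)[OF Z]]] by simp
 qed
qed

section \<open>Scaling of the energy and boundedness of its sublevel sets\<close>

definition lw :: "state => real" where "lw U = (\<Sum>i<6. LBINT y. P i y*U i y)"
definition lz :: "state => real" where "lz U = (\<Sum>i=6..<9. LBINT y. P i y*U i y)"

lemma load_eq: "load U = lw U + lz U"
 unfolding load_def lw_def lz_def by (subst sum.atLeastLessThan_concat[of 0 6 9, symmetric, unfolded atLeast0LessThan]) auto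

lemma load_bound:
 obtains Q where "Q\<ge>0" "\<And>U. U\<in>X ==> \<bar>lw U\<bar>\<le>Q*hw U" "\<And>U. U\<in>X ==> \<bar>lz U\<bar>\<le>Q*hz U"
proof
 let ?Q = "\<Sum>i<9. N (P i)"
 show "?Q\<ge>0" by (simp add: sum_nonneg)
 have one: "\<bar>LBINT y. P i y*U i y\<bar>\<le>?Q*N (U i)" if "U\<in>X" "i < 9" for U i
 proof -
  have "N (P i)\<le>?Q" using that by (intro member_le_sum) auto
  then have "N (P i)*N (U i)\<le>?Q*N (U i)" by (intro mult_right_mono) auto
  then show ?thesis using ltwo_CS[OF P[OF that(2)] sq(2)[OF that(1), of i]] that by simp
 qed
 show "\<bar>lw U\<bar>\<le>?Q*hw U" if "U\<in>X" for U unfolding lw_def hw_def sum_distrib_left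
  by (rule order_trans[OF sum_abs]) (intro sum_mono one that, simp)
 show "\<bar>lz U\<bar>\<le>?Q*hz U" if U: "U\<in>X" for U
 proof -
  have "\<bar>lz U\<bar>\<le>(\<Sum>i=6..<9. ?Q*N (U i))" unfolding lz_def
   by (rule order_trans[OF sum_abs]) (intro sum_mono one U, simp)
  also have "... = ?Q*(\<Sum>i=6..<9. N (U i))" by (rule sum_distrib_left[symmetric])
  also have "...\<le>?Q*hz U" unfolding hz_def by (intro mult_left_mono sum_mono2) (auto simp: sum_nonneg)
  finally show ?thesis .
 qed
qed

text \<open>For \<open>s = t^2\<close> the linear and the quadratic part of the strain scale alike,
  while curvature scales with \<open>t\<close>.\<close>

definition scale :: "real => real => state => state" where
 "scale s t U = (%i y. (if i < 6 then s else t)*U i y)"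

lemma scale:
 shows "U\<in>X ==> scale s t U\<in>X" "hw (scale s t U) = \<bar>s\<bar>*hw U" "hz (scale s t U) = \<bar>t\<bar>*hz U"
  "lw (scale s t U) = s*lw U" "lz (scale s t U) = t*lz U"
  "N (cf k (scale s t U)) = \<bar>t\<bar>*N (cf k U)" "s = t^2 ==> N (st k (scale s t U)) = \<bar>s\<bar>*N (st k U)"
proof -
 show "U\<in>X ==> scale s t U\<in>X" using lin[of U U s t 0 0] by (simp add: scale_def)
 show "hw (scale s t U) = \<bar>s\<bar>*hw U" by (simp add: hw_def scale_def ltwo_cmult sum_distrib_left)
 show "hz (scale s t U) = \<bar>t\<bar>*hz U" by (simp add: hz_def scale_def ltwo_cmult sum_distrib_left)
 show "lw (scale s t U) = s*lw U" by (simp add: lw_def scale_def sum_distrib_left mult.left_commute)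
 show "lz (scale s t U) = t*lz U" by (simp add: lz_def scale_def sum_distrib_left mult.left_commute)
 have "cf k (scale s t U) = (%y. t*cf k U y)" by (auto simp: cf_def scale_def algebra_simps)
 then show "N (cf k (scale s t U)) = \<bar>t\<bar>*N (cf k U)" by (simp add: ltwo_cmult)
 assume "s = t^2"
 then have "st k (scale s t U) = (%y. s * st k U y)" by (auto simp: st_def ml_def mq_def scale_def algebra_simps power2_eq_square)
 then show "N (st k (scale s t U)) = \<bar>s\<bar>*N (st k U)" by (simp add: ltwo_cmult)
qed

lemma energy_parts:
 assumes "k < 4"
 shows "\<alpha> k*(N (st k U))^2\<le>en U + load U" "\<beta> k*(N (cf k U))^2\<le>en U + load U"
proof -
 have a: "0\<le>(\<Sum>k<4. \<alpha> k*(N (st k U))^2)" "0\<le>(\<Sum>k<4. \<beta> k*(N (cf k U))^2)"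
  using \<alpha>(1) \<beta>(1) by (auto intro!: sum_nonneg)
 have "\<alpha> k*(N (st k U))^2\<le>(\<Sum>k<4. \<alpha> k*(N (st k U))^2)" "\<beta> k*(N (cf k U))^2\<le>(\<Sum>k<4. \<beta> k*(N (cf k U))^2)"
  using assms \<alpha>(1) \<beta>(1) by (auto intro!: member_le_sum[of k "{..<4}"])
 then show "\<alpha> k*(N (st k U))^2\<le>en U + load U" "\<beta> k*(N (cf k U))^2\<le>en U + load U"
  using a by (auto simp: en_def)
qed

text \<open>The anisotropic scaling \<open>(w / t^2, z / t)\<close> makes the strain homogeneous; a limit of rescaled
 states of bounded energy has zero strain and contradicts rigidity.\<close>

lemma bounded_sublevel: "\<exists>R. \<forall>U\<in>X. en U\<le>1 --> h U\<le>R"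
proof (rule ccontr)
 assume c: "\<not> ?thesis"
 \<comment> \<open>The bound is of the form \<open>T^2 + T\<close> because
   \<open>t n \<le> T\<close> would force \<open>hw \<le> T^2\<close> and
   \<open>hz \<le> T\<close>.\<close>
 have "\<forall>n. \<exists>U. U\<in>X\<and>en U\<le>1\<and>(real (Suc n))^2 + real (Suc n) < h U" using c by (meson not_le)
 from choice[OF this] obtain U where U: "\<And>n. U n\<in>X" "\<And>n. en (U n)\<le>1" "\<And>n. (real (Suc n))^2 + real (Suc n) < h (U n)" by auto
 \<comment> \<open>This \<open>t\<close> normalizes the rescaled state to
   \<open>hw + hz^2 = 1\<close>, a quantity that matches the scaling.\<close>
 define t where "t n = sqrt (hw (U n) + (hz (U n))^2)" for n
 have t2: "(t n)^2 = hw (U n) + (hz (U n))^2" for n using hw_nonneg[of "U n"] by (simp add: t_def)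
 have tn: "real (Suc n) < t n" for n
 proof (rule ccontr)
  assume "\<not> ?thesis"
  then have "t n\<le>real (Suc n)" by simp
  moreover have "0\<le>t n" using hw_nonneg[of "U n"] by (simp add: t_def)
  ultimately have le: "(t n)^2\<le>(real (Suc n))^2" by (rule power_mono)
  have "(hz (U n))^2\<le>(real (Suc n))^2" using le t2[of n] hw_nonneg[of "U n"] by linarith
  then have "hz (U n)\<le>real (Suc n)" by (rule power2_le_imp_le) simp
  moreover have "hw (U n)\<le>(real (Suc n))^2" using le t2[of n] zero_le_power2[of "hz (U n)"] by linarith
  ultimately show False using U(3)[of n] by (simp add: h_def)
 qed
 have t0: "t n > 0" "t n\<ge>1" for n using tn[of n] by auto
 define V where "V n = scale (1/(t n)^2) (1/t n) (U n)" for n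
 have VX: "V n\<in>X" for n unfolding V_def by (intro scale U)
 have hV: "hw (V n) = hw (U n)/(t n)^2" "hz (V n) = hz (U n)/t n" for n
  using t0(1)[of n] by (simp_all add: V_def scale)
 have one: "hw (V n) + (hz (V n))^2 = 1" for n
  unfolding hV power_divide add_divide_distrib[symmetric] t2[symmetric] using t0(1)[of n] by simp
 have V1: "hw (V n)\<le>1" "hz (V n)\<le>1" for n
 proof -
  show "hw (V n)\<le>1" using one[of n] zero_le_power2[of "hz (V n)"] by linarith
  have "(hz (V n))^2\<le>1^2" using one[of n] hw_nonneg[of "V n"] unfolding one_power2 by linarith
  then show "hz (V n)\<le>1" by (rule power2_le_imp_le) simp
 qed
 have V2: "h (V n)\<le>2" for n using V1[of n] by (simp add: h_def)
 obtain Q where Q: "Q\<ge>0" "\<And>U. U\<in>X ==> \<bar>lw U\<bar>\<le>Q*hw U" "\<And>U. U\<in>X ==> \<bar>lz U\<bar>\<le>Q*hz U" by (rule load_bound) (rule that)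
 have QV: "lw (V n)\<le>Q" "lz (V n)\<le>Q" for n
  using Q(2)[OF VX[of n]] Q(3)[OF VX[of n]] mult_left_mono[OF V1(1) Q(1), of n] mult_left_mono[OF V1(2) Q(1), of n] by auto
 have load: "load (U n) = (t n)^2*lw (V n) + t n*lz (V n)" for n
  using t0(1)[of n] by (simp add: load_eq V_def scale)
 have tt: "t n\<le>(t n)^2" for n using t0(2)[of n] by (simp add: power2_eq_square)
 have t2n: "1/(t n)^2\<le>1/real (Suc n)" "1/t n\<le>1/real (Suc n)" for n
  using tn[of n] tt[of n] by (auto intro!: divide_left_mono)
 \<comment> \<open>The squared strain scales by \<open>t^-4\<close>, whereas bounded energy allows
   it to grow only like the load, at most \<open>t^2\<close>; the quotient tends to 0.\<close>
 have stV: "\<alpha> k*(N (st k (V n)))^2\<le>(1 + 2*Q)*(1/real (Suc n))" if "k < 4" for k n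
 proof -
  have "\<alpha> k*(N (st k (V n)))^2 = \<alpha> k*(N (st k (U n)))^2*(1/(t n)^2)^2"
   unfolding V_def by (subst scale(7)) (auto simp: power_divide power_mult_distrib)
  also have "...\<le>((t n)^2*(1 + 2*Q))*(1/(t n)^2)^2"
  proof (rule mult_right_mono)
   have "(t n)^2*lw (V n)\<le>(t n)^2*Q" by (intro mult_left_mono QV) simp
   moreover have "t n*lz (V n)\<le>(t n)^2*Q"
   proof -
    have "t n*lz (V n)\<le>t n*Q" using t0(1)[of n] by (intro mult_left_mono QV) simp
    also have "...\<le>(t n)^2*Q" by (intro mult_right_mono tt Q(1))
    finally show ?thesis .
   qed
   moreover have "1\<le>(t n)^2" using tt[of n] t0(2)[of n] by linarith
   ultimately show "\<alpha> k*(N (st k (U n)))^2\<le>(t n)^2*(1 + 2*Q)"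
    using energy_parts(1)[OF that, of "U n"] U(2)[of n] load[of n] unfolding distrib_left by linarith
  qed simp
  also have "... = (1 + 2*Q)*(1/(t n)^2)" using t0(1)[of n] by (simp add: power2_eq_square)
  also have "...\<le>(1 + 2*Q)*(1/real (Suc n))" using Q(1) by (intro mult_left_mono t2n) auto
  finally show ?thesis .
 qed
 \<comment> \<open>The squared curvature scales only by \<open>t^-2\<close>, the same order as the
   work of the in-plane forces. This work survives on the right side until the in-plane components
   are known to vanish in the limit.\<close>
 have cfV: "\<beta> k*(N (cf k (V n)))^2\<le>\<bar>lw (V n)\<bar> + (1 + Q)*(1/real (Suc n))" if "k < 4" for k n
 proof -
  have "\<beta> k*(N (cf k (V n)))^2 = \<beta> k*(N (cf k (U n)))^2*(1/(t n)^2)"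
   unfolding V_def scale by (simp add: power_divide power_mult_distrib)
  also have "...\<le>(1 + ((t n)^2*lw (V n) + t n*lz (V n)))*(1/(t n)^2)"
   using energy_parts(2)[OF that, of "U n"] U(2)[of n] load[of n] by (intro mult_right_mono) auto
  also have "... = 1*(1/(t n)^2) + lw (V n) + lz (V n)*(1/t n)"
   using t0(1)[of n] by (simp add: field_simps power2_eq_square)
  also have "...\<le>1*(1/real (Suc n)) + \<bar>lw (V n)\<bar> + Q*(1/real (Suc n))"
  proof (intro add_mono mult_left_mono t2n abs_ge_self)
   have "lz (V n)*(1/t n)\<le>Q*(1/t n)" using t0(1)[of n] by (intro mult_right_mono QV) auto
   also have "...\<le>Q*(1/real (Suc n))" by (intro mult_left_mono t2n Q(1))
   finally show "lz (V n)*(1/t n)\<le>Q*(1/real (Suc n))" .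
  qed simp
  finally show ?thesis by (simp only: distrib_right mult_1_left add_ac)
 qed
 have inv: "(%n. 1/real (Suc n))---->0" by (rule LIMSEQ_Suc[OF lim_1_over_n])
 obtain r where r: "strict_mono (r :: nat => nat)" "\<forall>i\<in>{0, 3, 6, 7, 8}. ltwo_Cauchy lborel (%n. V (r n) i)"
  using rellich_states[of V 2, OF VX V2] by (elim exE conjE) (rule that)
 have invr: "(%n. 1/real (Suc (r n)))---->0" using LIMSEQ_subseq_LIMSEQ[OF inv r(1)] by (simp add: o_def)
 define W where "W n = V (r n)" for n
 have WX: "W n\<in>X" and W2: "h (W n)\<le>2" for n unfolding W_def by (rule VX V2)+
 have stW: "(%n. N (st k (W n)))---->0" if k: "k < 3" for k
 proof (rule null_sequence_of_squares[OF \<alpha>(2)[OF k]])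
  show "\<alpha> k*(N (st k (W n)))^2\<le>(1 + 2*Q)*(1/real (Suc (r n)))" for n unfolding W_def using k by (intro stV) simp
  show "(%n. (1 + 2*Q)*(1/real (Suc (r n))))---->0" using tendsto_mult_right_zero[OF invr] .
 qed
 have CW: "ltwo_Cauchy lborel (%n. W n i)" if "i < 9" for i
  by (rule first_order_Cauchy[OF WX W2 _ _ that]) (use r(2) ltwo_null_Cauchy[OF form_sq(4)[OF WX] stW] in \<open>auto simp: W_def\<close>)
 obtain Z where Z: "Z\<in>X" "\<And>i. i < 9 ==> (%n. N (dif (W n) Z i))---->0"
  using second_order_limit[OF WX W2 CW] by blast
 have "N (st k Z) = 0" if "k < 3" for k
  by (rule LIMSEQ_unique[OF st_tendsto[OF WX W2 Z] stW[OF that]])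
 \<comment> \<open>Rigidity is applied to the limit, which lies in \<open>X\<close> thanks to
   \<open>second_order_limit\<close>. Consequently the first nine components of \<open>W\<close>
   tend to 0, then the in-plane work, and finally the curvature.\<close>
 then have Z0: "N (Z i) = 0" if "i < 13" for i by (rule rigid[OF Z(1) _ that])
 have l9: "(%n. N (W n i))---->0" if i: "i < 9" for i
  using ltwo_tendsto_norm[OF sq(2)[OF Z(1)] sq(2)[OF WX] Z(2)[OF i]] Z0[of i] i by simp
 have hw0: "(%n. hw (W n))---->0" unfolding hw_def by (rule tendsto_null_sum) (use l9 in auto)
 have lw0: "(%n. \<bar>lw (W n)\<bar>)---->0"
  by (rule Lim_null_comparison[OF always_eventually tendsto_mult_right_zero[OF hw0, of Q]]) (use Q(2)[OF WX] in auto)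
 have cfW: "(%n. N (cf k (W n)))---->0" if k: "k < 3" for k
 proof (rule null_sequence_of_squares[OF \<beta>(2)[OF k]])
  show "\<beta> k*(N (cf k (W n)))^2\<le>\<bar>lw (W n)\<bar> + (1 + Q)*(1/real (Suc (r n)))" for n unfolding W_def using k by (intro cfV) simp
  show "(%n. \<bar>lw (W n)\<bar> + (1 + Q)*(1/real (Suc (r n))))---->0"
   using tendsto_add[OF lw0 tendsto_mult_right_zero[OF invr]] by simp
 qed
 have m: "(%n. N (W n 9))---->0" "(%n. N (W n 12))---->0" "(%n. N (%y. W n 10 y + W n 11 y))---->0"
  using cfW[of 0] cfW[of 1] cfW[of 2] by (simp_all add: cf_def[abs_def])
 note k = korn_tendsto[of W 7 9 10 8 11 12 sequentially, OF WX _ _ _ _ l9[of 7] m, unfolded deriv_table_def, simplified]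
 have "(%n. hz (W n))---->0" unfolding hz_def
 proof (rule tendsto_null_sum)
  fix i :: nat assume "i\<in>{6..<13}"
  then have "i < 9\<or>i = 9\<or>i = 10\<or>i = 11\<or>i = 12" by (auto simp: eval_nat_numeral less_Suc_eq)
  then show "(%n. N (W n i))---->0" using l9 m k by blast
 qed
 with hw0 have "(%n. hw (W n) + (hz (W n))^2)---->0 + 0^2" by (intro tendsto_intros)
 then show False using one by (simp add: W_def LIMSEQ_const_iff)
qed

text \<open>A minimizing sequence in the bounded sublevel set of height 1 is refined so that the
  slopes converge. The midpoint inequality then holds up to a vanishing error, which makes strain
  and curvature combinations Cauchy; all thirteen components follow, and the energy is continuous
  along this convergence.\<close>

theorem minimizer: "\<exists>U\<in>X. \<forall>W\<in>X. en U\<le>en W"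
proof -
 obtain R where R: "\<And>U. U\<in>X ==> en U\<le>1 ==> h U\<le>R" using bounded_sublevel by blast
 obtain Q where Q: "Q\<ge>0" "\<And>U. U\<in>X ==> \<bar>lw U\<bar>\<le>Q*hw U" "\<And>U. U\<in>X ==> \<bar>lz U\<bar>\<le>Q*hz U" by (rule load_bound) (rule that)
 obtain C where C: "C\<ge>0" "\<And>U W k. U\<in>X ==> W\<in>X ==>
  N (%y. mq k U y - mq k W y)\<le>C*(sqrt (h (dif U W)*(N (dif U W 7) + N (dif U W 8)))*(h U + h W))"
  by (rule mq_dif) (rule that)
 define S where "S = {U\<in>X. en U\<le>1}"
 let ?z = "(%i y. 0) :: state"
 have mq0: "mq k ?z = (%y. 0)" and h0: "h ?z = 0" and en0: "en ?z = 0" for k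
 proof -
  show mq0: "mq k ?z = (%y. 0)" for k by (auto simp: mq_def)
  show "h ?z = 0" by (simp add: h_eq)
  have "st k ?z = (%y. 0)" "cf k ?z = (%y. 0)" for k using mq0 by (auto simp: st_def ml_def cf_def)
  then show "en ?z = 0" by (simp add: en_def load_def)
 qed
 have zS: "?z\<in>S" using zero_X en0 by (simp add: S_def)
 have R0: "R\<ge>0" using R[OF zero_X] en0 h0 by simp
 have mqb: "N (mq k U)\<le>C*(sqrt (h U*(N (U 7) + N (U 8)))*h U)" if "U\<in>X" for U k
  using C(2)[OF that zero_X, of k] by (simp add: mq0 h0)
 have load: "\<bar>load U\<bar>\<le>Q*h U" if "U\<in>X" for U
  using Q(2)[OF that] Q(3)[OF that] unfolding load_eq h_def distrib_left by linarith
 have low: "- (Q * R)\<le>en U" if "U\<in>S" for U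
 proof -
  have "Q*h U\<le>Q * R" using R that by (intro mult_left_mono Q(1)) (auto simp: S_def)
  moreover have "- load U\<le>en U" using \<alpha>(1) \<beta>(1) by (auto simp: en_def intro!: add_nonneg_nonneg sum_nonneg)
  ultimately show ?thesis using load[of U] that by (simp add: S_def abs_le_iff)
 qed
 define I where "I = Inf (en ` S)"
 have bdd: "bdd_below (en ` S)" using low by (intro bdd_belowI2[of _ "- (Q * R)"])
 \<comment> \<open>Outside the sublevel set the energy exceeds 1, while the zero state inside has
   energy 0. Midpoints may leave \<open>S\<close> and still be compared with
   \<open>I\<close>.\<close>
 have I: "I\<le>en W" if "W\<in>X" for W
 proof (cases "en W\<le>1")
  case True
  then show ?thesis unfolding I_def using that by (intro cInf_lower bdd) (auto simp: S_def)
 next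
  case False
  have "I\<le>en ?z" unfolding I_def by (intro cInf_lower bdd imageI zS)
  then show ?thesis using False en0 by simp
 qed
 have "\<exists>U\<in>S. en U < I + 1/real (Suc n)" for n
  using cInf_lessD[of "en ` S" "I + 1/real (Suc n)"] zS by (auto simp: I_def)
 then have "\<forall>n. \<exists>U. U\<in>S\<and>en U < I + 1/real (Suc n)" by blast
 from choice[OF this] obtain U where U: "\<And>n. U n\<in>S" "\<And>n. en (U n) < I + 1/real (Suc n)" by auto
 have UX: "U n\<in>X" and UR: "h (U n)\<le>R" for n using U(1)[of n] R by (auto simp: S_def)
 obtain r where r: "strict_mono (r :: nat => nat)" "\<forall>i\<in>{0, 3, 6, 7, 8}. ltwo_Cauchy lborel (%n. U (r n) i)"
  using rellich_states[of U R, OF UX UR] by (elim exE conjE) (rule that)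
 define V where "V n = U (r n)" for n
 have VX: "V n\<in>X" and VR: "h (V n)\<le>R" for n unfolding V_def by (rule UX UR)+
 have enV: "(%n. en (V n))---->I"
 proof (rule LIMSEQ_near_Inf[OF I[OF VX]])
  fix n
  have "1/real (Suc (r n))\<le>1/real (Suc n)" using seq_suble[OF r(1), of n] by (intro frac_le) auto
  then show "en (V n)\<le>I + 1/real (Suc n)" using U(2)[of "r n"] by (simp add: V_def)
 qed
 obtain g7 where g7: "g7\<in>sqi" "(%n. N (%x. V n 7 x - g7 x))---->0"
  by (rule ltwo_complete[OF sq(2)[OF VX, of 7]]) (use r(2) that in \<open>auto simp: V_def\<close>)
 obtain g8 where g8: "g8\<in>sqi" "(%n. N (%x. V n 8 x - g8 x))---->0"
  by (rule ltwo_complete[OF sq(2)[OF VX, of 8]]) (use r(2) that in \<open>auto simp: V_def\<close>)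
 \<comment> \<open>The distance of the slopes from their limits. Errors are split as
   \<open>sqrt (a m) + sqrt (a n)\<close>, one summand for each index, so that each can be added to
   the energy of its own state.\<close>
 define a where "a n = N (%x. V n 7 x - g7 x) + N (%x. V n 8 x - g8 x)" for n
 have a: "a---->0" using tendsto_add[OF g7(2) g8(2)] by (simp add: a_def[abs_def])
 have a0: "a n\<ge>0" for n by (simp add: a_def)
 let ?D = "%m n. dif (V m) (V n)"
 have DX: "?D m n\<in>X" for m n by (intro dif_X VX)
 have D2: "h (?D m n)\<le>2 * R" for m n using h_dif[OF VX[of m] VX[of n]] VR[of m] VR[of n] by linarith
 have Da: "N (?D m n 7) + N (?D m n 8)\<le>a m + a n" for m n
  using ltwo_triangle3[OF sq(2)[OF VX[of m], of 7] g7(1) sq(2)[OF VX[of n], of 7]] ltwo_diff_commute[of lborel g7 "V n 7"]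
   ltwo_triangle3[OF sq(2)[OF VX[of m], of 8] g8(1) sq(2)[OF VX[of n], of 8]] ltwo_diff_commute[of lborel g8 "V n 8"]
  by (simp add: a_def)
 have mono: "C*(sqrt (x * s)*x)\<le>C*(sqrt ((2 * R) * s')*(2 * R))" if "0\<le>x" "x\<le>2 * R" "0\<le>s" "s\<le>s'" for x s s'
  using that C(1) R0 by (intro mult_left_mono mult_mono real_sqrt_le_mono) auto
 define K where "K = C*(sqrt (2 * R)*(2 * R))"
 have K0: "K\<ge>0" using C(1) R0 by (simp add: K_def)
 have mqD: "N (mq k (?D m n))\<le>K*(sqrt (a m) + sqrt (a n))" for k m n
 proof -
  have "N (mq k (?D m n))\<le>C*(sqrt ((2 * R)*(a m + a n))*(2 * R))"
   by (rule order_trans[OF mqb[OF DX] mono[OF h_nonneg D2 _ Da]]) auto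
  also have "... = K * sqrt (a m + a n)" by (simp add: K_def real_sqrt_mult)
  also have "...\<le>K*(sqrt (a m) + sqrt (a n))" by (intro mult_left_mono sqrt_add_le_add_sqrt K0 a0)
  finally show ?thesis .
 qed
 define B where "B = C*(sqrt ((2 * R)*(4 * R))*(2 * R)) + 2 * R"
 have N78: "N (U 7) + N (U 8)\<le>2*h U" for U :: state using N_le_h[of 7 U] N_le_h[of 8 U] by simp
 have mqB: "N (mq k U)\<le>C*(sqrt ((2 * R)*(4 * R))*(2 * R))" if "U\<in>X" "h U\<le>2 * R" for k U
  by (rule order_trans[OF mqb[OF that(1)] mono[OF h_nonneg that(2)]]) (use N78[of U] that(2) in auto)
 have mqB': "N (mq k (?D m n))\<le>B" for k m n using mqB[OF DX D2, of k m n] R0 by (simp add: B_def)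
 have stB: "N (st k (V n))\<le>B" for k n
 proof -
  have "N (ml k (V n))\<le>2*h (V n)"
  proof -
   note s = sq(2)[OF VX[of n]]
   have "N (ml k (V n)) = N (V n 1)\<or>N (ml k (V n)) = N (V n 5)\<or>N (ml k (V n)) = N (%y. V n 2 y + V n 4 y)\<or>N (ml k (V n)) = N (%y. V n 1 y + V n 5 y)"
    by (cases "k = 0"; cases "k = 1"; cases "k = 2") (simp_all add: ml_def[abs_def])
   moreover have "N (%y. V n 2 y + V n 4 y)\<le>N (V n 2) + N (V n 4)" "N (%y. V n 1 y + V n 5 y)\<le>N (V n 1) + N (V n 5)"
    by (intro ltwo_triangle s; simp)+
   ultimately show ?thesis using N_le_h[of 1 "V n"] N_le_h[of 2 "V n"] N_le_h[of 4 "V n"] N_le_h[of 5 "V n"] h_nonneg[of "V n"] by auto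
  qed
  moreover have "N (mq k (V n))\<le>C*(sqrt ((2 * R)*(4 * R))*(2 * R))" using VR[of n] R0 by (intro mqB VX) simp
  moreover have "N (st k (V n))\<le>N (ml k (V n)) + N (mq k (V n))"
   unfolding st_def[abs_def] by (intro ltwo_triangle form_sq VX)
  ultimately show ?thesis using VR[of n] by (simp add: B_def)
 qed
 have B0: "B\<ge>0" using stB[of 0 0] ltwo_nonneg order_trans by blast
 define A where "A = (\<Sum>k<4. \<alpha> k)"
 have A0: "A\<ge>0" using \<alpha>(1) by (simp add: A_def sum_nonneg)
 define L where "L = A*(B*K)"
 let ?ds = "%k m n. N (%y. st k (V m) y - st k (V n) y)" and ?dc = "%k m n. N (%y. cf k (V m) y - cf k (V n) y)"
 \<comment> \<open>The comparison of \<open>I\<close> with the energy of the midpoint. The errors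
   appear with the factor 2 because they are moved inside the mean of the two energies.\<close>
 have conv: "I + ((\<Sum>k<4. \<alpha> k*(?ds k m n)^2) + (\<Sum>k<4. \<beta> k*(?dc k m n)^2))/4
  \<le> ((en (V m) + 2*L * sqrt (a m)) + (en (V n) + 2*L * sqrt (a n)))/2" for m n
 proof -
  let ?M = "mid (V m) (V n)" and ?e = "B*(K*(sqrt (a m) + sqrt (a n)))"
  have st: "(N (st k ?M))^2\<le>((N (st k (V m)))^2 + (N (st k (V n)))^2)/2 - (?ds k m n)^2/4 + ?e" for k
  proof -
   let ?avg = "%y. (st k (V m) y + st k (V n) y)/2"
   define x e where "x = N ?avg" and "e = N (mq k (?D m n))/4"
   have "N (st k ?M)\<le>x + N (%y. (1/4) * mq k (?D m n) y)"
    unfolding x_def using ltwo_triangle_diff[of ?avg lborel "%y. (1/4) * mq k (?D m n) y"] form_sq[OF VX] form_sq[OF DX]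
    by (simp add: st_mid[abs_def] sq_int_add sq_int_divide)
   then have "N (st k ?M)\<le>x + e" unfolding ltwo_cmult e_def by simp
   then have 1: "(N (st k ?M))^2\<le>(x + e)^2" by (intro power_mono) auto
   have "x\<le>(1/2)*(N (st k (V m)) + N (st k (V n)))"
    unfolding x_def using ltwo_triangle[OF form_sq(4)[OF VX] form_sq(4)[OF VX], of k m k n] ltwo_cmult[of lborel "1/2" "%y. st k (V m) y + st k (V n) y"] by simp
   then have x: "x\<le>B" using stB[of k m] stB[of k n] by simp
   have e: "0\<le>e" "4*e\<le>B" "4*e\<le>K*(sqrt (a m) + sqrt (a n))" using mqB'[of k m n] mqD[of k m n] by (auto simp: e_def)
   \<comment> \<open>From \<open>x \<le> B\<close> and \<open>4*e \<le> B\<close> the factor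
     \<open>2*x + e\<close> is at most \<open>4*B\<close>, and \<open>4*e\<close> is the norm of the
     quadratic part at the difference, which is already estimated by \<open>a\<close>.\<close>
   have "(x + e)^2 = x^2 + e*(2*x + e)" by (simp add: power2_eq_square algebra_simps)
   also have "e*(2*x + e)\<le>e*(4*B)" using x e B0 by (intro mult_left_mono) auto
   also have "e*(4*B) = B*(4*e)" by simp
   also have "...\<le>?e" by (intro mult_left_mono e B0)
   finally have "(N (st k ?M))^2\<le>x^2 + ?e" using 1 by linarith
   moreover have "x^2 = ((N (st k (V m)))^2 + (N (st k (V n)))^2)/2 - (?ds k m n)^2/4"
    using ltwo_parallelogram[OF form_sq(4)[OF VX] form_sq(4)[OF VX], of k m k n] unfolding x_def by argo
   ultimately show ?thesis by simp
  qed
  have cf: "(N (cf k ?M))^2 = ((N (cf k (V m)))^2 + (N (cf k (V n)))^2)/2 - (?dc k m n)^2/4" for k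
  proof -
   have "cf k ?M = (%y. (cf k (V m) y + cf k (V n) y)/2)" by (auto simp: cf_def field_simps)
   then have "N (cf k ?M) = N (%y. (cf k (V m) y + cf k (V n) y)/2)" by simp
   then show ?thesis using ltwo_parallelogram[OF form_sq(2)[OF VX] form_sq(2)[OF VX], of k m k n] by (simp only:)
  qed
  have load: "load ?M = (load (V m) + load (V n))/2"
  proof -
   have i: "integ (%y. P i y*V n i y)" if "i < 9" for i n
    by (rule sq_int_mult_integrable[OF P[OF that] sq(2)[OF VX]]) (use that in simp)
   have "(LBINT y. P i y*?M i y) = ((LBINT y. P i y*V m i y) + (LBINT y. P i y*V n i y))/2" if "i < 9" for i
    using i[OF that, of m] i[OF that, of n] by (simp add: distrib_left)
   then show ?thesis unfolding load_def by (simp add: sum.distrib flip: sum_divide_distrib)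
  qed
  have "(\<Sum>k<4. \<alpha> k*(N (st k ?M))^2)\<le>(\<Sum>k<4. (\<alpha> k*(N (st k (V m)))^2 + \<alpha> k*(N (st k (V n)))^2)/2 - \<alpha> k*(?ds k m n)^2/4 + \<alpha> k*?e)"
   by (rule sum_mono) (use mult_left_mono[OF st \<alpha>(1)] in \<open>simp add: distrib_left right_diff_distrib\<close>)
  also have "... = ((\<Sum>k<4. \<alpha> k*(N (st k (V m)))^2) + (\<Sum>k<4. \<alpha> k*(N (st k (V n)))^2))/2 - (\<Sum>k<4. \<alpha> k*(?ds k m n)^2)/4 + A*?e"
   by (simp only: sum.distrib sum_subtractf A_def sum_divide_distrib[symmetric] sum_distrib_right[symmetric])
  finally have 1: "(\<Sum>k<4. \<alpha> k*(N (st k ?M))^2)\<le>((\<Sum>k<4. \<alpha> k*(N (st k (V m)))^2) + (\<Sum>k<4. \<alpha> k*(N (st k (V n)))^2))/2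
    - (\<Sum>k<4. \<alpha> k*(?ds k m n)^2)/4 + A*?e" .
  have 2: "(\<Sum>k<4. \<beta> k*(N (cf k ?M))^2) = ((\<Sum>k<4. \<beta> k*(N (cf k (V m)))^2) + (\<Sum>k<4. \<beta> k*(N (cf k (V n)))^2))/2 - (\<Sum>k<4. \<beta> k*(?dc k m n)^2)/4"
   unfolding cf by (simp only: right_diff_distrib distrib_left times_divide_eq_right sum.distrib sum_subtractf sum_divide_distrib[symmetric])
  have 3: "A*?e = L * sqrt (a m) + L * sqrt (a n)" by (simp add: L_def distrib_left mult_ac)
  have "I\<le>en ?M" by (intro I mid_X VX)
  then show ?thesis using 1 2 3 load unfolding en_def by argo
 qed
 define q where "q n = en (V n) + 2*L * sqrt (a n)" for n
 have "q---->I + 2*L * sqrt 0" unfolding q_def[abs_def] by (intro tendsto_intros enV a)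
 then have q: "q---->I" by simp
 have CC: "ltwo_Cauchy lborel (%n. st k (V n))" "ltwo_Cauchy lborel (%n. cf k (V n))" if k: "k < 3" for k
 proof -
  have k4: "k\<in>{..<4}" using k by simp
  have ge: "\<alpha> k*(?ds k m n)^2\<le>(\<Sum>k<4. \<alpha> k*(?ds k m n)^2)" "\<beta> k*(?dc k m n)^2\<le>(\<Sum>k<4. \<beta> k*(?dc k m n)^2)"
   "0\<le>(\<Sum>k<4. \<alpha> k*(?ds k m n)^2)" "0\<le>(\<Sum>k<4. \<beta> k*(?dc k m n)^2)" for m n
   using \<alpha>(1) \<beta>(1) by (auto intro!: member_le_sum[OF k4] sum_nonneg)
  show "ltwo_Cauchy lborel (%n. st k (V n))"
  proof (rule ltwo_CauchyI_minimizing[OF q, of "\<alpha> k/4"])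
   fix m n
   have "\<alpha> k*(N (%y. st k (V m) y - st k (V n) y))^2\<le>(\<Sum>k<4. \<alpha> k*(?ds k m n)^2) + (\<Sum>k<4. \<beta> k*(?dc k m n)^2)"
    using ge[of m n] by linarith
   then show "I + \<alpha> k/4*(N (%y. st k (V m) y - st k (V n) y))^2\<le>(q m + q n)/2"
    using conv[of m n] unfolding q_def by argo
  qed (use \<alpha>(2)[OF k] in simp)
  show "ltwo_Cauchy lborel (%n. cf k (V n))"
  proof (rule ltwo_CauchyI_minimizing[OF q, of "\<beta> k/4"])
   fix m n
   have "\<beta> k*(N (%y. cf k (V m) y - cf k (V n) y))^2\<le>(\<Sum>k<4. \<alpha> k*(?ds k m n)^2) + (\<Sum>k<4. \<beta> k*(?dc k m n)^2)"
    using ge[of m n] by linarith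
   then show "I + \<beta> k/4*(N (%y. cf k (V m) y - cf k (V n) y))^2\<le>(q m + q n)/2"
    using conv[of m n] unfolding q_def by argo
  qed (use \<beta>(2)[OF k] in simp)
 qed
 have C9: "ltwo_Cauchy lborel (%n. V n i)" if "i < 9" for i
  by (rule first_order_Cauchy[OF VX VR _ CC(1) that]) (use r(2) in \<open>auto simp: V_def\<close>)
 have C13: "ltwo_Cauchy lborel (%n. V n i)" if "i < 13" for i
  by (rule second_order_Cauchy[OF VX C9 CC(2) that])
 obtain Z where Z: "Z\<in>X" "\<And>i. i < 13 ==> (%n. N (dif (V n) Z i))---->0"
  using closed[OF VX C13] by blast
 have sl: "(%n. N (st k (V n)))---->N (st k Z)" for k by (rule st_tendsto[OF VX VR Z(1)]) (use Z(2) in simp)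
 have cl: "(%n. N (cf k (V n)))---->N (cf k Z)" for k
 proof (rule ltwo_tendsto_norm[OF form_sq(2)[OF Z(1)] form_sq(2)[OF VX]], unfold cf_dif, rule Lim_null_comparison[OF always_eventually])
  let ?b = "%n. (N (dif (V n) Z 9) + N (dif (V n) Z 12)) + (N (dif (V n) Z 10) + N (dif (V n) Z 11))"
  have "?b---->(0 + 0) + (0 + 0)" by (intro tendsto_add Z(2)) auto
  then show "?b---->0" by simp
  show "\<forall>n. norm (N (cf k (dif (V n) Z)))\<le>?b n"
  proof
   fix n
   let ?E = "dif (V n) Z"
   note s = sq(2)[OF dif_X[OF VX[of n] Z(1)]]
   have "N (cf k ?E) = N (?E 9)\<or>N (cf k ?E) = N (?E 12)\<or>N (cf k ?E) = N (%y. ?E 10 y + ?E 11 y)\<or>N (cf k ?E) = N (%y. ?E 9 y + ?E 12 y)"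
    by (cases "k = 0"; cases "k = 1"; cases "k = 2") (simp_all add: cf_def[abs_def])
   moreover have "N (%y. ?E 10 y + ?E 11 y)\<le>N (?E 10) + N (?E 11)" "N (%y. ?E 9 y + ?E 12 y)\<le>N (?E 9) + N (?E 12)"
    by (intro ltwo_triangle s; simp)+
   moreover have "0\<le>N (?E 9)" "0\<le>N (?E 10)" "0\<le>N (?E 11)" "0\<le>N (?E 12)" by auto
   ultimately show "norm (N (cf k ?E))\<le>?b n" unfolding real_norm_def abs_of_nonneg[OF ltwo_nonneg] by linarith
  qed
 qed
 have ll: "(%n. load (V n))---->load Z" unfolding load_def
 proof (rule tendsto_sum)
  fix i :: nat assume "i\<in>{..<9}"
  then have i: "i < 9" "i < 13" by auto
  show "(%n. LBINT y. P i y*V n i y)---->(LBINT y. P i y*Z i y)"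
   using ltwo_tendsto_inner[OF sq(2)[OF Z(1) i(2)] sq(2)[OF VX i(2)] Z(2)[OF i(2)] P[OF i(1)]] by (simp add: mult.commute)
 qed
 have "(%n. en (V n))---->en Z" unfolding en_def by (intro tendsto_intros sl cl ll)
 then have "en Z = I" using enV LIMSEQ_unique by blast
 then show ?thesis using Z(1) I by auto
qed

end

section \<open>The resultants of the applied forces\<close>

lemma rep_add: "rep S f f' ==> rep S g g' ==> rep S (%x. f x + g x) (%x. f' x + g' x)"
 and rep_diff: "rep S f f' ==> rep S g g' ==> rep S (%x. f x - g x) (%x. f' x - g' x)"
 and rep_mult: "rep S f f' ==> rep S g g' ==> rep S (%x. f x*g x) (%x. f' x*g' x)"
 and rep_cmult: "rep S f f' ==> rep S (%x. c*f x) (%x. c*f' x)"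
 using rep_apply2[of S f f' g g' "%x a b. a + b"] rep_apply2[of S f f' g g' "%x a b. a - b"]
  rep_apply2[of S f f' g g' "%x a b. a*b"] rep_apply2[of S f f' f f' "%x a b. c*a"]
 by (auto simp: rep_def)

lemma L2_inner:
 assumes "u\<in>L2 S"
 shows "(%y. u y \<bullet> v)\<in>L2 S"
proof -
 have m: "u\<in>borel_measurable (lebesgue_on S)" and i: "integrable (lebesgue_on S) (%y. (norm (u y))^2)" using assms by (auto simp: L2_def)
 have "integrable (lebesgue_on S) (%y. (norm (u y \<bullet> v))^2)"
 proof (rule Bochner_Integration.integrable_bound[OF integrable_mult_right[OF i, of "(norm v)^2"]])
  have "(norm (u y \<bullet> v))^2\<le>(norm v)^2*(norm (u y))^2" for y
   using power_mono[OF Cauchy_Schwarz_ineq2[of "u y" v], of 2] by (simp add: power_mult_distrib mult.commute)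
  then show "AE y in lebesgue_on S. norm ((norm (u y \<bullet> v))^2)\<le>norm ((norm v)^2*(norm (u y))^2)" by simp
 qed (use m in measurable)
 then show ?thesis using m by (auto simp: L2_def)
qed

lemma integrable_componentwise:
 fixes f :: "'a => 'b::euclidean_space"
 assumes "\<And>b. b\<in>Basis ==> integrable M (%x. f x \<bullet> b)"
 shows "integrable M f"
proof -
 have "integrable M (%x. \<Sum>b\<in>Basis. (f x \<bullet> b) *\<^sub>R b)" using assms by auto
 then show ?thesis by (simp add: euclidean_representation)
qed

text \<open>Cauchy-Schwarz on each fibre over the bounded set \<open>I\<close> gives square
  integrability of the fibre integral. The weight is 1 for the resultant forces and a truncated
  coordinate for the moments. Integrability of almost every fibre is recorded because an integral
  that does not exist would silently be 0.\<close>

lemma partial_integral_L2: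
 fixes G :: "'a::euclidean_space set" and F :: "'a\<times>real => real"
 assumes G: "G\<in>sets borel" and I: "bounded I" "I\<in>sets borel" and F: "F\<in>L2 (G\<times>I)"
  and w: "w\<in>bmeas" "\<And>t. \<bar>w t\<bar>\<le>B"
 shows "\<exists>P\<in>L2z G. rep G (%y. \<integral>t. w t*F (y, t) \<partial>lebesgue_on I) P"
  "AE y in lborel. y\<in>G --> integrable (lebesgue_on I) (%t. F (y, t))"
proof -
 have mP: "G\<times>I\<in>sets borel" using G I by (simp add: borel_prod[symmetric] pair_measureI)
 obtain F' where F': "rep (G\<times>I) F F'" by (rule rep_exists[OF mP]) (use F in \<open>auto simp: L2_def\<close>)
 then have L: "F'\<in>L2z (G\<times>I)" using rep_L2[OF F' mP] F by simp
 note [measurable] = L2zD(3)[OF L] w(1) I(2)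
 have off: "F' (y, t) = 0" if "y\<notin>G\<or>t\<notin>I" for y t using L2zD(2)[OF L, of "(y, t)"] that by auto
 have i2: "integrable (lborel \<Otimes>\<^sub>M lborel) (%p. (F' p)^2)" using sq_int_integrable[OF L2zD(1)[OF L]] by (simp add: lborel_prod)
 have m2: "F'\<in>borel_measurable (lborel \<Otimes>\<^sub>M lborel)" using L2zD(3)[OF L] by (simp add: lborel_prod)
 have sec: "AE y in lborel. (%t. F' (y, t))\<in>L2z I"
  using lborel_pair.AE_integrable_fst'[OF i2]
 proof eventually_elim
  case (elim y)
  then show ?case using off m2 by (auto simp: L2z_def sq_int_def)
 qed
 have "AE p in lborel \<Otimes>\<^sub>M lborel. p\<in>G\<times>I --> F p = F' p" unfolding lborel_prod using F' by (simp add: rep_def)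
 from lborel_pair.AE_pair[OF this]
 have secr: "AE y in lborel. y\<in>G --> rep I (%t. F (y, t)) (%t. F' (y, t))"
 proof eventually_elim
  case (elim y)
  show ?case
  proof
   assume y: "y\<in>G"
   have "AE t in lborel. t\<in>I --> F (y, t) = F' (y, t)" using elim y by simp
   then show "rep I (%t. F (y, t)) (%t. F' (y, t))" using off m2 by (auto simp: rep_def)
  qed
 qed
 define P where "P y = (LBINT t. w t*F' (y, t))" for y
 have mPP [measurable]: "P\<in>bmeas" unfolding P_def by measurable
 have fin: "emeasure lborel I < \<infinity>" by (rule emeasure_bounded_finite[OF I(1)])
 have si: "(%t. B*indicator I t)\<in>sqi" using fin I(2) by (intro sq_int_cmult indicator_sq_int) auto
 define c where "c = nrm (%t. B*indicator I t)"
 have sqi: "integ (%y. (P y)^2)"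
 proof (rule Bochner_Integration.integrable_bound[OF integrable_mult_right[OF lborel_pair.integrable_fst'[OF i2], of "c^2"]])
  show "AE y in lborel. norm ((P y)^2)\<le>norm (c^2*(LBINT t. (F' (y, t))^2))"
   using sec
  proof eventually_elim
   case (elim y)
   note s = L2zD(1)[OF elim]
   have B0: "B\<ge>0" using order_trans[OF abs_ge_zero w(2)] .
   have "\<bar>P y\<bar>\<le>(LBINT t. \<bar>w t*F' (y, t)\<bar>)" unfolding P_def by (rule integral_abs_bound)
   also have "...\<le>(LBINT t. (B*indicator I t)*\<bar>F' (y, t)\<bar>)"
   proof (rule Bochner_Integration.integral_mono'[OF sq_int_mult_integrable[OF si sq_int_abs[OF s]]])
    fix t
    show "\<bar>w t*F' (y, t)\<bar>\<le>B*indicator I t*\<bar>F' (y, t)\<bar>"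
     using mult_right_mono[OF w(2), of "\<bar>F' (y, t)\<bar>" t] off[of y t] by (cases "t\<in>I") (auto simp: abs_mult)
   qed (use B0 in auto)
   also have "...\<le>c*nrm (%t. F' (y, t))"
    using ltwo_CS[OF si sq_int_abs[OF s]] by (simp add: c_def ltwo_def)
   finally have "\<bar>P y\<bar>^2\<le>(c*nrm (%t. F' (y, t)))^2" by (rule power_mono) simp
   then show ?case by (simp add: power_mult_distrib ltwo_sq)
  qed
 qed simp
 have "P\<in>L2z G" using sqi off by (auto simp: L2z_def sq_int_def P_def)
 moreover have "rep G (%y. \<integral>t. w t*F (y, t) \<partial>lebesgue_on I) P"
 proof -
  have "AE y in lborel. y\<in>G --> (\<integral>t. w t*F (y, t) \<partial>lebesgue_on I) = P y" using secr
  proof eventually_elim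
   case (elim y)
   show ?case
   proof
    assume "y\<in>G"
    with elim have r: "rep I (%t. F (y, t)) (%t. F' (y, t))" by simp
    show "(\<integral>t. w t*F (y, t) \<partial>lebesgue_on I) = P y" unfolding P_def
     by (rule rep_integral(2)[OF rep_apply2[OF r r, of "%t a b. w t*a"] I(2)]) (use r in \<open>auto simp: rep_def\<close>)
   qed
  qed
  then show ?thesis using off by (auto simp: rep_def P_def)
 qed
 ultimately show "\<exists>P\<in>L2z G. rep G (%y. \<integral>t. w t*F (y, t) \<partial>lebesgue_on I) P" by blast
 show "AE y in lborel. y\<in>G --> integrable (lebesgue_on I) (%t. F (y, t))" using sec secr
 proof eventually_elim
  case (elim y)
  then show ?case using rep_integral(1) L2z_integrable[OF I(1)] I(2) by blast
 qed
qed

lemma L2_rep: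
 assumes "S\<in>sets borel" "f\<in>L2 S"
 obtains f' where "f'\<in>L2z S" "rep S f f'"
proof -
 obtain f' where f': "rep S f f'" by (rule rep_exists[OF assms(1)]) (use assms(2) in \<open>auto simp: L2_def\<close>)
 then show ?thesis using rep_L2[OF f' assms(1)] assms(2) that by blast
qed

lemma rep_cong_AE:
 assumes "rep S f f'" "AE x in lborel. x\<in>S --> g x = f x"
 shows "rep S g f'"
proof -
 have "AE x in lborel. x\<in>S --> f x = f' x" using assms(1) by (simp add: rep_def)
 with assms(2) have "AE x in lborel. x\<in>S --> g x = f' x" by eventually_elim auto
 then show ?thesis using assms(1) by (simp add: rep_def)
qed

context
 fixes D :: "(real^2) set" and e :: real and f g :: "(real^2)\<times>real => (real^2)\<times>real"
 assumes D: "D\<in>sets borel" and f: "f\<in>L2 (D\<times>{-e<..<e})" and g: "g\<in>L2_faces D e"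
begin

lemma faces: "(%y. g (y, e))\<in>L2 D" "(%y. g (y, - e))\<in>L2 D"
 using g by (auto simp: L2_faces_def)

text \<open>The vector-valued integral commutes with taking components only on integrable sections;
  finitely many components allow one common null set.\<close>

lemma section_integrable: "AE y in lborel. y\<in>D --> integrable (lebesgue_on {-e<..<e}) (%t. f (y, t))"
proof -
 have "AE y in lborel. \<forall>b\<in>Basis. y\<in>D --> integrable (lebesgue_on {-e<..<e}) (%t. f (y, t) \<bullet> b)"
  by (intro AE_finite_allI finite_Basis partial_integral_L2(2)[OF D _ _ L2_inner[OF f], of "%_. 1" 1]) auto
 then show ?thesis by eventually_elim (auto intro: integrable_componentwise)
qed

lemma resultant_p_rep: "\<exists>P\<in>L2z D. rep D (%y. resultant_p e f g y \<bullet> v) P"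
proof -
 obtain G where G: "G\<in>L2z D" "rep D (%y. g (y, e) \<bullet> v) G" by (rule L2_rep[OF D L2_inner[OF faces(1)]])
 obtain H where H: "H\<in>L2z D" "rep D (%y. g (y, - e) \<bullet> v) H" by (rule L2_rep[OF D L2_inner[OF faces(2)]])
 obtain P where P: "P\<in>L2z D" "rep D (%y. \<integral>t. 1*(f (y, t) \<bullet> v) \<partial>lebesgue_on {-e<..<e}) P"
  by (rule bexE[OF partial_integral_L2(1)[OF D _ _ L2_inner[OF f], of "%_. 1" 1 v]]) (use that in auto)
 have "rep D (%y. resultant_p e f g y \<bullet> v) (%y. P y + G y + H y)"
 proof (rule rep_cong_AE[OF rep_add[OF rep_add[OF P(2) G(2)] H(2)]])
  show "AE y in lborel. y\<in>D --> resultant_p e f g y \<bullet> v = (\<integral>t. 1*(f (y, t) \<bullet> v) \<partial>lebesgue_on {-e<..<e}) + g (y, e) \<bullet> v + g (y, - e) \<bullet> v"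
   using section_integrable by eventually_elim (auto simp: resultant_p_def inner_add_left)
 qed
 then show ?thesis using P(1) G(1) H(1) by (intro bexI[of _ "%y. P y + G y + H y"] L2z_add)
qed

lemma resultant_q_rep: "\<exists>Q\<in>L2z D. rep D (%y. resultant_q e f g y $ i) Q"
proof -
 let ?v = "(axis i 1, 0) :: (real^2)\<times>real" and ?I = "{-e<..<e}"
 have comp: "fst x $ i = x \<bullet> ?v" for x by (simp add: inner_prod_def inner_axis)
 obtain G where G: "G\<in>L2z D" "rep D (%y. g (y, e) \<bullet> ?v) G" by (rule L2_rep[OF D L2_inner[OF faces(1)]])
 obtain H where H: "H\<in>L2z D" "rep D (%y. g (y, - e) \<bullet> ?v) H" by (rule L2_rep[OF D L2_inner[OF faces(2)]])
 \<comment> \<open>The coordinate truncated to the interval: it coincides with \<open>t\<close> in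
   the range of integration and is bounded on the whole line, as the weight has to be.\<close>
 define w where "w t = max (- \<bar>e\<bar>) (min \<bar>e\<bar> t)" for t :: real
 have w: "w\<in>bmeas" "\<bar>w t\<bar>\<le>\<bar>e\<bar>" "t\<in>?I ==> w t = t" for t unfolding w_def by (auto simp: max_def min_def)
 obtain P where P: "P\<in>L2z D" "rep D (%y. \<integral>t. w t*(f (y, t) \<bullet> ?v) \<partial>lebesgue_on ?I) P"
  by (rule bexE[OF partial_integral_L2(1)[OF D _ _ L2_inner[OF f] w(1,2), of ?v]]) (use that in auto)
 have "rep D (%y. resultant_q e f g y $ i) (%y. P y + e*(G y - H y))"
 proof (rule rep_cong_AE[OF rep_add[OF P(2) rep_cmult[OF rep_diff[OF G(2) H(2)]]]])
  show "AE y in lborel. y\<in>D --> resultant_q e f g y $ i = (\<integral>t. w t*(f (y, t) \<bullet> ?v) \<partial>lebesgue_on ?I) + e*(g (y, e) \<bullet> ?v - g (y, - e) \<bullet> ?v)"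
   using section_integrable
  proof eventually_elim
   case (elim y)
   show ?case
   proof
    assume "y\<in>D"
    with elim have i: "integrable (lebesgue_on ?I) (%t. f (y, t))" by simp
    have mw: "w\<in>borel_measurable (lebesgue_on ?I)" using w(1) by (intro measurable_restrict_space1 measurable_completion) simp
    have "integrable (lebesgue_on ?I) (%t. w t *\<^sub>R fst (f (y, t)))"
    proof (rule Bochner_Integration.integrable_bound[OF integrable_mult_right[OF integrable_norm[OF i], of "\<bar>e\<bar>"]])
     show "(%t. w t *\<^sub>R fst (f (y, t)))\<in>borel_measurable (lebesgue_on ?I)"
      using mw borel_measurable_integrable[OF integrable_bounded_linear[OF bounded_linear_fst i]] by measurable
     have "norm (w t *\<^sub>R fst (f (y, t)))\<le>\<bar>e\<bar>*norm (f (y, t))" for t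
      using mult_mono[OF w(2) norm_fst_le[of "fst (f (y, t))" "snd (f (y, t))"], of t] by simp
     then show "AE t in lebesgue_on ?I. norm (w t *\<^sub>R fst (f (y, t)))\<le>norm (\<bar>e\<bar>*norm (f (y, t)))" by (intro AE_I2) simp
    qed
    from integral_inner_left[OF this, of "axis i 1"]
    have "(\<integral>t. w t *\<^sub>R fst (f (y, t)) \<partial>lebesgue_on ?I) $ i = (\<integral>t. w t*(f (y, t) \<bullet> ?v) \<partial>lebesgue_on ?I)"
     by (simp add: inner_axis comp[symmetric])
    moreover have "(\<integral>t. t *\<^sub>R fst (f (y, t)) \<partial>lebesgue_on ?I) = (\<integral>t. w t *\<^sub>R fst (f (y, t)) \<partial>lebesgue_on ?I)"
     by (rule Bochner_Integration.integral_cong) (auto simp: w(3))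
    ultimately show "resultant_q e f g y $ i = (\<integral>t. w t*(f (y, t) \<bullet> ?v) \<partial>lebesgue_on ?I) + e*(g (y, e) \<bullet> ?v - g (y, - e) \<bullet> ?v)"
     by (simp add: resultant_q_def comp[symmetric])
   qed
  qed
 qed
 then show ?thesis using P(1) G(1) H(1) by (intro bexI[of _ "%y. P y + e*(G y - H y)"] L2z_add L2z_cmult L2z_diff)
qed

end

section \<open>The plate energy on jets\<close>

text \<open>The elasticity form is diagonal in the two diagonal entries, the sum of the off-diagonal
  ones and the trace. Working with that sum leaves the two mixed entries independent, which suits
  the chosen weak derivatives.\<close>

lemma elastic_norm_sq_rep:
 assumes G: "G\<in>sets borel" and S: "\<And>i j. rep G (%y. s y $ i $ j) (S i j)"
  and sq: "S 1 1\<in>sqi" "S 2 2\<in>sqi" "(%y. S 1 2 y + S 2 1 y)\<in>sqi"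
 shows "elastic_norm_sq lam mu G s = 4 * mu*(nrm (S 1 1))^2 + 4 * mu*(nrm (S 2 2))^2
  + 2 * mu*(nrm (%y. S 1 2 y + S 2 1 y))^2 + 4*lam * mu/(lam + 2 * mu)*(nrm (%y. S 1 1 y + S 2 2 y))^2"
proof -
 let ?c = "4*lam * mu/(lam + 2 * mu)"
 have e: "(\<Sum>\<alpha>\<in>UNIV. \<Sum>b\<in>UNIV. \<Sum>\<sigma>\<in>UNIV. \<Sum>t\<in>UNIV. elasticity lam mu \<alpha> b \<sigma> t*a \<sigma> t*a \<alpha> b)
  = 4 * mu*(a 1 1)^2 + 4 * mu*(a 2 2)^2 + 2 * mu*(a 1 2 + a 2 1)^2 + ?c*(a 1 1 + a 2 2)^2" for a :: "2 => 2 => real"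
  unfolding sum_2 elasticity_def by (simp add: power2_eq_square algebra_simps)
 have "rep G (%y. 4 * mu*(s y $ 1 $ 1)^2 + 4 * mu*(s y $ 2 $ 2)^2 + 2 * mu*(s y $ 1 $ 2 + s y $ 2 $ 1)^2 + ?c*(s y $ 1 $ 1 + s y $ 2 $ 2)^2)
   (%y. 4 * mu*(S 1 1 y)^2 + 4 * mu*(S 2 2 y)^2 + 2 * mu*(S 1 2 y + S 2 1 y)^2 + ?c*(S 1 1 y + S 2 2 y)^2)"
  unfolding power2_eq_square by (intro rep_add rep_cmult rep_mult S)
 from rep_integral(2)[OF this G] show ?thesis
  unfolding elastic_norm_sq_def e ltwo_sq using sq_int_integrable[OF sq(1)] sq_int_integrable[OF sq(2)] sq_int_integrable[OF sq(3)]
   sq_int_integrable[OF sq_int_add[OF sq(1,2)]] by simp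
qed

definition pack :: "(2 list => real^2 => real) => (2 list => real^2 => real) => (2 list => real^2 => real) => state" where
 "pack j1 j2 j3 i = (if i < 3 then j1 ([[], [1], [2]] ! i) else if i < 6 then j2 ([[], [1], [2]] ! (i - 3))
   else j3 ([[], [1], [2], [1, 1], [1, 2], [2, 1], [2, 2]] ! (i - 6)))"

lemma pack_simps:
 "pack j1 j2 j3 0 = j1 []" "pack j1 j2 j3 1 = j1 [1]" "pack j1 j2 j3 2 = j1 [2]" "pack j1 j2 j3 3 = j2 []" "pack j1 j2 j3 4 = j2 [1]"
 "pack j1 j2 j3 5 = j2 [2]" "pack j1 j2 j3 6 = j3 []" "pack j1 j2 j3 7 = j3 [1]" "pack j1 j2 j3 8 = j3 [2]" "pack j1 j2 j3 9 = j3 [1, 1]"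
 "pack j1 j2 j3 (Suc 0) = j1 [1]" "pack j1 j2 j3 10 = j3 [1, 2]" "pack j1 j2 j3 11 = j3 [2, 1]" "pack j1 j2 j3 12 = j3 [2, 2]"
 by (simp_all add: pack_def)

lemma lists_le_1: "length as\<le>1 \<longleftrightarrow> as\<in>{[], [1], [2 :: 2]}"
proof (cases as)
 case (Cons a bs)
 then show ?thesis using exhaust_2[of a] by auto
qed simp

lemma lists_le_2: "length as\<le>2 \<longleftrightarrow> as\<in>{[], [1], [2], [1, 1], [1, 2], [2, 1], [2, 2 :: 2]}"
proof (cases as)
 case (Cons a bs)
 then show ?thesis using exhaust_2[of a] lists_le_1[of bs] by auto
qed simp

lemma sobolev_norm_tendsto:
 assumes G: "open G" and j: "\<And>n. jet G m (u n) (J n)" and l: "\<And>as. length as\<le>m ==> (%n. nrm (J n as))---->0"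
 shows "(%n. sobolev_norm m G (u n))---->0"
proof -
 have "(%n. sqrt (\<Sum>as | length as\<le>m. (nrm (J n as))^2))---->sqrt (\<Sum>as :: 2 list | length as\<le>m. 0^2)"
  by (intro tendsto_intros l) simp
 then show ?thesis unfolding sobolev_norm_jet[OF G j] by simp
qed

lemma jet_dif:
 assumes "open G" "bounded G" "jet G m u j" "jet G m v k"
 shows "jet G m (%y. u y - v y) (%as y. j as y - k as y)"
 using jet_linear[OF assms, of 1 "-1"] by simp

definition plate_states :: "(real^2) set => (real^2 => real^2) set => (real^2 => real) set => state set" where
 "plate_states G V\<^sub>H V\<^sub>3 = {pack j1 j2 j3 |w z j1 j2 j3. w\<in>V\<^sub>H\<and>z\<in>V\<^sub>3 \<and>
   jet G 1 (%y. w y $ 1) j1\<and>jet G 1 (%y. w y $ 2) j2\<and>jet G 2 z j3}"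

lemma plate_statesE:
 assumes "U\<in>plate_states G V\<^sub>H V\<^sub>3"
 obtains w z j1 j2 j3 where "w\<in>V\<^sub>H" "z\<in>V\<^sub>3" "jet G 1 (%y. w y $ 1) j1" "jet G 1 (%y. w y $ 2) j2" "jet G 2 z j3" "U = pack j1 j2 j3"
 using assms unfolding plate_states_def by blast

lemma plate_statesI:
 "w\<in>V\<^sub>H ==> z\<in>V\<^sub>3 ==> jet G 1 (%y. w y $ 1) j1 ==> jet G 1 (%y. w y $ 2) j2 ==> jet G 2 z j3 ==> pack j1 j2 j3\<in>plate_states G V\<^sub>H V\<^sub>3"
 unfolding plate_states_def by blast

text \<open>Squares of slopes are square integrable by the Ladyzhenskaya inequality. The fact is
  established for jets before the locale is available, since its rigidity axiom already speaks of
  the norms of \<open>st\<close>.\<close>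

lemma pack_st_sq:
 assumes G: "open G" "bounded G" "lipschitz_boundary G"
  and j: "jet G 1 u1 j1" "jet G 1 u2 j2" "jet G 2 z j3"
 shows "st k (pack j1 j2 j3)\<in>sqi"
proof -
 obtain C where C: "\<And>u v1 v2. wderiv G 1 u v1 ==> wderiv G 2 u v2 ==> (%x. (u x)^2)\<in>sqi"
  by (rule ladyzhenskaya[OF G]) (use that in blast)
 have z: "(%x. (j3 [i] x)^2)\<in>sqi" "j3 [i]\<in>borel_measurable lborel" for i
  using C[OF jet_wderiv[OF G(1,2) j(3), of "[i]" 1] jet_wderiv[OF G(1,2) j(3), of "[i]" 2]] L2zD(3)[OF jet_D(2)[OF j(3), of "[i]"]] by auto
 have s: "j1 [i]\<in>sqi" "j2 [i]\<in>sqi" for i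
  using L2zD(1)[OF jet_D(2)[OF j(1), of "[i]"]] L2zD(1)[OF jet_D(2)[OF j(2), of "[i]"]] by auto
 have m: "mq k (pack j1 j2 j3)\<in>sqi" unfolding mq_def[abs_def] pack_simps
  using z ltwo_mult(1)[OF z[of 1] z[of 2]] by (cases "k = 0"; cases "k = 1"; cases "k = 2") (auto intro!: sq_int_add sq_int_divide)
 have "ml k (pack j1 j2 j3)\<in>sqi" unfolding ml_def[abs_def] pack_simps
  using s by (cases "k = 0"; cases "k = 1"; cases "k = 2") (auto intro!: sq_int_add)
 from sq_int_add[OF this m] show ?thesis by (simp add: st_def[abs_def])
qed

lemma strain_rep:
 assumes j: "jet G 1 (%y. w y $ 1) j1" "jet G 1 (%y. w y $ 2) j2" "jet G 2 z j3"
 obtains S where "\<And>i j. rep G (%y. strain_E G (w, z) y $ i $ j) (S i j)" "S 1 1 = st 0 (pack j1 j2 j3)" "S 2 2 = st 1 (pack j1 j2 j3)"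
  "\<And>y. S 1 2 y = st 2 (pack j1 j2 j3) y/2" "\<And>y. S 2 1 y = st 2 (pack j1 j2 j3) y/2"
proof
 define J where "J b = (if b = (1 :: 2) then j1 else j2)" for b
 let ?S = "%i j y. 1/2*(J j [i] y + J i [j] y + j3 [i] y*j3 [j] y)"
 have J: "rep G (weak_deriv G [i] (%y. w y $ b)) (J b [i])" for i b
  using jet_D(3)[OF j(1), of "[i]"] jet_D(3)[OF j(2), of "[i]"] exhaust_2[of b] by (auto simp: J_def)
 have Z: "rep G (weak_deriv G [i] z) (j3 [i])" for i using jet_D(3)[OF j(3), of "[i]"] by simp
 show "rep G (%y. strain_E G (w, z) y $ i $ j) (?S i j)" for i j
  using rep_cmult[OF rep_add[OF rep_add[OF J J] rep_mult[OF Z Z]], of "1/2" i j j i i j] by (simp add: strain_E_def)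
 show "?S 1 1 = st 0 (pack j1 j2 j3)" "?S 2 2 = st 1 (pack j1 j2 j3)"
  by (auto simp: fun_eq_iff J_def st_def ml_def mq_def pack_simps power2_eq_square field_simps)
 show "?S 1 2 y = st 2 (pack j1 j2 j3) y/2" "?S 2 1 y = st 2 (pack j1 j2 j3) y/2" for y
  by (auto simp: J_def st_def ml_def mq_def pack_simps power2_eq_square field_simps)
qed

text \<open>The weights of the four squares in \<open>elastic_norm_sq_rep\<close>, shared by strain
  and curvature; the last one vanishes for \<open>lam = 0\<close>.\<close>

definition stiffness :: "real => real => nat => real" where
 "stiffness lam mu k = (if k < 2 then 4 * mu else if k = 2 then 2 * mu else 4*lam * mu/(lam + 2 * mu))"

lemma energy_J_pack:
 assumes G: "open G" "bounded G" "lipschitz_boundary G"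
  and j: "jet G 1 (%y. w y $ 1) j1" "jet G 1 (%y. w y $ 2) j2" "jet G 2 z j3"
  and p: "\<And>i. p i\<in>L2z G" "\<And>i. rep G (%y. fst (resultant_p \<epsilon> f g y) $ i) (p i)"
  and p3: "p3\<in>L2z G" "rep G (%y. snd (resultant_p \<epsilon> f g y)) p3"
  and q: "\<And>i. q i\<in>L2z G" "\<And>i. rep G (%y. resultant_q \<epsilon> f g y $ i) (q i)"
  and P: "P 0 = p 1" "P 3 = p 2" "P 6 = p3" "P 7 = (%y. - q 1 y)" "P 8 = (%y. - q 2 y)"
   "P 1 = (%y. 0)" "P 2 = (%y. 0)" "P 4 = (%y. 0)" "P 5 = (%y. 0)"
 defines "U \<equiv> pack j1 j2 j3"
 shows "energy_J G \<epsilon> lam mu f g (w, z) = (\<Sum>k<4. \<epsilon>/2 * stiffness lam mu k*(nrm (st k U))^2)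
  + (\<Sum>k<4. \<epsilon>^3/6 * stiffness lam mu k*(nrm (cf k U))^2) - (\<Sum>i<9. LBINT y. P i y*U i y)"
proof -
 have b: "G\<in>sets borel" using G by simp
 have e4: "(\<Sum>k<4. F k) = F 0 + F 1 + F 2 + F 3" for F :: "nat => real" by (simp add: eval_nat_numeral)
 have e9: "(\<Sum>k<9. F k) = F 0 + F 1 + F 2 + F 3 + F 4 + F 5 + F 6 + F 7 + F 8" for F :: "nat => real" by (simp add: eval_nat_numeral)
 note sq = pack_st_sq[OF G j, folded U_def]
 obtain S where S: "\<And>i j. rep G (%y. strain_E G (w, z) y $ i $ j) (S i j)" "S 1 1 = st 0 U" "S 2 2 = st 1 U"
  "\<And>y. S 1 2 y = st 2 U y/2" "\<And>y. S 2 1 y = st 2 U y/2"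
  by (rule strain_rep[OF j, folded U_def]) (rule that)
 have S2: "(%y. S 1 2 y + S 2 1 y) = st 2 U" by (simp add: fun_eq_iff S(4,5))
 have S3: "(%y. S 1 1 y + S 2 2 y) = st 3 U" by (simp add: S(2,3) fun_eq_iff st_def ml_def mq_def)
 have 1: "elastic_norm_sq lam mu G (strain_E G (w, z)) = (\<Sum>k<4. stiffness lam mu k*(nrm (st k U))^2)"
  by (subst elastic_norm_sq_rep[OF b S(1)]) (use sq in \<open>simp_all add: S(2,3) S2 S3[unfolded S(2,3)] e4 stiffness_def del: One_nat_def\<close>)
 define F where "F i j = j3 [i, j]" for i j :: 2
 have FS: "F i j\<in>sqi" for i j using L2zD(1)[OF jet_D(2)[OF j(3), of "[i, j]"]] by (simp add: F_def)
 have F: "rep G (%y. curvature_F G (w, z) y $ i $ j) (F i j)" for i j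
  using jet_D(3)[OF j(3), of "[i, j]"] by (simp add: F_def curvature_F_def)
 have F1: "F 1 1 = cf 0 U" "F 2 2 = cf 1 U" "(%y. F 1 2 y + F 2 1 y) = cf 2 U" "(%y. F 1 1 y + F 2 2 y) = cf 3 U"
  unfolding U_def by (auto simp: F_def cf_def[abs_def] pack_simps)
 have "cf 0 U\<in>sqi" "cf 1 U\<in>sqi" "cf 2 U\<in>sqi"
  unfolding F1[symmetric] by (intro sq_int_add FS)+
 then have 2: "elastic_norm_sq lam mu G (curvature_F G (w, z)) = (\<Sum>k<4. stiffness lam mu k*(nrm (cf k U))^2)"
  by (subst elastic_norm_sq_rep[OF b F]) (simp_all add: F1 F1(4)[unfolded F1(1,2)] e4 stiffness_def del: One_nat_def)
 have r: "rep G (%y. w y $ 1) (U 0)" "rep G (%y. w y $ 2) (U 3)" "rep G z (U 6)" "rep G (weak_deriv G [1] z) (U 7)" "rep G (weak_deriv G [2] z) (U 8)"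
  unfolding U_def pack_simps using jet_rep[OF G(1,2) j(1)] jet_rep[OF G(1,2) j(2)] jet_rep[OF G(1,2) j(3)] jet_D(3)[OF j(3), of "[1]"] jet_D(3)[OF j(3), of "[2]"] by auto
 have s: "U 0\<in>sqi" "U 3\<in>sqi" "U 6\<in>sqi" "U 7\<in>sqi" "U 8\<in>sqi"
  unfolding U_def pack_simps by (intro L2zD(1)[OF jet_D(2)[OF j(1)]] L2zD(1)[OF jet_D(2)[OF j(2)]] L2zD(1)[OF jet_D(2)[OF j(3)]]; simp)+
 have "rep G (%y. (fst (resultant_p \<epsilon> f g y) $ 1*w y $ 1 + fst (resultant_p \<epsilon> f g y) $ 2*w y $ 2) + snd (resultant_p \<epsilon> f g y)*z y
   - (resultant_q \<epsilon> f g y $ 1*weak_deriv G [1] z y + resultant_q \<epsilon> f g y $ 2*weak_deriv G [2] z y))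
   (%y. (p 1 y*U 0 y + p 2 y*U 3 y) + p3 y*U 6 y - (q 1 y*U 7 y + q 2 y*U 8 y))"
  by (intro rep_add rep_diff rep_mult r p p3 q)
 from rep_integral(2)[OF this b]
 have "load_L G \<epsilon> f g (w, z) = (LBINT y. (p 1 y*U 0 y + p 2 y*U 3 y) + p3 y*U 6 y - (q 1 y*U 7 y + q 2 y*U 8 y))"
  unfolding load_L_def sum_2 by simp
 also have "... = (\<Sum>i<9. LBINT y. P i y*U i y)"
  using sq_int_mult_integrable[OF L2zD(1)[OF p(1)[of 1]] s(1)] sq_int_mult_integrable[OF L2zD(1)[OF p(1)[of 2]] s(2)] sq_int_mult_integrable[OF L2zD(1)[OF p3(1)] s(3)]
   sq_int_mult_integrable[OF L2zD(1)[OF q(1)[of 1]] s(4)] sq_int_mult_integrable[OF L2zD(1)[OF q(1)[of 2]] s(5)]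
  by (simp add: e9 P del: One_nat_def)
 finally show ?thesis unfolding energy_J_def 1 2 by (simp add: sum_distrib_left mult.assoc)
qed

lemma pack_linear:
 "(%i y. (if i < 6 then a else a')*pack j1 j2 j3 i y + (if i < 6 then b else b')*pack k1 k2 k3 i y)
  = pack (%as y. a*j1 as y + b * k1 as y) (%as y. a*j2 as y + b * k2 as y) (%as y. a'*j3 as y + b' * k3 as y)"
 by (auto simp: pack_def fun_eq_iff)

lemma all13: "(\<forall>i<13. Q i) \<longleftrightarrow> Q 0\<and>Q 1\<and>Q 2\<and>Q 3\<and>Q 4\<and>Q 5\<and>Q 6\<and>Q 7\<and>Q 8\<and>Q 9\<and>Q 10\<and>Q 11\<and>Q 12" for Q :: "nat => bool"
 by (simp add: eval_nat_numeral All_less_Suc conj_ac)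

lemma closed_subspaceD:
 assumes "closed_subspace H nm V"
 shows "u\<in>V ==> u\<in>H" "(%y. 0)\<in>V" "u\<in>V ==> v\<in>V ==> (%y. a *\<^sub>R u y + b *\<^sub>R v y)\<in>V"
  "u\<in>H ==> (\<And>n. s n\<in>V) ==> (%n. nm (%y. s n y - u y))---->0 ==> u\<in>V"
proof -
 note c = assms[unfolded closed_subspace_def]
 show "u\<in>V ==> u\<in>H" "(%y. 0)\<in>V" using c by auto
 show "(%y. a *\<^sub>R u y + b *\<^sub>R v y)\<in>V" if "u\<in>V" "v\<in>V"
 proof -
  have "(%y. a *\<^sub>R u y)\<in>V" "(%y. b *\<^sub>R v y)\<in>V" using c that by auto
  then show ?thesis using c[THEN conjunct2, THEN conjunct2, THEN conjunct1] by simp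
 qed
 show "u\<in>V" if "u\<in>H" "\<And>n. s n\<in>V" "(%n. nm (%y. s n y - u y))---->0"
  using c[THEN conjunct2, THEN conjunct2, THEN conjunct2, THEN conjunct2, rule_format, OF that(1), of s] that by simp
qed

text \<open>Closedness is transferred through \<open>jet_limit\<close>: limits of jets are jets of a
  limit function, and convergence of all components is convergence in the Sobolev norms of the
  hypotheses. For rigidity, the three norms of \<open>st\<close> vanish only if every entry of the
  strain is 0 almost everywhere.\<close>

lemma plate_states_plate:
 assumes \<omega>: "open \<omega>" "bounded \<omega>" "lipschitz_boundary \<omega>"
  and H: "closed_subspace (sobolev_vec 1 \<omega>) (sobolev_vec_norm 1 \<omega>) V\<^sub>H" and V3: "closed_subspace (sobolev 2 \<omega>) (sobolev_norm 2 \<omega>) V\<^sub>3"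
  and rigid: "\<And>u. u\<in>V\<^sub>H\<times>V\<^sub>3 ==> (AE y in lebesgue_on \<omega>. strain_E \<omega> u y = 0) ==> AE y in lebesgue_on \<omega>. fst u y = 0\<and>snd u y = 0"
  and P: "\<And>i. i < 9 ==> P i\<in>sqi"
  and \<alpha>: "\<And>k. \<alpha> k\<ge>0" "\<And>k. k < 3 ==> \<alpha> k > 0" and \<beta>: "\<And>k. \<beta> k\<ge>0" "\<And>k. k < 3 ==> \<beta> k > 0"
 shows "plate \<omega> (plate_states \<omega> V\<^sub>H V\<^sub>3) P \<alpha> \<beta>"
proof
 let ?X = "plate_states \<omega> V\<^sub>H V\<^sub>3"
 note o = \<omega>(1,2)
 have b: "\<omega>\<in>sets borel" using \<omega> by simp
 have hcomp: "(%y. w y $ i)\<in>sobolev 1 \<omega>" if "w\<in>V\<^sub>H" for w i using closed_subspaceD(1)[OF H that] by (simp add: sobolev_vec_def)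
 show "open \<omega>" "bounded \<omega>" "lipschitz_boundary \<omega>" by fact+
 show "wderiv \<omega> e (U p) (U q)" if U: "U\<in>?X" and t: "(p, e, q)\<in>deriv_table" for U p e q
 proof -
  obtain w z j1 j2 j3 where "w\<in>V\<^sub>H" "z\<in>V\<^sub>3" and j: "jet \<omega> 1 (%y. w y $ 1) j1" "jet \<omega> 1 (%y. w y $ 2) j2" "jet \<omega> 2 z j3" and Ue: "U = pack j1 j2 j3"
   by (rule plate_statesE[OF U])
  have w: "wderiv \<omega> e (j1 []) (j1 [e])" "wderiv \<omega> e (j2 []) (j2 [e])" "wderiv \<omega> e (j3 []) (j3 [e])" "wderiv \<omega> e (j3 [i]) (j3 [i, e])" for i
   using jet_wderiv[OF o j(1), of "[]" e] jet_wderiv[OF o j(2), of "[]" e] jet_wderiv[OF o j(3), of "[]" e] jet_wderiv[OF o j(3), of "[i]" e] by auto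
  show ?thesis using t w unfolding deriv_table_def Ue by (auto simp: pack_simps)
 qed
 show "(%i y. (if i < 6 then a else a')*U i y + (if i < 6 then b else b')*W i y)\<in>?X" if U: "U\<in>?X" and W: "W\<in>?X" for U W a a' b b'
 proof -
  obtain w z j1 j2 j3 where j: "w\<in>V\<^sub>H" "z\<in>V\<^sub>3" "jet \<omega> 1 (%y. w y $ 1) j1" "jet \<omega> 1 (%y. w y $ 2) j2" "jet \<omega> 2 z j3" "U = pack j1 j2 j3"
   by (rule plate_statesE[OF U])
  obtain w' z' k1 k2 k3 where k: "w'\<in>V\<^sub>H" "z'\<in>V\<^sub>3" "jet \<omega> 1 (%y. w' y $ 1) k1" "jet \<omega> 1 (%y. w' y $ 2) k2" "jet \<omega> 2 z' k3" "W = pack k1 k2 k3"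
   by (rule plate_statesE[OF W])
  have "(%y. a *\<^sub>R w y + b *\<^sub>R w' y)\<in>V\<^sub>H" "(%y. a'*z y + b'*z' y)\<in>V\<^sub>3"
   using closed_subspaceD(3)[OF H j(1) k(1)] closed_subspaceD(3)[OF V3 j(2) k(2)] by auto
  then show ?thesis unfolding j(6) k(6) pack_linear
   by (rule plate_statesI)
    (use jet_linear[OF o j(3) k(3), of a b] jet_linear[OF o j(4) k(4), of a b] jet_linear[OF o j(5) k(5), of a' b'] in auto)
 qed
 have in_X: "\<exists>j1 j2 j3. jet \<omega> 1 (%y. w y $ 1) j1\<and>jet \<omega> 1 (%y. w y $ 2) j2\<and>jet \<omega> 2 z j3\<and>pack j1 j2 j3\<in>?X" if wz: "w\<in>V\<^sub>H" "z\<in>V\<^sub>3" for w z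
 proof -
  obtain j1 where 1: "jet \<omega> 1 (%y. w y $ 1) j1" by (rule jet_exists[OF o(1) hcomp[OF wz(1)]])
  obtain j2 where 2: "jet \<omega> 1 (%y. w y $ 2) j2" by (rule jet_exists[OF o(1) hcomp[OF wz(1)]])
  obtain j3 where 3: "jet \<omega> 2 z j3" by (rule jet_exists[OF o(1) closed_subspaceD(1)[OF V3 wz(2)]])
  show ?thesis using 1 2 3 plate_statesI[OF wz 1 2 3] by blast
 qed
 show "?X\<noteq>{}" using in_X[OF closed_subspaceD(2)[OF H] closed_subspaceD(2)[OF V3]] by blast
 show "\<exists>W\<in>?X. \<forall>i<13. (%n. nrm (%x. s n i x - W i x))---->0"
  if s: "\<And>n. s n\<in>?X" and C: "\<And>i. i < 13 ==> ltwo_Cauchy lborel (%n. s n i)" for s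
 proof -
  have "\<forall>n. \<exists>x. fst x\<in>V\<^sub>H\<and>fst (snd x)\<in>V\<^sub>3\<and>jet \<omega> 1 (%y. fst x y $ 1) (fst (snd (snd x)))\<and>jet \<omega> 1 (%y. fst x y $ 2) (fst (snd (snd (snd x))))
   \<and> jet \<omega> 2 (fst (snd x)) (snd (snd (snd (snd x))))\<and>s n = pack (fst (snd (snd x))) (fst (snd (snd (snd x)))) (snd (snd (snd (snd x))))"
  proof
   fix n
   obtain w z j1 j2 j3 where "w\<in>V\<^sub>H" "z\<in>V\<^sub>3" "jet \<omega> 1 (%y. w y $ 1) j1" "jet \<omega> 1 (%y. w y $ 2) j2" "jet \<omega> 2 z j3" "s n = pack j1 j2 j3"
    by (rule plate_statesE[OF s[of n]])
   then show "\<exists>x. fst x\<in>V\<^sub>H\<and>fst (snd x)\<in>V\<^sub>3\<and>jet \<omega> 1 (%y. fst x y $ 1) (fst (snd (snd x)))\<and>jet \<omega> 1 (%y. fst x y $ 2) (fst (snd (snd (snd x))))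
    \<and> jet \<omega> 2 (fst (snd x)) (snd (snd (snd (snd x))))\<and>s n = pack (fst (snd (snd x))) (fst (snd (snd (snd x)))) (snd (snd (snd (snd x))))"
    by (intro exI[of _ "(w, z, j1, j2, j3)"]) simp
  qed
  from choice[OF this] obtain x where x: "\<And>n. fst (x n)\<in>V\<^sub>H" "\<And>n. fst (snd (x n))\<in>V\<^sub>3" "\<And>n. jet \<omega> 1 (%y. fst (x n) y $ 1) (fst (snd (snd (x n))))"
   "\<And>n. jet \<omega> 1 (%y. fst (x n) y $ 2) (fst (snd (snd (snd (x n)))))" "\<And>n. jet \<omega> 2 (fst (snd (x n))) (snd (snd (snd (snd (x n)))))"
   "\<And>n. s n = pack (fst (snd (snd (x n)))) (fst (snd (snd (snd (x n))))) (snd (snd (snd (snd (x n)))))" by blast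
  define w z j1 j2 j3 where "w n = fst (x n)" and "z n = fst (snd (x n))" and "j1 n = fst (snd (snd (x n)))" and "j2 n = fst (snd (snd (snd (x n))))"
   and "j3 n = snd (snd (snd (snd (x n))))" for n
  note x' = x[folded w_def z_def j1_def j2_def j3_def]
  note C' = C[unfolded x'(6)]
  have c1: "ltwo_Cauchy lborel (%n. j1 n as)" "ltwo_Cauchy lborel (%n. j2 n as)" if "length as\<le>1" for as
   using that C'[of 0] C'[of 1] C'[of 2] C'[of 3] C'[of 4] C'[of 5] unfolding lists_le_1 pack_simps by auto
  have c3: "ltwo_Cauchy lborel (%n. j3 n as)" if "length as\<le>2" for as
   using that C'[of 6] C'[of 7] C'[of 8] C'[of 9] C'[of 10] C'[of 11] C'[of 12] unfolding lists_le_2 pack_simps by auto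
  obtain u1 k1 where k1: "jet \<omega> 1 u1 k1" "\<And>as. length as\<le>1 ==> (%n. nrm (%x. j1 n as x - k1 as x))---->0"
   by (rule jet_limit[OF o x'(3) c1(1)], assumption, rule that)
  obtain u2 k2 where k2: "jet \<omega> 1 u2 k2" "\<And>as. length as\<le>1 ==> (%n. nrm (%x. j2 n as x - k2 as x))---->0"
   by (rule jet_limit[OF o x'(4) c1(2)], assumption, rule that)
  obtain u3 k3 where k3: "jet \<omega> 2 u3 k3" "\<And>as. length as\<le>2 ==> (%n. nrm (%x. j3 n as x - k3 as x))---->0"
   by (rule jet_limit[OF o x'(5) c3], assumption, rule that)
  define W where "W y = (\<chi> i. if i = (1 :: 2) then u1 y else u2 y)" for y :: "real^2"
  have W: "(%y. W y $ 1) = u1" "(%y. W y $ 2) = u2" by (auto simp: W_def)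
  have WH: "W\<in>V\<^sub>H"
  proof (rule closed_subspaceD(4)[OF H _ x'(1)])
   show "W\<in>sobolev_vec 1 \<omega>" unfolding sobolev_vec_def mem_Collect_eq forall_2 W using jet_D(1)[OF k1(1)] jet_D(1)[OF k2(1)] by simp
   have n1: "(%n. sobolev_norm 1 \<omega> (%y. w n y $ 1 - u1 y))---->0"
    by (rule sobolev_norm_tendsto[OF o(1) jet_dif[OF o x'(3) k1(1)] k1(2)])
   have n2: "(%n. sobolev_norm 1 \<omega> (%y. w n y $ 2 - u2 y))---->0"
    by (rule sobolev_norm_tendsto[OF o(1) jet_dif[OF o x'(4) k2(1)] k2(2)])
   have "(%n. sqrt ((sobolev_norm 1 \<omega> (%y. w n y $ 1 - u1 y))^2 + (sobolev_norm 1 \<omega> (%y. w n y $ 2 - u2 y))^2))---->sqrt (0^2 + 0^2)"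
    by (intro tendsto_intros n1 n2)
   then show "(%n. sobolev_vec_norm 1 \<omega> (%y. w n y - W y))---->0"
    by (simp add: sobolev_vec_norm_def sum_2 W_def)
  qed
  have u3: "u3\<in>V\<^sub>3"
   by (rule closed_subspaceD(4)[OF V3 jet_D(1)[OF k3(1)] x'(2) sobolev_norm_tendsto[OF o(1) jet_dif[OF o x'(5) k3(1)] k3(2)]])
  have "pack k1 k2 k3\<in>?X" by (rule plate_statesI[OF WH u3]) (use W k1 k2 k3 in auto)
  moreover have "\<forall>i<13. (%n. nrm (%x. s n i x - pack k1 k2 k3 i x))---->0"
   unfolding x'(6) all13 pack_simps by (intro conjI k1(2) k2(2) k3(2)) simp_all
  ultimately show ?thesis by blast
 qed
 show "nrm (U i) = 0" if U: "U\<in>?X" and z: "\<And>k. k < 3 ==> nrm (st k U) = 0" and i: "i < 13" for U i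
 proof -
  obtain w u3 j1 j2 j3 where v: "w\<in>V\<^sub>H" "u3\<in>V\<^sub>3" and j: "jet \<omega> 1 (%y. w y $ 1) j1" "jet \<omega> 1 (%y. w y $ 2) j2" "jet \<omega> 2 u3 j3" and Ue: "U = pack j1 j2 j3"
   by (rule plate_statesE[OF U])
  obtain S where S: "\<And>i j. rep \<omega> (%y. strain_E \<omega> (w, u3) y $ i $ j) (S i j)" "S 1 1 = st 0 U" "S 2 2 = st 1 U"
   "\<And>y. S 1 2 y = st 2 U y/2" "\<And>y. S 2 1 y = st 2 U y/2"
   by (rule strain_rep[OF j, folded Ue]) (rule that)
  have z': "AE y in lborel. st k U y = 0" if "k < 3" for k
   using z[OF that] ltwo_eq_0_iff[OF pack_st_sq[OF \<omega> j, of k]] by (simp add: Ue)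
  have r: "AE y in lborel. y\<in>\<omega> --> strain_E \<omega> (w, u3) y $ i $ j = S i j y" for i j using S(1) by (simp add: rep_def)
  have "AE y in lebesgue_on \<omega>. strain_E \<omega> (w, u3) y = 0" unfolding AE_lebesgue_on_iff[OF b]
   using z'[of 0, simplified] z'[of 1, simplified] z'[of 2, simplified] r[of 1 1] r[of 1 2] r[of 2 1] r[of 2 2]
  proof eventually_elim
   case (elim y)
   then show ?case using S(2-5) by (auto simp: vec_eq_iff forall_2)
  qed
  from rigid[of "(w, u3)", OF _ this] v have "AE y in lebesgue_on \<omega>. w y = 0\<and>u3 y = 0" by simp
  then have "AE y in lebesgue_on \<omega>. w y $ 1 = 0" "AE y in lebesgue_on \<omega>. w y $ 2 = 0" "AE y in lebesgue_on \<omega>. u3 y = 0"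
   by (auto elim: eventually_mono)
  note jz = jet_zero[OF o j(1) this(1)] jet_zero[OF o j(2) this(2)] jet_zero[OF o j(3) this(3)]
  have "\<forall>i<13. nrm (U i) = 0" unfolding all13 Ue pack_simps using jz by auto
  then show ?thesis using i by blast
 qed
qed (use P \<alpha> \<beta> in auto)

theorem theorem2:
  fixes \<omega> :: "(real^2) set"
    and \<epsilon> lam mu :: real
    and f g :: "(real^2) \<times> real \<Rightarrow> (real^2) \<times> real"
    and V\<^sub>H :: "(real^2 \<Rightarrow> real^2) set"
    and V\<^sub>3 :: "(real^2 \<Rightarrow> real) set"
  assumes "\<epsilon> > 0" and "lam \<ge> 0" and "mu > 0"
    and "open \<omega>" and "bounded \<omega>" and "connected \<omega>" and "lipschitz_boundary \<omega>"
    and "f \<in> L2 (\<omega> \<times> {-\<epsilon><..<\<epsilon>})" and "g \<in> L2_faces \<omega> \<epsilon>"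
    and "closed_subspace (sobolev_vec 1 \<omega>) (sobolev_vec_norm 1 \<omega>) V\<^sub>H"
    and "closed_subspace (sobolev 2 \<omega>) (sobolev_norm 2 \<omega>) V\<^sub>3"
    and "\<And>u3. u3 \<in> V\<^sub>3 \<Longrightarrow>
           (\<And>\<alpha> \<beta>. AE y in lebesgue_on \<omega>. weak_deriv \<omega> [\<alpha>, \<beta>] u3 y = 0) \<Longrightarrow>
           AE y in lebesgue_on \<omega>. u3 y = 0"
    and "\<And>u. u \<in> V\<^sub>H \<times> V\<^sub>3 \<Longrightarrow>
           (AE y in lebesgue_on \<omega>. strain_E \<omega> u y = 0) \<Longrightarrow>
           AE y in lebesgue_on \<omega>. fst u y = 0 \<and> snd u y = 0"
  shows "\<exists>u. is_minimizer (energy_J \<omega> \<epsilon> lam mu f g) (V\<^sub>H \<times> V\<^sub>3) u"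
proof -
 note \<omega> = assms(4,5,7) and H = assms(10) and V3 = assms(11)
 have b: "\<omega>\<in>sets borel" using assms(4) by simp
 note rp = resultant_p_rep[OF b assms(8,9)] and rq = resultant_q_rep[OF b assms(8,9)]
 have "\<forall>i. \<exists>p. p\<in>L2z \<omega>\<and>rep \<omega> (%y. fst (resultant_p \<epsilon> f g y) $ i) p"
  using rp[of "(axis _ 1, 0)"] by (auto simp: inner_prod_def inner_axis)
 from choice[OF this] obtain p where p: "\<And>i. p i\<in>L2z \<omega>" "\<And>i. rep \<omega> (%y. fst (resultant_p \<epsilon> f g y) $ i) (p i)" by auto
 obtain p3 where p3: "p3\<in>L2z \<omega>" "rep \<omega> (%y. snd (resultant_p \<epsilon> f g y)) p3"
  using rp[of "(0, 1)"] by (auto simp: inner_prod_def)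
 have "\<forall>i. \<exists>q. q\<in>L2z \<omega>\<and>rep \<omega> (%y. resultant_q \<epsilon> f g y $ i) q" using rq by blast
 from choice[OF this] obtain q where q: "\<And>i. q i\<in>L2z \<omega>" "\<And>i. rep \<omega> (%y. resultant_q \<epsilon> f g y $ i) (q i)" by auto
 \<comment> \<open>Forces act on the three displacement components; the moments act with a minus
   sign on the slopes, as in the load.\<close>
 define P :: state where "P = (%i. if i = 0 then p 1 else if i = 3 then p 2 else if i = 6 then p3
  else if i = 7 then (%y. - q 1 y) else if i = 8 then (%y. - q 2 y) else (%y. 0))"
 have st: "stiffness lam mu k\<ge>0" "k < 3 ==> stiffness lam mu k > 0" for k using assms(2,3) by (auto simp: stiffness_def)
 interpret plate \<omega> "plate_states \<omega> V\<^sub>H V\<^sub>3" P "%k. \<epsilon>/2 * stiffness lam mu k" "%k. \<epsilon>^3/6 * stiffness lam mu k"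
 proof (rule plate_states_plate[OF \<omega> H V3 assms(13)])
  show "P i\<in>sqi" for i using L2zD(1)[OF p(1)] L2zD(1)[OF p3(1)] sq_int_uminus[OF L2zD(1)[OF q(1)]] by (simp add: P_def)
 qed (use st assms(1) in auto)
 \<comment> \<open>Valid for any jets of \<open>w\<close> and \<open>z\<close>, so the energy does
   not depend on representatives and each competitor can be represented afresh.\<close>
 have J: "energy_J \<omega> \<epsilon> lam mu f g (w, z) = en (pack j1 j2 j3)"
  if "jet \<omega> 1 (%y. w y $ 1) j1" "jet \<omega> 1 (%y. w y $ 2) j2" "jet \<omega> 2 z j3" for w z j1 j2 j3
  unfolding en_def load_def by (rule energy_J_pack[OF \<omega> that p p3 q]) (simp_all add: P_def)
 obtain U where U: "U\<in>plate_states \<omega> V\<^sub>H V\<^sub>3" "\<And>W. W\<in>plate_states \<omega> V\<^sub>H V\<^sub>3 ==> en U\<le>en W" using minimizer by blast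
 obtain w z j1 j2 j3 where u: "w\<in>V\<^sub>H" "z\<in>V\<^sub>3" and j: "jet \<omega> 1 (%y. w y $ 1) j1" "jet \<omega> 1 (%y. w y $ 2) j2" "jet \<omega> 2 z j3" and Ue: "U = pack j1 j2 j3"
  by (rule plate_statesE[OF U(1)])
 have le: "energy_J \<omega> \<epsilon> lam mu f g (w, z)\<le>energy_J \<omega> \<epsilon> lam mu f g v" if vV: "v\<in>V\<^sub>H\<times>V\<^sub>3" for v
 proof -
  obtain w' z' where v: "v = (w', z')" "w'\<in>V\<^sub>H" "z'\<in>V\<^sub>3" using vV by auto
  have c: "(%y. w' y $ i)\<in>sobolev 1 \<omega>" for i using closed_subspaceD(1)[OF H v(2)] by (simp add: sobolev_vec_def)
  obtain k1 where k1: "jet \<omega> 1 (%y. w' y $ 1) k1" by (rule jet_exists[OF \<omega>(1) c])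
  obtain k2 where k2: "jet \<omega> 1 (%y. w' y $ 2) k2" by (rule jet_exists[OF \<omega>(1) c])
  obtain k3 where k3: "jet \<omega> 2 z' k3" by (rule jet_exists[OF \<omega>(1) closed_subspaceD(1)[OF V3 v(3)]])
  from U(2)[OF plate_statesI[OF v(2,3) k1 k2 k3]] show ?thesis unfolding v(1) J[OF j] J[OF k1 k2 k3] Ue .
 qed
 have "is_minimizer (energy_J \<omega> \<epsilon> lam mu f g) (V\<^sub>H\<times>V\<^sub>3) (w, z)"
  unfolding is_minimizer_def using u le by (auto intro!: antisym INF_greatest INF_lower)
 then show ?thesis by blast
qed

end
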